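(* Let $X$ be a Krull scheme with generic point $\xi$ and put $K:=\mathrm{Cl}(X)$. Let $\mathcal{R}$ be a Cox sheaf on $X$, let $\mathcal{S}$ be the constant sheaf assigning $\mathcal{R}_\xi$, and let $\mu_Y:\mathcal{S}^+\to\imath_Y(\mathbb{Z})$ ($Y$ a prime divisor of $X$) be the associated discrete $K$-valuations, with $\mathrm{div}_K=\sum_Y\mu_Y$. Then $\mathcal{R}$ is quasi-coherent and has the following properties: (i) For each (non-empty) open $U$, the ring $\mathcal{R}(U)$ is $K$-factorial and $\deg_K(\mathcal{R}(U)^+)$ generates $K$. If $U$ is affine, then $\mathcal{S}(U)=Q^+(\mathcal{R}(U))$ and $\deg_K(\mathcal{R}(U)^+)$ equals $K$. (ii) $\{\mu_Y\}_Y$ are the essential $K$-valuations of $\mathcal{R}$, and the sections of their valuation sheaves $\mathcal{S}_{\mu_Y}$ are $$\mathcal{S}_{\mu_Y}(U)=\begin{cases}\mathcal{R}_Y & Y\in U\\ \mathcal{S}(X)& Y\notin U\end{cases}$$ in particular $\mathcal{R}(U)=\bigcap_{Y\in U}\mathcal{R}_Y\subseteq\mathcal{S}(X)$. (iii) The stalk at $x\in X$ is the $K$-local $K$-Krull ring $$\mathcal{R}_x=\bigcap_{x\in\overline{\{Y\}}}\mathcal{S}(X)_{\mu_{Y,X}}=\bigcap_{x\in\overline{\{Y\}}}\mathcal{R}_Y\subseteq\mathcal{S}(X).$$ The homogeneous elements of its $K$-maximal ideal $\mathfrak{a}_x$, respectively the homogeneous units of $\mathcal{R}_x$, are $$\mathfrak{a}_x\cap\mathcal{R}_x^+=\{f_x\in\mathcal{R}_x^+;\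 \text{there exist }U\ni x,\ f\in\mathcal{R}(U)^+\text{ such that }x\in|\mathrm{div}_{K,U}(f)|\},$$ $$\mathcal{R}_x^{+,*}=\{f_x\in\mathcal{R}_x^+;\ \text{there exist }U\ni x,\ f\in\mathcal{R}(U)^+\text{ such that }\mathrm{div}_{K,U}(f)=0\},$$ (where $f_x$ is the germ of $f$ at $x$), and $\deg_K(\mathcal{R}_x^{+,*})\subseteq\mathrm{Cl}(X)$ is the subgroup of classes $[D]$ represented by a divisor $D$ which is principal near $x$. (iv) For a prime divisor $Y$, each generator of the maximal ideal of $\mathcal{O}_{X,Y}=(\mathcal{R}_Y)_0$ also generates $\mathfrak{a}_Y$; in particular, $\mathcal{R}_Y$ has units in every degree.
   Context: Graded rings. Rings are commutative with $1$. For a $K$-graded ring $R$, $R^+$ is the set of non-zero homogeneous elements, $R^{+,*}$ the group of homogeneous units, $\deg_K$ the degree map on $R^+$. $R\neq 0$ is $K$-integral if it has no homogeneous zero divisors, $K$-simple if every element of $R^+$ is a unit, $K$-factorial if it is $K$-integral and $R^+$ is a factorial monoid. $Q^+(R)$ is the localization of a $K$-integral $R$ by $R^+$. A graded ideal $\mathfrak{p}\ne R$ is $K$-prime if $fg\in\mathfrak{p}$ with $f,g$ homogeneous implies $f\in\mathfrak{p}$ or $g\in\mathfrak{p}$; $R_{\mathfrak{p}}:=(R^+\setminus\mathfrak{p})^{-1}R$. $K$-maximal ideals are the maximal proper graded ideals; $R$ is $K$-local if it has exactly one. A discrete $K$-valuation on a $K$-simple ring $S$ is a surjective homomorphism $\nu:S^+\to\mathbb{Z}$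 with $\nu(a+b)\ge\min\{\nu(a),\nu(b)\}$ for $a,b\in S_w\setminus0$, $a+b\neq0$; its $K$-valuation ring $S_\nu$ is the subring generated by $\nu^{-1}(\mathbb{Z}_{\ge0})$. A $K$-Krull ring is an intersection of discrete $K$-valuation rings $S_{\nu_j}\subseteq S$ such that each $a\in R^+$ has only finitely many non-zero $\nu_j(a)$. Its $K$-prime divisors are the minimal non-zero $K$-prime ideals $\mathfrak{p}$; the essential $K$-valuations are the discrete $K$-valuations $\nu_{\mathfrak{p}}$ on $Q^+(R)$ with valuation rings $R_{\mathfrak{p}}$ (the minimal family defining $R$ in $Q^+(R)$). Krull schemes. A Krull scheme is an integral scheme with a finite cover by spectra of Krull rings; $\mathcal{K}$ is its constant sheaf of rational functions. A prime divisor is a point $Y$ with one-codimensional closure; it defines a discrete valuation $\nu_{Y}$ with valuation ring $\mathcal{O}_{X,Y}$. $\imath_Y(\mathbb{Z})$ is the skyscraper sheaf at $Y$, $\mathrm{WDiv}=\bigoplus_Y\imath_Y(\mathbb{Z})$, $\mathrm{div}=\sum_Y\nu_Y:\mathcal{K}^*\to\mathrm{WDiv}$, $\mathrm{Cl}=\mathrm{coker}(\mathrm{div})$, $pr_Y:\mathrm{WDiv}\to\imath_Y(\mathbb{Z})$ the projection. The support $|D|$ of $D\in\mathrm{WDiv}(U)$ is the union of the closures in $U$ of the $Y$ occurring with non-zero coefficient in $D$. Graded sheaves. A $K$-graded sheaf of rings is a sheaf of $K$-graded rings with degree-preserving restrictions. A discrete $K$-valuation on a sheaf $\mathcal{S}$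 of $K$-simple rings with values in $\imath_Y(\mathbb{Z})$ is a morphism $\mu:\mathcal{S}^+\to\imath_Y(\mathbb{Z})$ such that each $\mu_U$ is surjective and either a discrete $K$-valuation or zero; its valuation sheaf $\mathcal{S}_{\mu}$ is the graded subsheaf of rings generated by the homogeneous sections with non-negative value. A $K$-Krull sheaf in $\mathcal{S}$ is an intersection of such valuation sheaves such that for every $U$ each $f\in\mathcal{R}(U)^+$ has non-zero value for only finitely many of the valuations. The defining family is called the family of essential $K$-valuations of $\mathcal{R}$ if for each affine open $U$ its members which are not identically zero over $U$ form the family of essential $K$-valuations of the $K$-Krull ring $\mathcal{R}(U)$. Cox sheaves. $\mathcal{O}_X(\mathrm{WDiv}(X))=\bigoplus_{D\in\mathrm{WDiv}(X)}\mathcal{O}_X(D)\chi^D$ with $\mathcal{O}_X(D)(U)=\{f\in\mathcal{K}(U);f=0\text{ or }\mathrm{div}_U(f)+D_{|U}\ge0\}$. A Cox sheaf is a $\mathrm{Cl}(X)$-graded sheaf of rings $\mathcal{R}$ admitting a morphism of graded sheaves $\pi:\mathcal{O}_X(\mathrm{WDiv}(X))\to\mathcal{R}$, accompanied by the canonical map $\mathrm{WDiv}(X)\to\mathrm{Cl}(X)$, which restricts to isomorphisms $\mathcal{O}_X(D)\chi^D\to\mathcal{R}_{[D]}$ for all $D$. Via $\mathcal{R}(U)\to\mathcal{R}_\xi$, $\mathcal{R}$ is a subsheaf of $\mathcal{S}$. The stalk of $\mathcal{O}_X(\mathrm{WDiv}(X))$ at $\xi$ is $\mathcal{K}(X)[\mathrm{WDiv}(X)]$,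 and $\mu_Y$ is the discrete $K$-valuation with $\mu_{Y,U}(\pi_\xi(f\chi^D))=\nu_{Y,U}(f)+pr_{Y,U}(D_{|U})$ for $f\in\mathcal{K}(X)^*$, $D\in\mathrm{WDiv}(X)$; it restricts to $\nu_Y$ on $\mathcal{K}^*=\mathcal{S}_0^*$, and $\mathcal{R}=\bigcap_Y\mathcal{S}_{\mu_Y}$. $\mathrm{div}_{K}:=\sum_Y\mu_Y:\mathcal{S}^+\to\mathrm{WDiv}$, with component $\mathrm{div}_{K,U}$ over $U$. *)

theory Defs
  imports "HOL-Analysis.Abstract_Topology" "HOL-Library.Extended_Nat" "HOL-Algebra.Divisibility" "HOL-Algebra.Module"
    "HOL-Algebra.Generated_Groups" "HOL-Algebra.Generated_Rings" "HOL-Algebra.Product_Groups"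
begin

section \<open>Localization\<close>

text \<open>Fractions are equivalence classes of pairs. Operations on classes are written as unions over
  representatives; whenever the operation is well defined, all members of the union coincide.\<close>

definition rfrac :: "('a, 'm) ring_scheme \<Rightarrow> 'a set \<Rightarrow> 'a \<Rightarrow> 'a \<Rightarrow> ('a \<times> 'a) set" where
  "rfrac A T a s = {(a', s'). a' \<in> carrier A \<and> s' \<in> T \<and>
     (\<exists>u\<in>T. u \<otimes>\<^bsub>A\<^esub> (s' \<otimes>\<^bsub>A\<^esub> a) = u \<otimes>\<^bsub>A\<^esub> (s \<otimes>\<^bsub>A\<^esub> a'))}"

definition loc :: "('a, 'm) ring_scheme \<Rightarrow> 'a set \<Rightarrow> ('a \<times> 'a) set ring" where
  "loc A T =
    \<lparr>carrier = {rfrac A T a s | a s. a \<in> carrier A \<and> s \<in> T},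
     monoid.mult = (\<lambda>P Q. \<Union>(a, s)\<in>P. \<Union>(b, t)\<in>Q. rfrac A T (a \<otimes>\<^bsub>A\<^esub> b) (s \<otimes>\<^bsub>A\<^esub> t)),
     monoid.one = rfrac A T \<one>\<^bsub>A\<^esub> \<one>\<^bsub>A\<^esub>,
     ring.zero = rfrac A T \<zero>\<^bsub>A\<^esub> \<one>\<^bsub>A\<^esub>,
     ring.add = (\<lambda>P Q. \<Union>(a, s)\<in>P. \<Union>(b, t)\<in>Q.
              rfrac A T ((t \<otimes>\<^bsub>A\<^esub> a) \<oplus>\<^bsub>A\<^esub> (s \<otimes>\<^bsub>A\<^esub> b)) (s \<otimes>\<^bsub>A\<^esub> t))\<rparr>"

definition mfrac ::
  "('a, 'm) ring_scheme \<Rightarrow> ('a, 'b, 'n) module_scheme \<Rightarrow> 'a set \<Rightarrow> 'b \<Rightarrow> 'a \<Rightarrow> ('b \<times> 'a) set" where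
  "mfrac A M T m s = {(m', s'). m' \<in> carrier M \<and> s' \<in> T \<and>
     (\<exists>u\<in>T. u \<odot>\<^bsub>M\<^esub> (s' \<odot>\<^bsub>M\<^esub> m) = u \<odot>\<^bsub>M\<^esub> (s \<odot>\<^bsub>M\<^esub> m'))}"

text \<open>The fields \<open>mult\<close> and \<open>one\<close> of a module record carry no meaning.\<close>

definition mloc ::
  "('a, 'm) ring_scheme \<Rightarrow> ('a, 'b, 'n) module_scheme \<Rightarrow> 'a set
     \<Rightarrow> (('a \<times> 'a) set, ('b \<times> 'a) set) module" where
  "mloc A M T =
    \<lparr>carrier = {mfrac A M T m s | m s. m \<in> carrier M \<and> s \<in> T},
     monoid.mult = undefined,
     monoid.one = undefined,
     ring.zero = mfrac A M T \<zero>\<^bsub>M\<^esub> \<one>\<^bsub>A\<^esub>,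
     ring.add = (\<lambda>P Q. \<Union>(m, s)\<in>P. \<Union>(n, t)\<in>Q.
              mfrac A M T ((t \<odot>\<^bsub>M\<^esub> m) \<oplus>\<^bsub>M\<^esub> (s \<odot>\<^bsub>M\<^esub> n)) (s \<otimes>\<^bsub>A\<^esub> t)),
     module.smult = (\<lambda>P Q. \<Union>(a, s)\<in>P. \<Union>(m, t)\<in>Q. mfrac A M T (a \<odot>\<^bsub>M\<^esub> m) (s \<otimes>\<^bsub>A\<^esub> t))\<rparr>"

text \<open>The homomorphism \<open>a/s \<mapsto> h a / h s\<close> from a localization to \<open>B\<close>, defined when \<open>h\<close> sends
  denominators to units.\<close>

definition loc_lift :: "('b, 'n) ring_scheme \<Rightarrow> ('a \<Rightarrow> 'b) \<Rightarrow> ('a \<times> 'a) set \<Rightarrow> 'b" where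
  "loc_lift B h P = (THE z. \<exists>(a, s)\<in>P. z = h a \<otimes>\<^bsub>B\<^esub> inv\<^bsub>B\<^esub> (h s))"


section \<open>Graded rings\<close>

text \<open>\<open>gcomp R w\<close> is the homogeneous component of degree \<open>w\<close>; only the values at \<open>w\<close> in the carrier
  of the grading group matter. Grading groups are written multiplicatively, as are divisor groups below.\<close>

record ('a, 'k) gring = "'a ring" +
  gcomp :: "'k \<Rightarrow> 'a set"

definition graded_ring :: "('k, 'l) monoid_scheme \<Rightarrow> ('a, 'k, 'm) gring_scheme \<Rightarrow> bool" where
  "graded_ring K R \<longleftrightarrow> comm_group K \<and> cring R \<and>
     (\<forall>w\<in>carrier K. additive_subgroup (gcomp R w) R) \<and>
     (\<forall>v\<in>carrier K. \<forall>w\<in>carrier K. \<forall>a\<in>gcomp R v. \<forall>b\<in>gcomp R w.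
        a \<otimes>\<^bsub>R\<^esub> b \<in> gcomp R (v \<otimes>\<^bsub>K\<^esub> w)) \<and>
     (\<forall>a\<in>carrier R. \<exists>!c. c \<in> (\<Pi>\<^sub>E w\<in>carrier K. gcomp R w) \<and>
        finite {w \<in> carrier K. c w \<noteq> \<zero>\<^bsub>R\<^esub>} \<and>
        a = finsum R c {w \<in> carrier K. c w \<noteq> \<zero>\<^bsub>R\<^esub>})"

definition hom_elems :: "('k, 'l) monoid_scheme \<Rightarrow> ('a, 'k, 'm) gring_scheme \<Rightarrow> 'a set" where
  "hom_elems K R = (\<Union>w\<in>carrier K. gcomp R w)"

definition hplus :: "('k, 'l) monoid_scheme \<Rightarrow> ('a, 'k, 'm) gring_scheme \<Rightarrow> 'a set" where
  "hplus K R = hom_elems K R - {\<zero>\<^bsub>R\<^esub>}"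

definition hunits :: "('k, 'l) monoid_scheme \<Rightarrow> ('a, 'k, 'm) gring_scheme \<Rightarrow> 'a set" where
  "hunits K R = hplus K R \<inter> Units R"

definition hdeg :: "('k, 'l) monoid_scheme \<Rightarrow> ('a, 'k, 'm) gring_scheme \<Rightarrow> 'a \<Rightarrow> 'k" where
  "hdeg K R f = (THE w. w \<in> carrier K \<and> f \<in> gcomp R w)"

definition hmonoid :: "('k, 'l) monoid_scheme \<Rightarrow> ('a, 'k, 'm) gring_scheme \<Rightarrow> 'a monoid" where
  "hmonoid K R = \<lparr>carrier = hplus K R, monoid.mult = monoid.mult R, monoid.one = \<one>\<^bsub>R\<^esub>\<rparr>"

definition K_integral :: "('k, 'l) monoid_scheme \<Rightarrow> ('a, 'k, 'm) gring_scheme \<Rightarrow> bool" where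
  "K_integral K R \<longleftrightarrow> graded_ring K R \<and> carrier R \<noteq> {\<zero>\<^bsub>R\<^esub>} \<and>
     (\<forall>f\<in>hplus K R. \<forall>g\<in>hplus K R. f \<otimes>\<^bsub>R\<^esub> g \<noteq> \<zero>\<^bsub>R\<^esub>)"

definition K_simple :: "('k, 'l) monoid_scheme \<Rightarrow> ('a, 'k, 'm) gring_scheme \<Rightarrow> bool" where
  "K_simple K R \<longleftrightarrow> graded_ring K R \<and> carrier R \<noteq> {\<zero>\<^bsub>R\<^esub>} \<and> hplus K R \<subseteq> Units R"

definition K_factorial :: "('k, 'l) monoid_scheme \<Rightarrow> ('a, 'k, 'm) gring_scheme \<Rightarrow> bool" where
  "K_factorial K R \<longleftrightarrow> K_integral K R \<and> factorial_monoid (hmonoid K R)"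

definition graded_ideal :: "('k, 'l) monoid_scheme \<Rightarrow> ('a, 'k, 'm) gring_scheme \<Rightarrow> 'a set \<Rightarrow> bool" where
  "graded_ideal K R I \<longleftrightarrow> ideal I R \<and> I = Idl\<^bsub>R\<^esub> (I \<inter> hom_elems K R)"

definition K_prime_ideal :: "('k, 'l) monoid_scheme \<Rightarrow> ('a, 'k, 'm) gring_scheme \<Rightarrow> 'a set \<Rightarrow> bool" where
  "K_prime_ideal K R p \<longleftrightarrow> graded_ideal K R p \<and> p \<noteq> carrier R \<and>
     (\<forall>f\<in>hom_elems K R. \<forall>g\<in>hom_elems K R. f \<otimes>\<^bsub>R\<^esub> g \<in> p \<longrightarrow> f \<in> p \<or> g \<in> p)"

definition K_prime_divisors :: "('k, 'l) monoid_scheme \<Rightarrow> ('a, 'k, 'm) gring_scheme \<Rightarrow> 'a set set" where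
  "K_prime_divisors K R = {p. K_prime_ideal K R p \<and> p \<noteq> {\<zero>\<^bsub>R\<^esub>} \<and>
     (\<forall>q. K_prime_ideal K R q \<and> q \<noteq> {\<zero>\<^bsub>R\<^esub>} \<and> q \<subseteq> p \<longrightarrow> q = p)}"

definition K_maximal_ideal :: "('k, 'l) monoid_scheme \<Rightarrow> ('a, 'k, 'm) gring_scheme \<Rightarrow> 'a set \<Rightarrow> bool" where
  "K_maximal_ideal K R I \<longleftrightarrow> graded_ideal K R I \<and> I \<noteq> carrier R \<and>
     (\<forall>J. graded_ideal K R J \<and> J \<noteq> carrier R \<and> I \<subseteq> J \<longrightarrow> J = I)"

definition K_local :: "('k, 'l) monoid_scheme \<Rightarrow> ('a, 'k, 'm) gring_scheme \<Rightarrow> bool" where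
  "K_local K R \<longleftrightarrow> graded_ring K R \<and> (\<exists>!I. K_maximal_ideal K R I)"

definition max_K_ideal :: "('k, 'l) monoid_scheme \<Rightarrow> ('a, 'k, 'm) gring_scheme \<Rightarrow> 'a set" where
  "max_K_ideal K R = (THE I. K_maximal_ideal K R I)"

definition graded_ring_iso ::
  "('k, 'l) monoid_scheme \<Rightarrow> ('a, 'k, 'm) gring_scheme \<Rightarrow> ('b, 'k, 'n) gring_scheme \<Rightarrow> ('a \<Rightarrow> 'b) \<Rightarrow> bool"
where
  "graded_ring_iso K A B h \<longleftrightarrow> graded_ring K A \<and> graded_ring K B \<and> h \<in> ring_iso A B \<and>
     (\<forall>w\<in>carrier K. h ` gcomp A w = gcomp B w)"

text \<open>\<open>Qplus K R\<close> is $Q^+(R)$; a fraction of homogeneous elements \<open>a/s\<close> has degree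
  \<open>deg a - deg s\<close>.\<close>

definition Qplus :: "('k, 'l) monoid_scheme \<Rightarrow> ('a, 'k, 'm) gring_scheme \<Rightarrow> (('a \<times> 'a) set, 'k) gring" where
  "Qplus K R = ring.extend (loc R (hplus K R)) (gring.fields
     (\<lambda>w. {rfrac R (hplus K R) a s | a s u. u \<in> carrier K \<and> s \<in> hplus K R \<inter> gcomp R u \<and>
                                            a \<in> gcomp R (w \<otimes>\<^bsub>K\<^esub> u)}))"

text \<open>For \<open>K\<close>-integral \<open>R\<close>: the images in $Q^+(R)$ of \<open>R\<close> and of
  $R_p = (R^+ \setminus p)^{-1} R$.\<close>

definition Qplus_embed :: "('k, 'l) monoid_scheme \<Rightarrow> ('a, 'k, 'm) gring_scheme \<Rightarrow> ('a \<times> 'a) set set" where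
  "Qplus_embed K R = {rfrac R (hplus K R) a \<one>\<^bsub>R\<^esub> | a. a \<in> carrier R}"

definition Qplus_loc_at ::
  "('k, 'l) monoid_scheme \<Rightarrow> ('a, 'k, 'm) gring_scheme \<Rightarrow> 'a set \<Rightarrow> ('a \<times> 'a) set set" where
  "Qplus_loc_at K R p = {rfrac R (hplus K R) a s | a s. a \<in> carrier R \<and> s \<in> hplus K R - p}"

definition discrete_K_valuation ::
  "('k, 'l) monoid_scheme \<Rightarrow> ('a, 'k, 'm) gring_scheme \<Rightarrow> ('a \<Rightarrow> int) \<Rightarrow> bool" where
  "discrete_K_valuation K S \<nu> \<longleftrightarrow> K_simple K S \<and> \<nu> ` hplus K S = UNIV \<and>
     (\<forall>a\<in>hplus K S. \<forall>b\<in>hplus K S. \<nu> (a \<otimes>\<^bsub>S\<^esub> b) = \<nu> a + \<nu> b) \<and>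
     (\<forall>w\<in>carrier K. \<forall>a\<in>gcomp S w - {\<zero>\<^bsub>S\<^esub>}. \<forall>b\<in>gcomp S w - {\<zero>\<^bsub>S\<^esub>}.
        a \<oplus>\<^bsub>S\<^esub> b \<noteq> \<zero>\<^bsub>S\<^esub> \<longrightarrow> min (\<nu> a) (\<nu> b) \<le> \<nu> (a \<oplus>\<^bsub>S\<^esub> b))"

definition K_valuation_ring ::
  "('k, 'l) monoid_scheme \<Rightarrow> ('a, 'k, 'm) gring_scheme \<Rightarrow> ('a \<Rightarrow> int) \<Rightarrow> 'a set" where
  "K_valuation_ring K S \<nu> = generate_ring S {a \<in> hplus K S. 0 \<le> \<nu> a}"

text \<open>The subset \<open>A\<close> of the \<open>K\<close>-simple ring \<open>S\<close> is a \<open>K\<close>-Krull ring. An empty family is allowed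
  and gives \<open>A = S\<close>.\<close>

definition K_Krull_in :: "('k, 'l) monoid_scheme \<Rightarrow> ('a, 'k, 'm) gring_scheme \<Rightarrow> 'a set \<Rightarrow> bool" where
  "K_Krull_in K S A \<longleftrightarrow> K_simple K S \<and>
     (\<exists>N. (\<forall>\<nu>\<in>N. discrete_K_valuation K S \<nu>) \<and>
          A = carrier S \<inter> (\<Inter>\<nu>\<in>N. K_valuation_ring K S \<nu>) \<and>
          (\<forall>a\<in>A \<inter> hplus K S. finite {\<nu> \<in> N. \<nu> a \<noteq> 0}))"

definition essential_K_valuation ::
  "('k, 'l) monoid_scheme \<Rightarrow> ('a, 'k, 'm) gring_scheme \<Rightarrow> 'a set \<Rightarrow> (('a \<times> 'a) set \<Rightarrow> int) \<Rightarrow> bool" where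
  "essential_K_valuation K R p \<nu> \<longleftrightarrow> p \<in> K_prime_divisors K R \<and>
     discrete_K_valuation K (Qplus K R) \<nu> \<and> K_valuation_ring K (Qplus K R) \<nu> = Qplus_loc_at K R p"

text \<open>Ungraded notions are the graded ones for the trivial grading group.\<close>

abbreviation trivK :: "unit monoid" where
  "trivK \<equiv> singleton_group ()"

definition triv_graded :: "'a ring \<Rightarrow> ('a, unit) gring" where
  "triv_graded A = ring.extend A (gring.fields (\<lambda>_. carrier A))"

definition Krull_ring :: "'a ring \<Rightarrow> bool" where
  "Krull_ring A \<longleftrightarrow> domain A \<and>
     K_Krull_in trivK (Qplus trivK (triv_graded A)) (Qplus_embed trivK (triv_graded A))"


section \<open>Sheaves\<close>

text \<open>Sections over \<open>U\<close> form a ring record, possibly extended by a grading or a scalar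
  multiplication. Only values at open sets matter.\<close>

record ('p, 'a, 'm) sheaf =
  base :: "'p topology"
  sec :: "'p set \<Rightarrow> ('a, 'm) ring_scheme"
  restr :: "'p set \<Rightarrow> 'p set \<Rightarrow> 'a \<Rightarrow> 'a"

type_synonym ('p, 'a, 'k) gsheaf = "('p, 'a, ('a, 'k, unit) gring_ext) sheaf"

abbreviation opens :: "('p, 'a, 'm) sheaf \<Rightarrow> 'p set \<Rightarrow> bool" where
  "opens F U \<equiv> openin (base F) U"

definition sheaf_of_sets :: "('p, 'a, 'm) sheaf \<Rightarrow> bool" where
  "sheaf_of_sets F \<longleftrightarrow>
     (\<forall>U V. opens F U \<and> opens F V \<and> V \<subseteq> U \<longrightarrow> restr F U V ` carrier (sec F U) \<subseteq> carrier (sec F V)) \<and>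
     (\<forall>U. opens F U \<longrightarrow> (\<forall>s\<in>carrier (sec F U). restr F U U s = s)) \<and>
     (\<forall>U V W. opens F U \<and> opens F V \<and> opens F W \<and> V \<subseteq> U \<and> W \<subseteq> V \<longrightarrow>
        (\<forall>s\<in>carrier (sec F U). restr F V W (restr F U V s) = restr F U W s)) \<and>
     (\<forall>\<U> f. (\<forall>U\<in>\<U>. opens F U \<and> f U \<in> carrier (sec F U)) \<and>
        (\<forall>U\<in>\<U>. \<forall>V\<in>\<U>. restr F U (U \<inter> V) (f U) = restr F V (U \<inter> V) (f V)) \<longrightarrow>
        (\<exists>!s. s \<in> carrier (sec F (\<Union>\<U>)) \<and> (\<forall>U\<in>\<U>. restr F (\<Union>\<U>) U s = f U)))"

definition sheaf_of_rings :: "('p, 'a, 'm) sheaf \<Rightarrow> bool" where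
  "sheaf_of_rings F \<longleftrightarrow> sheaf_of_sets F \<and>
     (\<forall>U. opens F U \<longrightarrow> cring (sec F U)) \<and>
     (\<forall>U V. opens F U \<and> opens F V \<and> V \<subseteq> U \<longrightarrow> restr F U V \<in> ring_hom (sec F U) (sec F V))"

definition graded_sheaf ::
  "('k, 'l) monoid_scheme \<Rightarrow> ('p, 'a, ('a, 'k, 'm) gring_ext) sheaf \<Rightarrow> bool" where
  "graded_sheaf K F \<longleftrightarrow> sheaf_of_rings F \<and>
     (\<forall>U. opens F U \<longrightarrow> graded_ring K (sec F U)) \<and>
     (\<forall>U V. opens F U \<and> opens F V \<and> V \<subseteq> U \<longrightarrow>
        (\<forall>w\<in>carrier K. restr F U V ` gcomp (sec F U) w \<subseteq> gcomp (sec F V) w))"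

text \<open>A morphism of graded sheaves of rings, accompanied by the map \<open>\<psi>\<close> of grading groups.\<close>

definition graded_sheaf_morphism ::
  "('k, 'l) monoid_scheme \<Rightarrow> ('k \<Rightarrow> 'h) \<Rightarrow> ('p, 'a, ('a, 'k, 'm) gring_ext) sheaf
     \<Rightarrow> ('p, 'b, ('b, 'h, 'n) gring_ext) sheaf \<Rightarrow> ('p set \<Rightarrow> 'a \<Rightarrow> 'b) \<Rightarrow> bool" where
  "graded_sheaf_morphism L \<psi> F G \<pi> \<longleftrightarrow> base F = base G \<and>
     (\<forall>U. opens F U \<longrightarrow> \<pi> U \<in> ring_hom (sec F U) (sec G U)) \<and>
     (\<forall>U V. opens F U \<and> opens F V \<and> V \<subseteq> U \<longrightarrow>
        (\<forall>s\<in>carrier (sec F U). \<pi> V (restr F U V s) = restr G U V (\<pi> U s))) \<and>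
     (\<forall>U. opens F U \<longrightarrow> (\<forall>w\<in>carrier L. \<pi> U ` gcomp (sec F U) w \<subseteq> gcomp (sec G U) (\<psi> w)))"

definition germ :: "('p, 'a, 'm) sheaf \<Rightarrow> 'p \<Rightarrow> 'p set \<Rightarrow> 'a \<Rightarrow> ('p set \<times> 'a) set" where
  "germ F x U s = {(V, t). opens F V \<and> x \<in> V \<and> t \<in> carrier (sec F V) \<and>
     (\<exists>W. opens F W \<and> x \<in> W \<and> W \<subseteq> U \<inter> V \<and> restr F U W s = restr F V W t)}"

definition stalk :: "('p, 'a, 'm) sheaf \<Rightarrow> 'p \<Rightarrow> ('p set \<times> 'a) set ring" where
  "stalk F x =
    \<lparr>carrier = {germ F x U s | U s. opens F U \<and> x \<in> U \<and> s \<in> carrier (sec F U)},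
     monoid.mult = (\<lambda>P Q. \<Union>(U, s)\<in>P. \<Union>(V, t)\<in>Q. germ F x (U \<inter> V)
       (restr F U (U \<inter> V) s \<otimes>\<^bsub>sec F (U \<inter> V)\<^esub> restr F V (U \<inter> V) t)),
     monoid.one = germ F x (topspace (base F)) \<one>\<^bsub>sec F (topspace (base F))\<^esub>,
     ring.zero = germ F x (topspace (base F)) \<zero>\<^bsub>sec F (topspace (base F))\<^esub>,
     ring.add = (\<lambda>P Q. \<Union>(U, s)\<in>P. \<Union>(V, t)\<in>Q. germ F x (U \<inter> V)
       (restr F U (U \<inter> V) s \<oplus>\<^bsub>sec F (U \<inter> V)\<^esub> restr F V (U \<inter> V) t))\<rparr>"

definition gstalk ::
  "('p, 'a, ('a, 'k, 'm) gring_ext) sheaf \<Rightarrow> 'p \<Rightarrow> (('p set \<times> 'a) set, 'k) gring" where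
  "gstalk F x = ring.extend (stalk F x) (gring.fields
     (\<lambda>w. {germ F x U s | U s. opens F U \<and> x \<in> U \<and> s \<in> gcomp (sec F U) w}))"

text \<open>The canonical map $F_x \to F_y$ for \<open>x\<close> in the closure of \<open>y\<close>.\<close>

definition cospec :: "('p, 'a, 'm) sheaf \<Rightarrow> 'p \<Rightarrow> ('p set \<times> 'a) set \<Rightarrow> ('p set \<times> 'a) set" where
  "cospec F y z = (\<Union>(U, s)\<in>z. germ F y U s)"

text \<open>The constant sheaf on an irreducible space: non-empty open sets are connected.\<close>

definition const_sheaf :: "'p topology \<Rightarrow> ('a, 'k) gring \<Rightarrow> ('p, 'a, 'k) gsheaf" where
  "const_sheaf T A =
    \<lparr>base = T,
     sec = (\<lambda>U. if U = {} then A\<lparr>carrier := {\<zero>\<^bsub>A\<^esub>}, monoid.one := \<zero>\<^bsub>A\<^esub>, gcomp := (\<lambda>_. {\<zero>\<^bsub>A\<^esub>})\<rparr> else A),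
     restr = (\<lambda>U V s. if V = {} then \<zero>\<^bsub>A\<^esub> else s)\<rparr>"


section \<open>Schemes\<close>

text \<open>A ringed space is given by its structure sheaf \<open>Sch\<close>, with underlying space \<open>base Sch\<close>.\<close>

definition spec :: "('a, 'm) ring_scheme \<Rightarrow> 'a set set" where
  "spec A = {p. primeideal p A}"

definition zariski :: "('a, 'm) ring_scheme \<Rightarrow> 'a set topology" where
  "zariski A = topology_generated_by {{p \<in> spec A. f \<notin> p} | f. f \<in> carrier A}"

definition spec_sheaf ::
  "('a, 'm) ring_scheme \<Rightarrow> ('a set, 'a set \<Rightarrow> ('a \<times> 'a) set, unit) sheaf" where
  "spec_sheaf A =
    \<lparr>base = zariski A,
     sec = (\<lambda>U.
       \<lparr>carrier = {s \<in> \<Pi>\<^sub>E p\<in>U. carrier (loc A (carrier A - p)).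
          \<forall>p\<in>U. \<exists>W a f. openin (zariski A) W \<and> p \<in> W \<and> W \<subseteq> U \<and> a \<in> carrier A \<and> f \<in> carrier A \<and>
            (\<forall>q\<in>W. f \<notin> q \<and> s q = rfrac A (carrier A - q) a f)},
        monoid.mult = (\<lambda>s t. \<lambda>p\<in>U. s p \<otimes>\<^bsub>loc A (carrier A - p)\<^esub> t p),
        monoid.one = (\<lambda>p\<in>U. \<one>\<^bsub>loc A (carrier A - p)\<^esub>),
        ring.zero = (\<lambda>p\<in>U. \<zero>\<^bsub>loc A (carrier A - p)\<^esub>),
        ring.add = (\<lambda>s t. \<lambda>p\<in>U. s p \<oplus>\<^bsub>loc A (carrier A - p)\<^esub> t p)\<rparr>),
     restr = (\<lambda>U V s. restrict s V)\<rparr>"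

text \<open>The sheaf on the spectrum of \<open>A\<close> associated to an \<open>A\<close>-module \<open>M\<close>.\<close>

definition tilde ::
  "('a, 'm) ring_scheme \<Rightarrow> ('a, 'b, 'n) module_scheme
    \<Rightarrow> ('a set, 'a set \<Rightarrow> ('b \<times> 'a) set, ('a set \<Rightarrow> ('a \<times> 'a) set, 'a set \<Rightarrow> ('b \<times> 'a) set, unit) module_ext) sheaf"
where
  "tilde A M =
    \<lparr>base = zariski A,
     sec = (\<lambda>U.
       \<lparr>carrier = {s \<in> \<Pi>\<^sub>E p\<in>U. carrier (mloc A M (carrier A - p)).
          \<forall>p\<in>U. \<exists>W m f. openin (zariski A) W \<and> p \<in> W \<and> W \<subseteq> U \<and> m \<in> carrier M \<and> f \<in> carrier A \<and>
            (\<forall>q\<in>W. f \<notin> q \<and> s q = mfrac A M (carrier A - q) m f)},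
        monoid.mult = undefined,
        monoid.one = undefined,
        ring.zero = (\<lambda>p\<in>U. \<zero>\<^bsub>mloc A M (carrier A - p)\<^esub>),
        ring.add = (\<lambda>s t. \<lambda>p\<in>U. s p \<oplus>\<^bsub>mloc A M (carrier A - p)\<^esub> t p),
        module.smult = (\<lambda>a s. \<lambda>p\<in>U. a p \<odot>\<^bsub>mloc A M (carrier A - p)\<^esub> s p)\<rparr>),
     restr = (\<lambda>U V s. restrict s V)\<rparr>"

definition ringed_space_iso ::
  "('p, 'a, 'm) sheaf \<Rightarrow> ('q, 'b, 'n) sheaf \<Rightarrow> ('p \<Rightarrow> 'q) \<Rightarrow> ('q set \<Rightarrow> 'b \<Rightarrow> 'a) \<Rightarrow> bool" where
  "ringed_space_iso Sch Z h \<phi> \<longleftrightarrow> homeomorphic_map (base Sch) (base Z) h \<and>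
     (\<forall>V. opens Z V \<longrightarrow> \<phi> V \<in> ring_iso (sec Z V) (sec Sch {x \<in> topspace (base Sch). h x \<in> V})) \<and>
     (\<forall>V W. opens Z V \<and> opens Z W \<and> W \<subseteq> V \<longrightarrow> (\<forall>s\<in>carrier (sec Z V).
        \<phi> W (restr Z V W s) =
        restr Sch {x \<in> topspace (base Sch). h x \<in> V} {x \<in> topspace (base Sch). h x \<in> W} (\<phi> V s)))"

definition open_restrict :: "('p, 'a, 'm) sheaf \<Rightarrow> 'p set \<Rightarrow> ('p, 'a, 'm) sheaf" where
  "open_restrict Sch U = Sch\<lparr>base := subtopology (base Sch) U\<rparr>"

text \<open>An isomorphism of ringed spaces onto a locally ringed space is automatically local.\<close>

definition is_Spec_of :: "('p, 'a, unit) sheaf \<Rightarrow> 'p set \<Rightarrow> 'a ring \<Rightarrow> bool" where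
  "is_Spec_of Sch U A \<longleftrightarrow> opens Sch U \<and> cring A \<and>
     (\<exists>h \<phi>. ringed_space_iso (open_restrict Sch U) (spec_sheaf A) h \<phi>)"

definition affine_open :: "('p, 'a, unit) sheaf \<Rightarrow> 'p set \<Rightarrow> bool" where
  "affine_open Sch U \<longleftrightarrow> (\<exists>A. is_Spec_of Sch U A)"

definition is_scheme :: "('p, 'a, unit) sheaf \<Rightarrow> bool" where
  "is_scheme Sch \<longleftrightarrow> sheaf_of_rings Sch \<and>
     (\<forall>x\<in>topspace (base Sch). \<exists>!m. maximalideal m (stalk Sch x)) \<and>
     (\<forall>x\<in>topspace (base Sch). \<exists>U. x \<in> U \<and> affine_open Sch U)"

definition integral_scheme :: "('p, 'a, unit) sheaf \<Rightarrow> bool" where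
  "integral_scheme Sch \<longleftrightarrow> is_scheme Sch \<and> topspace (base Sch) \<noteq> {} \<and>
     (\<forall>U. opens Sch U \<and> U \<noteq> {} \<longrightarrow> domain (sec Sch U))"

definition Krull_scheme :: "('p, 'a, unit) sheaf \<Rightarrow> bool" where
  "Krull_scheme Sch \<longleftrightarrow> integral_scheme Sch \<and>
     (\<exists>\<C>. finite \<C> \<and> \<Union>\<C> = topspace (base Sch) \<and>
       (\<forall>U\<in>\<C>. \<exists>A. Krull_ring A \<and> is_Spec_of Sch U A))"

definition generic_point :: "('p, 'a, 'm) sheaf \<Rightarrow> 'p \<Rightarrow> bool" where
  "generic_point Sch \<xi> \<longleftrightarrow> \<xi> \<in> topspace (base Sch) \<and> base Sch closure_of {\<xi>} = topspace (base Sch)"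

definition sheaf_of_modules ::
  "('p, 'a, unit) sheaf \<Rightarrow> ('p, 'b, ('a, 'b, unit) module_ext) sheaf \<Rightarrow> bool" where
  "sheaf_of_modules Sch F \<longleftrightarrow> base F = base Sch \<and> sheaf_of_sets F \<and>
     (\<forall>U. opens Sch U \<longrightarrow> module (sec Sch U) (sec F U)) \<and>
     (\<forall>U V. opens Sch U \<and> opens Sch V \<and> V \<subseteq> U \<longrightarrow>
        (\<forall>s\<in>carrier (sec F U). \<forall>t\<in>carrier (sec F U).
           restr F U V (s \<oplus>\<^bsub>sec F U\<^esub> t) = restr F U V s \<oplus>\<^bsub>sec F V\<^esub> restr F U V t) \<and>
        (\<forall>a\<in>carrier (sec Sch U). \<forall>s\<in>carrier (sec F U).
           restr F U V (a \<odot>\<^bsub>sec F U\<^esub> s) = restr Sch U V a \<odot>\<^bsub>sec F V\<^esub> restr F U V s))"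

text \<open>Locally \<open>F\<close> is the sheaf of a module \<open>M\<close> over \<open>A\<close>, compatibly with an isomorphism to the
  spectrum of \<open>A\<close>. Since \<open>A\<close> and \<open>M\<close> are then isomorphic to the rings and modules of sections, they may
  be taken on the same types.\<close>

definition quasi_coherent ::
  "('p, 'a, unit) sheaf \<Rightarrow> ('p, 'b, ('a, 'b, unit) module_ext) sheaf \<Rightarrow> bool" where
  "quasi_coherent Sch F \<longleftrightarrow> sheaf_of_modules Sch F \<and>
     (\<forall>x\<in>topspace (base Sch). \<exists>U (A :: 'a ring) (M :: ('a, 'b) module) h \<phi> \<psi>.
        x \<in> U \<and> opens Sch U \<and> cring A \<and> module A M \<and>
        ringed_space_iso (open_restrict Sch U) (spec_sheaf A) h \<phi> \<and>
        (\<forall>V. openin (zariski A) V \<longrightarrow>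
           bij_betw (\<psi> V) (carrier (sec (tilde A M) V)) (carrier (sec F {y \<in> U. h y \<in> V})) \<and>
           (\<forall>s\<in>carrier (sec (tilde A M) V). \<forall>t\<in>carrier (sec (tilde A M) V).
              \<psi> V (s \<oplus>\<^bsub>sec (tilde A M) V\<^esub> t) = \<psi> V s \<oplus>\<^bsub>sec F {y \<in> U. h y \<in> V}\<^esub> \<psi> V t) \<and>
           (\<forall>a\<in>carrier (sec (spec_sheaf A) V). \<forall>s\<in>carrier (sec (tilde A M) V).
              \<psi> V (a \<odot>\<^bsub>sec (tilde A M) V\<^esub> s) = \<phi> V a \<odot>\<^bsub>sec F {y \<in> U. h y \<in> V}\<^esub> \<psi> V s)) \<and>
        (\<forall>V W. openin (zariski A) V \<and> openin (zariski A) W \<and> W \<subseteq> V \<longrightarrow>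
           (\<forall>s\<in>carrier (sec (tilde A M) V).
              \<psi> W (restr (tilde A M) V W s) = restr F {y \<in> U. h y \<in> V} {y \<in> U. h y \<in> W} (\<psi> V s))))"


section \<open>Divisors on Krull schemes\<close>

definition irreducible_set :: "'p topology \<Rightarrow> 'p set \<Rightarrow> bool" where
  "irreducible_set T Z \<longleftrightarrow> Z \<noteq> {} \<and> Z \<subseteq> topspace T \<and>
     (\<forall>A B. closedin T A \<and> closedin T B \<and> Z \<subseteq> A \<union> B \<longrightarrow> Z \<subseteq> A \<or> Z \<subseteq> B)"

definition codim :: "'p topology \<Rightarrow> 'p set \<Rightarrow> enat" where
  "codim T Z = Sup {enat n | n. \<exists>C :: nat \<Rightarrow> 'p set. C 0 = Z \<and>
     (\<forall>i\<le>n. closedin T (C i) \<and> irreducible_set T (C i)) \<and> (\<forall>i<n. C i \<subset> C (Suc i))}"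

definition prime_divisors :: "('p, 'a, 'm) sheaf \<Rightarrow> 'p set" where
  "prime_divisors Sch = {Y \<in> topspace (base Sch). codim (base Sch) (base Sch closure_of {Y}) = 1}"

text \<open>Divisors on \<open>U\<close> are extensional functions on the prime divisors of \<open>Sch\<close> lying in \<open>U\<close>;
  \<open>D Y\<close> is the projection to the component at \<open>Y\<close>.\<close>

definition wdiv :: "('p, 'a, 'm) sheaf \<Rightarrow> 'p set \<Rightarrow> ('p \<Rightarrow> int) monoid" where
  "wdiv Sch U = sum_group (prime_divisors Sch \<inter> U) (\<lambda>_. integer_group)"

abbreviation WDiv :: "('p, 'a, 'm) sheaf \<Rightarrow> ('p \<Rightarrow> int) monoid" where
  "WDiv Sch \<equiv> wdiv Sch (topspace (base Sch))"

definition div_restrict :: "('p, 'a, 'm) sheaf \<Rightarrow> 'p set \<Rightarrow> ('p \<Rightarrow> int) \<Rightarrow> ('p \<Rightarrow> int)" where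
  "div_restrict Sch U D = restrict D (prime_divisors Sch \<inter> U)"

definition div_support :: "('p, 'a, 'm) sheaf \<Rightarrow> 'p set \<Rightarrow> ('p \<Rightarrow> int) \<Rightarrow> 'p set" where
  "div_support Sch U D =
     (\<Union>Y\<in>{Y \<in> prime_divisors Sch \<inter> U. D Y \<noteq> 0}. subtopology (base Sch) U closure_of {Y})"

text \<open>In the following \<open>\<xi>\<close> is the generic point; the function field is the stalk at \<open>\<xi>\<close>.\<close>

definition rat_sheaf ::
  "('p, 'a, unit) sheaf \<Rightarrow> 'p \<Rightarrow> ('p, ('p set \<times> 'a) set, unit) gsheaf" where
  "rat_sheaf Sch \<xi> = const_sheaf (base Sch) (triv_graded (stalk Sch \<xi>))"

definition rat_units :: "('p, 'a, unit) sheaf \<Rightarrow> 'p \<Rightarrow> ('p set \<times> 'a) set set" where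
  "rat_units Sch \<xi> = carrier (stalk Sch \<xi>) - {\<zero>\<^bsub>stalk Sch \<xi>\<^esub>}"

definition nu :: "('p, 'a, unit) sheaf \<Rightarrow> 'p \<Rightarrow> 'p \<Rightarrow> ('p set \<times> 'a) set \<Rightarrow> int" where
  "nu Sch \<xi> Y = (THE \<nu>. \<nu> \<in> extensional (rat_units Sch \<xi>) \<and>
     discrete_K_valuation trivK (triv_graded (stalk Sch \<xi>)) \<nu> \<and>
     K_valuation_ring trivK (triv_graded (stalk Sch \<xi>)) \<nu> = cospec Sch \<xi> ` carrier (stalk Sch Y))"

definition pdiv :: "('p, 'a, unit) sheaf \<Rightarrow> 'p \<Rightarrow> 'p set \<Rightarrow> ('p set \<times> 'a) set \<Rightarrow> ('p \<Rightarrow> int)" where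
  "pdiv Sch \<xi> U f = (\<lambda>Y\<in>prime_divisors Sch \<inter> U. nu Sch \<xi> Y f)"

definition Prin :: "('p, 'a, unit) sheaf \<Rightarrow> 'p \<Rightarrow> ('p \<Rightarrow> int) set" where
  "Prin Sch \<xi> = pdiv Sch \<xi> (topspace (base Sch)) ` rat_units Sch \<xi>"

definition Cl :: "('p, 'a, unit) sheaf \<Rightarrow> 'p \<Rightarrow> ('p \<Rightarrow> int) set monoid" where
  "Cl Sch \<xi> = WDiv Sch Mod Prin Sch \<xi>"

definition div_class :: "('p, 'a, unit) sheaf \<Rightarrow> 'p \<Rightarrow> ('p \<Rightarrow> int) \<Rightarrow> ('p \<Rightarrow> int) set" where
  "div_class Sch \<xi> D = Prin Sch \<xi> #>\<^bsub>WDiv Sch\<^esub> D"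

definition O_sec :: "('p, 'a, unit) sheaf \<Rightarrow> 'p \<Rightarrow> ('p \<Rightarrow> int) \<Rightarrow> 'p set \<Rightarrow> ('p set \<times> 'a) set set" where
  "O_sec Sch \<xi> D U = {f \<in> carrier (sec (rat_sheaf Sch \<xi>) U). f = \<zero>\<^bsub>stalk Sch \<xi>\<^esub> \<or>
     (\<forall>Y\<in>prime_divisors Sch \<inter> U. 0 \<le> pdiv Sch \<xi> U f Y + div_restrict Sch U D Y)}"

text \<open>The group algebra \<open>A[G]\<close>: finitely supported functions on \<open>G\<close> with convolution.
  \<open>gmono A f D\<close> is \<open>f\<close> times the basis element of \<open>D\<close>.\<close>

definition group_alg :: "('a, 'm) ring_scheme \<Rightarrow> ('g, 'l) monoid_scheme \<Rightarrow> ('g \<Rightarrow> 'a) ring" where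
  "group_alg A G =
    \<lparr>carrier = {F. (\<forall>g. F g \<in> carrier A) \<and> (\<forall>g. g \<notin> carrier G \<longrightarrow> F g = \<zero>\<^bsub>A\<^esub>) \<and>
                   finite {g. F g \<noteq> \<zero>\<^bsub>A\<^esub>}},
     monoid.mult = (\<lambda>F H g. if g \<in> carrier G
       then finsum A (\<lambda>h. F h \<otimes>\<^bsub>A\<^esub> H (inv\<^bsub>G\<^esub> h \<otimes>\<^bsub>G\<^esub> g)) {h \<in> carrier G. F h \<noteq> \<zero>\<^bsub>A\<^esub>} else \<zero>\<^bsub>A\<^esub>),
     monoid.one = (\<lambda>g. if g = \<one>\<^bsub>G\<^esub> then \<one>\<^bsub>A\<^esub> else \<zero>\<^bsub>A\<^esub>),
     ring.zero = (\<lambda>g. \<zero>\<^bsub>A\<^esub>),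
     ring.add = (\<lambda>F H g. F g \<oplus>\<^bsub>A\<^esub> H g)\<rparr>"

definition gmono :: "('a, 'm) ring_scheme \<Rightarrow> 'a \<Rightarrow> 'g \<Rightarrow> ('g \<Rightarrow> 'a)" where
  "gmono A f D = (\<lambda>g. if g = D then f else \<zero>\<^bsub>A\<^esub>)"

definition O_WDiv ::
  "('p, 'a, unit) sheaf \<Rightarrow> 'p
     \<Rightarrow> ('p, ('p \<Rightarrow> int) \<Rightarrow> ('p set \<times> 'a) set, 'p \<Rightarrow> int) gsheaf" where
  "O_WDiv Sch \<xi> =
    \<lparr>base = base Sch,
     sec = (\<lambda>U. ring.extend
       ((group_alg (sec (rat_sheaf Sch \<xi>) U) (WDiv Sch))\<lparr>carrier :=
          {F \<in> carrier (group_alg (sec (rat_sheaf Sch \<xi>) U) (WDiv Sch)).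
             \<forall>D\<in>carrier (WDiv Sch). F D \<in> O_sec Sch \<xi> D U}\<rparr>)
       (gring.fields (\<lambda>D. {gmono (stalk Sch \<xi>) f D | f. f \<in> O_sec Sch \<xi> D U}))),
     restr = (\<lambda>U V F D. restr (rat_sheaf Sch \<xi>) U V (F D))\<rparr>"


section \<open>Discrete valuations on sheaves\<close>

text \<open>\<open>S\<close> is a sheaf of \<open>K\<close>-simple rings. Since the zero ring over the empty set has no non-zero
  homogeneous elements, \<open>\<mu>\<close> is only considered over non-empty open sets.\<close>

definition skyscraper_sec :: "'p \<Rightarrow> 'p set \<Rightarrow> int set" where
  "skyscraper_sec Y U = (if Y \<in> U then UNIV else {0})"

definition discrete_K_valuation_sheaf ::
  "('k, 'l) monoid_scheme \<Rightarrow> ('p, 'a, 'k) gsheaf \<Rightarrow> 'p \<Rightarrow> ('p set \<Rightarrow> 'a \<Rightarrow> int) \<Rightarrow> bool" where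
  "discrete_K_valuation_sheaf K S Y \<mu> \<longleftrightarrow>
     (\<forall>U. opens S U \<and> U \<noteq> {} \<longrightarrow> K_simple K (sec S U) \<and>
        \<mu> U ` hplus K (sec S U) = skyscraper_sec Y U \<and>
        (\<forall>a\<in>hplus K (sec S U). \<forall>b\<in>hplus K (sec S U). \<mu> U (a \<otimes>\<^bsub>sec S U\<^esub> b) = \<mu> U a + \<mu> U b) \<and>
        (discrete_K_valuation K (sec S U) (\<mu> U) \<or> (\<forall>a\<in>hplus K (sec S U). \<mu> U a = 0))) \<and>
     (\<forall>U V. opens S U \<and> opens S V \<and> V \<subseteq> U \<and> V \<noteq> {} \<longrightarrow>
        (\<forall>a\<in>hplus K (sec S U). \<mu> V (restr S U V a) = (if Y \<in> V then \<mu> U a else 0)))"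

text \<open>Sections over \<open>U\<close> of the generated subsheaf of rings: those which locally lie in the subring
  generated by the homogeneous sections of non-negative value.\<close>

definition K_valuation_sheaf_sec ::
  "('k, 'l) monoid_scheme \<Rightarrow> ('p, 'a, 'k) gsheaf \<Rightarrow> ('p set \<Rightarrow> 'a \<Rightarrow> int) \<Rightarrow> 'p set \<Rightarrow> 'a set" where
  "K_valuation_sheaf_sec K S \<mu> U = {s \<in> carrier (sec S U).
     \<forall>x\<in>U. \<exists>V. opens S V \<and> x \<in> V \<and> V \<subseteq> U \<and>
       restr S U V s \<in> generate_ring (sec S V) {a \<in> hplus K (sec S V). 0 \<le> \<mu> V a}}"


section \<open>Cox sheaves\<close>

text \<open>\<open>\<pi>\<close> exhibits the \<open>Cl(X)\<close>-graded sheaf \<open>R\<close> as a Cox sheaf.\<close>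

definition Cox_sheaf ::
  "('p, 'a, unit) sheaf \<Rightarrow> 'p \<Rightarrow> ('p, 'r, ('p \<Rightarrow> int) set) gsheaf
     \<Rightarrow> ('p set \<Rightarrow> (('p \<Rightarrow> int) \<Rightarrow> ('p set \<times> 'a) set) \<Rightarrow> 'r) \<Rightarrow> bool" where
  "Cox_sheaf Sch \<xi> R \<pi> \<longleftrightarrow> graded_sheaf (Cl Sch \<xi>) R \<and>
     graded_sheaf_morphism (WDiv Sch) (div_class Sch \<xi>) (O_WDiv Sch \<xi>) R \<pi> \<and>
     (\<forall>U. opens Sch U \<longrightarrow> (\<forall>D\<in>carrier (WDiv Sch).
        bij_betw (\<pi> U) (gcomp (sec (O_WDiv Sch \<xi>) U) D) (gcomp (sec R U) (div_class Sch \<xi> D))))"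

text \<open>The image of \<open>\<R>(U)\<close> in the generic stalk (for non-empty open \<open>U\<close>).\<close>

definition generic_image :: "('p, 'r, 'm) sheaf \<Rightarrow> 'p \<Rightarrow> 'p set \<Rightarrow> ('p set \<times> 'r) set set" where
  "generic_image R \<xi> U = germ R \<xi> U ` carrier (sec R U)"

definition stalk_image :: "('p, 'r, 'm) sheaf \<Rightarrow> 'p \<Rightarrow> 'p \<Rightarrow> ('p set \<times> 'r) set set" where
  "stalk_image R \<xi> x = cospec R \<xi> ` carrier (stalk R x)"

definition generic_sheaf :: "('p, 'r, 'k) gsheaf \<Rightarrow> 'p \<Rightarrow> ('p, ('p set \<times> 'r) set, 'k) gsheaf" where
  "generic_sheaf R \<xi> = const_sheaf (base R) (gstalk R \<xi>)"

text \<open>The map induced by \<open>\<pi>\<close> on stalks at \<open>\<xi>\<close>, where the stalk of \<open>O_WDiv Sch \<xi>\<close> is the group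
  algebra of \<open>WDiv Sch\<close> over the function field.\<close>

definition pi_generic ::
  "('p, 'a, unit) sheaf \<Rightarrow> 'p \<Rightarrow> ('p, 'r, ('p \<Rightarrow> int) set) gsheaf
     \<Rightarrow> ('p set \<Rightarrow> (('p \<Rightarrow> int) \<Rightarrow> ('p set \<times> 'a) set) \<Rightarrow> 'r)
     \<Rightarrow> (('p \<Rightarrow> int) \<Rightarrow> ('p set \<times> 'a) set) \<Rightarrow> ('p set \<times> 'r) set" where
  "pi_generic Sch \<xi> R \<pi> F = (THE z. \<exists>U. opens Sch U \<and> U \<noteq> {} \<and>
     F \<in> carrier (sec (O_WDiv Sch \<xi>) U) \<and> z = germ R \<xi> U (\<pi> U F))"

definition Cox_mu ::
  "('p, 'a, unit) sheaf \<Rightarrow> 'p \<Rightarrow> ('p, 'r, ('p \<Rightarrow> int) set) gsheaf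
     \<Rightarrow> ('p set \<Rightarrow> (('p \<Rightarrow> int) \<Rightarrow> ('p set \<times> 'a) set) \<Rightarrow> 'r)
     \<Rightarrow> 'p \<Rightarrow> 'p set \<Rightarrow> ('p set \<times> 'r) set \<Rightarrow> int" where
  "Cox_mu Sch \<xi> R \<pi> Y U s = (if Y \<in> U then
     (THE n. \<exists>f\<in>rat_units Sch \<xi>. \<exists>D\<in>carrier (WDiv Sch).
        s = pi_generic Sch \<xi> R \<pi> (gmono (stalk Sch \<xi>) f D) \<and> n = nu Sch \<xi> Y f + D Y)
     else 0)"

definition Cox_div ::
  "('p, 'a, unit) sheaf \<Rightarrow> 'p \<Rightarrow> ('p, 'r, ('p \<Rightarrow> int) set) gsheaf
     \<Rightarrow> ('p set \<Rightarrow> (('p \<Rightarrow> int) \<Rightarrow> ('p set \<times> 'a) set) \<Rightarrow> 'r)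
     \<Rightarrow> 'p set \<Rightarrow> ('p set \<times> 'r) set \<Rightarrow> ('p \<Rightarrow> int)" where
  "Cox_div Sch \<xi> R \<pi> U s = (\<lambda>Y\<in>prime_divisors Sch \<inter> U. Cox_mu Sch \<xi> R \<pi> Y U s)"

text \<open>The map \<open>\<O>(U) \<rightarrow> \<R>(U)\<close>, \<open>a \<mapsto> \<pi>(a \<chi>\<^sup>0)\<close>, onto the component of trivial degree. The case
  distinction covers the empty set, over which all rational functions are zero.\<close>

definition Cox_scalar ::
  "('p, 'a, unit) sheaf \<Rightarrow> 'p \<Rightarrow> ('p set \<Rightarrow> (('p \<Rightarrow> int) \<Rightarrow> ('p set \<times> 'a) set) \<Rightarrow> 'r)
     \<Rightarrow> 'p set \<Rightarrow> 'a \<Rightarrow> 'r" where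
  "Cox_scalar Sch \<xi> \<pi> U a =
     \<pi> U (gmono (stalk Sch \<xi>) (if U = {} then \<zero>\<^bsub>stalk Sch \<xi>\<^esub> else germ Sch \<xi> U a) \<one>\<^bsub>WDiv Sch\<^esub>)"

definition Cox_scalar_stalk ::
  "('p, 'a, unit) sheaf \<Rightarrow> 'p \<Rightarrow> ('p, 'r, ('p \<Rightarrow> int) set) gsheaf
     \<Rightarrow> ('p set \<Rightarrow> (('p \<Rightarrow> int) \<Rightarrow> ('p set \<times> 'a) set) \<Rightarrow> 'r)
     \<Rightarrow> 'p \<Rightarrow> ('p set \<times> 'a) set \<Rightarrow> ('p set \<times> 'r) set" where
  "Cox_scalar_stalk Sch \<xi> R \<pi> x z = (\<Union>(U, a)\<in>z. germ R x U (Cox_scalar Sch \<xi> \<pi> U a))"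

definition Cox_module ::
  "('p, 'a, unit) sheaf \<Rightarrow> 'p \<Rightarrow> ('p, 'r, ('p \<Rightarrow> int) set) gsheaf
     \<Rightarrow> ('p set \<Rightarrow> (('p \<Rightarrow> int) \<Rightarrow> ('p set \<times> 'a) set) \<Rightarrow> 'r)
     \<Rightarrow> ('p, 'r, ('a, 'r, unit) module_ext) sheaf" where
  "Cox_module Sch \<xi> R \<pi> =
    \<lparr>base = base R,
     sec = (\<lambda>U. ring.extend (ring.truncate (sec R U))
       (module.fields (\<lambda>a r. Cox_scalar Sch \<xi> \<pi> U a \<otimes>\<^bsub>sec R U\<^esub> r))),
     restr = restr R\<rparr>"

text \<open>The canonical map $Q^+(\mathcal{R}(U)) \to \mathcal{S}(U)$.\<close>

definition Qplus_to_generic ::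
  "('p, 'r, 'k) gsheaf \<Rightarrow> 'p \<Rightarrow> 'p set \<Rightarrow> ('r \<times> 'r) set \<Rightarrow> ('p set \<times> 'r) set" where
  "Qplus_to_generic R \<xi> U = loc_lift (sec (generic_sheaf R \<xi>) U) (germ R \<xi> U)"

text \<open>The family \<open>\<mu>\<close>, indexed by a set \<open>P\<close> of points, defines \<open>R\<close> as a \<open>K\<close>-Krull sheaf in the constant
  sheaf of its generic stalk.\<close>

definition K_Krull_sheaf_by ::
  "('k, 'l) monoid_scheme \<Rightarrow> ('p, 'r, 'k) gsheaf \<Rightarrow> 'p \<Rightarrow> 'p set
     \<Rightarrow> ('p \<Rightarrow> 'p set \<Rightarrow> ('p set \<times> 'r) set \<Rightarrow> int) \<Rightarrow> bool" where
  "K_Krull_sheaf_by K R \<xi> P \<mu> \<longleftrightarrow>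
     (\<forall>Y\<in>P. discrete_K_valuation_sheaf K (generic_sheaf R \<xi>) Y (\<mu> Y)) \<and>
     (\<forall>U. opens R U \<and> U \<noteq> {} \<longrightarrow>
        inj_on (germ R \<xi> U) (carrier (sec R U)) \<and>
        generic_image R \<xi> U = carrier (sec (generic_sheaf R \<xi>) U) \<inter>
          (\<Inter>Y\<in>P. K_valuation_sheaf_sec K (generic_sheaf R \<xi>) (\<mu> Y) U) \<and>
        (\<forall>f\<in>hplus K (sec R U). finite {Y \<in> P. \<mu> Y U (germ R \<xi> U f) \<noteq> 0}))"

text \<open>For affine \<open>U\<close>, the valuations \<open>\<mu> Y U\<close> which are not identically zero correspond, via
  $Q^+(\mathcal{R}(U)) \to \mathcal{S}(U)$, one-to-one to the essential \<open>K\<close>-valuations of the \<open>K\<close>-Krull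
  ring \<open>\<R>(U)\<close>.\<close>

definition essential_K_valuations_of_sheaf ::
  "('p, 'a, unit) sheaf \<Rightarrow> ('k, 'l) monoid_scheme \<Rightarrow> ('p, 'r, 'k) gsheaf \<Rightarrow> 'p \<Rightarrow> 'p set
     \<Rightarrow> ('p \<Rightarrow> 'p set \<Rightarrow> ('p set \<times> 'r) set \<Rightarrow> int) \<Rightarrow> bool" where
  "essential_K_valuations_of_sheaf Sch K R \<xi> P \<mu> \<longleftrightarrow>
     K_Krull_sheaf_by K R \<xi> P \<mu> \<and>
     (\<forall>U. affine_open Sch U \<and> U \<noteq> {} \<longrightarrow>
        K_Krull_in K (Qplus K (sec R U)) (Qplus_embed K (sec R U)) \<and>
        (\<exists>\<theta>. bij_betw \<theta> {Y \<in> P. \<exists>a\<in>hplus K (sec (generic_sheaf R \<xi>) U). \<mu> Y U a \<noteq> 0}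
               (K_prime_divisors K (sec R U)) \<and>
             (\<forall>Y\<in>P. (\<exists>a\<in>hplus K (sec (generic_sheaf R \<xi>) U). \<mu> Y U a \<noteq> 0) \<longrightarrow>
                essential_K_valuation K (sec R U) (\<theta> Y) (\<mu> Y U \<circ> Qplus_to_generic R \<xi> U))))"

end

(* The geometry is translated into the K-simple ring S, the stalk of the Cox sheaf at the generic point.
   Every non-zero homogeneous element of S is pi(f chi^D) for a non-zero rational function f and a divisor D,
   and mu_Y takes it to nu_Y(f) + D(Y); this is well defined because two such representations differ by a global
   unit of degree zero. The sections over U and the stalk at x become the subrings of S consisting of the elements
   whose homogeneous components have non-negative value at the prime divisors in U, respectively at those whose
   closure contains x. With f = 1 one sees that homogeneous elements of S with arbitrarily prescribed values exist,
   so in such a subring divisibility of homogeneous elements is comparison of values. Factoriality, prime divisors,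
   essential valuations, rings of fractions, K-maximal ideals and units can all be read off from this.

   Two facts on Krull schemes enter: the local ring at x is the intersection of the discrete valuation rings of the
   prime divisors whose closure contains x, and for finitely many prime divisors of an affine open set whose closures
   avoid x there is a function that does not vanish at x but vanishes along them to prescribed orders. The latter
   supplies denominators, hence sections in every degree over affine sets and quasi-coherence. *)
theory Submission
  imports Defs
begin

abbreviation (input) "secs F U \<equiv> carrier (sec F U)"
abbreviation (input) "stks F x \<equiv> carrier (stalk F x)"
abbreviation (input) gmult ("_ *[_] _" [70, 0, 71] 70) where "x *[G] y \<equiv> x \<otimes>\<^bsub>G\<^esub> y"
abbreviation (input) gone ("1[_]") where "1[G] \<equiv> \<one>\<^bsub>G\<^esub>"
abbreviation (input) ginv ("inv[_] _" [0, 81] 80) where "inv[G] x \<equiv> inv\<^bsub>G\<^esub> x"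
abbreviation (input) radd ("_ +[_] _" [65, 0, 66] 65) where "x +[G] y \<equiv> x \<oplus>\<^bsub>G\<^esub> y"
abbreviation (input) rzero ("0[_]") where "0[G] \<equiv> \<zero>\<^bsub>G\<^esub>"
abbreviation (input) rneg ("\<ominus>[_] _" [0, 81] 80) where "\<ominus>[G] x \<equiv> \<ominus>\<^bsub>G\<^esub> x"
abbreviation (input) rminus ("_ \<ominus>[_] _" [65, 0, 66] 65) where "x \<ominus>[G] y \<equiv> x \<ominus>\<^bsub>G\<^esub> y"

section \<open>Graded rings and their homogeneous components\<close>

text \<open>Localizations and stalks are bare records whose operations are only known to be closed;
  the ring axioms are pulled back along the bijection. That zero goes to zero is asked separately,
  because \<open>ring_hom\<close> speaks of sums, products and one only.\<close>

lemma cring_transport: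
  assumes "cring B" "h \<in> ring_hom A B" "bij_betw h (carrier A) (carrier B)"
    and "0[A] \<in> carrier A" "h 0[A] = 0[B]" "1[A] \<in> carrier A"
    and "\<And>x y. x \<in> carrier A \<Longrightarrow> y \<in> carrier A \<Longrightarrow> x *[A] y \<in> carrier A"
    and "\<And>x y. x \<in> carrier A \<Longrightarrow> y \<in> carrier A \<Longrightarrow> x +[A] y \<in> carrier A"
  shows "cring A"
proof -
  interpret B: cring B by fact
  let ?k = "inv_into (carrier A) h"
  note hom = ring_hom_mult[OF assms(2)] ring_hom_add[OF assms(2)] ring_hom_one[OF assms(2)]
  have b: "bij_betw ?k (carrier B) (carrier A)" by (rule bij_betw_inv_into[OF assms(3)])
  have k: "?k y \<in> carrier A" "h (?k y) = y" if "y \<in> carrier B" for y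
    using that bij_betw_apply[OF b] bij_betw_inv_into_right[OF assms(3)] by simp_all
  have kI: "?k y = x" if "x \<in> carrier A" "h x = y" for x y
    using bij_betw_inv_into_left[OF assms(3) that(1)] that(2) by simp
  have "?k \<in> ring_iso B A"
    unfolding ring_iso_def ring_hom_def using b k by (simp add: kI hom assms)
  from B.ring_iso_imp_img_cring[OF this] show ?thesis using kI[OF assms(4,5)] by simp
qed

text \<open>The family of homogeneous components of \<open>a\<close>; the formula repeats the
  uniqueness clause of \<open>graded_ring\<close>. For \<open>a\<close> in the ring the family is
  extensional, so only its values on \<open>carrier K\<close> are meaningful.\<close>

definition hcomp :: "('k, 'l) monoid_scheme \<Rightarrow> ('a, 'k, 'm) gring_scheme \<Rightarrow> 'a \<Rightarrow> 'k \<Rightarrow> 'a" where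
  "hcomp K R a = (THE c. c \<in> (\<Pi>\<^sub>E w\<in>carrier K. gcomp R w) \<and>
        finite {w \<in> carrier K. c w \<noteq> 0[R]} \<and>
        a = finsum R c {w \<in> carrier K. c w \<noteq> 0[R]})"

locale grd = K: comm_group K + R: cring R
  for K :: "('k, 'l) monoid_scheme" (structure) and R :: "('a, 'k, 'm) gring_scheme" (structure) +
  assumes grd: "graded_ring K R"

lemma grdI: "graded_ring K R \<Longrightarrow> grd K R"
  by (simp add: grd_def grd_axioms_def graded_ring_def)

context grd
begin

abbreviation "supp a \<equiv> {w \<in> carrier K. hcomp K R a w \<noteq> 0[R]}"

lemma gcomp_sub: "w \<in> carrier K \<Longrightarrow> additive_subgroup (gcomp R w) R"
  using grd by (simp add: graded_ring_def)

lemma gcomp_carrier: "w \<in> carrier K \<Longrightarrow> a \<in> gcomp R w \<Longrightarrow> a \<in> carrier R"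
  using additive_subgroup.a_Hcarr[OF gcomp_sub] .

lemma gcomp_zero: "w \<in> carrier K \<Longrightarrow> 0[R] \<in> gcomp R w"
  using additive_subgroup.zero_closed[OF gcomp_sub] .

lemma gcomp_add: "w \<in> carrier K \<Longrightarrow> a \<in> gcomp R w \<Longrightarrow> b \<in> gcomp R w \<Longrightarrow> a +[R] b \<in> gcomp R w"
  using additive_subgroup.a_closed[OF gcomp_sub] .

lemma gcomp_neg: "w \<in> carrier K \<Longrightarrow> a \<in> gcomp R w \<Longrightarrow> \<ominus>[R] a \<in> gcomp R w"
  using subgroup.m_inv_closed[OF additive_subgroup.a_subgroup[OF gcomp_sub]] by (simp add: a_inv_def)

lemma gcomp_mult: "v \<in> carrier K \<Longrightarrow> w \<in> carrier K \<Longrightarrow> a \<in> gcomp R v \<Longrightarrow> b \<in> gcomp R w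
  \<Longrightarrow> a *[R] b \<in> gcomp R (v *[K] w)"
  using grd by (simp add: graded_ring_def)

lemma hcomp_unique_ex:
  assumes "a \<in> carrier R"
  shows "\<exists>!c. c \<in> (\<Pi>\<^sub>E w\<in>carrier K. gcomp R w) \<and>
        finite {w \<in> carrier K. c w \<noteq> 0[R]} \<and>
        a = finsum R c {w \<in> carrier K. c w \<noteq> 0[R]}"
  using grd assms by (simp add: graded_ring_def)

lemma hcomp_props:
  assumes "a \<in> carrier R"
  shows "hcomp K R a \<in> (\<Pi>\<^sub>E w\<in>carrier K. gcomp R w)" "finite (supp a)"
    "a = finsum R (hcomp K R a) (supp a)"
  using theI'[OF hcomp_unique_ex[OF assms]] by (simp_all add: hcomp_def)

lemma hcomp_in: "a \<in> carrier R \<Longrightarrow> w \<in> carrier K \<Longrightarrow> hcomp K R a w \<in> gcomp R w"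
  using hcomp_props(1) by blast

lemma hcomp_carrier: "a \<in> carrier R \<Longrightarrow> w \<in> carrier K \<Longrightarrow> hcomp K R a w \<in> carrier R"
  using hcomp_in gcomp_carrier by blast

lemma hcomp_sum:
  assumes "a \<in> carrier R" "finite J" "supp a \<subseteq> J" "J \<subseteq> carrier K"
  shows "finsum R (hcomp K R a) J = a"
proof -
  have "finsum R (hcomp K R a) (supp a) = finsum R (hcomp K R a) J"
    by (rule R.add.finprod_mono_neutral_cong_left) (use assms hcomp_carrier in auto)
  thus ?thesis using hcomp_props(3)[OF assms(1)] by simp
qed

text \<open>\<open>J\<close> need not be the exact support: padding the decomposition by zeros turns
  it into the one that \<open>hcomp\<close> selects. Every finite homogeneous decomposition thus
  reveals the components.\<close>

lemma hcomp_eqI: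
  assumes J: "finite J" "J \<subseteq> carrier K" and d: "\<And>w. w \<in> J \<Longrightarrow> d w \<in> gcomp R w"
    and a: "a = finsum R d J" and w: "w \<in> carrier K"
  shows "hcomp K R a w = (if w \<in> J then d w else 0[R])"
proof -
  define c where "c = (\<lambda>w\<in>carrier K. if w \<in> J then d w else 0[R])"
  have dc: "d \<in> J \<rightarrow> carrier R" using J d gcomp_carrier by blast
  have s: "{w \<in> carrier K. c w \<noteq> 0[R]} \<subseteq> J" by (auto simp: c_def split: if_splits)
  have 1: "c \<in> (\<Pi>\<^sub>E w\<in>carrier K. gcomp R w)" using d gcomp_zero by (auto simp: c_def)
  have 2: "finite {w \<in> carrier K. c w \<noteq> 0[R]}" using s J finite_subset by blast
  have 3: "finsum R c {w \<in> carrier K. c w \<noteq> 0[R]} = finsum R d J"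
    by (rule R.add.finprod_mono_neutral_cong_left) (use J s dc in \<open>auto simp: c_def split: if_splits\<close>)
  have ac: "a \<in> carrier R" using a dc by simp
  have "hcomp K R a = c"
    unfolding hcomp_def by (rule the1_equality[OF hcomp_unique_ex[OF ac]]) (use 1 2 3 a in simp)
  thus ?thesis using w by (simp add: c_def)
qed

lemma hcomp_homog:
  assumes "a \<in> gcomp R v" "v \<in> carrier K" "w \<in> carrier K"
  shows "hcomp K R a w = (if w = v then a else 0[R])"
  using hcomp_eqI[of "{v}" "\<lambda>_. a" a w] assms gcomp_carrier by simp

lemma hcomp_zero: "w \<in> carrier K \<Longrightarrow> hcomp K R 0[R] w = 0[R]"
  using hcomp_homog gcomp_zero by metis

lemma hcomp_add:
  assumes "a \<in> carrier R" "b \<in> carrier R" "w \<in> carrier K"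
  shows "hcomp K R (a +[R] b) w = hcomp K R a w +[R] hcomp K R b w"
proof -
  \<comment> \<open>Adding \<open>w\<close> makes the formula for its component the same whether or
    not \<open>w\<close> lies in one of the supports.\<close>
  let ?J = "insert w (supp a \<union> supp b)"
  have J: "finite ?J" "?J \<subseteq> carrier K" using assms hcomp_props(2) by auto
  have "a +[R] b = finsum R (hcomp K R a) ?J +[R] finsum R (hcomp K R b) ?J"
    using hcomp_sum[OF assms(1) J(1) subset_trans[OF Un_upper1 subset_insertI] J(2)]
      hcomp_sum[OF assms(2) J(1) subset_trans[OF Un_upper2 subset_insertI] J(2)] by simp
  also have "\<dots> = finsum R (\<lambda>w. hcomp K R a w +[R] hcomp K R b w) ?J"
    by (rule R.finsum_addf[symmetric]) (use assms hcomp_carrier in auto)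
  finally have e: "a +[R] b = finsum R (\<lambda>w. hcomp K R a w +[R] hcomp K R b w) ?J" .
  have d: "hcomp K R a u +[R] hcomp K R b u \<in> gcomp R u" if "u \<in> ?J" for u
  proof -
    have u: "u \<in> carrier K" using that J(2) by (rule subsetD[rotated])
    show ?thesis by (rule gcomp_add[OF u hcomp_in[OF assms(1) u] hcomp_in[OF assms(2) u]])
  qed
  show ?thesis using hcomp_eqI[OF J d e assms(3)] by simp
qed

text \<open>Multiplying a decomposition termwise by \<open>b\<close> and translating its index set
  by \<open>v\<close> gives a homogeneous decomposition again, so \<open>hcomp_eqI\<close>
  applies.\<close>

lemma hcomp_mult_homog:
  assumes "a \<in> carrier R" "v \<in> carrier K" "b \<in> gcomp R v" "w \<in> carrier K"
  shows "hcomp K R (b *[R] a) (v *[K] w) = b *[R] hcomp K R a w"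
proof -
  let ?J = "insert w (supp a)"
  let ?d = "\<lambda>u. b *[R] hcomp K R a (inv[K] v *[K] u)"
  have J: "finite ?J" "?J \<subseteq> carrier K" using assms hcomp_props(2) by auto
  have bR: "b \<in> carrier R" using assms gcomp_carrier by blast
  have canc: "inv[K] v *[K] (v *[K] u) = u" if "u \<in> carrier K" for u
    using that assms by (simp add: K.m_assoc[symmetric])
  have "b *[R] a = b *[R] finsum R (hcomp K R a) ?J"
    using hcomp_sum[OF assms(1) J(1) subset_insertI J(2)] by simp
  also have "\<dots> = finsum R (\<lambda>u. b *[R] hcomp K R a u) ?J"
    by (rule R.finsum_rdistr) (use J assms bR hcomp_carrier in auto)
  also have "\<dots> = finsum R (\<lambda>u. ?d (v *[K] u)) ?J"
    by (rule R.finsum_cong') (use J assms bR hcomp_carrier canc in auto)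
  also have "\<dots> = finsum R ?d ((\<lambda>u. v *[K] u) ` ?J)"
    by (rule R.finsum_reindex[symmetric])
      (use J assms bR hcomp_carrier canc in \<open>auto simp: inj_on_def\<close>)
  finally have e: "b *[R] a = finsum R ?d ((\<lambda>u. v *[K] u) ` ?J)" .
  have d: "?d u \<in> gcomp R u" if u: "u \<in> (\<lambda>u. v *[K] u) ` ?J" for u
  proof -
    obtain u' where u': "u = v *[K] u'" "u' \<in> carrier K" using imageE[OF u] subsetD[OF J(2)] by metis
    show ?thesis unfolding u'(1) canc[OF u'(2)] using gcomp_mult assms hcomp_in u' by blast
  qed
  have "hcomp K R (b *[R] a) (v *[K] w) = ?d (v *[K] w)"
    using hcomp_eqI[OF _ _ d e, of "v *[K] w"] J assms by auto
  thus ?thesis using canc assms by simp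
qed

lemma hcomp_mult_homog':
  assumes "a \<in> carrier R" "v \<in> carrier K" "b \<in> gcomp R v" "w \<in> carrier K"
  shows "hcomp K R (b *[R] a) w = b *[R] hcomp K R a (inv[K] v *[K] w)"
  using hcomp_mult_homog[OF assms(1-3), of "inv[K] v *[K] w"] assms by (simp add: K.m_assoc[symmetric])

lemma hcomp_ext:
  assumes "a \<in> carrier R" "b \<in> carrier R" "\<And>w. w \<in> carrier K \<Longrightarrow> hcomp K R a w = hcomp K R b w"
  shows "a = b"
proof -
  let ?J = "supp a \<union> supp b"
  have J: "finite ?J" "?J \<subseteq> carrier K" using assms hcomp_props(2) by auto
  have "finsum R (hcomp K R a) ?J = finsum R (hcomp K R b) ?J"
    by (rule R.finsum_cong') (use assms hcomp_carrier in auto)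
  thus ?thesis using hcomp_sum[OF assms(1) J(1) Un_upper1 J(2)] hcomp_sum[OF assms(2) J(1) Un_upper2 J(2)] by simp
qed

lemma hcomp_neg:
  assumes "a \<in> carrier R" "w \<in> carrier K"
  shows "hcomp K R (\<ominus>[R] a) w = \<ominus>[R] hcomp K R a w"
proof -
  have "hcomp K R (\<ominus>[R] a) w +[R] hcomp K R a w = 0[R]"
    using hcomp_add[of "\<ominus>[R] a" a w] assms by (simp add: R.l_neg hcomp_zero)
  thus ?thesis using assms hcomp_carrier by (metis R.a_inv_closed R.minus_equality)
qed

lemma gcomp_disjoint:
  assumes "a \<in> gcomp R v" "a \<in> gcomp R w" "v \<in> carrier K" "w \<in> carrier K" "a \<noteq> 0[R]"
  shows "v = w"
  using hcomp_homog[of a v w] hcomp_homog[of a w w] assms by metis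

lemma hdeg_eq: "a \<in> gcomp R w \<Longrightarrow> w \<in> carrier K \<Longrightarrow> a \<noteq> 0[R] \<Longrightarrow> hdeg K R a = w"
  unfolding hdeg_def using gcomp_disjoint by blast

lemma hplusE:
  assumes "a \<in> hplus K R"
  obtains w where "w \<in> carrier K" "a \<in> gcomp R w" "a \<noteq> 0[R]" "a \<in> carrier R" "hdeg K R a = w"
  using assms gcomp_carrier hdeg_eq by (auto simp: hplus_def hom_elems_def)

lemma hplusI: "w \<in> carrier K \<Longrightarrow> a \<in> gcomp R w \<Longrightarrow> a \<noteq> 0[R] \<Longrightarrow> a \<in> hplus K R"
  by (auto simp: hplus_def hom_elems_def)

lemma hplus_carrier: "a \<in> hplus K R \<Longrightarrow> a \<in> carrier R"
  by (auto elim: hplusE)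

lemma hom_elems_carrier: "a \<in> hom_elems K R \<Longrightarrow> a \<in> carrier R"
  by (auto simp: hom_elems_def gcomp_carrier)

text \<open>Let \<open>e\<close> be the component of the identity in degree \<open>1[K]\<close>.
  Comparing components in \<open>b 1 = b\<close> gives \<open>b e = b\<close> for every homogeneous
  \<open>b\<close>; summing this over the components of the identity yields
  \<open>e = 1\<close>.\<close>

lemma one_homog: "1[R] \<in> gcomp R 1[K]"
proof -
  let ?e = "hcomp K R 1[R] 1[K]"
  have e: "?e \<in> carrier R" "?e \<in> gcomp R 1[K]" by (rule hcomp_carrier hcomp_in; simp)+
  have h: "b *[R] ?e = b" if "b \<in> gcomp R v" "v \<in> carrier K" for b v
    using hcomp_mult_homog[of "1[R]" v b "1[K]"] that gcomp_carrier hcomp_homog by simp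
  have "1[R] *[R] ?e = finsum R (hcomp K R 1[R]) (supp 1[R]) *[R] ?e"
    using hcomp_props(3)[of "1[R]"] by simp
  also have "\<dots> = finsum R (\<lambda>w. hcomp K R 1[R] w *[R] ?e) (supp 1[R])"
    by (rule R.finsum_ldistr) (use e hcomp_props(2) hcomp_carrier in auto)
  also have "\<dots> = finsum R (hcomp K R 1[R]) (supp 1[R])"
    by (rule R.finsum_cong') (use h[OF hcomp_in] hcomp_carrier in auto)
  also have "\<dots> = 1[R]" using hcomp_props(3)[of "1[R]"] by simp
  finally show ?thesis using e by simp
qed

text \<open>In the product of \<open>u\<close> with its inverse only the component of the inverse in
  degree \<open>inv[K] w\<close> contributes to degree \<open>1[K]\<close>. That component is
  therefore already an inverse of \<open>u\<close>.\<close>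

lemma inv_homog:
  assumes "u \<in> gcomp R w" "w \<in> carrier K" "u \<in> Units R"
  shows "inv[R] u \<in> gcomp R (inv[K] w)"
proof -
  have x: "inv[R] u \<in> carrier R" "u *[R] inv[R] u = 1[R]" "u \<in> carrier R"
    using assms by auto
  let ?y = "hcomp K R (inv[R] u) (inv[K] w)"
  have "hcomp K R (u *[R] inv[R] u) (w *[K] inv[K] w) = u *[R] ?y"
    using hcomp_mult_homog x assms by blast
  hence "u *[R] ?y = 1[R]" using x assms one_homog by (simp add: hcomp_homog)
  hence "?y = inv[R] u" using x hcomp_carrier[OF x(1)] assms
    by (metis K.inv_closed R.comm_inv_char)
  thus ?thesis using hcomp_in[OF x(1), of "inv[K] w"] assms by simp
qed

text \<open>Induction along the homogeneous decomposition. The last premise concerns only the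
  components of the given \<open>a\<close>, so that what is known about \<open>a\<close> can be used
  there.\<close>

lemma hom_induct:
  assumes "a \<in> carrier R" "P 0[R]"
    and "\<And>x y. x \<in> carrier R \<Longrightarrow> y \<in> carrier R \<Longrightarrow> P x \<Longrightarrow> P y \<Longrightarrow> P (x +[R] y)"
    and "\<And>w. w \<in> carrier K \<Longrightarrow> P (hcomp K R a w)"
  shows "P a"
proof -
  have "finite J \<Longrightarrow> J \<subseteq> carrier K \<Longrightarrow> P (finsum R (hcomp K R a) J)" for J
  proof (induction J rule: finite_induct)
    case (insert w J)
    have "finsum R (hcomp K R a) (insert w J) = hcomp K R a w +[R] finsum R (hcomp K R a) J"
      using insert assms(1) hcomp_carrier by (intro R.finsum_insert) auto
    thus ?case using insert assms hcomp_carrier by (auto intro!: assms(3) R.finsum_closed)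
  qed (use assms in simp)
  thus ?thesis using hcomp_sum[OF assms(1) hcomp_props(2)[OF assms(1)] subset_refl]
    hcomp_props(2)[OF assms(1)] by fastforce
qed

text \<open>The elements all of whose components lie in \<open>I\<close> form an ideal containing
  the homogeneous elements of \<open>I\<close>. It contains the ideal generated by these, which is
  \<open>I\<close>.\<close>

lemma graded_ideal_hcomp:
  assumes "graded_ideal K R I" "a \<in> I" "w \<in> carrier K"
  shows "hcomp K R a w \<in> I"
proof -
  interpret I: ideal I R using assms by (simp add: graded_ideal_def)
  define J where "J = {a \<in> carrier R. \<forall>w\<in>carrier K. hcomp K R a w \<in> I}"
  have add: "x +[R] y \<in> J" if "x \<in> J" "y \<in> J" for x y
    using that by (auto simp: J_def hcomp_add)
  have mul: "b *[R] x \<in> J" if b: "b \<in> carrier R" and x: "x \<in> J" for b x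
  proof (rule hom_induct[OF b])
    have xR: "x \<in> carrier R" using x by (simp add: J_def)
    show "0[R] *[R] x \<in> J" using xR by (simp add: J_def hcomp_zero)
    show "(c +[R] d) *[R] x \<in> J" if "c \<in> carrier R" "d \<in> carrier R" "c *[R] x \<in> J" "d *[R] x \<in> J" for c d
      using that add xR by (simp add: R.l_distr)
    show "hcomp K R b v *[R] x \<in> J" if v: "v \<in> carrier K" for v
      using hcomp_mult_homog'[OF xR v hcomp_in[OF b v]] x xR hcomp_carrier[OF b v] v
      by (auto simp: J_def I.I_l_closed)
  qed
  have "ideal J R"
  proof (rule idealI[OF R.ring_axioms])
    show "subgroup J (add_monoid R)"
      by (rule R.add.subgroupI) (use add in \<open>auto simp: J_def hcomp_zero hcomp_neg a_inv_def[symmetric]\<close>)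
    show "b *[R] x \<in> J" "x *[R] b \<in> J" if "x \<in> J" "b \<in> carrier R" for x b
      using mul[OF that(2,1)] that by (auto simp: J_def R.m_comm)
  qed
  moreover have "I \<inter> hom_elems K R \<subseteq> J"
    by (auto simp: J_def hom_elems_def gcomp_carrier hcomp_homog)
  ultimately have "Idl\<^bsub>R\<^esub> (I \<inter> hom_elems K R) \<subseteq> J" by (rule R.genideal_minimal)
  moreover have "I = Idl\<^bsub>R\<^esub> (I \<inter> hom_elems K R)" using assms(1) unfolding graded_ideal_def by blast
  ultimately show ?thesis using assms J_def by blast
qed

lemma graded_idealI:
  assumes "ideal I R" "\<And>a w. a \<in> I \<Longrightarrow> w \<in> carrier K \<Longrightarrow> hcomp K R a w \<in> I"
  shows "graded_ideal K R I"
proof -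
  interpret I: ideal I R by fact
  let ?H = "I \<inter> hom_elems K R"
  have H: "?H \<subseteq> carrier R" using hom_elems_carrier by blast
  interpret J: ideal "Idl\<^bsub>R\<^esub> ?H" R by (rule R.genideal_ideal[OF H])
  have "a \<in> Idl\<^bsub>R\<^esub> ?H" if a: "a \<in> I" for a
  proof (rule hom_induct[of a])
    show "hcomp K R a w \<in> Idl\<^bsub>R\<^esub> ?H" if w: "w \<in> carrier K" for w
      using assms(2)[OF a w] hcomp_in[OF I.a_Hcarr[OF a] w] w R.genideal_self[OF H]
      by (auto simp: hom_elems_def)
  qed (use a I.a_Hcarr J.a_closed in auto)
  moreover have "Idl\<^bsub>R\<^esub> ?H \<subseteq> I" by (rule R.genideal_minimal[OF assms(1)]) simp
  ultimately show ?thesis using assms(1) by (auto simp: graded_ideal_def)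
qed

lemma graded_ideal_cgen:
  assumes "t \<in> hom_elems K R"
  shows "graded_ideal K R (PIdl\<^bsub>R\<^esub> t)"
proof (rule graded_idealI)
  obtain v where v: "v \<in> carrier K" "t \<in> gcomp R v" using assms by (auto simp: hom_elems_def)
  have tR: "t \<in> carrier R" using v gcomp_carrier by blast
  show "ideal (PIdl\<^bsub>R\<^esub> t) R" by (rule R.cgenideal_ideal[OF tR])
  show "hcomp K R a w \<in> PIdl\<^bsub>R\<^esub> t" if aw: "a \<in> PIdl\<^bsub>R\<^esub> t" "w \<in> carrier K" for a w
  proof -
    obtain x where x: "x \<in> carrier R" "a = t *[R] x" using aw tR by (auto simp: cgenideal_def R.m_comm)
    have "hcomp K R a w = t *[R] hcomp K R x (inv[K] v *[K] w)"
      unfolding x(2) by (rule hcomp_mult_homog'[OF x(1) v aw(2)])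
    moreover have "hcomp K R x (inv[K] v *[K] w) \<in> carrier R"
      using x v aw by (simp add: hcomp_carrier)
    ultimately show ?thesis using tR R.m_comm by (auto simp: cgenideal_def)
  qed
qed

end

text \<open>Uniqueness is asked only for decompositions of zero. Applied to the difference of two
  decompositions over the union of their supports, it gives uniqueness in general.\<close>

lemma graded_ringI:
  assumes "comm_group K" "cring R"
    and sub: "\<And>w. w \<in> carrier K \<Longrightarrow> additive_subgroup (gcomp R w) R"
    and mult: "\<And>v w a b. v \<in> carrier K \<Longrightarrow> w \<in> carrier K \<Longrightarrow> a \<in> gcomp R v \<Longrightarrow> b \<in> gcomp R w
        \<Longrightarrow> a *[R] b \<in> gcomp R (v *[K] w)"
    and ex: "\<And>a. a \<in> carrier R \<Longrightarrow> \<exists>c J. finite J \<and> J \<subseteq> carrier K \<and> (\<forall>w\<in>J. c w \<in> gcomp R w) \<and> a = finsum R c J"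
    and uniq: "\<And>c J w. finite J \<Longrightarrow> J \<subseteq> carrier K \<Longrightarrow> (\<And>w. w \<in> J \<Longrightarrow> c w \<in> gcomp R w)
        \<Longrightarrow> finsum R c J = 0[R] \<Longrightarrow> w \<in> J \<Longrightarrow> c w = 0[R]"
  shows "graded_ring K R"
  unfolding graded_ring_def
proof (intro conjI ballI)
  interpret R: cring R by fact
  have sc: "gcomp R w \<subseteq> carrier R" if "w \<in> carrier K" for w
    using additive_subgroup.a_Hcarr[OF sub[OF that]] by blast
  have zero: "0[R] \<in> gcomp R w" if "w \<in> carrier K" for w
    using additive_subgroup.zero_closed[OF sub[OF that]] .
  fix a assume a: "a \<in> carrier R"
  let ?s = "\<lambda>c. {w \<in> carrier K. c w \<noteq> 0[R]}"
  obtain c J where c: "finite J" "J \<subseteq> carrier K" "\<forall>w\<in>J. c w \<in> gcomp R w" "a = finsum R c J"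
    using ex[OF a] by blast
  define c' where "c' = (\<lambda>w\<in>carrier K. if w \<in> J then c w else 0[R])"
  show "\<exists>!c. c \<in> (\<Pi>\<^sub>E w\<in>carrier K. gcomp R w) \<and> finite (?s c) \<and> a = finsum R c (?s c)"
  proof (rule ex1I[of _ c'])
    have s: "?s c' \<subseteq> J" by (auto simp: c'_def split: if_splits)
    have "finsum R c' (?s c') = finsum R c J"
      by (rule R.add.finprod_mono_neutral_cong_left) (use c s subsetD[OF sc] in \<open>auto simp: c'_def subset_iff split: if_splits\<close>)
    thus *: "c' \<in> (\<Pi>\<^sub>E w\<in>carrier K. gcomp R w) \<and> finite (?s c') \<and> a = finsum R c' (?s c')"
      using c s zero finite_subset by (auto simp: c'_def)
    fix d assume d: "d \<in> (\<Pi>\<^sub>E w\<in>carrier K. gcomp R w) \<and> finite (?s d) \<and> a = finsum R d (?s d)"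
    let ?L = "?s c' \<union> ?s d"
    let ?e = "\<lambda>w. c' w +[R] \<ominus>[R] d w"
    have cR: "c' w \<in> carrier R" if "w \<in> carrier K" for w using * that sc by blast
    have dR: "d w \<in> carrier R" if "w \<in> carrier K" for w using d that sc by blast
    have e: "?e w \<in> gcomp R w" if w: "w \<in> carrier K" for w
    proof -
      have "c' w \<in> gcomp R w" "d w \<in> gcomp R w" using * d w by blast+
      thus ?thesis using additive_subgroup.a_closed[OF sub[OF w]]
        subgroup.m_inv_closed[OF additive_subgroup.a_subgroup[OF sub[OF w]]] by (simp add: a_inv_def)
    qed
    have 1: "finsum R c' (?s c') = finsum R c' ?L" "finsum R d (?s d) = finsum R d ?L"
      by (rule R.add.finprod_mono_neutral_cong_left; use * d cR dR in auto)+
    have "finsum R ?e ?L = finsum R c' ?L +[R] finsum R (\<lambda>w. \<ominus>[R] d w) ?L"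
      by (rule R.finsum_addf) (use cR dR in auto)
    also have "finsum R (\<lambda>w. \<ominus>[R] d w) ?L = finsum R (\<lambda>w. (\<ominus>[R] 1[R]) *[R] d w) ?L"
      by (rule R.finsum_cong') (use dR in \<open>auto simp: R.l_minus\<close>)
    also have "\<dots> = (\<ominus>[R] 1[R]) *[R] finsum R d ?L"
      by (rule R.finsum_rdistr[symmetric]) (use * d dR in auto)
    also have "\<dots> = \<ominus>[R] a" using a 1 d by (auto simp: R.l_minus)
    also have "finsum R c' ?L = a" using 1 * by simp
    finally have "finsum R ?e ?L = 0[R]" using a by (simp add: R.r_neg)
    hence ez: "?e w = 0[R]" if "w \<in> ?L" for w
      by (intro uniq[of ?L ?e w]) (use * d e that in auto)
    have "c' w = d w" if "w \<in> carrier K" for w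
    proof (cases "w \<in> ?L")
      case True
      from ez[OF this] show ?thesis using cR[OF that] dR[OF that] by (metis R.minus_eq R.r_right_minus_eq)
    qed (use that in auto)
    thus "d = c'" using * d by (intro extensionalityI[of _ "carrier K"]) (auto simp: PiE_def)
  qed
qed (use assms in auto)

locale grd_hom = A: grd K A + S: grd K S
  for K :: "('k, 'l) monoid_scheme" and A :: "('a, 'k, 'm) gring_scheme" and S :: "('b, 'k, 'n) gring_scheme" +
  fixes h
  assumes hom: "h \<in> ring_hom A S" and homg: "\<And>w a. w \<in> carrier K \<Longrightarrow> a \<in> gcomp A w \<Longrightarrow> h a \<in> gcomp S w"
begin

sublocale rh: ring_hom_cring A S h
  by (rule ring_hom_cringI[OF A.R.cring_axioms S.R.cring_axioms hom])

lemma hom_hcomp: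
  assumes "a \<in> carrier A" "w \<in> carrier K"
  shows "hcomp K S (h a) w = h (hcomp K A a w)"
proof -
  have "h a = h (finsum A (hcomp K A a) (A.supp a))"
    using A.hcomp_props(3)[OF assms(1)] by (rule arg_cong)
  also have "\<dots> = finsum S (\<lambda>w. h (hcomp K A a w)) (A.supp a)"
    using rh.hom_finsum[of "hcomp K A a" "A.supp a"] assms A.hcomp_carrier by (auto simp: o_def)
  finally have e: "h a = finsum S (\<lambda>w. h (hcomp K A a w)) (A.supp a)" .
  have "hcomp K S (h a) w = (if w \<in> A.supp a then h (hcomp K A a w) else 0[S])"
    by (rule S.hcomp_eqI[OF _ _ _ e]) (use assms A.hcomp_props(2) A.hcomp_in homg in auto)
  thus ?thesis using assms by auto
qed

end

section \<open>Localizations inside a larger ring\<close>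

locale loc_map = A: cring A + B: cring B
  for A :: "('a, 'm) ring_scheme" and B :: "('b, 'n) ring_scheme" +
  fixes j :: "'a \<Rightarrow> 'b" and T :: "'a set"
  assumes j_hom: "j \<in> ring_hom A B" and j_inj: "inj_on j (carrier A)"
    and T_carrier: "T \<subseteq> carrier A" and T_one: "1[A] \<in> T"
    and T_mult: "\<And>s t. s \<in> T \<Longrightarrow> t \<in> T \<Longrightarrow> s *[A] t \<in> T"
    and T_units: "\<And>s. s \<in> T \<Longrightarrow> j s \<in> Units B"
begin

definition q :: "'a \<Rightarrow> 'a \<Rightarrow> 'b" where "q a s = j a *[B] inv[B] (j s)"

lemma j_simps:
  "a \<in> carrier A \<Longrightarrow> j a \<in> carrier B" "a \<in> carrier A \<Longrightarrow> b \<in> carrier A \<Longrightarrow> j (a *[A] b) = j a *[B] j b"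
  "a \<in> carrier A \<Longrightarrow> b \<in> carrier A \<Longrightarrow> j (a +[A] b) = j a +[B] j b" "j 1[A] = 1[B]"
  using j_hom by (auto simp: ring_hom_def)

lemma j_zero: "j 0[A] = 0[B]"
  using ring_hom_cring.hom_zero[OF ring_hom_cringI[OF A.cring_axioms B.cring_axioms j_hom]] .

lemma T_sub: "s \<in> T \<Longrightarrow> s \<in> carrier A"
  using T_carrier by blast

lemma T_inv: "s \<in> T \<Longrightarrow> inv[B] (j s) \<in> carrier B" "s \<in> T \<Longrightarrow> j s *[B] inv[B] (j s) = 1[B]"
  using T_units by auto

lemma q_carrier: "a \<in> carrier A \<Longrightarrow> s \<in> T \<Longrightarrow> q a s \<in> carrier B"
  by (simp add: q_def j_simps T_inv)

lemma q_cancel: "a \<in> carrier A \<Longrightarrow> s \<in> T \<Longrightarrow> q a s *[B] j s = j a"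
  using T_inv[of s] T_sub[of s] by (simp add: q_def j_simps B.m_assoc B.m_comm[of "inv[B] j s"])

lemma q_eqI:
  assumes "x \<in> carrier B" "s \<in> T" "a \<in> carrier A" "x *[B] j s = j a"
  shows "x = q a s"
proof -
  have "q a s = x *[B] (j s *[B] inv[B] (j s))"
    using assms(4) B.m_assoc[OF assms(1) _ T_inv(1)[OF assms(2)], of "j s"] assms(2) T_sub j_simps(1)
    by (simp add: q_def)
  thus ?thesis using assms T_inv by simp
qed

lemma q_eq:
  assumes "a \<in> carrier A" "b \<in> carrier A" "s \<in> T" "t \<in> T"
  shows "q a s = q b t \<longleftrightarrow> t *[A] a = s *[A] b"
proof
  assume e: "q a s = q b t"
  have "j (t *[A] a) = q a s *[B] j s *[B] j t"
    using assms T_sub by (simp add: q_cancel j_simps B.m_comm)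
  also have "\<dots> = q b t *[B] j t *[B] j s"
    unfolding e using assms T_sub by (simp add: q_carrier j_simps B.m_ac)
  also have "\<dots> = j (s *[A] b)" using assms T_sub by (simp add: q_cancel j_simps B.m_comm)
  finally show "t *[A] a = s *[A] b" using assms T_sub j_inj by (simp add: inj_on_def)
next
  assume e: "t *[A] a = s *[A] b"
  have "q a s *[B] j t *[B] j s = j (t *[A] a)"
  proof -
    have "q a s *[B] j t *[B] j s = q a s *[B] j s *[B] j t"
      using assms T_sub by (simp add: q_carrier j_simps B.m_ac)
    thus ?thesis using assms T_sub by (simp add: q_cancel j_simps B.m_comm)
  qed
  also have "\<dots> = j b *[B] j s" using assms T_sub e by (simp add: j_simps B.m_comm)
  finally have "(q a s *[B] j t) *[B] j s *[B] inv[B] (j s) = j b *[B] j s *[B] inv[B] (j s)" by simp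
  hence "q a s *[B] j t = j b"
    using assms T_sub T_inv by (simp add: q_carrier j_simps B.m_assoc)
  thus "q a s = q b t" using assms q_eqI q_carrier by blast
qed

lemma rfrac_fibre:
  assumes "a \<in> carrier A" "s \<in> T"
  shows "rfrac A T a s = {(b, t). b \<in> carrier A \<and> t \<in> T \<and> q b t = q a s}"
proof -
  have "(\<exists>u\<in>T. u *[A] (t *[A] a) = u *[A] (s *[A] b)) \<longleftrightarrow> q b t = q a s"
    if "b \<in> carrier A" "t \<in> T" for b t
  proof
    assume "\<exists>u\<in>T. u *[A] (t *[A] a) = u *[A] (s *[A] b)"
    then obtain u where u: "u \<in> T" "u *[A] (t *[A] a) = u *[A] (s *[A] b)" by blast
    have "j u *[B] j (t *[A] a) = j u *[B] j (s *[A] b)"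
      using u assms that T_sub by (metis A.m_closed j_simps(2))
    hence "j (t *[A] a) = j (s *[A] b)"
      using B.Units_l_cancel[OF T_units[OF u(1)]] assms that T_sub j_simps(1) by (meson A.m_closed)
    hence "t *[A] a = s *[A] b" using assms that T_sub j_inj by (simp add: inj_on_def)
    thus "q b t = q a s" using q_eq[of a b s t] assms that by simp
  next
    assume "q b t = q a s"
    hence "t *[A] a = s *[A] b" using q_eq[of a b s t] assms that by simp
    thus "\<exists>u\<in>T. u *[A] (t *[A] a) = u *[A] (s *[A] b)" using T_one by auto
  qed
  thus ?thesis by (auto simp: rfrac_def)
qed

lemma rfrac_eq:
  assumes "a \<in> carrier A" "b \<in> carrier A" "s \<in> T" "t \<in> T"
  shows "rfrac A T a s = rfrac A T b t \<longleftrightarrow> q a s = q b t"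
  using assms by (auto simp: rfrac_fibre set_eq_iff)

lemma loc_lift_rfrac:
  assumes "a \<in> carrier A" "s \<in> T"
  shows "loc_lift B j (rfrac A T a s) = q a s"
  unfolding loc_lift_def rfrac_fibre[OF assms]
  by (rule the_equality) (use assms in \<open>auto simp: q_def\<close>)

lemma loc_mem: "P \<in> carrier (loc A T) \<longleftrightarrow> (\<exists>a\<in>carrier A. \<exists>s\<in>T. P = rfrac A T a s)"
  by (auto simp: loc_def)

text \<open>The union over representatives collapses as soon as the value of the result is a
  function \<open>g\<close> of the values of the arguments: then all its members are the same
  fibre.\<close>

lemma loc_op:
  assumes "a \<in> carrier A" "s \<in> T" "b \<in> carrier A" "t \<in> T"
    and c: "\<And>a s b t. a \<in> carrier A \<Longrightarrow> s \<in> T \<Longrightarrow> b \<in> carrier A \<Longrightarrow> t \<in> T \<Longrightarrow> f a s b t \<in> carrier A \<and> q (f a s b t) (s *[A] t) = g (q a s) (q b t)"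
  shows "(\<Union>(a, s)\<in>rfrac A T a s. \<Union>(b, t)\<in>rfrac A T b t. rfrac A T (f a s b t) (s *[A] t)) = rfrac A T (f a s b t) (s *[A] t)"
  (is "?L = ?R")
proof -
  have *: "rfrac A T (f a' s' b' t') (s' *[A] t') = ?R"
    if "(a', s') \<in> rfrac A T a s" "(b', t') \<in> rfrac A T b t" for a' s' b' t'
    using that assms(1-4) c by (auto simp: rfrac_fibre rfrac_eq T_mult)
  have "(a, s) \<in> rfrac A T a s" "(b, t) \<in> rfrac A T b t" using assms by (auto simp: rfrac_fibre)
  thus ?thesis using * by blast
qed

lemma q_mult:
  assumes "a \<in> carrier A" "s \<in> T" "b \<in> carrier A" "t \<in> T"
  shows "q (a *[A] b) (s *[A] t) = q a s *[B] q b t"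
proof (rule q_eqI[symmetric])
  have "q a s *[B] q b t *[B] j (s *[A] t) = (q a s *[B] j s) *[B] (q b t *[B] j t)"
    using assms T_sub by (simp add: j_simps q_carrier B.m_ac)
  thus "q a s *[B] q b t *[B] j (s *[A] t) = j (a *[A] b)"
    using assms T_sub by (simp add: j_simps q_cancel)
qed (use assms T_sub in \<open>auto simp: q_carrier T_mult\<close>)

lemma q_add:
  assumes "a \<in> carrier A" "s \<in> T" "b \<in> carrier A" "t \<in> T"
  shows "q ((t *[A] a) +[A] (s *[A] b)) (s *[A] t) = q a s +[B] q b t"
proof (rule q_eqI[symmetric])
  have "(q a s +[B] q b t) *[B] j (s *[A] t) = j t *[B] (q a s *[B] j s) +[B] j s *[B] (q b t *[B] j t)"
    using assms T_sub by (simp add: j_simps q_carrier B.m_ac B.l_distr B.r_distr)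
  thus "(q a s +[B] q b t) *[B] j (s *[A] t) = j ((t *[A] a) +[A] (s *[A] b))"
    using assms T_sub by (simp add: j_simps q_cancel)
qed (use assms T_sub in \<open>auto simp: q_carrier T_mult\<close>)

lemma loc_mult:
  assumes "a \<in> carrier A" "s \<in> T" "b \<in> carrier A" "t \<in> T"
  shows "rfrac A T a s *[loc A T] rfrac A T b t = rfrac A T (a *[A] b) (s *[A] t)"
  using loc_op[OF assms, of "\<lambda>a s b t. a *[A] b" "\<lambda>x y. x *[B] y"] by (simp add: loc_def q_mult)

lemma loc_add:
  assumes "a \<in> carrier A" "s \<in> T" "b \<in> carrier A" "t \<in> T"
  shows "rfrac A T a s +[loc A T] rfrac A T b t = rfrac A T ((t *[A] a) +[A] (s *[A] b)) (s *[A] t)"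
  using loc_op[OF assms, of "\<lambda>a s b t. (t *[A] a) +[A] (s *[A] b)" "\<lambda>x y. x +[B] y"] T_sub
  by (simp add: loc_def q_add)

lemma loc_zero: "0[loc A T] = rfrac A T 0[A] 1[A]" and loc_one: "1[loc A T] = rfrac A T 1[A] 1[A]"
  by (simp_all add: loc_def)

lemma q_one: "a \<in> carrier A \<Longrightarrow> q a 1[A] = j a"
  by (simp add: q_def j_simps)

lemma loc_lift_hom: "loc_lift B j \<in> ring_hom (loc A T) B"
proof (rule ring_hom_memI)
  show "loc_lift B j x \<in> carrier B" if "x \<in> carrier (loc A T)" for x
    using that by (auto simp: loc_mem loc_lift_rfrac q_carrier)
  show "loc_lift B j (x *[loc A T] y) = loc_lift B j x *[B] loc_lift B j y"
    if "x \<in> carrier (loc A T)" "y \<in> carrier (loc A T)" for x y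
    using that T_sub by (auto simp: loc_mem loc_mult loc_lift_rfrac q_mult T_mult)
  show "loc_lift B j (x +[loc A T] y) = loc_lift B j x +[B] loc_lift B j y"
    if "x \<in> carrier (loc A T)" "y \<in> carrier (loc A T)" for x y
    using that T_sub by (auto simp: loc_mem loc_add loc_lift_rfrac q_add T_mult)
  show "loc_lift B j 1[loc A T] = 1[B]"
    by (simp add: loc_one loc_lift_rfrac T_one q_one j_simps)
qed

lemma loc_lift_zero: "loc_lift B j 0[loc A T] = 0[B]"
  by (simp add: loc_zero loc_lift_rfrac T_one q_one j_zero)

lemma loc_lift_inj: "inj_on (loc_lift B j) (carrier (loc A T))"
proof (rule inj_onI)
  fix x y assume "x \<in> carrier (loc A T)" "y \<in> carrier (loc A T)" and e: "loc_lift B j x = loc_lift B j y"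
  then obtain a s b t where *: "a \<in> carrier A" "s \<in> T" "b \<in> carrier A" "t \<in> T"
    "x = rfrac A T a s" "y = rfrac A T b t" unfolding loc_mem by blast
  show "x = y" using e * rfrac_eq[of a b s t] by (simp add: loc_lift_rfrac)
qed

lemma loc_lift_image: "loc_lift B j ` carrier (loc A T) = {q a s | a s. a \<in> carrier A \<and> s \<in> T}"
proof (rule equalityI; rule subsetI)
  fix x assume "x \<in> loc_lift B j ` carrier (loc A T)"
  then obtain P where P: "x = loc_lift B j P" "P \<in> carrier (loc A T)" by (rule imageE)
  obtain a s where *: "a \<in> carrier A" "s \<in> T" "P = rfrac A T a s"
    using P(2) loc_mem[of P] by (elim iffE impE bexE) auto
  have "x = q a s" using loc_lift_rfrac[OF *(1,2)] P(1) *(3) by simp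
  thus "x \<in> {q a s | a s. a \<in> carrier A \<and> s \<in> T}" using *(1,2) by blast
next
  fix x assume "x \<in> {q a s | a s. a \<in> carrier A \<and> s \<in> T}"
  then obtain a s where *: "a \<in> carrier A" "s \<in> T" "x = q a s" by (elim CollectE exE conjE)
  hence "rfrac A T a s \<in> carrier (loc A T)" using loc_mem[of "rfrac A T a s"] by auto
  from imageI[OF this, of "loc_lift B j"]
  show "x \<in> loc_lift B j ` carrier (loc A T)" using loc_lift_rfrac[OF *(1,2)] *(3) by simp
qed

text \<open>When every element of \<open>B\<close> is a fraction, no ring axiom has to be checked on
  representatives: all of them are pulled back from \<open>B\<close>.\<close>

lemma loc_cring:
  assumes "carrier B \<subseteq> {q a s | a s. a \<in> carrier A \<and> s \<in> T}"
  shows "cring (loc A T)" "loc_lift B j \<in> ring_iso (loc A T) B"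
proof -
  have i: "loc_lift B j ` carrier (loc A T) = carrier B"
    unfolding loc_lift_image using assms by (auto simp: q_carrier)
  hence bij: "bij_betw (loc_lift B j) (carrier (loc A T)) (carrier B)"
    by (simp add: bij_betw_def loc_lift_inj)
  show "loc_lift B j \<in> ring_iso (loc A T) B" using loc_lift_hom bij by (simp add: ring_iso_def)
  show "cring (loc A T)"
  proof (rule cring_transport[OF B.cring_axioms loc_lift_hom bij _ loc_lift_zero])
    show "x *[loc A T] y \<in> carrier (loc A T)" if xy: "x \<in> carrier (loc A T)" "y \<in> carrier (loc A T)" for x y
    proof -
      obtain a s b t where *: "a \<in> carrier A" "s \<in> T" "b \<in> carrier A" "t \<in> T"
        "x = rfrac A T a s" "y = rfrac A T b t" using xy unfolding loc_mem by blast
      show ?thesis unfolding *(5,6) loc_mult[OF *(1,2,3,4)] loc_mem using * T_mult T_sub by blast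
    qed
    show "x +[loc A T] y \<in> carrier (loc A T)" if xy: "x \<in> carrier (loc A T)" "y \<in> carrier (loc A T)" for x y
    proof -
      obtain a s b t where *: "a \<in> carrier A" "s \<in> T" "b \<in> carrier A" "t \<in> T"
        "x = rfrac A T a s" "y = rfrac A T b t" using xy unfolding loc_mem by blast
      show ?thesis unfolding *(5,6) loc_add[OF *(1,2,3,4)] loc_mem using * T_mult T_sub by blast
    qed
    show "0[loc A T] \<in> carrier (loc A T)" "1[loc A T] \<in> carrier (loc A T)"
      unfolding loc_mem loc_zero loc_one using T_one A.zero_closed A.one_closed by blast+
  qed
qed

end

section \<open>Transport along graded isomorphisms\<close>

lemma Qplus_simps [simp]:
  "carrier (Qplus K R) = carrier (loc R (hplus K R))"
  "monoid.mult (Qplus K R) = monoid.mult (loc R (hplus K R))"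
  "ring.add (Qplus K R) = ring.add (loc R (hplus K R))"
  "monoid.one (Qplus K R) = monoid.one (loc R (hplus K R))"
  "ring.zero (Qplus K R) = ring.zero (loc R (hplus K R))"
  "gcomp (Qplus K R) w = {rfrac R (hplus K R) a s | a s u. u \<in> carrier K \<and> s \<in> hplus K R \<inter> gcomp R u \<and>
                                            a \<in> gcomp R (w *[K] u)}"
  by (simp_all add: Qplus_def ring.defs gring.defs)

lemma graded_ring_transport:
  assumes B: "graded_ring K B" and A: "cring A" and h: "h \<in> ring_iso A B"
    and g: "\<And>w. w \<in> carrier K \<Longrightarrow> gcomp A w \<subseteq> carrier A"
    and hg: "\<And>w. w \<in> carrier K \<Longrightarrow> h ` gcomp A w = gcomp B w"
  shows "graded_ring K A" "graded_ring_iso K A B h"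
proof -
  interpret B: grd K B by (rule grdI[OF B])
  interpret A: cring A by (rule A)
  have hom: "h \<in> ring_hom A B" and bij: "bij_betw h (carrier A) (carrier B)"
    using h by (auto simp: ring_iso_def)
  interpret hm: ring_hom_cring A B h by (rule ring_hom_cringI[OF A B.R.cring_axioms hom])
  have inj: "x = y" if "x \<in> carrier A" "y \<in> carrier A" "h x = h y" for x y
    using bij that by (auto simp: bij_betw_def inj_on_def)
  have mem: "x \<in> gcomp A w \<longleftrightarrow> h x \<in> gcomp B w" if x: "x \<in> carrier A" and w: "w \<in> carrier K" for x w
  proof
    assume "h x \<in> gcomp B w"
    hence "h x \<in> h ` gcomp A w" by (simp add: hg[OF w])
    then obtain y where "y \<in> gcomp A w" "h x = h y" by blast
    thus "x \<in> gcomp A w" using inj[OF x, of y] g[OF w] by auto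
  qed (use hg[OF w] in blast)
  show gA: "graded_ring K A"
  proof (rule graded_ringI[OF B.K.comm_group_axioms A])
    fix w assume w: "w \<in> carrier K"
    show "additive_subgroup (gcomp A w) A"
    proof (rule additive_subgroupI)
      have c: "\<ominus>[A] a \<in> gcomp A w" "a +[A] b \<in> gcomp A w"
        if "a \<in> gcomp A w" "b \<in> gcomp A w" for a b
      proof -
        have c: "a \<in> carrier A" "b \<in> carrier A" using that g[OF w] by blast+
        hence "h a \<in> gcomp B w" "h b \<in> gcomp B w" using mem[OF _ w] that by auto
        thus "\<ominus>[A] a \<in> gcomp A w" "a +[A] b \<in> gcomp A w"
          using mem[OF _ w] c B.gcomp_neg[OF w] B.gcomp_add[OF w] by simp_all
      qed
      show "subgroup (gcomp A w) (add_monoid A)"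
        by (rule A.add.subgroupI)
          (use g[OF w] mem[OF A.zero_closed w] B.gcomp_zero[OF w] c in \<open>auto simp: a_inv_def\<close>)
    qed
  next
    fix v w a b assume v: "v \<in> carrier K" and w: "w \<in> carrier K" and a: "a \<in> gcomp A v" and b: "b \<in> gcomp A w"
    have "a \<in> carrier A" "b \<in> carrier A" using a b g[OF v] g[OF w] by auto
    thus "a *[A] b \<in> gcomp A (v *[K] w)"
      using mem v w a b B.gcomp_mult[OF v w] by simp
  next
    fix a assume a: "a \<in> carrier A"
    let ?J = "B.supp (h a)" and ?c = "\<lambda>w. inv_into (carrier A) h (hcomp K B (h a) w)"
    have ha: "h a \<in> carrier B" using a by simp
    have c: "?c w \<in> carrier A \<and> h (?c w) = hcomp K B (h a) w" if "w \<in> carrier K" for w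
    proof -
      have "hcomp K B (h a) w \<in> h ` carrier A" using B.hcomp_carrier[OF ha that] bij by (simp add: bij_betw_def)
      thus ?thesis using inv_into_into f_inv_into_f by metis
    qed
    have "h (finsum A ?c ?J) = finsum B (h \<circ> ?c) ?J" by (rule hm.hom_finsum) (use c in auto)
    also have "\<dots> = finsum B (hcomp K B (h a)) ?J"
      by (rule B.R.finsum_cong') (use c B.hcomp_carrier[OF ha] in auto)
    also have "\<dots> = h a" using B.hcomp_props(3)[OF ha] by simp
    finally have "a = finsum A ?c ?J" by (intro inj[OF a] A.finsum_closed) (use c in auto)
    moreover have "\<forall>w\<in>?J. ?c w \<in> gcomp A w" using mem c B.hcomp_in[OF ha] by auto
    ultimately show "\<exists>c J. finite J \<and> J \<subseteq> carrier K \<and> (\<forall>w\<in>J. c w \<in> gcomp A w) \<and> a = finsum A c J"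
      using B.hcomp_props(2)[OF ha] by (intro exI[of _ ?c] exI[of _ ?J]) auto
  next
    fix c J w assume J: "finite J" "J \<subseteq> carrier K" and c: "\<And>w. w \<in> J \<Longrightarrow> c w \<in> gcomp A w"
      and z: "finsum A c J = 0[A]" and w: "w \<in> J"
    have cA: "c w \<in> carrier A" if "w \<in> J" for w using c[OF that] g J that by blast
    have cB: "h (c w) \<in> gcomp B w" if "w \<in> J" for w using c[OF that] hg J that by blast
    have wK: "w \<in> carrier K" using w J by blast
    have "h (finsum A c J) = finsum B (h \<circ> c) J" by (rule hm.hom_finsum) (use cA in auto)
    hence e: "0[B] = finsum B (\<lambda>w. h (c w)) J" using z by (simp add: o_def)
    have "h (c w) = 0[B]"
      using B.hcomp_eqI[OF J cB e wK] B.hcomp_zero[OF wK] w by simp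
    thus "c w = 0[A]" using inj[OF cA[OF w] A.zero_closed] by simp
  qed
  thus "graded_ring_iso K A B h" using B h hg by (simp add: graded_ring_iso_def)
qed

lemma graded_ring_iso_inv:
  assumes "graded_ring_iso K A B h"
  shows "graded_ring_iso K B A (inv_into (carrier A) h)"
proof -
  have A: "graded_ring K A" and B: "graded_ring K B" and h: "h \<in> ring_iso A B"
    and hg: "\<And>w. w \<in> carrier K \<Longrightarrow> h ` gcomp A w = gcomp B w"
    using assms by (auto simp: graded_ring_iso_def)
  interpret A: grd K A by (rule grdI[OF A])
  have inj: "inj_on h (carrier A)" using h by (simp add: ring_iso_def bij_betw_def)
  have "inv_into (carrier A) h \<in> ring_iso B A" using ring_iso_set_sym[OF A.R.ring_axioms h] .
  moreover have "inv_into (carrier A) h ` gcomp B w = gcomp A w" if w: "w \<in> carrier K" for w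
    using inv_into_image_cancel[OF inj, of "gcomp A w"] A.gcomp_carrier[OF w] hg[OF w] by auto
  ultimately show ?thesis using A B by (simp add: graded_ring_iso_def)
qed

locale grd_iso =
  fixes K :: "('k, 'l) monoid_scheme" and A :: "('a, 'k, 'm) gring_scheme" and B :: "('b, 'k, 'n) gring_scheme" and h
  assumes iso: "graded_ring_iso K A B h"
begin

sublocale grd_hom K A B h
proof (intro grd_hom.intro grd_hom_axioms.intro)
  show "grd K A" "grd K B" using iso by (simp_all add: graded_ring_iso_def grdI)
  show "h \<in> ring_hom A B" using iso by (simp add: graded_ring_iso_def ring_iso_def)
  show "h a \<in> gcomp B w" if "w \<in> carrier K" "a \<in> gcomp A w" for w a
    using iso that unfolding graded_ring_iso_def by blast
qed

lemma bij: "bij_betw h (carrier A) (carrier B)"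
  using iso by (auto simp: graded_ring_iso_def ring_iso_def)

lemma inj: "x \<in> carrier A \<Longrightarrow> y \<in> carrier A \<Longrightarrow> h x = h y \<longleftrightarrow> x = y"
  using bij by (auto simp: bij_betw_def inj_on_def)

lemma gcomp_image: "w \<in> carrier K \<Longrightarrow> h ` gcomp A w = gcomp B w"
  using iso by (simp add: graded_ring_iso_def)

lemma gcomp_iff: "x \<in> carrier A \<Longrightarrow> w \<in> carrier K \<Longrightarrow> h x \<in> gcomp B w \<longleftrightarrow> x \<in> gcomp A w"
  using gcomp_image[of w] A.gcomp_carrier inj by (metis (no_types, lifting) imageE image_eqI)

lemma hplus_iff: "x \<in> carrier A \<Longrightarrow> h x \<in> hplus K B \<longleftrightarrow> x \<in> hplus K A"
  using gcomp_iff inj[of x "0[A]"] by (auto simp: hplus_def hom_elems_def)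

lemma hplus_image: "h ` hplus K A = hplus K B"
proof -
  have "hplus K B \<subseteq> h ` carrier A" using bij S.hplus_carrier by (auto simp: bij_betw_def)
  thus ?thesis using hplus_iff A.hplus_carrier by blast
qed

lemma Units_iff: "x \<in> carrier A \<Longrightarrow> h x \<in> Units B \<longleftrightarrow> x \<in> Units A"
proof
  assume x: "x \<in> carrier A" "h x \<in> Units B"
  then obtain y where y: "y \<in> carrier B" "y *[B] h x = 1[B]" by (auto simp: Units_def)
  then obtain z where z: "z \<in> carrier A" "h z = y"
    unfolding bij_betw_imp_surj_on[OF bij, symmetric] by blast
  hence "z *[A] x = 1[A]" using inj[of "z *[A] x" "1[A]"] x y by simp
  thus "x \<in> Units A" using x(1) z(1) A.R.m_comm[of z x] unfolding Units_def by auto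
next
  assume x: "x \<in> carrier A" "x \<in> Units A"
  then obtain y where y: "y \<in> carrier A" "y *[A] x = 1[A]" by (auto simp: Units_def)
  hence "h y *[B] h x = 1[B]" using x rh.hom_mult[of y x] by simp
  thus "h x \<in> Units B" using x y S.R.m_comm by (auto simp: Units_def intro!: bexI[of _ "h y"])
qed

lemma K_simple_iff: "K_simple K A" if "K_simple K B"
proof -
  have "carrier A \<noteq> {0[A]}" using that bij by (auto simp: K_simple_def bij_betw_def)
  thus ?thesis using that Units_iff A.hplus_carrier hplus_iff A.grd by (auto simp: K_simple_def)
qed

lemma discrete_transport:
  assumes "discrete_K_valuation K B \<nu>"
  shows "discrete_K_valuation K A (\<nu> \<circ> h)"
proof -
  have 1: "(\<nu> \<circ> h) ` hplus K A = UNIV"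
    using assms hplus_image unfolding discrete_K_valuation_def by (simp only: image_comp[symmetric])
  have 2: "(\<nu> \<circ> h) (a *[A] b) = (\<nu> \<circ> h) a + (\<nu> \<circ> h) b" if "a \<in> hplus K A" "b \<in> hplus K A" for a b
    using that assms hplus_iff A.hplus_carrier by (simp add: discrete_K_valuation_def)
  have 3: "min ((\<nu> \<circ> h) a) ((\<nu> \<circ> h) b) \<le> (\<nu> \<circ> h) (a +[A] b)"
    if w: "w \<in> carrier K" and a: "a \<in> gcomp A w - {0[A]}" and b: "b \<in> gcomp A w - {0[A]}"
      and ne: "a +[A] b \<noteq> 0[A]" for w a b
  proof -
    have c: "a \<in> carrier A" "b \<in> carrier A" using a b A.gcomp_carrier[OF w] by auto
    have "h a \<in> gcomp B w - {0[B]}" "h b \<in> gcomp B w - {0[B]}" "h a +[B] h b \<noteq> 0[B]"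
      using c a b ne gcomp_iff[OF _ w] inj[of a "0[A]"] inj[of b "0[A]"] inj[of "a +[A] b" "0[A]"] by simp_all
    thus ?thesis using assms w c by (simp add: discrete_K_valuation_def)
  qed
  show ?thesis unfolding discrete_K_valuation_def
    using K_simple_iff assms 1 2 3 by (auto simp: discrete_K_valuation_def)
qed

lemma generate_forward:
  assumes X: "X \<subseteq> carrier A" and "x \<in> generate_ring A X"
  shows "h x \<in> generate_ring B (h ` X)"
  using assms(2)
proof (induction rule: generate_ring.induct)
  case (a_inv x) thus ?case
    using A.R.generate_ring_in_carrier[OF X] generate_ring.a_inv[of "h x" B] by simp
next
  case (eng_add x y) thus ?case
    using A.R.generate_ring_in_carrier[OF X] generate_ring.eng_add[of "h x" B _ "h y"] by simp
next
  case (eng_mult x y) thus ?case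
    using A.R.generate_ring_in_carrier[OF X] generate_ring.eng_mult[of "h x" B _ "h y"] by simp
next
  case one show ?case using generate_ring.one[of B] by simp
next
  case (incl x) thus ?case by (intro generate_ring.incl) simp
qed

end

lemma (in grd_iso) generate_transport:
  assumes "X \<subseteq> carrier A" "x \<in> carrier A"
  shows "h x \<in> generate_ring B (h ` X) \<longleftrightarrow> x \<in> generate_ring A X"
proof
  let ?g = "inv_into (carrier A) h"
  interpret inv: grd_iso K B A ?g by (rule grd_iso.intro) (rule graded_ring_iso_inv[OF iso])
  have i: "inj_on h (carrier A)" using bij by (simp add: bij_betw_def)
  assume "h x \<in> generate_ring B (h ` X)"
  hence "?g (h x) \<in> generate_ring A (?g ` h ` X)"
    by (intro inv.generate_forward) (use assms in auto)
  thus "x \<in> generate_ring A X" using inv_into_image_cancel[OF i assms(1)] inv_into_f_f[OF i assms(2)] by simp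
qed (rule generate_forward[OF assms(1)])

context grd_iso
begin

lemma valuation_ring_transport:
  assumes "x \<in> carrier A"
  shows "h x \<in> K_valuation_ring K B \<nu> \<longleftrightarrow> x \<in> K_valuation_ring K A (\<nu> \<circ> h)"
proof -
  have "h ` {a \<in> hplus K A. 0 \<le> (\<nu> \<circ> h) a} = {b \<in> hplus K B. 0 \<le> \<nu> b}"
    by (auto simp flip: hplus_image)
  thus ?thesis unfolding K_valuation_ring_def
    using generate_transport[OF _ assms, of "{a \<in> hplus K A. 0 \<le> (\<nu> \<circ> h) a}"] A.hplus_carrier by auto
qed

text \<open>Precomposition with \<open>h\<close> carries a defining family of \<open>B\<close> to
  one of \<open>A\<close>. A family is thus moved against the direction of the isomorphism.\<close>

lemma Krull_transport:
  assumes X: "X \<subseteq> carrier A" and Kr: "K_Krull_in K B (h ` X)"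
  shows "K_Krull_in K A X"
proof -
  obtain N where N: "\<forall>\<nu>\<in>N. discrete_K_valuation K B \<nu>"
    "h ` X = carrier B \<inter> (\<Inter>\<nu>\<in>N. K_valuation_ring K B \<nu>)"
    "\<forall>a\<in>h ` X \<inter> hplus K B. finite {\<nu> \<in> N. \<nu> a \<noteq> 0}" and s: "K_simple K B"
    using Kr by (auto simp: K_Krull_in_def)
  let ?N = "(\<lambda>\<nu>. \<nu> \<circ> h) ` N"
  have "X = carrier A \<inter> (\<Inter>\<nu>\<in>?N. K_valuation_ring K A \<nu>)"
  proof -
    have "x \<in> X \<longleftrightarrow> (\<forall>\<nu>\<in>N. x \<in> K_valuation_ring K A (\<nu> \<circ> h))" if x: "x \<in> carrier A" for x
    proof -
      have "x \<in> X \<longleftrightarrow> h x \<in> h ` X" using x X inj by (auto simp: subset_iff)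
      thus ?thesis using N(2) x valuation_ring_transport[OF x] by simp
    qed
    thus ?thesis using X by auto
  qed
  moreover have "finite {\<nu> \<in> ?N. \<nu> a \<noteq> 0}" if a: "a \<in> X \<inter> hplus K A" for a
  proof -
    have "finite {\<nu> \<in> N. \<nu> (h a) \<noteq> 0}" using N(3) a X hplus_iff by auto
    moreover have "{\<nu> \<in> ?N. \<nu> a \<noteq> 0} \<subseteq> (\<lambda>\<nu>. \<nu> \<circ> h) ` {\<nu> \<in> N. \<nu> (h a) \<noteq> 0}" by auto
    ultimately show ?thesis using finite_surj by blast
  qed
  moreover have "\<forall>\<nu>\<in>?N. discrete_K_valuation K A \<nu>" using N(1) discrete_transport by blast
  ultimately show ?thesis unfolding K_Krull_in_def using K_simple_iff[OF s] by blast
qed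

end

section \<open>Subrings of a simple graded ring cut out by valuations\<close>

text \<open>Every finitely supported family of integers is a family of values, so the homogeneous elements of \<open>A\<close>
  form, up to units, a free monoid on \<open>Q\<close>.\<close>

locale cox_sub = grd_hom K A S \<iota>
  for K :: "('k, 'l) monoid_scheme" and A :: "('a, 'k, 'm) gring_scheme" and S :: "('b, 'k, 'n) gring_scheme" and \<iota> +
  fixes Q :: "'p set" and m :: "'p \<Rightarrow> 'b \<Rightarrow> int"
  assumes simple: "hplus K S \<subseteq> Units S" "carrier S \<noteq> {0[S]}"
    and \<iota>_inj: "inj_on \<iota> (carrier A)"
    and img: "\<And>w. w \<in> carrier K \<Longrightarrow> \<iota> ` gcomp A w = {s \<in> gcomp S w. s = 0[S] \<or> (\<forall>Y\<in>Q. 0 \<le> m Y s)}"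
    and m_mult: "\<And>Y a b. Y \<in> Q \<Longrightarrow> a \<in> hplus K S \<Longrightarrow> b \<in> hplus K S \<Longrightarrow> m Y (a *[S] b) = m Y a + m Y b"
    and m_add: "\<And>Y w a b. Y \<in> Q \<Longrightarrow> w \<in> carrier K \<Longrightarrow> a \<in> gcomp S w \<Longrightarrow> b \<in> gcomp S w \<Longrightarrow> a \<noteq> 0[S] \<Longrightarrow> b \<noteq> 0[S]
        \<Longrightarrow> a +[S] b \<noteq> 0[S] \<Longrightarrow> min (m Y a) (m Y b) \<le> m Y (a +[S] b)"
    and m_fin: "\<And>a. a \<in> hplus K S \<Longrightarrow> finite {Y \<in> Q. m Y a \<noteq> 0}"
    and m_surj: "\<And>D. finite {Y \<in> Q. D Y \<noteq> (0::int)} \<Longrightarrow> \<exists>s\<in>hplus K S. \<forall>Y\<in>Q. m Y s = D Y"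
    and S_nonzero: "\<And>w. w \<in> carrier K \<Longrightarrow> \<exists>s\<in>gcomp S w. s \<noteq> 0[S]"
begin

lemma S_one_zero: "1[S] \<noteq> 0[S]"
  using S.R.one_zeroD simple(2) by blast

lemma unit_nz: "u \<in> Units S \<Longrightarrow> u \<noteq> 0[S]"
  using S_one_zero by (metis S.R.Units_closed S.R.Units_r_inv_ex S.R.l_null)

lemma hS_unit: "a \<in> hplus K S \<Longrightarrow> a \<in> Units S"
  using simple(1) by (rule subsetD)

lemma hS_one: "1[S] \<in> hplus K S"
  by (rule S.hplusI[OF A.K.one_closed S.one_homog S_one_zero])

lemma hS_mult:
  assumes a: "a \<in> hplus K S" and b: "b \<in> hplus K S"
  shows "a *[S] b \<in> hplus K S"
proof -
  obtain v where v: "v \<in> carrier K" "a \<in> gcomp S v" using a by (rule S.hplusE)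
  obtain w where w: "w \<in> carrier K" "b \<in> gcomp S w" using b by (rule S.hplusE)
  have "a *[S] b \<in> Units S" by (rule S.R.Units_m_closed[OF hS_unit[OF a] hS_unit[OF b]])
  thus ?thesis using S.hplusI[OF A.K.m_closed[OF v(1) w(1)] S.gcomp_mult[OF v(1) w(1) v(2) w(2)]] unit_nz by simp
qed

lemma hS_inv:
  assumes a: "a \<in> hplus K S"
  shows "inv[S] a \<in> hplus K S"
proof -
  obtain v where v: "v \<in> carrier K" "a \<in> gcomp S v" using a by (rule S.hplusE)
  show ?thesis
    by (rule S.hplusI[OF _ S.inv_homog[OF v(2,1) hS_unit[OF a]]])
      (use v unit_nz S.R.Units_inv_Units[OF hS_unit[OF a]] in auto)
qed

lemma m_one: "Y \<in> Q \<Longrightarrow> m Y 1[S] = 0"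
  using m_mult[OF _ hS_one hS_one, of Y] by simp

lemma m_inv: "Y \<in> Q \<Longrightarrow> a \<in> hplus K S \<Longrightarrow> m Y (inv[S] a) = - m Y a"
  using m_mult[of Y a "inv[S] a"] hS_inv[of a] hS_unit[of a] m_one[of Y] by simp

lemma neg_one: "\<ominus>[S] 1[S] \<in> hplus K S"
proof (rule S.hplusI[OF A.K.one_closed S.gcomp_neg[OF A.K.one_closed S.one_homog]])
  show "\<ominus>[S] 1[S] \<noteq> 0[S]" using S_one_zero by (metis S.R.minus_minus S.R.minus_zero S.R.one_closed)
qed

text \<open>The square of \<open>-1\<close> is \<open>1\<close> and the integers are torsion-free,
  so \<open>-1\<close> has value zero.\<close>

lemma m_neg:
  assumes Y: "Y \<in> Q" and a: "a \<in> hplus K S"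
  shows "m Y (\<ominus>[S] a) = m Y a"
proof -
  have "m Y (\<ominus>[S] 1[S] *[S] \<ominus>[S] 1[S]) = 2 * m Y (\<ominus>[S] 1[S])" using m_mult[OF Y neg_one neg_one] by simp
  moreover have "\<ominus>[S] 1[S] *[S] \<ominus>[S] 1[S] = 1[S]" by (simp add: S.R.l_minus)
  ultimately have "m Y (\<ominus>[S] 1[S]) = 0" using m_one[OF Y] by simp
  moreover have "\<ominus>[S] a = \<ominus>[S] 1[S] *[S] a" using S.hplus_carrier[OF a] by (simp add: S.R.l_minus)
  ultimately show ?thesis using m_mult[OF Y neg_one a] by simp
qed

definition nonneg :: "'p set \<Rightarrow> 'b \<Rightarrow> bool" where
  "nonneg Q' x \<longleftrightarrow> x = 0[S] \<or> (\<forall>Y\<in>Q'. 0 \<le> m Y x)"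

lemma nonneg_add:
  assumes "Q' \<subseteq> Q" "w \<in> carrier K" "a \<in> gcomp S w" "b \<in> gcomp S w" "nonneg Q' a" "nonneg Q' b"
  shows "nonneg Q' (a +[S] b)"
proof (cases "a = 0[S] \<or> b = 0[S] \<or> a +[S] b = 0[S]")
  case True
  have "a \<in> carrier S" "b \<in> carrier S" using S.gcomp_carrier[OF assms(2)] assms(3,4) by auto
  thus ?thesis using True assms(5,6) by (auto simp: nonneg_def)
next
  case False
  have "0 \<le> m Y (a +[S] b)" if Y: "Y \<in> Q'" for Y
  proof -
    have "min (m Y a) (m Y b) \<le> m Y (a +[S] b)" using m_add[of Y w a b] False assms(1-4) Y by auto
    moreover have "0 \<le> m Y a" "0 \<le> m Y b" using assms(5,6) False Y by (auto simp: nonneg_def)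
    ultimately show ?thesis by simp
  qed
  thus ?thesis by (simp add: nonneg_def)
qed

lemma hom_elems_cases: "x \<in> hom_elems K S \<Longrightarrow> x = 0[S] \<or> x \<in> hplus K S"
  by (auto simp: hplus_def)

lemma nonneg_mult:
  assumes "Q' \<subseteq> Q" "a \<in> hom_elems K S" "b \<in> hom_elems K S" "nonneg Q' a" "nonneg Q' b"
  shows "nonneg Q' (a *[S] b)"
proof (cases "a = 0[S] \<or> b = 0[S]")
  case True
  thus ?thesis using S.hom_elems_carrier assms(2,3) by (auto simp: nonneg_def)
next
  case False
  hence "a \<in> hplus K S" "b \<in> hplus K S" using hom_elems_cases assms(2,3) by auto
  thus ?thesis using assms(1,4,5) False m_mult[of _ a b] by (auto simp: nonneg_def subset_iff)
qed

lemma nonneg_neg: "Q' \<subseteq> Q \<Longrightarrow> a \<in> hom_elems K S \<Longrightarrow> nonneg Q' a \<Longrightarrow> nonneg Q' (\<ominus>[S] a)"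
  using hom_elems_cases[of a] m_neg[of _ a] by (auto simp: nonneg_def subset_iff)

text \<open>The condition is imposed on each component, so enlarging \<open>Q'\<close> amounts to
  intersecting. \<open>V Q\<close> will turn out to be the image of \<open>A\<close>, and
  \<open>V {Y}\<close> the valuation ring of \<open>m Y\<close>.\<close>

definition V :: "'p set \<Rightarrow> 'b set" where
  "V Q' = {s \<in> carrier S. \<forall>w\<in>carrier K. nonneg Q' (hcomp K S s w)}"

lemma V_carrier: "s \<in> V Q' \<Longrightarrow> s \<in> carrier S"
  by (simp add: V_def)

lemma nonneg_zero: "nonneg Q' 0[S]"
  by (simp add: nonneg_def)

lemma V_hom: "x \<in> gcomp S w \<Longrightarrow> w \<in> carrier K \<Longrightarrow> x \<in> V Q' \<longleftrightarrow> nonneg Q' x"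
  using S.gcomp_carrier[of w x] by (auto simp: V_def S.hcomp_homog nonneg_zero)

lemma V_zero: "0[S] \<in> V Q'"
  using V_hom[OF S.gcomp_zero[OF A.K.one_closed] A.K.one_closed] nonneg_zero by simp

lemma V_add: "Q' \<subseteq> Q \<Longrightarrow> s \<in> V Q' \<Longrightarrow> t \<in> V Q' \<Longrightarrow> s +[S] t \<in> V Q'"
  using nonneg_add[OF _ _ S.hcomp_in S.hcomp_in] by (simp add: V_def S.hcomp_add)

lemma hcomp_hom: "s \<in> carrier S \<Longrightarrow> w \<in> carrier K \<Longrightarrow> hcomp K S s w \<in> hom_elems K S"
  using S.hcomp_in[of s w] by (auto simp: hom_elems_def)

lemma V_neg: "Q' \<subseteq> Q \<Longrightarrow> s \<in> V Q' \<Longrightarrow> \<ominus>[S] s \<in> V Q'"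
  using nonneg_neg[OF _ hcomp_hom] by (simp add: V_def S.hcomp_neg)

lemma V_one: "Q' \<subseteq> Q \<Longrightarrow> 1[S] \<in> V Q'"
  using V_hom[OF S.one_homog A.K.one_closed] m_one by (auto simp: nonneg_def subset_iff)

text \<open>Multiplication by a homogeneous factor only shifts components; additivity in the first
  argument does the rest, so that no convolution formula for the components of a product is
  required.\<close>

lemma V_mult: "s *[S] t \<in> V Q'" if Q': "Q' \<subseteq> Q" and s: "s \<in> V Q'" and t: "t \<in> V Q'"
proof (rule S.hom_induct[OF V_carrier[OF s]])
  note tS = V_carrier[OF t]
  show "0[S] *[S] t \<in> V Q'" using tS V_zero by simp
  show "(x +[S] y) *[S] t \<in> V Q'" if "x \<in> carrier S" "y \<in> carrier S" "x *[S] t \<in> V Q'" "y *[S] t \<in> V Q'" for x y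
    using that V_add[OF Q'] tS by (simp add: S.R.l_distr)
  show "hcomp K S s w *[S] t \<in> V Q'" if w: "w \<in> carrier K" for w
  proof -
    note sw = S.hcomp_in[OF V_carrier[OF s] w]
    have "nonneg Q' (hcomp K S (hcomp K S s w *[S] t) u)" if u: "u \<in> carrier K" for u
    proof -
      have wu: "inv[K] w *[K] u \<in> carrier K" using w u by simp
      show ?thesis unfolding S.hcomp_mult_homog'[OF tS w sw u]
        using nonneg_mult[OF Q' hcomp_hom[OF V_carrier[OF s] w] hcomp_hom[OF tS wu]] s t w wu
        by (simp add: V_def)
    qed
    thus ?thesis using S.hcomp_carrier[OF V_carrier[OF s] w] tS by (simp add: V_def)
  qed
qed

lemma V_generate: "V {Y} = K_valuation_ring K S (m Y)" if Y: "Y \<in> Q"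
proof
  let ?X = "{a \<in> hplus K S. 0 \<le> m Y a}"
  have sub: "{Y} \<subseteq> Q" using Y by simp
  show "K_valuation_ring K S (m Y) \<subseteq> V {Y}"
  proof
    fix x assume "x \<in> K_valuation_ring K S (m Y)"
    hence "x \<in> generate_ring S ?X" by (simp add: K_valuation_ring_def)
    thus "x \<in> V {Y}"
    proof (induction rule: generate_ring.induct)
      case (incl h)
      then obtain w where w: "w \<in> carrier K" "h \<in> gcomp S w" by (auto elim: S.hplusE)
      show ?case using V_hom[OF w(2,1)] incl by (simp add: nonneg_def)
    qed (use V_one[OF sub] V_neg[OF sub] V_add[OF sub] V_mult[OF sub] in auto)
  qed
  show "V {Y} \<subseteq> K_valuation_ring K S (m Y)"
  proof
    fix x assume x: "x \<in> V {Y}"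
    show "x \<in> K_valuation_ring K S (m Y)" unfolding K_valuation_ring_def
    proof (rule S.hom_induct[OF V_carrier[OF x]])
      \<comment> \<open>Zero is not among the generators, so it is produced as
        \<open>1 - 1\<close>.\<close>
      have "1[S] +[S] \<ominus>[S] 1[S] \<in> generate_ring S ?X"
        using generate_ring.eng_add[OF generate_ring.one generate_ring.a_inv[OF generate_ring.one]] .
      thus z: "0[S] \<in> generate_ring S ?X" by (simp add: S.R.r_neg)
      show "hcomp K S x w \<in> generate_ring S ?X" if w: "w \<in> carrier K" for w
      proof (cases "hcomp K S x w = 0[S]")
        case False
        hence "hcomp K S x w \<in> ?X" using x w hom_elems_cases[OF hcomp_hom[OF V_carrier[OF x] w]]
          by (auto simp: V_def nonneg_def)
        thus ?thesis by (rule generate_ring.incl)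
      qed (use z in simp)
    qed (rule generate_ring.eng_add)
  qed
qed

lemma V_inter: "V Q = carrier S \<inter> (\<Inter>Y\<in>Q. V {Y})"
  by (auto simp: V_def nonneg_def)

lemma \<iota>_eq: "a \<in> carrier A \<Longrightarrow> b \<in> carrier A \<Longrightarrow> \<iota> a = \<iota> b \<longleftrightarrow> a = b"
  using \<iota>_inj by (auto simp: inj_on_def)

text \<open>\<open>\<iota>\<close> is injective and commutes with taking components, so degrees in
  \<open>A\<close> can be tested in \<open>S\<close>.\<close>

lemma gcomp_iff:
  assumes a: "a \<in> carrier A" and w: "w \<in> carrier K"
  shows "\<iota> a \<in> gcomp S w \<longleftrightarrow> a \<in> gcomp A w"
proof
  assume "\<iota> a \<in> gcomp S w"
  hence "hcomp K S (\<iota> a) w = \<iota> a" using w by (simp add: S.hcomp_homog)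
  hence "\<iota> (hcomp K A a w) = \<iota> a" using hom_hcomp[OF a w] by simp
  hence "hcomp K A a w = a" using \<iota>_eq A.hcomp_carrier a w by simp
  thus "a \<in> gcomp A w" using A.hcomp_in[OF a w] by simp
qed (use homg w in blast)

lemma hplus_iff: "a \<in> carrier A \<Longrightarrow> \<iota> a \<in> hplus K S \<longleftrightarrow> a \<in> hplus K A"
  using gcomp_iff \<iota>_eq[of a "0[A]"] by (auto simp: hplus_def hom_elems_def)

lemma img_nonneg:
  assumes a: "a \<in> hplus K A" and Y: "Y \<in> Q"
  shows "0 \<le> m Y (\<iota> a)"
proof -
  obtain w where w: "w \<in> carrier K" "a \<in> gcomp A w" using a by (rule A.hplusE)
  have "\<iota> a \<in> \<iota> ` gcomp A w" using w by simp
  moreover have "\<iota> a \<noteq> 0[S]" using a hplus_iff[of a] A.hplus_carrier[OF a] by (simp add: hplus_def)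
  ultimately show ?thesis using img[OF w(1)] Y by simp
qed

lemma lift_homog:
  assumes "x \<in> gcomp S w" "w \<in> carrier K" "nonneg Q x"
  shows "\<exists>a\<in>gcomp A w. \<iota> a = x"
proof -
  have "x \<in> \<iota> ` gcomp A w" using assms img[OF assms(2)] by (simp add: nonneg_def)
  thus ?thesis by auto
qed

lemma lift_hplus:
  assumes "x \<in> hplus K S" "\<And>Y. Y \<in> Q \<Longrightarrow> 0 \<le> m Y x"
  shows "\<exists>a\<in>hplus K A. \<iota> a = x"
proof -
  obtain w where w: "w \<in> carrier K" "x \<in> gcomp S w" using assms(1) by (rule S.hplusE)
  obtain a where a: "a \<in> gcomp A w" "\<iota> a = x" using lift_homog[OF w(2,1)] assms(2) by (auto simp: nonneg_def)
  have "a \<in> hplus K A" using hplus_iff[OF A.gcomp_carrier[OF w(1) a(1)]] a(2) assms(1) by simp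
  thus ?thesis using a(2) by blast
qed

lemma img_V: "\<iota> ` carrier A = V Q"
proof (rule equalityI; rule subsetI)
  fix x assume "x \<in> \<iota> ` carrier A"
  then obtain a where a: "x = \<iota> a" "a \<in> carrier A" by (rule imageE)
  have "nonneg Q (hcomp K S x w)" if w: "w \<in> carrier K" for w
  proof -
    have "\<iota> (hcomp K A a w) \<in> \<iota> ` gcomp A w" using A.hcomp_in[OF a(2) w] by simp
    thus ?thesis using hom_hcomp[OF a(2) w] a(1) img[OF w] by (simp add: nonneg_def)
  qed
  thus "x \<in> V Q" using a by (simp add: V_def)
next
  fix x assume x: "x \<in> V Q"
  show "x \<in> \<iota> ` carrier A"
  proof (rule S.hom_induct[OF V_carrier[OF x]])
    show "0[S] \<in> \<iota> ` carrier A" using imageI[of "0[A]" "carrier A" \<iota>] by simp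
    show "y +[S] z \<in> \<iota> ` carrier A" if yz: "y \<in> \<iota> ` carrier A" "z \<in> \<iota> ` carrier A" for y z
    proof -
      obtain a where a: "y = \<iota> a" "a \<in> carrier A" using yz(1) by (rule imageE)
      obtain b where b: "z = \<iota> b" "b \<in> carrier A" using yz(2) by (rule imageE)
      show ?thesis using a b imageI[of "a +[A] b" "carrier A" \<iota>] by simp
    qed
    show "hcomp K S x w \<in> \<iota> ` carrier A" if w: "w \<in> carrier K" for w
    proof -
      obtain a where "a \<in> gcomp A w" "\<iota> a = hcomp K S x w"
        using lift_homog[OF S.hcomp_in[OF V_carrier[OF x] w] w] x w by (auto simp: V_def)
      thus ?thesis using A.gcomp_carrier[OF w] by (metis imageI)
    qed
  qed
qed

lemma \<iota>_hplus: "a \<in> hplus K A \<Longrightarrow> \<iota> a \<in> hplus K S"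
  using hplus_iff A.hplus_carrier by blast

lemma hA_mult: "a \<in> hplus K A \<Longrightarrow> b \<in> hplus K A \<Longrightarrow> a *[A] b \<in> hplus K A"
  using hplus_iff[of "a *[A] b"] hS_mult[OF \<iota>_hplus \<iota>_hplus] A.hplus_carrier by simp

lemma hA_one: "1[A] \<in> hplus K A"
  using hplus_iff[of "1[A]"] hS_one by simp

lemma m_\<iota>_mult: "Y \<in> Q \<Longrightarrow> a \<in> hplus K A \<Longrightarrow> b \<in> hplus K A \<Longrightarrow> m Y (\<iota> (a *[A] b)) = m Y (\<iota> a) + m Y (\<iota> b)"
  using m_mult[OF _ \<iota>_hplus \<iota>_hplus] A.hplus_carrier by simp

text \<open>The quotient of \<open>b\<close> by \<open>a\<close> exists in \<open>S\<close>, where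
  non-zero homogeneous elements are units, and it lies in the image of \<open>A\<close> as soon as
  its values are non-negative.\<close>

lemma divides:
  assumes a: "a \<in> hplus K A" and b: "b \<in> hplus K A" and le: "\<And>Y. Y \<in> Q \<Longrightarrow> m Y (\<iota> a) \<le> m Y (\<iota> b)"
  shows "\<exists>c\<in>hplus K A. b = a *[A] c"
proof -
  let ?x = "inv[S] (\<iota> a) *[S] \<iota> b"
  have x: "?x \<in> hplus K S" by (rule hS_mult[OF hS_inv[OF \<iota>_hplus[OF a]] \<iota>_hplus[OF b]])
  have "0 \<le> m Y ?x" if Y: "Y \<in> Q" for Y
    using m_mult[OF Y hS_inv[OF \<iota>_hplus[OF a]] \<iota>_hplus[OF b]] m_inv[OF Y \<iota>_hplus[OF a]] le[OF Y] by simp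
  then obtain c where c: "c \<in> hplus K A" "\<iota> c = ?x" using lift_hplus[OF x] by blast
  have "\<iota> a *[S] ?x = \<iota> b"
    using hS_unit[OF \<iota>_hplus[OF a]] A.hplus_carrier[OF b] S.hplus_carrier[OF hS_inv[OF \<iota>_hplus[OF a]]]
      A.hplus_carrier[OF a] by (simp add: S.R.m_assoc[symmetric])
  hence "\<iota> (a *[A] c) = \<iota> b" using c A.hplus_carrier[OF a] A.hplus_carrier[OF c(1)] by simp
  hence "a *[A] c = b" using \<iota>_eq[of "a *[A] c" b] A.hplus_carrier[OF a] A.hplus_carrier[OF b] A.hplus_carrier[OF c(1)] by simp
  thus ?thesis using c by blast
qed

lemma A_nonzero: "1[A] \<noteq> 0[A]"
  using hA_one by (simp add: hplus_def)

text \<open>An element and its inverse have non-negative values with sum zero. Conversely, an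
  element with all values zero divides the identity.\<close>

lemma unit_iff:
  assumes a: "a \<in> hplus K A"
  shows "a \<in> Units A \<longleftrightarrow> (\<forall>Y\<in>Q. m Y (\<iota> a) = 0)"
proof
  assume u: "a \<in> Units A"
  obtain w where w: "w \<in> carrier K" "a \<in> gcomp A w" using a by (rule A.hplusE)
  have i: "inv[A] a \<in> hplus K A"
  proof (rule A.hplusI[OF _ A.inv_homog[OF w(2,1) u]])
    show "inv[A] a \<noteq> 0[A]" using u A_nonzero A.R.Units_r_inv[OF u] A.hplus_carrier[OF a] by (metis A.R.r_null)
  qed (use w in simp)
  show "\<forall>Y\<in>Q. m Y (\<iota> a) = 0"
  proof
    fix Y assume Y: "Y \<in> Q"
    have "m Y (\<iota> a) + m Y (\<iota> (inv[A] a)) = 0" using m_\<iota>_mult[OF Y a i] u m_one[OF Y] by simp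
    thus "m Y (\<iota> a) = 0" using img_nonneg[OF a Y] img_nonneg[OF i Y] by simp
  qed
next
  assume "\<forall>Y\<in>Q. m Y (\<iota> a) = 0"
  then obtain c where "c \<in> hplus K A" "1[A] = a *[A] c"
    using divides[OF a hA_one] m_one by auto
  thus "a \<in> Units A" using A.hplus_carrier a A.R.m_comm[of a c] unfolding Units_def by auto
qed

lemma hunits_eq: "hunits K A = {a \<in> hplus K A. \<forall>Y\<in>Q. m Y (\<iota> a) = 0}"
  unfolding hunits_def using unit_iff by auto

lemma A_integral: "K_integral K A"
  unfolding K_integral_def using A.grd hA_mult A_nonzero A.R.one_closed by (auto simp: hplus_def)

lemma simpleS: "K_simple K S"
  unfolding K_simple_def using S.grd simple by blast

lemma lift_eff:
  assumes "finite {Y \<in> Q. D Y \<noteq> (0::int)}" "\<And>Y. Y \<in> Q \<Longrightarrow> 0 \<le> D Y"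
  shows "\<exists>a\<in>hplus K A. \<forall>Y\<in>Q. m Y (\<iota> a) = D Y"
proof -
  obtain s where s: "s \<in> hplus K S" "\<forall>Y\<in>Q. m Y s = D Y" using m_surj[OF assms(1)] by blast
  obtain a where "a \<in> hplus K A" "\<iota> a = s" using lift_hplus[OF s(1)] s(2) assms(2) by auto
  thus ?thesis using s(2) by blast
qed

text \<open>For \<open>Y\<close> in \<open>Q\<close> this is a homogeneous prime element whose
  divisor on \<open>Q\<close> is the single point \<open>Y\<close>; it will generate the prime
  divisor belonging to \<open>Y\<close>.\<close>

definition tt :: "'p \<Rightarrow> 'a" where
  "tt Y = (SOME a. a \<in> hplus K A \<and> (\<forall>Z\<in>Q. m Z (\<iota> a) = (if Z = Y then 1 else 0)))"

lemma tt: "tt Y \<in> hplus K A" "Z \<in> Q \<Longrightarrow> m Z (\<iota> (tt Y)) = (if Z = Y then 1 else 0)"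
proof -
  have "\<exists>a. a \<in> hplus K A \<and> (\<forall>Z\<in>Q. m Z (\<iota> a) = (if Z = Y then 1 else 0))"
  proof -
    have "finite {Z \<in> Q. (if Z = Y then 1 else 0) \<noteq> (0::int)}"
      by (rule finite_subset[of _ "{Y}"]) auto
    hence "\<exists>a\<in>hplus K A. \<forall>Z\<in>Q. m Z (\<iota> a) = (if Z = Y then 1 else 0)" by (rule lift_eff) simp
    thus ?thesis by blast
  qed
  from someI_ex[OF this] show "tt Y \<in> hplus K A" "Z \<in> Q \<Longrightarrow> m Z (\<iota> (tt Y)) = (if Z = Y then 1 else 0)"
    unfolding tt_def by auto
qed

subsection \<open>Factoriality\<close>

abbreviation "H \<equiv> hmonoid K A"

lemma H_simps: "carrier H = hplus K A" "monoid.mult H = monoid.mult A" "monoid.one H = 1[A]"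
  by (simp_all add: hmonoid_def)

lemma H_cancel: "comm_monoid_cancel H"
proof (rule comm_monoid_cancelI)
  show "comm_monoid H"
    by (rule comm_monoidI) (use hA_mult hA_one A.hplus_carrier in \<open>auto simp: H_simps A.R.m_assoc intro: A.R.m_comm\<close>)
  fix a b c assume e: "a *[H] c = b *[H] c" and abc: "a \<in> carrier H" "b \<in> carrier H" "c \<in> carrier H"
  have car: "a \<in> carrier A" "b \<in> carrier A" "c \<in> carrier A" using abc A.hplus_carrier by (auto simp: H_simps)
  have "\<iota> a *[S] \<iota> c = \<iota> b *[S] \<iota> c" using e car by (simp add: H_simps flip: rh.hom_mult)
  hence "\<iota> c *[S] \<iota> a = \<iota> c *[S] \<iota> b" using car by (simp add: S.R.m_comm)
  moreover have "\<iota> c \<in> Units S" using hS_unit[OF \<iota>_hplus] abc by (simp add: H_simps)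
  ultimately have "\<iota> a = \<iota> b" using S.R.Units_l_cancel car by simp
  thus "a = b" using \<iota>_eq car by simp
qed

lemma H_divides: "a \<in> hplus K A \<Longrightarrow> b \<in> hplus K A \<Longrightarrow> a divides\<^bsub>H\<^esub> b \<longleftrightarrow> (\<forall>Y\<in>Q. m Y (\<iota> a) \<le> m Y (\<iota> b))"
proof
  assume a: "a \<in> hplus K A" "b \<in> hplus K A" "a divides\<^bsub>H\<^esub> b"
  then obtain c where c: "c \<in> hplus K A" "b = a *[A] c" by (auto simp: factor_def H_simps)
  show "\<forall>Y\<in>Q. m Y (\<iota> a) \<le> m Y (\<iota> b)" unfolding c(2) using m_\<iota>_mult[OF _ a(1) c(1)] img_nonneg[OF c(1)] by simp
next
  assume "a \<in> hplus K A" "b \<in> hplus K A" "\<forall>Y\<in>Q. m Y (\<iota> a) \<le> m Y (\<iota> b)"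
  thus "a divides\<^bsub>H\<^esub> b" using divides[of a b] by (auto simp: factor_def H_simps)
qed

lemma H_unit:
  assumes a: "a \<in> hplus K A"
  shows "a \<in> Units H \<longleftrightarrow> (\<forall>Y\<in>Q. m Y (\<iota> a) = 0)"
proof -
  have "(\<exists>c\<in>hplus K A. c *[A] a = 1[A] \<and> a *[A] c = 1[A]) \<longleftrightarrow> a \<in> Units A"
  proof
    assume "\<exists>c\<in>hplus K A. c *[A] a = 1[A] \<and> a *[A] c = 1[A]"
    thus "a \<in> Units A" using A.hplus_carrier a by (auto simp: Units_def)
  next
    assume "a \<in> Units A"
    hence "\<forall>Y\<in>Q. m Y (\<iota> a) = 0" using unit_iff[OF a] by simp
    then obtain c where "c \<in> hplus K A" "1[A] = a *[A] c"
      using divides[OF a hA_one] m_one by auto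
    thus "\<exists>c\<in>hplus K A. c *[A] a = 1[A] \<and> a *[A] c = 1[A]"
      using A.R.m_comm[of a c] A.hplus_carrier a by auto
  qed
  thus ?thesis using unit_iff[OF a] a by (simp add: Units_def[of H] H_simps)
qed

text \<open>The degree of the divisor of \<open>a\<close>. Values of elements of \<open>A\<close>
  are non-negative, so \<open>nat\<close> loses nothing there.\<close>

definition size :: "'a \<Rightarrow> nat" where
  "size a = (\<Sum>Y\<in>{Y \<in> Q. m Y (\<iota> a) \<noteq> 0}. nat (m Y (\<iota> a)))"

lemma size_less:
  assumes a: "a \<in> hplus K A" and b: "b \<in> hplus K A" and pf: "properfactor H a b"
  shows "size a < size b"
proof -
  have le: "\<forall>Y\<in>Q. m Y (\<iota> a) \<le> m Y (\<iota> b)" using pf H_divides[OF a b] by (simp add: properfactor_def)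
  have "\<not> (\<forall>Y\<in>Q. m Y (\<iota> b) \<le> m Y (\<iota> a))" using pf H_divides[OF b a] by (simp add: properfactor_def)
  then obtain Y where Y: "Y \<in> Q" "m Y (\<iota> a) < m Y (\<iota> b)" by auto
  let ?f = "\<lambda>a Y. nat (m Y (\<iota> a))"
  let ?J = "{Y \<in> Q. m Y (\<iota> b) \<noteq> 0}"
  have J: "finite ?J" by (rule m_fin[OF \<iota>_hplus[OF b]])
  have "size a = sum (?f a) ?J" unfolding size_def
  proof (rule sum.mono_neutral_left[OF J])
    show "{Y \<in> Q. m Y (\<iota> a) \<noteq> 0} \<subseteq> ?J" using le img_nonneg[OF a] by force
  qed auto
  also have "\<dots> < sum (?f b) ?J"
  proof (rule sum_strict_mono_ex1[OF J])
    show "\<forall>Y\<in>?J. ?f a Y \<le> ?f b Y" using le by (auto intro: nat_mono)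
    show "\<exists>Y\<in>?J. ?f a Y < ?f b Y" using Y img_nonneg[OF a Y(1)] by (intro bexI[of _ Y]) auto
  qed
  finally show ?thesis by (simp add: size_def)
qed

text \<open>A non-unit has a positive value at some \<open>Y\<close> and is therefore divisible by
  \<open>tt Y\<close>. As \<open>tt Y\<close> is not a unit, irreducibility leaves only an element
  associated with it.\<close>

lemma H_irred:
  assumes b: "b \<in> hplus K A" and irr: "irreducible H b"
  shows "\<exists>Y\<in>Q. \<forall>Z\<in>Q. m Z (\<iota> b) = (if Z = Y then 1 else 0)"
proof -
  have "b \<notin> Units H" using irr by (simp add: irreducible_def)
  then obtain Y where Y: "Y \<in> Q" "m Y (\<iota> b) \<noteq> 0" using H_unit[OF b] by auto
  have Yp: "1 \<le> m Y (\<iota> b)" using Y img_nonneg[OF b Y(1)] by simp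
  have d: "tt Y divides\<^bsub>H\<^esub> b" unfolding H_divides[OF tt(1) b]
  proof
    fix Z assume Z: "Z \<in> Q"
    show "m Z (\<iota> (tt Y)) \<le> m Z (\<iota> b)" using tt(2)[OF Z, of Y] Yp img_nonneg[OF b Z] by auto
  qed
  have nu: "tt Y \<notin> Units H"
  proof
    assume "tt Y \<in> Units H"
    hence "m Y (\<iota> (tt Y)) = 0" using H_unit[OF tt(1)] Y(1) by blast
    thus False using tt(2)[OF Y(1), of Y] by simp
  qed
  have "\<not> properfactor H (tt Y) b"
    using irr nu tt(1)[of Y] by (auto simp: irreducible_def H_simps)
  hence "b divides\<^bsub>H\<^esub> tt Y" using d by (auto simp: properfactor_def)
  hence "\<forall>Z\<in>Q. m Z (\<iota> b) = m Z (\<iota> (tt Y))"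
    using d H_divides[OF tt(1) b] H_divides[OF b tt(1)] by (auto intro: order.antisym)
  thus ?thesis using tt(2) Y(1) by auto
qed

text \<open>A cancellative monoid is factorial if proper factors are well-founded and irreducible
  elements are prime. The former is measured by \<open>size\<close>; the latter holds because
  divisibility by an irreducible element only asks for value at least one at a single
  \<open>Y\<close>, and values are additive.\<close>

theorem factorial: "K_factorial K A"
proof -
  interpret H: comm_monoid_cancel H by (rule H_cancel)
  have "divisor_chain_condition_monoid H"
  proof
    have "{(x, y). x \<in> carrier H \<and> y \<in> carrier H \<and> properfactor H x y} \<subseteq> measure size"
      using size_less by (auto simp: H_simps)
    thus "wf {(x, y). x \<in> carrier H \<and> y \<in> carrier H \<and> properfactor H x y}" by (rule wf_subset[OF wf_measure])
  qed
  moreover have "primeness_condition_monoid H"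
  proof
    fix b assume "b \<in> carrier H" and irr: "irreducible H b"
    hence b: "b \<in> hplus K A" by (simp add: H_simps)
    obtain Y where Y: "Y \<in> Q" "\<forall>Z\<in>Q. m Z (\<iota> b) = (if Z = Y then 1 else 0)" using H_irred[OF b irr] by blast
    have dv: "b divides\<^bsub>H\<^esub> x \<longleftrightarrow> 1 \<le> m Y (\<iota> x)" if x: "x \<in> hplus K A" for x
      unfolding H_divides[OF b x] using Y img_nonneg[OF x] by (auto split: if_splits)
    show "prime H b" unfolding prime_def
    proof (intro conjI ballI impI)
      show "b \<notin> Units H" using irr by (simp add: irreducible_def)
      fix x y assume "x \<in> carrier H" "y \<in> carrier H" and d: "b divides\<^bsub>H\<^esub> x *[H] y"
      hence x: "x \<in> hplus K A" and y: "y \<in> hplus K A" by (auto simp: H_simps)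
      have "1 \<le> m Y (\<iota> x) + m Y (\<iota> y)"
        using d dv[OF hA_mult[OF x y]] m_\<iota>_mult[OF Y(1) x y] by (simp add: H_simps)
      thus "b divides\<^bsub>H\<^esub> x \<or> b divides\<^bsub>H\<^esub> y"
        using dv[OF x] dv[OF y] img_nonneg[OF x Y(1)] img_nonneg[OF y Y(1)] by linarith
    qed
  qed
  ultimately show ?thesis using A_integral factorial_condition_one[of H] by (simp add: K_factorial_def)
qed

subsection \<open>Fractions\<close>

text \<open>The last clause keeps the denominator free of zeros wherever \<open>s\<close> has no
  pole. It is what later places the denominator outside a given prime divisor.\<close>

lemma denominator:
  assumes s: "s \<in> carrier S"
  shows "\<exists>t\<in>hplus K A. \<iota> t *[S] s \<in> \<iota> ` carrier A \<and> (\<forall>Y\<in>Q. s \<in> V {Y} \<longrightarrow> m Y (\<iota> t) = 0)"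
proof -
  let ?J = "S.supp s"
  \<comment> \<open>The sum of the pole orders of the components bounds each of them, vanishes where
    there are no poles, and makes sense for an empty support.\<close>
  define D where "D Y = (\<Sum>w\<in>?J. max 0 (- m Y (hcomp K S s w)))" for Y
  have J: "finite ?J" using S.hcomp_props(2)[OF s] .
  have hp: "hcomp K S s w \<in> hplus K S" if "w \<in> ?J" for w
    using hom_elems_cases[OF hcomp_hom[OF s]] that by auto
  have D0: "0 \<le> D Y" for Y unfolding D_def by (rule sum_nonneg) simp
  have "{Y \<in> Q. D Y \<noteq> 0} \<subseteq> (\<Union>w\<in>?J. {Y \<in> Q. m Y (hcomp K S s w) \<noteq> 0})"
  proof
    fix Y assume Y: "Y \<in> {Y \<in> Q. D Y \<noteq> 0}"
    then obtain w where "w \<in> ?J" "max 0 (- m Y (hcomp K S s w)) \<noteq> 0"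
      unfolding D_def using sum.neutral[of ?J "\<lambda>w. max 0 (- m Y (hcomp K S s w))"] by blast
    thus "Y \<in> (\<Union>w\<in>?J. {Y \<in> Q. m Y (hcomp K S s w) \<noteq> 0})" using Y by auto
  qed
  moreover have "finite (\<Union>w\<in>?J. {Y \<in> Q. m Y (hcomp K S s w) \<noteq> 0})"
    by (rule finite_UN_I[OF J m_fin[OF hp]])
  ultimately have "finite {Y \<in> Q. D Y \<noteq> 0}" by (rule finite_subset)
  then obtain t where t: "t \<in> hplus K A" "\<forall>Y\<in>Q. m Y (\<iota> t) = D Y" using lift_eff D0 by metis
  obtain v where v: "v \<in> carrier K" "\<iota> t \<in> gcomp S v" using \<iota>_hplus[OF t(1)] by (rule S.hplusE)
  have "\<iota> t *[S] s \<in> V Q"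
  proof -
    have "nonneg Q (hcomp K S (\<iota> t *[S] s) w)" if w: "w \<in> carrier K" for w
    proof -
      let ?u = "inv[K] v *[K] w"
      have u: "?u \<in> carrier K" using v w by simp
      show ?thesis unfolding S.hcomp_mult_homog'[OF s v w]
      proof (cases "?u \<in> ?J")
        case True
        have "0 \<le> m Y (\<iota> t *[S] hcomp K S s ?u)" if Y: "Y \<in> Q" for Y
        proof -
          have "max 0 (- m Y (hcomp K S s ?u)) \<le> D Y" unfolding D_def
            by (rule member_le_sum[OF True _ J]) simp
          thus ?thesis using m_mult[OF Y \<iota>_hplus[OF t(1)] hp[OF True]] t(2) Y by simp
        qed
        thus "nonneg Q (\<iota> t *[S] hcomp K S s ?u)" by (simp add: nonneg_def)
      next
        case False
        hence "hcomp K S s ?u = 0[S]" using u by simp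
        thus "nonneg Q (\<iota> t *[S] hcomp K S s ?u)" using t(1) A.hplus_carrier by (simp add: nonneg_def)
      qed
    qed
    thus ?thesis using s t(1) A.hplus_carrier by (simp add: V_def)
  qed
  moreover have "m Y (\<iota> t) = 0" if Y: "Y \<in> Q" and sV: "s \<in> V {Y}" for Y
  proof -
    have "D Y = 0" unfolding D_def by (rule sum.neutral) (use sV in \<open>auto simp: V_def nonneg_def\<close>)
    thus ?thesis using t(2) Y by simp
  qed
  ultimately show ?thesis using t(1) img_V by blast
qed

sublocale lm: loc_map A S \<iota> "hplus K A"
proof
  show "\<iota> \<in> ring_hom A S" by (rule hom)
  show "inj_on \<iota> (carrier A)" by (rule \<iota>_inj)
  show "hplus K A \<subseteq> carrier A" using A.hplus_carrier by blast
qed (use hA_one hA_mult hS_unit[OF \<iota>_hplus] in auto)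

lemma frac_repr:
  assumes s: "s \<in> carrier S"
  shows "\<exists>a\<in>carrier A. \<exists>t\<in>hplus K A. s = lm.q a t \<and> (\<forall>Y\<in>Q. s \<in> V {Y} \<longrightarrow> m Y (\<iota> t) = 0)"
proof -
  obtain t where t: "t \<in> hplus K A" "\<iota> t *[S] s \<in> \<iota> ` carrier A" "\<forall>Y\<in>Q. s \<in> V {Y} \<longrightarrow> m Y (\<iota> t) = 0"
    using denominator[OF s] by blast
  obtain a where a: "\<iota> t *[S] s = \<iota> a" "a \<in> carrier A" using t(2) by (rule imageE)
  have "s = lm.q a t" by (rule lm.q_eqI[OF s t(1) a(2)]) (use a s t(1) A.hplus_carrier S.R.m_comm in simp)
  thus ?thesis using a(2) t by blast
qed

text \<open>By \<open>frac_repr\<close> every element of \<open>S\<close> is a fraction of elements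
  of \<open>A\<close> with homogeneous denominator, so the abstract localization maps onto
  \<open>S\<close>. It remains to compare degrees.\<close>

theorem Qplus_iso: "graded_ring_iso K (Qplus K A) S (loc_lift S \<iota>)" and Qplus_graded: "graded_ring K (Qplus K A)"
proof -
  have sub: "carrier S \<subseteq> {lm.q a s | a s. a \<in> carrier A \<and> s \<in> hplus K A}"
  proof
    fix x assume "x \<in> carrier S"
    from frac_repr[OF this] show "x \<in> {lm.q a s | a s. a \<in> carrier A \<and> s \<in> hplus K A}" by blast
  qed
  have cr: "cring (Qplus K A)"
    by (rule cring_transport[OF S.R.cring_axioms, of "loc_lift S \<iota>"])
      (use lm.loc_cring[OF sub] cring.cring_simprules[OF lm.loc_cring(1)[OF sub]] lm.loc_lift_zero
        in \<open>simp_all add: ring_iso_def ring_hom_def\<close>)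
  have iso: "loc_lift S \<iota> \<in> ring_iso (Qplus K A) S"
    using lm.loc_cring(2)[OF sub] by (simp add: ring_iso_def ring_hom_def)
  have g: "gcomp (Qplus K A) w \<subseteq> carrier (Qplus K A)" if w: "w \<in> carrier K" for w
  proof
    fix x assume "x \<in> gcomp (Qplus K A) w"
    then obtain a s u where *: "u \<in> carrier K" "s \<in> hplus K A" "a \<in> gcomp A (w *[K] u)" "x = rfrac A (hplus K A) a s"
      by auto
    thus "x \<in> carrier (Qplus K A)" using lm.loc_mem[of x] A.gcomp_carrier[OF A.K.m_closed[OF w *(1)]] by auto
  qed
  have hg: "loc_lift S \<iota> ` gcomp (Qplus K A) w = gcomp S w" if w: "w \<in> carrier K" for w
  proof (rule equalityI; rule subsetI)
    fix y assume "y \<in> loc_lift S \<iota> ` gcomp (Qplus K A) w"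
    then obtain a s u where *: "u \<in> carrier K" "s \<in> hplus K A" "s \<in> gcomp A u" "a \<in> gcomp A (w *[K] u)"
      "y = loc_lift S \<iota> (rfrac A (hplus K A) a s)" by auto
    have wu: "w *[K] u \<in> carrier K" using w * by simp
    have "y = \<iota> a *[S] inv[S] (\<iota> s)"
      using *(5) lm.loc_lift_rfrac[OF A.gcomp_carrier[OF wu *(4)] *(2)] by (simp add: lm.q_def)
    moreover have "\<iota> a *[S] inv[S] (\<iota> s) \<in> gcomp S (w *[K] u *[K] inv[K] u)"
    proof (rule S.gcomp_mult[OF wu _ homg[OF wu *(4)]])
      show "inv[S] (\<iota> s) \<in> gcomp S (inv[K] u)"
        by (rule S.inv_homog[OF homg[OF *(1,3)] *(1) hS_unit[OF \<iota>_hplus[OF *(2)]]])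
    qed (use * in simp)
    moreover have "w *[K] u *[K] inv[K] u = w" using w * by (simp add: A.K.m_assoc)
    ultimately show "y \<in> gcomp S w" by simp
  next
    fix y assume y: "y \<in> gcomp S w"
    have yS: "y \<in> carrier S" by (rule S.gcomp_carrier[OF w y])
    obtain a t where at: "a \<in> carrier A" "t \<in> hplus K A" "y = lm.q a t" using frac_repr[OF yS] by blast
    obtain u where u: "u \<in> carrier K" "t \<in> gcomp A u" using at(2) by (rule A.hplusE)
    have "y *[S] \<iota> t = \<iota> a" using lm.q_cancel[OF at(1,2)] at(3) by simp
    moreover have "y *[S] \<iota> t \<in> gcomp S (w *[K] u)" by (rule S.gcomp_mult[OF w u(1) y homg[OF u]])
    \<comment> \<open>The numerator is homogeneous because its image is the product of
      \<open>y\<close> with the image of the denominator.\<close>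
    ultimately have "a \<in> gcomp A (w *[K] u)" using gcomp_iff[OF at(1) A.K.m_closed[OF w u(1)]] by simp
    hence "rfrac A (hplus K A) a t \<in> gcomp (Qplus K A) w" using at(2) u by auto
    from imageI[OF this, of "loc_lift S \<iota>"] show "y \<in> loc_lift S \<iota> ` gcomp (Qplus K A) w"
      using at lm.loc_lift_rfrac by simp
  qed
  show "graded_ring_iso K (Qplus K A) S (loc_lift S \<iota>)" "graded_ring K (Qplus K A)"
    using graded_ring_transport[OF S.grd cr iso g hg] by auto
qed

lemma discrete:
  assumes Y: "Y \<in> Q"
  shows "discrete_K_valuation K S (m Y)"
proof -
  have "m Y ` hplus K S = UNIV"
  proof (rule UNIV_eq_I[symmetric])
    fix n :: int
    have "finite {Z \<in> Q. (if Z = Y then n else 0) \<noteq> 0}" by (rule finite_subset[of _ "{Y}"]) auto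
    from m_surj[OF this] obtain s where "s \<in> hplus K S" "m Y s = n" using Y by auto
    thus "n \<in> m Y ` hplus K S" by blast
  qed
  thus ?thesis unfolding discrete_K_valuation_def using simpleS m_mult[OF Y] m_add[OF Y] by auto
qed

theorem Krull: "K_Krull_in K S (\<iota> ` carrier A)"
  unfolding K_Krull_in_def
proof (intro conjI exI[of _ "m ` Q"] ballI)
  show "K_simple K S" by (rule simpleS)
  show "discrete_K_valuation K S \<nu>" if "\<nu> \<in> m ` Q" for \<nu> using that discrete by blast
  show "\<iota> ` carrier A = carrier S \<inter> (\<Inter>\<nu>\<in>m ` Q. K_valuation_ring K S \<nu>)"
    unfolding img_V V_inter using V_generate by auto
  fix a assume "a \<in> \<iota> ` carrier A \<inter> hplus K S"
  hence "finite (m ` {Y \<in> Q. m Y a \<noteq> 0})" using m_fin by blast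
  thus "finite {\<nu> \<in> m ` Q. \<nu> a \<noteq> 0}" by (rule rev_finite_subset) blast
qed

theorem Krull_Qplus: "K_Krull_in K (Qplus K A) (Qplus_embed K A)"
proof -
  interpret I: grd_iso K "Qplus K A" S "loc_lift S \<iota>" by (rule grd_iso.intro[OF Qplus_iso])
  have "loc_lift S \<iota> (rfrac A (hplus K A) a 1[A]) = \<iota> a" if "a \<in> carrier A" for a
    using that lm.loc_lift_rfrac[OF that hA_one] lm.q_one by simp
  hence e: "loc_lift S \<iota> ` Qplus_embed K A = \<iota> ` carrier A"
    unfolding Qplus_embed_def by (auto simp: image_iff) metis
  have sub: "Qplus_embed K A \<subseteq> carrier (Qplus K A)"
  proof
    fix P assume "P \<in> Qplus_embed K A"
    then obtain a where "a \<in> carrier A" "P = rfrac A (hplus K A) a 1[A]" unfolding Qplus_embed_def by blast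
    thus "P \<in> carrier (Qplus K A)" using lm.loc_mem[of P] hA_one by auto
  qed
  show ?thesis by (rule I.Krull_transport[OF sub]) (use e Krull in simp)
qed

subsection \<open>Prime divisors\<close>

abbreviation "pp Y \<equiv> PIdl\<^bsub>A\<^esub> (tt Y)"

text \<open>If a homogeneous \<open>a\<close> is a multiple of \<open>tt Y\<close>, the cofactor is
  homogeneous too, being a quotient of homogeneous units of \<open>S\<close>. Conversely, value at
  least one at \<open>Y\<close> suffices for divisibility, since \<open>tt Y\<close> has value zero
  elsewhere.\<close>

lemma pp_mem:
  assumes Y: "Y \<in> Q" and a: "a \<in> hplus K A"
  shows "a \<in> pp Y \<longleftrightarrow> 1 \<le> m Y (\<iota> a)"
proof
  assume "a \<in> pp Y"
  then obtain x where x: "x \<in> carrier A" "a = x *[A] tt Y" by (auto simp: cgenideal_def)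
  note t = A.hplus_carrier[OF tt(1)[of Y]] hS_unit[OF \<iota>_hplus[OF tt(1)[of Y]]]
  have "\<iota> x = \<iota> a *[S] inv[S] (\<iota> (tt Y))" using x t by (simp add: S.R.m_assoc)
  also have "\<dots> \<in> hplus K S" by (rule hS_mult[OF \<iota>_hplus[OF a] hS_inv[OF \<iota>_hplus[OF tt(1)]]])
  finally have "x \<in> hplus K A" using hplus_iff[OF x(1)] by simp
  thus "1 \<le> m Y (\<iota> a)" unfolding x(2) using m_\<iota>_mult[OF Y _ tt(1)] img_nonneg[OF _ Y] tt(2)[OF Y, of Y] by simp
next
  assume "1 \<le> m Y (\<iota> a)"
  hence "m Z (\<iota> (tt Y)) \<le> m Z (\<iota> a)" if "Z \<in> Q" for Z using tt(2)[OF that, of Y] img_nonneg[OF a that] by auto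
  then obtain c where "c \<in> hplus K A" "a = tt Y *[A] c" using divides[OF tt(1) a] by blast
  thus "a \<in> pp Y" using A.hplus_carrier tt(1) A.R.m_comm by (auto simp: cgenideal_def)
qed

lemma zero_pp: "0[A] \<in> pp Y"
  using A.hplus_carrier[OF tt(1)[of Y]] by (auto simp: cgenideal_def intro!: exI[of _ "0[A]"])

lemma pp_prime:
  assumes Y: "Y \<in> Q"
  shows "K_prime_ideal K A (pp Y)"
proof -
  have t: "tt Y \<in> hom_elems K A" using tt(1) by (simp add: hplus_def)
  have "1[A] \<notin> pp Y" using pp_mem[OF Y hA_one] m_one[OF Y] by simp
  hence ne: "pp Y \<noteq> carrier A" by auto
  have "f \<in> pp Y \<or> g \<in> pp Y" if f: "f \<in> hom_elems K A" and g: "g \<in> hom_elems K A" and fg: "f *[A] g \<in> pp Y" for f g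
  proof (cases "f = 0[A] \<or> g = 0[A]")
    case True thus ?thesis using zero_pp by auto
  next
    case False
    hence fg': "f \<in> hplus K A" "g \<in> hplus K A" using f g by (auto simp: hplus_def)
    have "1 \<le> m Y (\<iota> f) + m Y (\<iota> g)" using pp_mem[OF Y hA_mult[OF fg']] fg m_\<iota>_mult[OF Y fg'] by simp
    thus ?thesis using pp_mem[OF Y] fg' img_nonneg[OF _ Y] by smt
  qed
  thus ?thesis unfolding K_prime_ideal_def using A.graded_ideal_cgen[OF t] ne by blast
qed

text \<open>A non-zero homogeneous element of \<open>q\<close> of least \<open>size\<close> is not a
  unit, so some \<open>tt Y\<close> splits off. The cofactor is smaller and hence outside
  \<open>q\<close>, and primeness puts \<open>tt Y\<close> into \<open>q\<close>.\<close>

lemma pp_least: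
  assumes q: "K_prime_ideal K A q" "q \<noteq> {0[A]}"
  shows "\<exists>Y\<in>Q. pp Y \<subseteq> q"
proof -
  have gi: "graded_ideal K A q" using q by (simp add: K_prime_ideal_def)
  interpret q: ideal q A using gi by (simp add: graded_ideal_def)
  obtain x where x: "x \<in> q" "x \<noteq> 0[A]" using q(2) q.zero_closed by blast
  have xA: "x \<in> carrier A" by (rule q.a_Hcarr[OF x(1)])
  obtain w where w: "w \<in> carrier K" "hcomp K A x w \<noteq> 0[A]"
    using A.hcomp_ext[OF xA A.R.zero_closed] x(2) A.hcomp_zero by metis
  have "hcomp K A x w \<in> q" by (rule A.graded_ideal_hcomp[OF gi x(1) w(1)])
  moreover have "hcomp K A x w \<in> hplus K A" by (rule A.hplusI[OF w(1) A.hcomp_in[OF xA w(1)] w(2)])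
  ultimately have ex: "\<exists>a. a \<in> hplus K A \<and> a \<in> q" by blast
  define a where "a = arg_min size (\<lambda>a. a \<in> hplus K A \<and> a \<in> q)"
  have a: "a \<in> hplus K A" "a \<in> q" and amin: "\<And>b. b \<in> hplus K A \<Longrightarrow> b \<in> q \<Longrightarrow> size a \<le> size b"
    using arg_min_nat_lemma[of "\<lambda>a. a \<in> hplus K A \<and> a \<in> q", OF _, of _ size] ex unfolding a_def by blast+
  have "1[A] \<notin> q" using q(1) q.one_imp_carrier by (auto simp: K_prime_ideal_def)
  hence "a \<notin> Units A" using a(2) q.I_r_closed A.R.Units_l_inv[of a] A.R.Units_inv_closed[of a] q.I_l_closed by metis
  then obtain Y where Y: "Y \<in> Q" "m Y (\<iota> a) \<noteq> 0" using unit_iff[OF a(1)] by auto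
  have "a \<in> pp Y" using pp_mem[OF Y(1) a(1)] Y img_nonneg[OF a(1) Y(1)] by simp
  have "m Z (\<iota> (tt Y)) \<le> m Z (\<iota> a)" if "Z \<in> Q" for Z
    using tt(2)[OF that, of Y] img_nonneg[OF a(1) that] Y by auto
  then obtain c where c: "c \<in> hplus K A" "a = tt Y *[A] c" using divides[OF tt(1) a(1)] by blast
  have "properfactor H c a"
  proof -
    have "c divides\<^bsub>H\<^esub> a" unfolding H_divides[OF c(1) a(1)] unfolding c(2)
      using m_\<iota>_mult[OF _ tt(1) c(1)] img_nonneg[OF tt(1)] by simp
    moreover have "\<not> a divides\<^bsub>H\<^esub> c"
      unfolding H_divides[OF a(1) c(1)] using m_\<iota>_mult[OF Y(1) tt(1) c(1)] tt(2)[OF Y(1), of Y] Y(1) c(2)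
      by (intro notI) (drule bspec[OF _ Y(1)], simp)
    ultimately show ?thesis by (simp add: properfactor_def)
  qed
  hence "c \<notin> q" using amin[OF c(1)] size_less[OF c(1) a(1)] by auto
  moreover have "c \<in> hom_elems K A" "tt Y \<in> hom_elems K A" using c(1) tt(1) by (auto simp: hplus_def)
  ultimately have "tt Y \<in> q" using q(1) a(2) c(2) by (auto simp: K_prime_ideal_def)
  hence "pp Y \<subseteq> q" using q.I_l_closed by (auto simp: cgenideal_def)
  thus ?thesis using Y(1) by blast
qed

lemma pp_inj:
  assumes Y: "Y \<in> Q" and Z: "Z \<in> Q" and s: "pp Y \<subseteq> pp Z"
  shows "Y = Z"
proof -
  have "tt Y \<in> pp Y" using pp_mem[OF Y tt(1)] tt(2)[OF Y, of Y] by simp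
  hence "1 \<le> m Z (\<iota> (tt Y))" using s pp_mem[OF Z tt(1)] by blast
  thus "Y = Z" using tt(2)[OF Z, of Y] by (auto split: if_splits)
qed

text \<open>The ideals \<open>pp Y\<close> are K-prime and pairwise incomparable, and every non-zero
  K-prime ideal contains one of them.\<close>

theorem prime_divisors: "K_prime_divisors K A = pp ` Q"
proof (rule equalityI; rule subsetI)
  fix p assume p: "p \<in> K_prime_divisors K A"
  hence "K_prime_ideal K A p" "p \<noteq> {0[A]}" by (simp_all add: K_prime_divisors_def)
  from pp_least[OF this] obtain Y where Y: "Y \<in> Q" "pp Y \<subseteq> p" by blast
  have "pp Y \<noteq> {0[A]}" using pp_mem[OF Y(1) tt(1)[of Y]] tt(2)[OF Y(1), of Y] tt(1)[of Y] by (auto simp: hplus_def)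
  hence "pp Y = p" using p Y pp_prime[OF Y(1)] by (simp add: K_prime_divisors_def)
  thus "p \<in> pp ` Q" using Y by blast
next
  fix p assume "p \<in> pp ` Q"
  then obtain Y where Y: "p = pp Y" "Y \<in> Q" by (rule imageE)
  have ne: "pp Y \<noteq> {0[A]}" using pp_mem[OF Y(2) tt(1)[of Y]] tt(2)[OF Y(2), of Y] tt(1)[of Y] by (auto simp: hplus_def)
  have "q = pp Y" if q: "K_prime_ideal K A q" "q \<noteq> {0[A]}" "q \<subseteq> pp Y" for q
  proof -
    obtain Z where Z: "Z \<in> Q" "pp Z \<subseteq> q" using pp_least[OF q(1,2)] by blast
    hence "Z = Y" using pp_inj[OF Z(1) Y(2)] q(3) by blast
    thus ?thesis using Z q(3) by blast
  qed
  thus "p \<in> K_prime_divisors K A" using pp_prime[OF Y(2)] ne Y(1) by (simp add: K_prime_divisors_def)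
qed

lemma pp_bij: "bij_betw (\<lambda>Y. pp Y) Q (K_prime_divisors K A)"
  unfolding bij_betw_def prime_divisors by (auto intro!: inj_onI pp_inj)

theorem essential: "Y \<in> Q \<Longrightarrow> essential_K_valuation K A (pp Y) (m Y \<circ> loc_lift S \<iota>)"
proof -
  assume Y: "Y \<in> Q"
  interpret I: grd_iso K "Qplus K A" S "loc_lift S \<iota>" by (rule grd_iso.intro[OF Qplus_iso])
  have sub: "{Y} \<subseteq> Q" using Y by simp
  have "K_valuation_ring K (Qplus K A) (m Y \<circ> loc_lift S \<iota>) = Qplus_loc_at K A (pp Y)" (is "?L = ?R")
  proof (rule equalityI; rule subsetI)
    fix P assume P: "P \<in> ?L"
    have "?L \<subseteq> carrier (Qplus K A)" unfolding K_valuation_ring_def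
      by (rule I.A.R.generate_ring_incl) (use I.A.hplus_carrier in auto)
    hence Pc: "P \<in> carrier (Qplus K A)" using P by blast
    have PV: "loc_lift S \<iota> P \<in> V {Y}" using P I.valuation_ring_transport[OF Pc] V_generate[OF Y] by simp
    \<comment> \<open>An element without pole at \<open>Y\<close> admits a denominator of value zero
      at \<open>Y\<close>, that is, one outside \<open>pp Y\<close>.\<close>
    obtain a t where at: "a \<in> carrier A" "t \<in> hplus K A" "loc_lift S \<iota> P = lm.q a t" "m Y (\<iota> t) = 0"
      using frac_repr[OF V_carrier[OF PV]] PV Y by blast
    have r: "rfrac A (hplus K A) a t \<in> carrier (Qplus K A)" using at lm.loc_mem by auto
    have "P = rfrac A (hplus K A) a t" using I.inj[OF Pc r] at lm.loc_lift_rfrac by simp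
    moreover have "t \<notin> pp Y" using pp_mem[OF Y at(2)] at(4) by simp
    ultimately show "P \<in> ?R" using at unfolding Qplus_loc_at_def by blast
  next
    fix P assume "P \<in> ?R"
    then obtain a t where at: "a \<in> carrier A" "t \<in> hplus K A" "t \<notin> pp Y" "P = rfrac A (hplus K A) a t"
      unfolding Qplus_loc_at_def by blast
    have Pc: "P \<in> carrier (Qplus K A)" using at lm.loc_mem by auto
    note ti = hS_inv[OF \<iota>_hplus[OF at(2)]]
    obtain w where w: "w \<in> carrier K" "inv[S] (\<iota> t) \<in> gcomp S w" using ti by (rule S.hplusE)
    have "m Y (\<iota> t) = 0" using pp_mem[OF Y at(2)] at(3) img_nonneg[OF at(2) Y] by simp
    hence "inv[S] (\<iota> t) \<in> V {Y}" using V_hom[OF w(2,1)] m_inv[OF Y \<iota>_hplus[OF at(2)]] by (simp add: nonneg_def)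
    moreover have "\<iota> a \<in> V {Y}" using img_V at(1) V_inter Y by blast
    ultimately have "loc_lift S \<iota> P \<in> V {Y}"
      using V_mult[OF sub] lm.loc_lift_rfrac[OF at(1,2)] at(4) by (simp add: lm.q_def)
    thus "P \<in> ?L" using I.valuation_ring_transport[OF Pc] V_generate[OF Y] by simp
  qed
  thus ?thesis unfolding essential_K_valuation_def
    using prime_divisors Y I.discrete_transport[OF discrete[OF Y]] by blast
qed

text \<open>Writing a non-zero homogeneous element of \<open>S\<close> of degree \<open>w\<close> as
  a fraction exhibits \<open>w\<close> as the difference of the degrees of numerator and
  denominator.\<close>

theorem degrees_generate: "generate K (hdeg K A ` hplus K A) = carrier K"
proof (rule equalityI; rule subsetI)
  let ?D = "hdeg K A ` hplus K A"
  have D: "?D \<subseteq> carrier K" by (auto elim: A.hplusE)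
  show "w \<in> carrier K" if "w \<in> generate K ?D" for w using A.K.generate_in_carrier[OF D that] .
  fix w assume w: "w \<in> carrier K"
  obtain s where s: "s \<in> gcomp S w" "s \<noteq> 0[S]" using S_nonzero[OF w] by blast
  have sS: "s \<in> carrier S" by (rule S.gcomp_carrier[OF w s(1)])
  obtain t where t: "t \<in> hplus K A" "\<iota> t *[S] s \<in> \<iota> ` carrier A" using denominator[OF sS] by blast
  obtain a where a: "\<iota> t *[S] s = \<iota> a" "a \<in> carrier A" using t(2) by (rule imageE)
  obtain v where v: "v \<in> carrier K" "t \<in> gcomp A v" "hdeg K A t = v" using t(1) by (rule A.hplusE)
  have "\<iota> a \<in> gcomp S (v *[K] w)" using S.gcomp_mult[OF v(1) w homg[OF v(1,2)] s(1)] a(1) by simp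
  hence ag: "a \<in> gcomp A (v *[K] w)" using gcomp_iff[OF a(2)] v w by simp
  have ah: "a \<in> hplus K A"
    using hplus_iff[OF a(2)] hS_mult[OF \<iota>_hplus[OF t(1)] S.hplusI[OF w s]] a(1) by simp
  have "hdeg K A a = v *[K] w" using A.hdeg_eq[OF ag] v w ah by (simp add: hplus_def)
  hence "v *[K] w \<in> ?D" "v \<in> ?D" using ah t(1) v(3) by (metis imageI)+
  hence "inv[K] v *[K] (v *[K] w) \<in> generate K ?D" by (intro generate.eng generate.inv generate.incl)
  thus "w \<in> generate K ?D" using v w by (simp add: A.K.m_assoc[symmetric])
qed

subsection \<open>The local case\<close>

context
  assumes local: "\<And>a b. a \<in> gcomp A 1[K] \<Longrightarrow> b \<in> gcomp A 1[K] \<Longrightarrow> a +[A] b = 1[A] \<Longrightarrow> a \<in> Units A \<or> b \<in> Units A"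
begin

text \<open>The candidate for the unique K-maximal ideal. The non-unit condition is put on the
  components, because only homogeneous units matter for graded ideals.\<close>

definition aa :: "'a set" where
  "aa = {a \<in> carrier A. \<forall>w\<in>carrier K. hcomp K A a w \<notin> Units A}"

lemma zero_nonunit: "0[A] \<notin> Units A"
  using A_nonzero by (metis A.R.Units_closed A.R.Units_r_inv_ex A.R.l_null)

text \<open>Dividing by the supposed unit \<open>a + b\<close> moves the equation to degree
  \<open>1[K]\<close>, where \<open>local\<close> makes one of the summands a unit.\<close>

lemma nonunit_add:
  assumes w: "w \<in> carrier K" and a: "a \<in> gcomp A w" "a \<notin> Units A" and b: "b \<in> gcomp A w" "b \<notin> Units A"
  shows "a +[A] b \<notin> Units A"
proof
  assume u: "a +[A] b \<in> Units A"
  let ?i = "inv[A] (a +[A] b)"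
  note ab = A.gcomp_carrier[OF w a(1)] A.gcomp_carrier[OF w b(1)]
  have i: "?i \<in> gcomp A (inv[K] w)" by (rule A.inv_homog[OF A.gcomp_add[OF w a(1) b(1)] w u])
  have ic: "?i \<in> carrier A" "?i \<in> Units A" using u by auto
  have g: "?i *[A] a \<in> gcomp A 1[K]" "?i *[A] b \<in> gcomp A 1[K]"
    using A.gcomp_mult[OF _ w i a(1)] A.gcomp_mult[OF _ w i b(1)] w by simp_all
  have "?i *[A] a +[A] ?i *[A] b = 1[A]" using ab ic u by (simp flip: A.R.r_distr)
  from local[OF g this] consider "?i *[A] a \<in> Units A" | "?i *[A] b \<in> Units A" by blast
  thus False
  proof cases
    case 1 thus False using A.R.prod_unit_l[OF 1 ic(2) ic(1) ab(1)] a(2) ic by simp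
  next
    case 2 thus False using A.R.prod_unit_l[OF 2 ic(2) ic(1) ab(2)] b(2) ic by simp
  qed
qed

lemma aa_ideal: "graded_ideal K A aa"
proof (rule A.graded_idealI)
  have add: "x +[A] y \<in> aa" if x: "x \<in> aa" and y: "y \<in> aa" for x y
  proof -
    have c: "x \<in> carrier A" "y \<in> carrier A" using x y by (auto simp: aa_def)
    have "hcomp K A (x +[A] y) w \<notin> Units A" if w: "w \<in> carrier K" for w
      unfolding A.hcomp_add[OF c w]
      by (rule nonunit_add[OF w A.hcomp_in[OF c(1) w] _ A.hcomp_in[OF c(2) w]]) (use x y w in \<open>auto simp: aa_def\<close>)
    thus ?thesis using c by (simp add: aa_def)
  qed
  have zero: "0[A] \<in> aa" using zero_nonunit by (simp add: aa_def A.hcomp_zero)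
  have mul: "b *[A] x \<in> aa" if b: "b \<in> carrier A" and x: "x \<in> aa" for b x
  proof (rule A.hom_induct[OF b])
    have xA: "x \<in> carrier A" using x by (simp add: aa_def)
    show "0[A] *[A] x \<in> aa" using xA zero by simp
    show "(c +[A] d) *[A] x \<in> aa" if "c \<in> carrier A" "d \<in> carrier A" "c *[A] x \<in> aa" "d *[A] x \<in> aa" for c d
      using that add xA by (simp add: A.R.l_distr)
    show "hcomp K A b v *[A] x \<in> aa" if v: "v \<in> carrier K" for v
    proof -
      note bv = A.hcomp_in[OF b v]
      have bc: "hcomp K A b v \<in> carrier A" by (rule A.hcomp_carrier[OF b v])
      have "hcomp K A (hcomp K A b v *[A] x) w \<notin> Units A" if w: "w \<in> carrier K" for w
      proof
        have u: "inv[K] v *[K] w \<in> carrier K" using v w by simp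
        assume "hcomp K A (hcomp K A b v *[A] x) w \<in> Units A"
        hence "hcomp K A b v *[A] hcomp K A x (inv[K] v *[K] w) \<in> Units A"
          using A.hcomp_mult_homog'[OF xA v bv w] by simp
        hence "hcomp K A x (inv[K] v *[K] w) \<in> Units A"
          using A.R.unit_factor[of "hcomp K A x (inv[K] v *[K] w)" "hcomp K A b v"] A.hcomp_carrier[OF xA u] bc
          by (simp add: A.R.m_comm)
        thus False using x u by (simp add: aa_def)
      qed
      thus ?thesis using bc xA by (simp add: aa_def)
    qed
  qed
  show "ideal aa A"
  proof (rule idealI[OF A.R.ring_axioms])
    have "\<ominus>[A] a \<in> aa" if "a \<in> aa" for a
    proof -
      have "a \<in> carrier A" using that by (simp add: aa_def)
      thus ?thesis using mul[OF A.R.a_inv_closed[OF A.R.one_closed] that] by (simp add: A.R.l_minus)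
    qed
    thus "subgroup aa (add_monoid A)"
      by (intro A.R.add.subgroupI) (use add zero in \<open>auto simp: aa_def a_inv_def\<close>)
    show "b *[A] x \<in> aa" "x *[A] b \<in> aa" if "x \<in> aa" "b \<in> carrier A" for x b
      using mul[OF that(2,1)] that by (auto simp: aa_def A.R.m_comm)
  qed
  show "hcomp K A a w \<in> aa" if a: "a \<in> aa" and w: "w \<in> carrier K" for a w
  proof -
    have aA: "a \<in> carrier A" using a by (simp add: aa_def)
    show ?thesis using a w A.hcomp_homog[OF A.hcomp_in[OF aA w] w] zero_nonunit A.hcomp_carrier[OF aA w]
      by (auto simp: aa_def)
  qed
qed

text \<open>A graded ideal contains the components of its elements, and a proper one contains no
  unit.\<close>

lemma aa_greatest:
  assumes "graded_ideal K A J" "J \<noteq> carrier A" shows "J \<subseteq> aa"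
proof
  interpret J: ideal J A using assms(1) by (simp add: graded_ideal_def)
  fix x assume x: "x \<in> J"
  have "hcomp K A x w \<notin> Units A" if w: "w \<in> carrier K" for w
  proof
    assume u: "hcomp K A x w \<in> Units A"
    have "hcomp K A x w \<in> J" by (rule A.graded_ideal_hcomp[OF assms(1) x w])
    hence "inv[A] (hcomp K A x w) *[A] hcomp K A x w \<in> J" by (rule J.I_l_closed) (use u in simp)
    hence "1[A] \<in> J" using u by simp
    thus False using J.one_imp_carrier assms(2) by simp
  qed
  thus "x \<in> aa" using J.a_Hcarr[OF x] by (simp add: aa_def)
qed

lemma aa_max: "K_maximal_ideal K A I \<longleftrightarrow> I = aa"
proof -
  have "1[A] \<notin> aa"
  proof
    assume "1[A] \<in> aa"
    hence "hcomp K A 1[A] 1[K] \<notin> Units A" by (simp add: aa_def)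
    thus False using A.hcomp_homog[OF A.one_homog] by simp
  qed
  hence "aa \<noteq> carrier A" by auto
  thus ?thesis unfolding K_maximal_ideal_def using aa_ideal aa_greatest by blast
qed

lemma max_K_ideal_eq: "max_K_ideal K A = aa"
  unfolding max_K_ideal_def by (rule the_equality) (simp_all add: aa_max)

theorem K_local: "K_local K A"
  unfolding K_local_def using A.grd aa_max by auto

theorem max_K_ideal_hplus: "max_K_ideal K A \<inter> hplus K A = {a \<in> hplus K A. \<exists>Y\<in>Q. m Y (\<iota> a) \<noteq> 0}"
proof -
  have "a \<in> aa \<longleftrightarrow> (\<exists>Y\<in>Q. m Y (\<iota> a) \<noteq> 0)" if a: "a \<in> hplus K A" for a
  proof -
    obtain w where w: "w \<in> carrier K" "a \<in> gcomp A w" using a by (rule A.hplusE)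
    have "a \<in> aa \<longleftrightarrow> a \<notin> Units A"
      using w zero_nonunit A.gcomp_carrier[OF w] by (auto simp: aa_def A.hcomp_homog)
    thus ?thesis using unit_iff[OF a] by blast
  qed
  thus ?thesis unfolding max_K_ideal_eq by blast
qed

text \<open>With a single valuation every homogeneous non-unit has value at least one and is
  therefore divisible by \<open>t\<close>.\<close>

theorem max_K_ideal_principal:
  assumes Q: "Q = {Y}" and t: "t \<in> hplus K A" "m Y (\<iota> t) = 1"
  shows "max_K_ideal K A = PIdl\<^bsub>A\<^esub> t"
proof (rule equalityI; rule subsetI)
  have tA: "t \<in> carrier A" by (rule A.hplus_carrier[OF t(1)])
  have I: "ideal (PIdl\<^bsub>A\<^esub> t) A" by (rule A.R.cgenideal_ideal[OF tA])
  have zI: "0[A] \<in> PIdl\<^bsub>A\<^esub> t"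
    by (rule additive_subgroup.zero_closed[OF ideal.axioms(1)[OF I]])
  fix x assume "x \<in> max_K_ideal K A"
  hence x: "x \<in> aa" unfolding max_K_ideal_eq .
  hence xA: "x \<in> carrier A" by (simp add: aa_def)
  show "x \<in> PIdl\<^bsub>A\<^esub> t"
  proof (rule A.hom_induct[OF xA])
    show "hcomp K A x w \<in> PIdl\<^bsub>A\<^esub> t" if w: "w \<in> carrier K" for w
    proof (cases "hcomp K A x w = 0[A]")
      case False
      let ?x = "hcomp K A x w"
      have h: "?x \<in> hplus K A" by (rule A.hplusI[OF w A.hcomp_in[OF xA w] False])
      have "?x \<notin> Units A" using x w by (simp add: aa_def)
      hence "m Y (\<iota> ?x) \<noteq> 0" using unit_iff[OF h] Q by simp
      hence "m Z (\<iota> t) \<le> m Z (\<iota> ?x)" if "Z \<in> Q" for Z using that Q t img_nonneg[OF h, of Y] by simp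
      then obtain c where "c \<in> hplus K A" "?x = t *[A] c" using divides[OF t(1) h] by blast
      thus ?thesis using tA A.hplus_carrier A.R.m_comm by (auto simp: cgenideal_def)
    qed (use zI in simp)
  qed (use zI additive_subgroup.a_closed[OF ideal.axioms(1)[OF I]] in simp_all)
next
  fix x assume "x \<in> PIdl\<^bsub>A\<^esub> t"
  then obtain y where y: "y \<in> carrier A" "x = y *[A] t" by (auto simp: cgenideal_def)
  have J: "ideal aa A" using aa_ideal by (simp add: graded_ideal_def)
  have "Y \<in> Q" "m Y (\<iota> t) \<noteq> 0" using Q t(2) by simp_all
  hence "t \<in> max_K_ideal K A \<inter> hplus K A" unfolding max_K_ideal_hplus using t(1) by blast
  hence "t \<in> aa" unfolding max_K_ideal_eq by (rule IntD1)
  thus "x \<in> max_K_ideal K A" unfolding y(2) max_K_ideal_eq by (rule ideal.I_l_closed[OF J _ y(1)])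
qed

end

end

section \<open>Families of discrete valuations on a field\<close>

definition dval :: "('a, 'm) ring_scheme \<Rightarrow> ('a \<Rightarrow> int) \<Rightarrow> bool" where
  "dval F \<nu> \<longleftrightarrow> \<nu> ` (carrier F - {0[F]}) = UNIV \<and>
     (\<forall>x\<in>carrier F - {0[F]}. \<forall>y\<in>carrier F - {0[F]}. \<nu> (x *[F] y) = \<nu> x + \<nu> y) \<and>
     (\<forall>x\<in>carrier F - {0[F]}. \<forall>y\<in>carrier F - {0[F]}. x +[F] y \<noteq> 0[F] \<longrightarrow> min (\<nu> x) (\<nu> y) \<le> \<nu> (x +[F] y))"

definition vr :: "('a, 'm) ring_scheme \<Rightarrow> ('a \<Rightarrow> int) \<Rightarrow> 'a set" where
  "vr F \<nu> = {x \<in> carrier F. x = 0[F] \<or> 0 \<le> \<nu> x}"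

context field
begin

abbreviation "nz \<equiv> carrier R - {\<zero>}"

lemma nz_mult: "x \<in> nz \<Longrightarrow> y \<in> nz \<Longrightarrow> x \<otimes> y \<in> nz"
  using integral by auto

lemma nz_unit: "x \<in> nz \<Longrightarrow> x \<in> Units R"
  by (simp add: field_Units)

lemma nz_inv: "x \<in> nz \<Longrightarrow> inv x \<in> nz"
  using Units_inv_Units[of x] by (simp add: field_Units)

lemma nz_one: "\<one> \<in> nz"
  by simp

lemma nz_r_inv: "x \<in> nz \<Longrightarrow> x \<otimes> inv x = \<one>"
  using nz_unit by simp

lemma nz_l_inv: "x \<in> nz \<Longrightarrow> inv x \<otimes> x = \<one>"
  using nz_unit by simp

context
  fixes \<nu> assumes d: "dval R \<nu>"
begin

lemma dval_mult: "x \<in> nz \<Longrightarrow> y \<in> nz \<Longrightarrow> \<nu> (x \<otimes> y) = \<nu> x + \<nu> y"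
  using d unfolding dval_def by blast

lemma dval_add: "x \<in> nz \<Longrightarrow> y \<in> nz \<Longrightarrow> x \<oplus> y \<noteq> \<zero> \<Longrightarrow> min (\<nu> x) (\<nu> y) \<le> \<nu> (x \<oplus> y)"
  using d unfolding dval_def by blast

lemma dval_surj: "\<exists>x\<in>nz. \<nu> x = n"
proof -
  have "n \<in> \<nu> ` nz" using d unfolding dval_def by blast
  thus ?thesis by blast
qed

lemma dval_one: "\<nu> \<one> = 0"
  using dval_mult[OF nz_one nz_one] by simp

lemma dval_inv: "x \<in> nz \<Longrightarrow> \<nu> (inv x) = - \<nu> x"
  using dval_mult[OF _ nz_inv, of x x] nz_r_inv[of x] dval_one by simp

lemma dval_pow: "x \<in> nz \<Longrightarrow> x [^] (n::nat) \<in> nz \<and> \<nu> (x [^] n) = int n * \<nu> x"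
proof (induction n)
  case 0 thus ?case using dval_one by simp
next
  case (Suc n)
  hence IH: "x [^] n \<in> nz" "\<nu> (x [^] n) = int n * \<nu> x" by blast+
  have "x [^] Suc n = x [^] n \<otimes> x" by simp
  thus ?case using nz_mult[OF IH(1) Suc.prems] dval_mult[OF IH(1) Suc.prems] IH(2) by (simp add: algebra_simps)
qed

end

lemma vr_nz: "x \<in> nz \<Longrightarrow> x \<in> vr R \<nu> \<longleftrightarrow> 0 \<le> \<nu> x"
  by (auto simp: vr_def)

text \<open>The common valuation ring has the same units for both, so \<open>v\<close> and
  \<open>w\<close> vanish together. Dividing \<open>y\<close> by a power of an element
  \<open>t\<close> with \<open>v t = 1\<close> gives \<open>w y = v y * w t\<close>, and
  surjectivity of \<open>w\<close> forces \<open>w t = 1\<close>.\<close>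

lemma dval_unique:
  assumes v: "dval R v" and w: "dval R w" and eq: "vr R v = vr R w" and x: "x \<in> nz"
  shows "v x = w x"
proof -
  have pos: "0 \<le> v y \<longleftrightarrow> 0 \<le> w y" if "y \<in> nz" for y using eq vr_nz[OF that] by blast
  have zero: "v y = 0 \<longleftrightarrow> w y = 0" if "y \<in> nz" for y
    using pos[OF that] pos[OF nz_inv[OF that]] dval_inv[OF v that] dval_inv[OF w that] by auto
  obtain t where t: "t \<in> nz" "v t = 1" using dval_surj[OF v, of 1] by blast
  have wt: "0 < w t" using pos[OF t(1)] zero[OF t(1)] t(2) by simp
  have lin: "w y = v y * w t" if y: "y \<in> nz" for y
  proof (cases "0 \<le> v y")
    case True
    define n where "n = nat (v y)"
    note p = dval_pow[OF v t(1), of n] dval_pow[OF w t(1), of n]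
    have i: "inv (t [^] n) \<in> nz" using nz_inv p(1) by blast
    have "v (y \<otimes> inv (t [^] n)) = 0"
      using dval_mult[OF v y i] dval_inv[OF v conjunct1[OF p(1)]] p(1) t(2) True by (simp add: n_def)
    hence "w (y \<otimes> inv (t [^] n)) = 0" using zero[OF nz_mult[OF y i]] by simp
    thus ?thesis using dval_mult[OF w y i] dval_inv[OF w conjunct1[OF p(1)]] p(2) True by (simp add: n_def)
  next
    case False
    define n where "n = nat (- v y)"
    note p = dval_pow[OF v t(1), of n] dval_pow[OF w t(1), of n]
    have i: "t [^] n \<in> nz" using p(1) by blast
    have "v (y \<otimes> t [^] n) = 0"
      using dval_mult[OF v y i] p(1) t(2) False by (simp add: n_def)
    hence "w (y \<otimes> t [^] n) = 0" using zero[OF nz_mult[OF y i]] by simp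
    thus ?thesis using dval_mult[OF w y i] p(2) False by (simp add: n_def)
  qed
  obtain s where s: "s \<in> nz" "w s = 1" using dval_surj[OF w, of 1] by blast
  have "v s * w t = 1" using lin[OF s(1)] s(2) by simp
  hence "w t = 1" using wt by (auto simp: zmult_eq_1_iff)
  thus ?thesis using lin[OF x] by simp
qed

end

text \<open>\<open>N\<close> is any defining family and may contain redundant valuations. The ring
  is kept as a subset of its field of fractions, so that its localizations are subsets of the same
  field.\<close>

locale krull_fam = field F for F :: "('a, 'm) ring_scheme" (structure) +
  fixes A :: "'a set" and N :: "('a \<Rightarrow> int) set"
  assumes N: "\<And>\<nu>. \<nu> \<in> N \<Longrightarrow> dval F \<nu>"
    and A_eq: "A = {x \<in> carrier F. x = \<zero> \<or> (\<forall>\<nu>\<in>N. 0 \<le> \<nu> x)}"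
    and A_fin: "\<And>a. a \<in> A \<Longrightarrow> a \<noteq> \<zero> \<Longrightarrow> finite {\<nu> \<in> N. \<nu> a \<noteq> 0}"
    and A_frac: "\<And>x. x \<in> carrier F \<Longrightarrow> \<exists>a\<in>A. \<exists>b\<in>A. b \<noteq> \<zero> \<and> x \<otimes> b = a"
begin

definition fprime :: "'a set \<Rightarrow> bool" where
  "fprime p \<longleftrightarrow> p \<subseteq> A \<and> \<zero> \<in> p \<and> \<one> \<notin> p \<and> (\<forall>x\<in>p. \<forall>y\<in>p. x \<oplus> y \<in> p) \<and> (\<forall>a\<in>A. \<forall>x\<in>p. a \<otimes> x \<in> p) \<and>
     (\<forall>x\<in>A. \<forall>y\<in>A. x \<otimes> y \<in> p \<longrightarrow> x \<in> p \<or> y \<in> p)"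

text \<open>Height one, in the form of minimality among the non-zero primes.\<close>

definition hprime :: "'a set \<Rightarrow> bool" where
  "hprime p \<longleftrightarrow> fprime p \<and> p \<noteq> {\<zero>} \<and> (\<forall>q. fprime q \<and> q \<noteq> {\<zero>} \<and> q \<subseteq> p \<longrightarrow> q = p)"

definition locp :: "'a set \<Rightarrow> 'a set" where
  "locp p = {x \<in> carrier F. \<exists>s\<in>A. s \<notin> p \<and> s \<otimes> x \<in> A}"

text \<open>The contraction to \<open>A\<close> of the maximal ideal of the valuation ring.\<close>

definition center :: "('a \<Rightarrow> int) \<Rightarrow> 'a set" where
  "center \<nu> = {a \<in> A. a = \<zero> \<or> 0 < \<nu> a}"

lemma A_sub: "a \<in> A \<Longrightarrow> a \<in> carrier F"
  by (simp add: A_eq)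

lemma A_nz: "a \<in> A \<Longrightarrow> a \<noteq> \<zero> \<Longrightarrow> a \<in> nz"
  by (simp add: A_eq)

lemma A_mem: "x \<in> nz \<Longrightarrow> x \<in> A \<longleftrightarrow> (\<forall>\<nu>\<in>N. 0 \<le> \<nu> x)"
  by (auto simp: A_eq)

lemma A_pos: "a \<in> A \<Longrightarrow> a \<noteq> \<zero> \<Longrightarrow> \<nu> \<in> N \<Longrightarrow> 0 \<le> \<nu> a"
  by (auto simp: A_eq)

lemma A_zero: "\<zero> \<in> A" by (simp add: A_eq)

lemma A_one: "\<one> \<in> A"
proof -
  have "0 \<le> \<nu> \<one>" if "\<nu> \<in> N" for \<nu> using dval_one[OF N[OF that]] by simp
  thus ?thesis using A_mem[OF nz_one] by blast
qed

lemma A_mult: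
  assumes a: "a \<in> A" and b: "b \<in> A"
  shows "a \<otimes> b \<in> A"
proof -
  show ?thesis
  proof (cases "a = \<zero> \<or> b = \<zero>")
    case True thus ?thesis using a b A_sub A_zero by auto
  next
    case False
    hence n: "a \<in> nz" "b \<in> nz" using a b A_nz by auto
    have "0 \<le> \<nu> (a \<otimes> b)" if "\<nu> \<in> N" for \<nu>
      using dval_mult[OF N[OF that] n] A_pos[OF a _ that] A_pos[OF b _ that] False by simp
    thus ?thesis using A_mem[OF nz_mult[OF n]] by blast
  qed
qed

text \<open>The family is locally finite on \<open>A\<close> only by assumption; writing
  \<open>x\<close> as a fraction extends this to the field.\<close>

lemma fin: "x \<in> nz \<Longrightarrow> finite {\<nu> \<in> N. \<nu> x \<noteq> 0}"
proof -
  assume x: "x \<in> nz"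
  then obtain a b where ab: "a \<in> A" "b \<in> A" "b \<noteq> \<zero>" "x \<otimes> b = a" using A_frac[of x] by blast
  have bn: "b \<in> nz" using ab A_nz by blast
  have an: "a \<noteq> \<zero>" using ab(4) nz_mult[OF x bn] by auto
  have "{\<nu> \<in> N. \<nu> x \<noteq> 0} \<subseteq> {\<nu> \<in> N. \<nu> a \<noteq> 0} \<union> {\<nu> \<in> N. \<nu> b \<noteq> 0}"
  proof
    fix \<nu> assume v: "\<nu> \<in> {\<nu> \<in> N. \<nu> x \<noteq> 0}"
    have "\<nu> a = \<nu> x + \<nu> b" using dval_mult[OF N x bn, of \<nu>] ab(4) v by simp
    thus "\<nu> \<in> {\<nu> \<in> N. \<nu> a \<noteq> 0} \<union> {\<nu> \<in> N. \<nu> b \<noteq> 0}" using v by auto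
  qed
  thus ?thesis using A_fin[OF ab(1) an] A_fin[OF ab(2,3)] by (rule finite_subset[OF _ finite_UnI])
qed

lemma center_prime:
  assumes v: "\<nu> \<in> N"
  shows "fprime (center \<nu>)"
proof -
  note d = N[OF v]
  have add: "x \<oplus> y \<in> center \<nu>" if x: "x \<in> center \<nu>" and y: "y \<in> center \<nu>" for x y
  proof -
    have c: "x \<in> A" "y \<in> A" "x \<in> carrier F" "y \<in> carrier F" using x y A_sub by (auto simp: center_def)
    show ?thesis
    proof (cases "x = \<zero> \<or> y = \<zero> \<or> x \<oplus> y = \<zero>")
      case True
      thus ?thesis using x y c A_zero by (auto simp: center_def)
    next
      case False
      hence n: "x \<in> nz" "y \<in> nz" "x \<oplus> y \<in> nz" using c by auto
      have "min (\<mu> x) (\<mu> y) \<le> \<mu> (x \<oplus> y)" if "\<mu> \<in> N" for \<mu> using dval_add[OF N[OF that] n(1,2)] False by simp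
      moreover have "0 \<le> \<mu> x" "0 \<le> \<mu> y" if "\<mu> \<in> N" for \<mu> using A_pos that c False by auto
      ultimately have "x \<oplus> y \<in> A" using A_mem[OF n(3)] by fastforce
      moreover have "0 < \<nu> (x \<oplus> y)" using dval_add[OF d n(1,2)] False x y by (auto simp: center_def)
      ultimately show ?thesis by (simp add: center_def)
    qed
  qed
  have mul: "a \<otimes> x \<in> center \<nu>" if a: "a \<in> A" and x: "x \<in> center \<nu>" for a x
  proof (cases "a = \<zero> \<or> x = \<zero>")
    case True thus ?thesis using a x A_sub A_zero by (auto simp: center_def)
  next
    case False
    hence n: "a \<in> nz" "x \<in> nz" using a x A_nz by (auto simp: center_def)
    show ?thesis using A_mult[OF a] x dval_mult[OF d n] A_pos[OF a _ v] False by (auto simp: center_def)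
  qed
  have pr: "x \<in> center \<nu> \<or> y \<in> center \<nu>" if x: "x \<in> A" and y: "y \<in> A" and xy: "x \<otimes> y \<in> center \<nu>" for x y
  proof (cases "x = \<zero> \<or> y = \<zero>")
    case True thus ?thesis using x y by (auto simp: center_def)
  next
    case False
    hence n: "x \<in> nz" "y \<in> nz" using x y A_nz by auto
    have "0 < \<nu> x + \<nu> y" using xy dval_mult[OF d n] nz_mult[OF n] by (auto simp: center_def)
    thus ?thesis using x y A_pos[OF x _ v] A_pos[OF y _ v] False by (auto simp: center_def)
  qed
  show ?thesis unfolding fprime_def
  proof (intro conjI ballI impI)
    show "center \<nu> \<subseteq> A" by (auto simp: center_def)
    show "\<zero> \<in> center \<nu>" using A_zero by (simp add: center_def)
    show "\<one> \<notin> center \<nu>" using dval_one[OF d] by (simp add: center_def)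
  qed (use add mul pr in blast)+
qed

lemma fprimeD:
  assumes "fprime p"
  shows "p \<subseteq> A" "\<zero> \<in> p" "\<one> \<notin> p" "x \<in> p \<Longrightarrow> y \<in> p \<Longrightarrow> x \<oplus> y \<in> p" "a \<in> A \<Longrightarrow> x \<in> p \<Longrightarrow> a \<otimes> x \<in> p"
    "x \<in> A \<Longrightarrow> y \<in> A \<Longrightarrow> x \<otimes> y \<in> p \<Longrightarrow> x \<in> p \<or> y \<in> p"
  using assms unfolding fprime_def by blast+

lemma A_locp: "fprime q \<Longrightarrow> A \<subseteq> locp q"
proof
  fix x assume q: "fprime q" and x: "x \<in> A"
  have "\<one> \<otimes> x \<in> A" using x A_sub by simp
  thus "x \<in> locp q" unfolding locp_def using A_one fprimeD(3)[OF q] A_sub[OF x] by blast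
qed

text \<open>The total pole order of \<open>y\<close> along the family; the sum is finite for
  non-zero \<open>y\<close> by \<open>fin_neg\<close>.\<close>

definition neg :: "'a \<Rightarrow> nat" where
  "neg y = (\<Sum>\<nu>\<in>{\<nu> \<in> N. \<nu> y < 0}. nat (- \<nu> y))"

lemma fin_neg: "y \<in> nz \<Longrightarrow> finite {\<nu> \<in> N. \<nu> y < 0}"
  using fin[of y] by (rule rev_finite_subset) auto

lemma neg_less:
  assumes y: "y \<in> nz" and b: "b \<in> A" "b \<noteq> \<zero>" and v: "\<nu> \<in> N" "\<nu> y < 0" "0 < \<nu> b"
  shows "neg (b \<otimes> y) < neg y"
proof -
  have bn: "b \<in> nz" using A_nz[OF b] .
  let ?J = "{\<nu> \<in> N. \<nu> y < 0}"
  have e: "\<mu> (b \<otimes> y) = \<mu> b + \<mu> y" "0 \<le> \<mu> b" if "\<mu> \<in> N" for \<mu>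
    using dval_mult[OF N[OF that] bn y] A_pos[OF b that] by auto
  have "neg (b \<otimes> y) = (\<Sum>\<nu>\<in>?J. nat (- \<nu> (b \<otimes> y)))"
    unfolding neg_def
  proof (rule sum.mono_neutral_left[OF fin_neg[OF y]])
    show "{\<nu> \<in> N. \<nu> (b \<otimes> y) < 0} \<subseteq> ?J"
    proof
      fix \<mu> assume "\<mu> \<in> {\<nu> \<in> N. \<nu> (b \<otimes> y) < 0}"
      thus "\<mu> \<in> ?J" using e[of \<mu>] by simp
    qed
  qed auto
  also have "\<dots> < (\<Sum>\<nu>\<in>?J. nat (- \<nu> y))"
  proof (rule sum_strict_mono_ex1[OF fin_neg[OF y]])
    show "\<forall>\<mu>\<in>?J. nat (- \<mu> (b \<otimes> y)) \<le> nat (- \<mu> y)"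
    proof
      fix \<mu> assume "\<mu> \<in> ?J"
      thus "nat (- \<mu> (b \<otimes> y)) \<le> nat (- \<mu> y)" using e[of \<mu>] by (intro nat_mono) simp
    qed
    show "\<exists>\<mu>\<in>?J. nat (- \<mu> (b \<otimes> y)) < nat (- \<mu> y)" using e[OF v(1)] v by (intro bexI[of _ \<nu>]) auto
  qed
  finally show ?thesis by (simp add: neg_def)
qed

text \<open>Choosing \<open>a\<close> with \<open>a x\<close> outside the localization and as few poles as possible, the conductor of
  \<open>y = a x\<close> is the center of each of the remaining poles. It is principal after localization, so it has
  height one.\<close>

lemma core:
  assumes q: "fprime q" and x: "x \<in> carrier F" "x \<notin> locp q"
  shows "\<exists>p \<nu>. p \<subseteq> q \<and> hprime p \<and> \<nu> \<in> N \<and> vr F \<nu> = locp p \<and> p = center \<nu> \<and> x \<notin> locp p"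
proof -
  have A_loc: "A \<subseteq> locp q" by (rule A_locp[OF q])
  define P where "P a \<longleftrightarrow> a \<in> A \<and> a \<otimes> x \<notin> locp q" for a
  have "P \<one>" using x A_one by (simp add: P_def)
  then obtain a where aP: "P a" and amin: "\<And>b. P b \<Longrightarrow> neg (a \<otimes> x) \<le> neg (b \<otimes> x)"
    using ex_has_least_nat[of P \<one> "\<lambda>a. neg (a \<otimes> x)"] by blast
  have aA: "a \<in> A" and aF: "a \<in> carrier F" using aP A_sub by (auto simp: P_def)
  define y where "y = a \<otimes> x"
  have yF: "y \<in> carrier F" using aF x y_def by simp
  have yq: "y \<notin> locp q" using aP by (simp add: P_def y_def)
  have y0: "y \<noteq> \<zero>" using yq A_loc A_zero by blast
  have yn: "y \<in> nz" using yF y0 by simp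
  have yA: "y \<notin> A" using yq A_loc by blast
  have min1: "neg y \<le> neg (b \<otimes> y)" if b: "b \<in> A" "b \<otimes> y \<notin> locp q" for b
  proof -
    have e: "b \<otimes> y = (b \<otimes> a) \<otimes> x" unfolding y_def using A_sub[OF b(1)] aF x by (simp add: m_assoc)
    have "P (b \<otimes> a)" using b A_mult[OF b(1) aA] e by (simp add: P_def)
    from amin[OF this] show ?thesis using e y_def by simp
  qed
  let ?Neg = "{\<nu> \<in> N. \<nu> y < 0}"
  \<comment> \<open>Otherwise \<open>b\<close> reduces a pole of \<open>y\<close> while
    \<open>b y\<close> stays outside the localization, against the minimal choice of
    \<open>a\<close>.\<close>
  have K1: "\<nu> b = 0" if b: "b \<in> A" "b \<noteq> \<zero>" "b \<otimes> y \<notin> locp q" and v: "\<nu> \<in> ?Neg" for b \<nu>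
  proof (rule ccontr)
    assume "\<nu> b \<noteq> 0"
    hence "0 < \<nu> b" using A_pos[OF b(1,2), of \<nu>] v by auto
    hence "neg (b \<otimes> y) < neg y" using neg_less[OF yn b(1,2), of \<nu>] v by simp
    thus False using min1[OF b(1,3)] by simp
  qed
  \<comment> \<open>Elements outside \<open>q\<close> are invertible in \<open>locp q\<close>, so
    multiplying by \<open>s\<close> cannot bring \<open>y\<close> into it, and \<open>K1\<close>
    applies.\<close>
  have K2: "\<nu> s = 0" if s: "s \<in> A" "s \<notin> q" and v: "\<nu> \<in> ?Neg" for s \<nu>
  proof (rule K1[OF s(1) _ _ v])
    show "s \<noteq> \<zero>" using s(2) fprimeD(2)[OF q] by blast
    show "s \<otimes> y \<notin> locp q"
    proof
      assume "s \<otimes> y \<in> locp q"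
      then obtain t where t: "t \<in> A" "t \<notin> q" "t \<otimes> (s \<otimes> y) \<in> A" by (auto simp: locp_def)
      have "t \<otimes> s \<notin> q" using fprimeD(6)[OF q t(1) s(1)] t s by blast
      moreover have "(t \<otimes> s) \<otimes> y \<in> A" using t(3) A_sub[OF t(1)] A_sub[OF s(1)] yF by (simp add: m_assoc)
      ultimately have "y \<in> locp q" unfolding locp_def using A_mult[OF t(1) s(1)] yF by blast
      thus False using yq by simp
    qed
  qed
  have K3: "b \<otimes> y \<in> A" if b: "b \<in> A" "b \<noteq> \<zero>" "b \<otimes> y \<in> locp q" for b
  proof -
    have bn: "b \<in> nz" using A_nz b by blast
    have byn: "b \<otimes> y \<in> nz" by (rule nz_mult[OF bn yn])
    obtain s where s: "s \<in> A" "s \<notin> q" "s \<otimes> (b \<otimes> y) \<in> A" using b(3) by (auto simp: locp_def)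
    have s0: "s \<noteq> \<zero>" using s(2) fprimeD(2)[OF q] by blast
    have sn: "s \<in> nz" using A_nz[OF s(1) s0] .
    have "0 \<le> \<nu> (b \<otimes> y)" if v: "\<nu> \<in> N" for \<nu>
    proof (cases "\<nu> y < 0")
      case True
      hence "\<nu> s = 0" using K2[OF s(1,2)] v by blast
      moreover have "0 \<le> \<nu> (s \<otimes> (b \<otimes> y))" using A_mem[OF nz_mult[OF sn byn]] s(3) v by blast
      ultimately show ?thesis using dval_mult[OF N[OF v] sn byn] by simp
    next
      case False
      thus ?thesis using dval_mult[OF N[OF v] bn yn] A_pos[OF b(1,2) v] by simp
    qed
    thus ?thesis using A_mem[OF byn] by blast
  qed
  obtain l where l: "l \<in> N" "l y < 0" using yA A_mem[OF yn] by (auto simp: not_le)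
  note d = N[OF l(1)]
  define p where "p = center l"
  \<comment> \<open>A positive value at the pole \<open>l\<close> forces \<open>b y\<close> into
    \<open>locp q\<close> by \<open>K1\<close>, hence into \<open>A\<close> by \<open>K3\<close>.
    Conversely \<open>l y < 0\<close> makes \<open>l b\<close> positive.\<close>
  have K4: "b \<in> p \<longleftrightarrow> b \<otimes> y \<in> A" if b: "b \<in> A" "b \<noteq> \<zero>" for b
  proof
    assume "b \<in> p"
    hence "l b \<noteq> 0" using b by (simp add: p_def center_def)
    thus "b \<otimes> y \<in> A" using K1[OF b, of l] K3[OF b] l by blast
  next
    assume bY: "b \<otimes> y \<in> A"
    have bn: "b \<in> nz" using A_nz b by blast
    have "0 \<le> l b + l y" using A_mem[OF nz_mult[OF bn yn]] bY l(1) dval_mult[OF d bn yn] by auto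
    thus "b \<in> p" using l(2) b by (simp add: p_def center_def)
  qed
  have pp: "fprime p" unfolding p_def by (rule center_prime[OF l(1)])
  have pq: "p \<subseteq> q"
  proof
    fix b assume b: "b \<in> p"
    show "b \<in> q"
    proof (rule ccontr)
      assume bq: "b \<notin> q"
      have bA: "b \<in> A" using b by (simp add: p_def center_def)
      have "l b = 0" by (rule K2[OF bA bq]) (use l in simp)
      moreover have "b \<noteq> \<zero>" using bq fprimeD(2)[OF q] by blast
      ultimately show False using b by (simp add: p_def center_def)
    qed
  qed
  have lmul: "l (b \<otimes> y) = l b + l y" "b \<otimes> y \<noteq> \<zero>" if "b \<in> A" "b \<noteq> \<zero>" for b
    using dval_mult[OF d A_nz[OF that] yn] nz_mult[OF A_nz[OF that] yn] by auto
  obtain c0 d0 where cd: "c0 \<in> A" "d0 \<in> A" "d0 \<noteq> \<zero>" "y \<otimes> d0 = c0" using A_frac[OF yF] by blast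
  have d0p: "d0 \<in> p" using K4[OF cd(2,3)] cd A_sub[OF cd(2)] yF by (simp add: m_comm)
  \<comment> \<open>If multiplication by \<open>y\<close> preserved \<open>p\<close>, it would lower
    the positive values of \<open>l\<close> on \<open>p\<close> forever, as \<open>l y\<close> is
    negative.\<close>
  have K5: "\<exists>b0\<in>p. b0 \<noteq> \<zero> \<and> b0 \<otimes> y \<notin> p"
  proof (rule ccontr)
    assume *: "\<not> ?thesis"
    define P' where "P' b \<longleftrightarrow> b \<in> p \<and> b \<noteq> \<zero>" for b
    obtain b where b: "P' b" and bmin: "\<And>c. P' c \<Longrightarrow> nat (l b) \<le> nat (l c)"
      using ex_has_least_nat[of P' d0 "\<lambda>b. nat (l b)"] d0p cd(3) by (auto simp: P'_def)
    have bA: "b \<in> A" "b \<noteq> \<zero>" and lb: "0 < l b" using b by (auto simp: P'_def p_def center_def)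
    have "b \<otimes> y \<in> p" using * b by (auto simp: P'_def)
    hence "P' (b \<otimes> y)" using lmul[OF bA] by (simp add: P'_def)
    from bmin[OF this] show False using lmul[OF bA] l(2) lb by simp
  qed
  then obtain b0 where b0: "b0 \<in> p" "b0 \<noteq> \<zero>" "b0 \<otimes> y \<notin> p" by blast
  have b0A: "b0 \<in> A" using b0 by (simp add: p_def center_def)
  define u where "u = b0 \<otimes> y"
  have uA: "u \<in> A" using K4[OF b0A b0(2)] b0(1) by (simp add: u_def)
  have up: "u \<notin> p" using b0(3) by (simp add: u_def)
  \<comment> \<open>For \<open>b\<close> in \<open>p\<close> the element \<open>b y\<close> lies in
    \<open>A\<close>. As \<open>u\<close> is outside \<open>p\<close>, this identity says that
    \<open>b0\<close> generates \<open>p\<close> after localization.\<close>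
  have swap: "b \<otimes> u = b0 \<otimes> (b \<otimes> y)" if "b \<in> A" for b
    unfolding u_def using A_sub[OF that] A_sub[OF b0A] yF by (simp add: m_lcomm)
  have hp: "hprime p" unfolding hprime_def
  proof (intro conjI allI impI)
    show "fprime p" by (rule pp)
    show "p \<noteq> {\<zero>}" using b0 by blast
    fix q' assume *: "fprime q' \<and> q' \<noteq> {\<zero>} \<and> q' \<subseteq> p"
    hence q': "fprime q'" "q' \<subseteq> p" by blast+
    define P' where "P' b \<longleftrightarrow> b \<in> q' \<and> b \<noteq> \<zero>" for b
    have "\<exists>e. P' e" using * fprimeD(2)[OF q'(1)] by (auto simp: P'_def)
    then obtain c where c: "P' c" and cmin: "\<And>e. P' e \<Longrightarrow> nat (l c) \<le> nat (l e)"
      using ex_has_least_nat[of P' _ "\<lambda>b. nat (l b)"] by blast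
    have cq: "c \<in> q'" "c \<noteq> \<zero>" using c by (auto simp: P'_def)
    have cp: "c \<in> p" using cq q' by blast
    have cA: "c \<in> A" and lc: "0 < l c" using cp cq by (auto simp: p_def center_def)
    have cyA: "c \<otimes> y \<in> A" using K4[OF cA cq(2)] cp by blast
    have "u \<otimes> c \<in> q'" by (rule fprimeD(5)[OF q'(1) uA cq(1)])
    hence "b0 \<otimes> (c \<otimes> y) \<in> q'" using swap[OF cA] A_sub[OF uA] A_sub[OF cA] by (simp add: m_comm)
    hence "b0 \<in> q' \<or> c \<otimes> y \<in> q'" by (rule fprimeD(6)[OF q'(1) b0A cyA])
    \<comment> \<open>The value of \<open>c y\<close> under \<open>l\<close> is smaller than that of
      \<open>c\<close>, which was chosen least in \<open>q'\<close>. Primeness of \<open>q'\<close>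
      then leaves \<open>b0\<close> as the factor inside.\<close>
    moreover have "c \<otimes> y \<notin> q'"
    proof
      assume "c \<otimes> y \<in> q'"
      hence "P' (c \<otimes> y)" using lmul[OF cA cq(2)] by (simp add: P'_def)
      from cmin[OF this] show False using lmul[OF cA cq(2)] l(2) lc by simp
    qed
    ultimately have b0q: "b0 \<in> q'" by blast
    show "q' = p"
    proof (rule equalityI[OF q'(2)]; rule subsetI)
      fix b assume b: "b \<in> p"
      show "b \<in> q'"
      proof (cases "b = \<zero>")
        case False
        have bA: "b \<in> A" using b by (simp add: p_def center_def)
        have byA: "b \<otimes> y \<in> A" using K4[OF bA False] b by blast
        have "b \<otimes> u \<in> q'"
          unfolding swap[OF bA] using fprimeD(5)[OF q'(1) byA b0q] A_sub[OF byA] A_sub[OF b0A] by (simp add: m_comm)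
        thus ?thesis using fprimeD(6)[OF q'(1) bA uA] up q'(2) by blast
      qed (use fprimeD(2)[OF q'(1)] in simp)
    qed
  qed
  have vl: "vr F l = locp p"
  proof (rule equalityI; rule subsetI)
    fix z assume z: "z \<in> vr F l"
    hence zF: "z \<in> carrier F" by (simp add: vr_def)
    show "z \<in> locp p"
    proof (cases "z = \<zero>")
      case True thus ?thesis using A_locp[OF pp] A_zero by blast
    next
      case False
      hence zn: "z \<in> nz" and lz: "0 \<le> l z" using z by (auto simp: vr_def)
      \<comment> \<open>The denominators of \<open>z\<close>. One of least value under
        \<open>l\<close> lies outside \<open>p\<close>, for otherwise its product with
        \<open>y\<close> would be a denominator of smaller value.\<close>
      define P' where "P' b \<longleftrightarrow> b \<in> A \<and> b \<noteq> \<zero> \<and> z \<otimes> b \<in> A" for b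
      obtain b1 where "P' b1" using A_frac[OF zF] by (auto simp: P'_def)
      then obtain b where b: "P' b" and bmin: "\<And>c. P' c \<Longrightarrow> nat (l b) \<le> nat (l c)"
        using ex_has_least_nat[of P' _ "\<lambda>b. nat (l b)"] by blast
      have bA: "b \<in> A" "b \<noteq> \<zero>" "z \<otimes> b \<in> A" using b by (auto simp: P'_def)
      have "b \<notin> p"
      proof
        assume bp: "b \<in> p"
        hence lb: "0 < l b" using bA by (simp add: p_def center_def)
        have zb0: "z \<otimes> b \<noteq> \<zero>" using nz_mult[OF zn A_nz[OF bA(1,2)]] by simp
        have "0 < l (z \<otimes> b)" using dval_mult[OF d zn A_nz[OF bA(1,2)]] lz lb by simp
        hence "z \<otimes> b \<in> p" using bA by (simp add: p_def center_def)
        hence "(z \<otimes> b) \<otimes> y \<in> A" using K4[OF bA(3) zb0] by blast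
        hence "z \<otimes> (b \<otimes> y) \<in> A" using A_sub[OF bA(1)] zF yF by (simp add: m_assoc)
        moreover have "b \<otimes> y \<in> A" using K4[OF bA(1,2)] bp by blast
        ultimately have "P' (b \<otimes> y)" using lmul[OF bA(1,2)] by (simp add: P'_def)
        from bmin[OF this] show False using lmul[OF bA(1,2)] l(2) lb by simp
      qed
      moreover have "b \<otimes> z \<in> A" using bA(3) A_sub[OF bA(1)] zF by (simp add: m_comm)
      ultimately show ?thesis unfolding locp_def using bA(1) zF by blast
    qed
  next
    fix z assume "z \<in> locp p"
    then obtain s where s: "s \<in> A" "s \<notin> p" "s \<otimes> z \<in> A" and zF: "z \<in> carrier F" by (auto simp: locp_def)
    have s0: "s \<noteq> \<zero>" using s(2) fprimeD(2)[OF pp] by blast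
    have sn: "s \<in> nz" by (rule A_nz[OF s(1) s0])
    have ls: "l s = 0" using s A_pos[OF s(1) s0 l(1)] by (simp add: p_def center_def)
    show "z \<in> vr F l"
    proof (cases "z = \<zero>")
      case False
      hence zn: "z \<in> nz" using zF by simp
      have "0 \<le> l (s \<otimes> z)" using A_mem[OF nz_mult[OF sn zn]] s(3) l(1) by blast
      thus ?thesis using dval_mult[OF d sn zn] ls vr_nz[OF zn] by simp
    qed (simp add: vr_def)
  qed
  have "x \<notin> locp p"
  proof
    assume "x \<in> locp p"
    then obtain s where s: "s \<in> A" "s \<notin> p" "s \<otimes> x \<in> A" by (auto simp: locp_def)
    have s0: "s \<noteq> \<zero>" using s(2) fprimeD(2)[OF pp] by blast
    have "a \<otimes> (s \<otimes> x) \<in> A" by (rule A_mult[OF aA s(3)])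
    hence "s \<otimes> y \<in> A" unfolding y_def using A_sub[OF s(1)] aF x(1) by (simp add: m_lcomm)
    thus False using K4[OF s(1) s0] s(2) by blast
  qed
  thus ?thesis using pq hp l(1) vl p_def by blast
qed

text \<open>The inverse of a non-zero element of \<open>p\<close> is not in \<open>locp p\<close>,
  so \<open>core\<close> applies with \<open>q = p\<close>. The height one prime that it supplies
  lies inside \<open>p\<close> and equals it by minimality.\<close>

theorem hprime_val: "hprime p \<Longrightarrow> \<exists>\<nu>\<in>N. vr F \<nu> = locp p \<and> p = center \<nu>"
proof -
  assume p: "hprime p"
  hence fp: "fprime p" by (simp add: hprime_def)
  obtain c where c: "c \<in> p" "c \<noteq> \<zero>" using p fprimeD(2)[OF fp] by (auto simp: hprime_def)
  have cA: "c \<in> A" using fprimeD(1)[OF fp] c(1) by blast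
  have cn: "c \<in> nz" by (rule A_nz[OF cA c(2)])
  have "inv c \<notin> locp p"
  proof
    assume "inv c \<in> locp p"
    then obtain s where s: "s \<in> A" "s \<notin> p" "s \<otimes> inv c \<in> A" by (auto simp: locp_def)
    have "(s \<otimes> inv c) \<otimes> c \<in> p" by (rule fprimeD(5)[OF fp s(3) c(1)])
    moreover have "(s \<otimes> inv c) \<otimes> c = s" using A_sub[OF s(1)] nz_inv[OF cn] nz_l_inv[OF cn] cn by (simp add: m_assoc)
    ultimately show False using s(2) by simp
  qed
  then obtain p' \<nu> where *: "p' \<subseteq> p" "hprime p'" "\<nu> \<in> N" "vr F \<nu> = locp p'" "p' = center \<nu>"
    using core[OF fp, of "inv c"] nz_inv[OF cn] by blast
  have "p' = p" using p *(1,2) by (simp add: hprime_def)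
  thus ?thesis using * by blast
qed

text \<open>An element outside \<open>locp q\<close> is, by \<open>core\<close>, outside the
  localization at some height one prime contained in \<open>q\<close>.\<close>

theorem locp_inter: "fprime q \<Longrightarrow> locp q = {x \<in> carrier F. \<forall>p. hprime p \<and> p \<subseteq> q \<longrightarrow> x \<in> locp p}"
proof (rule equalityI; rule subsetI)
  fix x assume "x \<in> locp q"
  thus "x \<in> {x \<in> carrier F. \<forall>p. hprime p \<and> p \<subseteq> q \<longrightarrow> x \<in> locp p}" unfolding locp_def by blast
next
  fix x assume q: "fprime q" and x: "x \<in> {x \<in> carrier F. \<forall>p. hprime p \<and> p \<subseteq> q \<longrightarrow> x \<in> locp p}"
  show "x \<in> locp q"
  proof (rule ccontr)
    assume "x \<notin> locp q"
    from core[OF q _ this] x show False by blast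
  qed
qed

end

section \<open>Ungraded Krull rings\<close>

lemma triv_simps [simp]:
  "carrier (triv_graded A) = carrier A" "monoid.mult (triv_graded A) = monoid.mult A" "monoid.one (triv_graded A) = 1[A]"
  "ring.zero (triv_graded A) = 0[A]" "ring.add (triv_graded A) = ring.add A" "gcomp (triv_graded A) w = carrier A"
  by (simp_all add: triv_graded_def ring.defs gring.defs)

lemma triv_Units [simp]: "Units (triv_graded A) = Units A"
  by (simp add: Units_def)

lemma triv_hplus [simp]: "hplus trivK (triv_graded A) = carrier A - {0[A]}"
  by (auto simp: hplus_def hom_elems_def singleton_group_def)

lemma triv_cring: "cring A \<Longrightarrow> cring (triv_graded A)"
  by (rule cring_transport[of A id]) (auto simp: ring_hom_def cring.cring_simprules bij_betw_def)

lemma trivK_carrier [simp]: "carrier trivK = {()}"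
  by (simp add: singleton_group_def)

lemma triv_graded:
  assumes A: "cring A" shows "graded_ring trivK (triv_graded A)"
proof (rule graded_ringI)
  interpret T: cring "triv_graded A" by (rule triv_cring[OF A])
  show "comm_group trivK" by simp
  show "cring (triv_graded A)" by (rule T.cring_axioms)
  have "subgroup (carrier (triv_graded A)) (add_monoid (triv_graded A))" using T.add.subgroup_self by simp
  thus "additive_subgroup (gcomp (triv_graded A) w) (triv_graded A)" for w
    by (simp add: additive_subgroup_def)
  show "a *[triv_graded A] b \<in> gcomp (triv_graded A) (v *[trivK] w)"
    if "a \<in> gcomp (triv_graded A) v" "b \<in> gcomp (triv_graded A) w" for v w a b
    using that T.m_closed by simp
  show "\<exists>c J. finite J \<and> J \<subseteq> carrier trivK \<and> (\<forall>w\<in>J. c w \<in> gcomp (triv_graded A) w) \<and> a = finsum (triv_graded A) c J"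
    if a: "a \<in> carrier (triv_graded A)" for a
    using a T.r_zero[OF a] by (intro exI[of _ "\<lambda>_. a"] exI[of _ "{()}"]) simp
  show "c w = 0[triv_graded A]"
    if "finite J" "J \<subseteq> carrier trivK" "\<And>w. w \<in> J \<Longrightarrow> c w \<in> gcomp (triv_graded A) w"
      "finsum (triv_graded A) c J = 0[triv_graded A]" "w \<in> J" for c J w
  proof -
    have "J = {()}" using that(2,5) by auto
    thus ?thesis using that(3)[of "()"] that(4) T.r_zero[of "c ()"] by simp
  qed
qed

lemma triv_simple: "field F \<Longrightarrow> K_simple trivK (triv_graded F)"
proof -
  assume "field F"
  then interpret F: field F .
  have "carrier F \<noteq> {0[F]}" using F.one_not_zero F.one_closed by blast
  thus ?thesis using triv_graded[OF F.cring_axioms] by (simp add: K_simple_def F.field_Units)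
qed

lemma dval_iff: "field F \<Longrightarrow> discrete_K_valuation trivK (triv_graded F) \<nu> \<longleftrightarrow> dval F \<nu>"
  using triv_simple[of F] by (auto simp: discrete_K_valuation_def dval_def)

lemma (in field) dval_neg:
  assumes d: "dval R \<nu>" and x: "x \<in> nz"
  shows "\<ominus> x \<in> nz" "\<nu> (\<ominus> x) = \<nu> x"
proof -
  show n: "\<ominus> x \<in> nz" using x by (metis DiffD1 DiffD2 DiffI a_inv_closed local.minus_minus local.minus_zero singletonD singletonI)
  have m: "\<ominus> \<one> \<in> nz" by (metis DiffI a_inv_closed local.minus_minus local.minus_zero one_closed one_not_zero singletonD)
  have "2 * \<nu> (\<ominus> \<one>) = \<nu> (\<ominus> \<one> \<otimes> \<ominus> \<one>)" using dval_mult[OF d m m] by simp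
  also have "\<dots> = 0" using dval_one[OF d] by (simp add: l_minus)
  finally have "\<nu> (\<ominus> \<one>) = 0" by simp
  thus "\<nu> (\<ominus> x) = \<nu> x" using dval_mult[OF d m x] x by (simp add: l_minus)
qed

lemma (in field) vr_add:
  assumes d: "dval R \<nu>" and x: "x \<in> vr R \<nu>" and y: "y \<in> vr R \<nu>" shows "x \<oplus> y \<in> vr R \<nu>"
proof (cases "x = \<zero> \<or> y = \<zero> \<or> x \<oplus> y = \<zero>")
  case True thus ?thesis using x y by (auto simp: vr_def)
next
  case False
  hence n: "x \<in> nz" "y \<in> nz" "0 \<le> \<nu> x" "0 \<le> \<nu> y" using x y by (auto simp: vr_def)
  have "min (\<nu> x) (\<nu> y) \<le> \<nu> (x \<oplus> y)" using dval_add[OF d n(1,2)] False by simp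
  hence "0 \<le> \<nu> (x \<oplus> y)" using n(3,4) by linarith
  thus ?thesis using n by (simp add: vr_def)
qed

lemma (in field) vr_mult:
  assumes d: "dval R \<nu>" and x: "x \<in> vr R \<nu>" and y: "y \<in> vr R \<nu>" shows "x \<otimes> y \<in> vr R \<nu>"
proof (cases "x = \<zero> \<or> y = \<zero>")
  case True thus ?thesis using x y by (auto simp: vr_def)
next
  case False
  hence n: "x \<in> nz" "y \<in> nz" "0 \<le> \<nu> x" "0 \<le> \<nu> y" using x y by (auto simp: vr_def)
  thus ?thesis using dval_mult[OF d n(1,2)] by (simp add: vr_def)
qed

text \<open>The elements of non-negative value together with zero are closed under the ring
  operations, so generating a subring adds only zero.\<close>

lemma vr_generate:
  fixes R :: "'a ring" (structure)
  assumes F: "field R" and d: "dval R \<nu>"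
  shows "K_valuation_ring trivK (triv_graded R) \<nu> = vr R \<nu>"
proof (rule equalityI; rule subsetI)
  interpret F: field R by (rule F)
  let ?X = "{a \<in> hplus trivK (triv_graded R). 0 \<le> \<nu> a}"
  interpret T: cring "triv_graded R" by (rule triv_cring[OF F.cring_axioms])
  have neg: "\<ominus>[triv_graded R] x = \<ominus> x" if "x \<in> carrier R" for x
    by (rule T.minus_equality) (use that in \<open>simp_all add: F.l_neg\<close>)
  fix x
  {
    assume "x \<in> K_valuation_ring trivK (triv_graded R) \<nu>"
    hence "x \<in> generate_ring (triv_graded R) ?X" by (simp add: K_valuation_ring_def)
    thus "x \<in> vr R \<nu>"
    proof (induction rule: generate_ring.induct)
      case (a_inv h)
      hence h: "h \<in> carrier R" by (simp add: vr_def)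
      have "\<ominus> h \<in> vr R \<nu>" using a_inv F.dval_neg[OF d, of h] h by (cases "h = \<zero>") (auto simp: vr_def)
      thus ?case using neg[OF h] by simp
    next
      case one show ?case using F.dval_one[OF d] by (simp add: vr_def)
    next
      case (incl h) thus ?case by (simp add: vr_def)
    qed (use F.vr_add[OF d] F.vr_mult[OF d] in simp_all)
  }
  assume x: "x \<in> vr R \<nu>"
  show "x \<in> K_valuation_ring trivK (triv_graded R) \<nu>" unfolding K_valuation_ring_def
  proof (cases "x = \<zero>")
    case True
    have "\<one> \<oplus> \<ominus> \<one> \<in> generate_ring (triv_graded R) ?X"
      using generate_ring.eng_add[OF generate_ring.one generate_ring.a_inv[OF generate_ring.one], of "triv_graded R" ?X]
      by (simp add: neg)
    thus "x \<in> generate_ring (triv_graded R) ?X" using True by (simp add: F.r_neg)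
  next
    case False
    thus "x \<in> generate_ring (triv_graded R) ?X" using x by (intro generate_ring.incl) (simp add: vr_def)
  qed
qed

text \<open>\<open>Krull_ring\<close> speaks of classes of pairs. The lemma moves the defining
  family into a given field of fractions, which will be the stalk at the generic point, the same for
  all charts.\<close>

theorem Krull_ring_fam:
  fixes A :: "'a ring" and F :: "'b ring"
  assumes Kr: "Krull_ring A" and F: "field F" and j: "j \<in> ring_hom A F" "inj_on j (carrier A)"
    and frac: "\<And>x. x \<in> carrier F \<Longrightarrow> \<exists>a\<in>carrier A. \<exists>b\<in>carrier A. b \<noteq> 0[A] \<and> x *[F] j b = j a"
  shows "\<exists>N. krull_fam F (j ` carrier A) N"
proof -
  interpret F: field F by (rule F)
  interpret A: domain A using Kr by (simp add: Krull_ring_def)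
  have Acr: "cring A" and Fcr: "cring F" by (rule A.cring_axioms, rule F.cring_axioms)
  let ?A = "triv_graded A" and ?F = "triv_graded F"
  interpret h: ring_hom_cring A F j by (rule ring_hom_cringI[OF Acr Fcr j(1)])
  have T: "hplus trivK ?A = carrier A - {0[A]}" by simp
  have jnz: "j s \<in> F.nz" if "s \<in> carrier A" "s \<noteq> 0[A]" for s
    using inj_onD[OF j(2) _ that(1) A.zero_closed] h.hom_zero h.hom_closed that by auto
  interpret lm: loc_map ?A ?F j "hplus trivK ?A"
  proof (rule loc_map.intro[OF triv_cring[OF Acr] triv_cring[OF Fcr]], rule loc_map_axioms.intro)
    show "j \<in> ring_hom ?A ?F" using j(1) by (simp add: ring_hom_def)
    show "s *[?A] t \<in> hplus trivK ?A" if "s \<in> hplus trivK ?A" "t \<in> hplus trivK ?A" for s t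
      using that A.integral by auto
    show "j s \<in> Units ?F" if "s \<in> hplus trivK ?A" for s
      using that jnz F.nz_unit by simp
  qed (use j(2) in auto)
  have sub: "carrier ?F \<subseteq> {lm.q a s | a s. a \<in> carrier ?A \<and> s \<in> hplus trivK ?A}"
  proof
    fix x assume x: "x \<in> carrier ?F"
    hence "x \<in> carrier F" by simp
    from frac[OF this] obtain a b where ab: "a \<in> carrier A" "b \<in> carrier A" "b \<noteq> 0[A]" "x *[F] j b = j a" by blast
    have "x = lm.q a b" by (rule lm.q_eqI) (use x ab in auto)
    thus "x \<in> {lm.q a s | a s. a \<in> carrier ?A \<and> s \<in> hplus trivK ?A}" using ab by auto
  qed
  let ?Q = "Qplus trivK ?A" and ?h = "loc_lift ?F j"
  have iso0: "?h \<in> ring_iso ?Q ?F" using lm.loc_cring(2)[OF sub] by (simp add: ring_iso_def ring_hom_def)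
  have crQ: "cring ?Q"
    by (rule cring_transport[OF triv_cring[OF Fcr], of ?h])
      (use lm.loc_cring[OF sub] cring.cring_simprules[OF lm.loc_cring(1)[OF sub]] lm.loc_lift_zero
        in \<open>simp_all add: ring_iso_def ring_hom_def\<close>)
  have g: "gcomp ?Q w = carrier ?Q" for w
  proof (rule equalityI; rule subsetI)
    fix P assume "P \<in> gcomp ?Q w"
    then obtain a s where "a \<in> carrier A" "s \<in> hplus trivK ?A" "P = rfrac ?A (hplus trivK ?A) a s" by auto
    thus "P \<in> carrier ?Q" using lm.loc_mem[of P] by auto
  next
    fix P assume "P \<in> carrier ?Q"
    then obtain a s where "a \<in> carrier A" "s \<in> hplus trivK ?A" "P = rfrac ?A (hplus trivK ?A) a s"
      using lm.loc_mem[of P] by auto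
    thus "P \<in> gcomp ?Q w" by auto
  qed
  have iso: "graded_ring_iso trivK ?Q ?F ?h"
    by (rule graded_ring_transport(2)[OF triv_graded[OF Fcr] crQ iso0])
      (use g iso0 in \<open>auto simp: ring_iso_def bij_betw_def\<close>)
  \<comment> \<open>\<open>Krull_transport\<close> pulls a family back, so the inverse isomorphism
    is what leads from the field of classes to \<open>F\<close>.\<close>
  let ?i = "inv_into (carrier ?Q) ?h"
  interpret I: grd_iso trivK ?Q ?F ?h by (rule grd_iso.intro[OF iso])
  interpret J: grd_iso trivK ?F ?Q ?i by (rule grd_iso.intro[OF graded_ring_iso_inv[OF iso]])
  have sub2: "Qplus_embed trivK ?A \<subseteq> carrier ?Q"
  proof
    fix P assume "P \<in> Qplus_embed trivK ?A"
    then obtain a where a: "a \<in> carrier ?A" "P = rfrac ?A (hplus trivK ?A) a 1[?A]" unfolding Qplus_embed_def by blast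
    hence "\<exists>a\<in>carrier ?A. \<exists>s\<in>hplus trivK ?A. P = rfrac ?A (hplus trivK ?A) a s" using lm.T_one by blast
    hence "P \<in> carrier (loc ?A (hplus trivK ?A))" by (rule lm.loc_mem[THEN iffD2])
    thus "P \<in> carrier ?Q" by (simp only: Qplus_simps(1))
  qed
  have "?h (rfrac ?A (hplus trivK ?A) a 1[?A]) = j a" if "a \<in> carrier A" for a
    using that lm.loc_lift_rfrac[OF _ lm.T_one, of a] lm.q_one[of a] by simp
  hence e: "?h ` Qplus_embed trivK ?A = j ` carrier A"
    unfolding Qplus_embed_def by (auto simp: image_iff) metis
  have inj: "inj_on ?h (carrier ?Q)" using I.bij by (simp add: bij_betw_def)
  have e2: "?i ` (j ` carrier A) = Qplus_embed trivK ?A"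
    unfolding e[symmetric] by (rule inv_into_image_cancel[OF inj sub2])
  have jF: "j ` carrier A \<subseteq> carrier F" by auto
  have "K_Krull_in trivK ?F (j ` carrier A)"
    by (rule J.Krull_transport) (use jF e2 Kr in \<open>simp_all add: Krull_ring_def\<close>)
  then obtain N where N: "\<forall>\<nu>\<in>N. discrete_K_valuation trivK ?F \<nu>"
    "j ` carrier A = carrier ?F \<inter> (\<Inter>\<nu>\<in>N. K_valuation_ring trivK ?F \<nu>)"
    "\<forall>a\<in>j ` carrier A \<inter> hplus trivK ?F. finite {\<nu> \<in> N. \<nu> a \<noteq> 0}"
    unfolding K_Krull_in_def by blast
  have dv: "dval F \<nu>" if "\<nu> \<in> N" for \<nu> using N(1) that dval_iff[OF F] by blast
  have "krull_fam F (j ` carrier A) N"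
  proof (intro krull_fam.intro krull_fam_axioms.intro F dv)
    show "j ` carrier A = {x \<in> carrier F. x = 0[F] \<or> (\<forall>\<nu>\<in>N. 0 \<le> \<nu> x)}"
      unfolding N(2) using vr_generate[OF F dv] by (auto simp: vr_def)
    show "finite {\<nu> \<in> N. \<nu> a \<noteq> 0}" if "a \<in> j ` carrier A" "a \<noteq> 0[F]" for a
      using N(3) that jF by auto
    show "\<exists>a\<in>j ` carrier A. \<exists>b\<in>j ` carrier A. b \<noteq> 0[F] \<and> x *[F] b = a" if x: "x \<in> carrier F" for x
    proof -
      obtain a b where ab: "a \<in> carrier A" "b \<in> carrier A" "b \<noteq> 0[A]" "x *[F] j b = j a" using frac[OF x] by blast
      have "j b \<noteq> 0[F]" using jnz[OF ab(2,3)] by simp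
      thus ?thesis using ab by blast
    qed
  qed
  thus ?thesis by blast
qed

section \<open>Stalks\<close>

locale rsheaf =
  fixes F :: "('p, 'a, 'm) sheaf"
  assumes sheaf: "sheaf_of_rings F"
begin

abbreviation "op \<equiv> opens F"

lemma sh: "sheaf_of_sets F"
  using sheaf by (simp add: sheaf_of_rings_def)

lemma sec_cring: "op U \<Longrightarrow> cring (sec F U)"
  using sheaf by (simp add: sheaf_of_rings_def)

lemma restr_ring_hom: "op U \<Longrightarrow> op V \<Longrightarrow> V \<subseteq> U \<Longrightarrow> restr F U V \<in> ring_hom (sec F U) (sec F V)"
  using sheaf by (simp add: sheaf_of_rings_def)

lemma restr_closed: "op U \<Longrightarrow> op V \<Longrightarrow> V \<subseteq> U \<Longrightarrow> s \<in> secs F U \<Longrightarrow> restr F U V s \<in> secs F V"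
  using restr_ring_hom by (simp add: ring_hom_def Pi_iff)

lemma restr_mult: "op U \<Longrightarrow> op V \<Longrightarrow> V \<subseteq> U \<Longrightarrow> s \<in> secs F U \<Longrightarrow> t \<in> secs F U
   \<Longrightarrow> restr F U V (s *[sec F U] t) = restr F U V s *[sec F V] restr F U V t"
  using restr_ring_hom by (simp add: ring_hom_def)

lemma restr_add: "op U \<Longrightarrow> op V \<Longrightarrow> V \<subseteq> U \<Longrightarrow> s \<in> secs F U \<Longrightarrow> t \<in> secs F U
   \<Longrightarrow> restr F U V (s +[sec F U] t) = restr F U V s +[sec F V] restr F U V t"
  using restr_ring_hom by (simp add: ring_hom_def)

lemma restr_one: "op U \<Longrightarrow> op V \<Longrightarrow> V \<subseteq> U \<Longrightarrow> restr F U V 1[sec F U] = 1[sec F V]"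
  using restr_ring_hom by (simp add: ring_hom_def)

lemma restr_zero: "op U \<Longrightarrow> op V \<Longrightarrow> V \<subseteq> U \<Longrightarrow> restr F U V 0[sec F U] = 0[sec F V]"
  by (rule ring_hom_cring.hom_zero[OF ring_hom_cringI[OF sec_cring sec_cring restr_ring_hom]])

lemma restr_id: "op U \<Longrightarrow> s \<in> secs F U \<Longrightarrow> restr F U U s = s"
  by (rule sh[unfolded sheaf_of_sets_def, THEN conjunct2, THEN conjunct1, THEN spec[of _ U], THEN mp, THEN bspec])

lemma restr_comp: "op U \<Longrightarrow> op V \<Longrightarrow> op W \<Longrightarrow> V \<subseteq> U \<Longrightarrow> W \<subseteq> V \<Longrightarrow> s \<in> secs F U
  \<Longrightarrow> restr F V W (restr F U V s) = restr F U W s"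
  by (rule sh[unfolded sheaf_of_sets_def, THEN conjunct2, THEN conjunct2, THEN conjunct1, THEN spec[of _ U],
      THEN spec[of _ V], THEN spec[of _ W], THEN mp, THEN bspec]) (intro conjI; assumption)

lemma glue:
  assumes "\<And>U. U \<in> \<U> \<Longrightarrow> op U" "\<And>U. U \<in> \<U> \<Longrightarrow> f U \<in> secs F U"
    and "\<And>U V. U \<in> \<U> \<Longrightarrow> V \<in> \<U> \<Longrightarrow> restr F U (U \<inter> V) (f U) = restr F V (U \<inter> V) (f V)"
  shows "\<exists>!s. s \<in> secs F (\<Union>\<U>) \<and> (\<forall>U\<in>\<U>. restr F (\<Union>\<U>) U s = f U)"
  by (rule sh[unfolded sheaf_of_sets_def, THEN conjunct2, THEN conjunct2, THEN conjunct2, THEN spec[of _ \<U>],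
      THEN spec[of _ f], THEN mp]) (intro conjI ballI assms; assumption)

text \<open>Uniqueness in the gluing axiom, for the cover by all open sets on which \<open>s\<close>
  and \<open>t\<close> agree.\<close>

lemma locality:
  assumes "op U" "s \<in> secs F U" "t \<in> secs F U"
    and loc: "\<And>x. x \<in> U \<Longrightarrow> \<exists>W. op W \<and> x \<in> W \<and> W \<subseteq> U \<and> restr F U W s = restr F U W t"
  shows "s = t"
proof -
  define \<U> where "\<U> = {W. op W \<and> W \<subseteq> U \<and> restr F U W s = restr F U W t}"
  have un: "\<Union>\<U> = U" using loc by (auto simp: \<U>_def)
  have "\<exists>!r. r \<in> secs F (\<Union>\<U>) \<and> (\<forall>W\<in>\<U>. restr F (\<Union>\<U>) W r = restr F U W s)"
  proof (rule glue)
    fix V W assume "V \<in> \<U>" "W \<in> \<U>"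
    hence o: "op V" "op W" "op (V \<inter> W)" "V \<subseteq> U" "W \<subseteq> U" by (auto simp: \<U>_def)
    have "restr F V (V \<inter> W) (restr F U V s) = restr F U (V \<inter> W) s"
      by (rule restr_comp[OF assms(1) o(1,3,4) Int_lower1 assms(2)])
    moreover have "restr F W (V \<inter> W) (restr F U W s) = restr F U (V \<inter> W) s"
      by (rule restr_comp[OF assms(1) o(2,3,5) Int_lower2 assms(2)])
    ultimately show "restr F V (V \<inter> W) (restr F U V s) = restr F W (V \<inter> W) (restr F U W s)" by simp
  qed (use assms restr_closed in \<open>auto simp: \<U>_def\<close>)
  thus ?thesis unfolding un using assms(2,3) by (auto simp: \<U>_def)
qed

lemma empty_sec: "s \<in> secs F {} \<Longrightarrow> t \<in> secs F {} \<Longrightarrow> s = t"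
  by (rule locality) auto

lemma germ_mem:
  "(V, t) \<in> germ F x U s \<longleftrightarrow> op V \<and> x \<in> V \<and> t \<in> secs F V \<and>
     (\<exists>W. op W \<and> x \<in> W \<and> W \<subseteq> U \<inter> V \<and> restr F U W s = restr F V W t)"
  by (simp add: germ_def)

lemma germ_self: "op U \<Longrightarrow> x \<in> U \<Longrightarrow> s \<in> secs F U \<Longrightarrow> (U, s) \<in> germ F x U s"
  unfolding germ_mem by auto

lemma germ_eqI:
  assumes "op U" "op V" "op W" "x \<in> W" "W \<subseteq> U" "W \<subseteq> V"
    and s: "s \<in> secs F U" and t: "t \<in> secs F V" and e: "restr F U W s = restr F V W t"
  shows "germ F x U s = germ F x V t"
proof -
  have *: "germ F x U s \<subseteq> germ F x V t"
    if o: "op U" "op V" "W \<subseteq> U" "W \<subseteq> V" and s: "s \<in> secs F U" and t: "t \<in> secs F V"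
      and e: "restr F U W s = restr F V W t" for U V s t
  proof (rule subrelI)
    fix V' t' assume "(V', t') \<in> germ F x U s"
    then obtain W' where *: "op V'" "x \<in> V'" "t' \<in> secs F V'" "op W'" "x \<in> W'" "W' \<subseteq> U \<inter> V'"
      "restr F U W' s = restr F V' W' t'" unfolding germ_mem by blast
    let ?W = "W \<inter> W'"
    have oW: "op ?W" by (rule openin_Int[OF assms(3) *(4)])
    have "restr F V ?W t = restr F W ?W (restr F V W t)" using restr_comp[OF o(2) assms(3) oW o(4) _ t] by simp
    also have "\<dots> = restr F U ?W s" unfolding e[symmetric] using restr_comp[OF o(1) assms(3) oW o(3) _ s] by simp
    also have "\<dots> = restr F W' ?W (restr F U W' s)" using restr_comp[OF o(1) *(4) oW _ _ s] *(6) by simp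
    also have "\<dots> = restr F V' ?W t'" unfolding *(7) using restr_comp[OF *(1,4) oW _ _ *(3)] *(6) by simp
    finally show "(V', t') \<in> germ F x V t"
      unfolding germ_mem using * oW assms(4) o by (intro conjI exI[of _ ?W]) auto
  qed
  show ?thesis using *[OF assms(1,2,5,6) s t e] *[OF assms(2,1,6,5) t s e[symmetric]] by (rule equalityI)
qed

lemma germ_eq:
  assumes "op U" "x \<in> U" "s \<in> secs F U" "op V" "x \<in> V" "t \<in> secs F V"
  shows "germ F x U s = germ F x V t \<longleftrightarrow> (\<exists>W. op W \<and> x \<in> W \<and> W \<subseteq> U \<and> W \<subseteq> V \<and> restr F U W s = restr F V W t)"
proof
  assume "germ F x U s = germ F x V t"
  hence "(V, t) \<in> germ F x U s" using germ_self assms by simp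
  thus "\<exists>W. op W \<and> x \<in> W \<and> W \<subseteq> U \<and> W \<subseteq> V \<and> restr F U W s = restr F V W t" unfolding germ_mem by auto
next
  assume "\<exists>W. op W \<and> x \<in> W \<and> W \<subseteq> U \<and> W \<subseteq> V \<and> restr F U W s = restr F V W t"
  then obtain W where "op W" "x \<in> W" "W \<subseteq> U" "W \<subseteq> V" "restr F U W s = restr F V W t" by blast
  thus "germ F x U s = germ F x V t" using germ_eqI assms by metis
qed

lemma germ_of_mem: "op U \<Longrightarrow> s \<in> secs F U \<Longrightarrow> (V, t) \<in> germ F x U s \<Longrightarrow> germ F x V t = germ F x U s"
  unfolding germ_mem using germ_eqI[of V U _ x t s] by auto

lemma germ_restr: "op U \<Longrightarrow> op V \<Longrightarrow> x \<in> V \<Longrightarrow> V \<subseteq> U \<Longrightarrow> s \<in> secs F U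
   \<Longrightarrow> germ F x V (restr F U V s) = germ F x U s"
  using germ_eqI[of V U V x "restr F U V s" s] restr_closed restr_id by simp

lemma stalk_mem: "z \<in> stks F x \<longleftrightarrow> (\<exists>U s. op U \<and> x \<in> U \<and> s \<in> secs F U \<and> z = germ F x U s)"
  by (auto simp: stalk_def)

lemma stalkI: "op U \<Longrightarrow> x \<in> U \<Longrightarrow> s \<in> secs F U \<Longrightarrow> germ F x U s \<in> stks F x"
  unfolding stalk_mem by blast

lemma stalkE:
  assumes "z \<in> stks F x"
  obtains U s where "op U" "x \<in> U" "s \<in> secs F U" "z = germ F x U s"
  using assms unfolding stalk_mem by blast

lemma stalk_in:
  assumes "z \<in> stks F x" "op V" "x \<in> V"
  obtains U s where "op U" "x \<in> U" "U \<subseteq> V" "s \<in> secs F U" "z = germ F x U s"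
proof -
  obtain U s where *: "op U" "x \<in> U" "s \<in> secs F U" "z = germ F x U s" using assms(1) by (rule stalkE)
  have "op (U \<inter> V)" using * assms by (simp add: openin_Int)
  thus ?thesis using that[of "U \<inter> V" "restr F U (U \<inter> V) s"] * assms germ_restr[of U "U \<inter> V"] restr_closed[of U "U \<inter> V"] by simp
qed

lemma stalk_common:
  assumes "z \<in> stks F x" "op V" "x \<in> V" "t \<in> secs F V"
  obtains U s where "op U" "x \<in> U" "U \<subseteq> V" "s \<in> secs F U" "z = germ F x U s"
    "restr F V U t \<in> secs F U" "germ F x V t = germ F x U (restr F V U t)"
proof -
  obtain U s where *: "op U" "x \<in> U" "U \<subseteq> V" "s \<in> secs F U" "z = germ F x U s"
    using stalk_in[OF assms(1-3)] by metis
  show ?thesis by (rule that[OF *]) (use * assms germ_restr restr_closed in simp_all)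
qed

text \<open>Sum and product are treated alike: any operation \<open>g\<close> compatible with
  restriction can be compared for two pairs of representatives on the intersection of the
  neighbourhoods where these agree.\<close>

lemma stalk_op:
  assumes U: "op U" "x \<in> U" "s \<in> secs F U" and V: "op V" "x \<in> V" "t \<in> secs F V"
    and cl: "\<And>U s t. op U \<Longrightarrow> s \<in> secs F U \<Longrightarrow> t \<in> secs F U \<Longrightarrow> g U s t \<in> secs F U"
    and re: "\<And>U V s t. op U \<Longrightarrow> op V \<Longrightarrow> V \<subseteq> U \<Longrightarrow> s \<in> secs F U \<Longrightarrow> t \<in> secs F U
       \<Longrightarrow> restr F U V (g U s t) = g V (restr F U V s) (restr F U V t)"
  shows "(\<Union>(U, s)\<in>germ F x U s. \<Union>(V, t)\<in>germ F x V t. germ F x (U \<inter> V) (g (U \<inter> V) (restr F U (U \<inter> V) s) (restr F V (U \<inter> V) t)))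
     = germ F x (U \<inter> V) (g (U \<inter> V) (restr F U (U \<inter> V) s) (restr F V (U \<inter> V) t))" (is "?L = ?R")
proof -
  have *: "germ F x (U' \<inter> V') (g (U' \<inter> V') (restr F U' (U' \<inter> V') s') (restr F V' (U' \<inter> V') t')) = ?R"
    if 1: "(U', s') \<in> germ F x U s" and 2: "(V', t') \<in> germ F x V t" for U' s' V' t'
  proof -
    obtain W1 where a: "op U'" "x \<in> U'" "s' \<in> secs F U'" "op W1" "x \<in> W1" "W1 \<subseteq> U \<inter> U'"
      "restr F U W1 s = restr F U' W1 s'" using 1 unfolding germ_mem by blast
    obtain W2 where b: "op V'" "x \<in> V'" "t' \<in> secs F V'" "op W2" "x \<in> W2" "W2 \<subseteq> V \<inter> V'"
      "restr F V W2 t = restr F V' W2 t'" using 2 unfolding germ_mem by blast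
    let ?W = "W1 \<inter> W2"
    have o: "op ?W" "op (U \<inter> V)" "op (U' \<inter> V')" using a b U V by (auto intro: openin_Int)
    have s: "restr F U ?W s = restr F U' ?W s'"
      using restr_comp[OF U(1) a(4) o(1) _ _ U(3)] restr_comp[OF a(1,4) o(1) _ _ a(3)] a(6,7) by simp
    have t: "restr F V ?W t = restr F V' ?W t'"
      using restr_comp[OF V(1) b(4) o(1) _ _ V(3)] restr_comp[OF b(1,4) o(1) _ _ b(3)] b(6,7) by simp
    have c1: "restr F U (U \<inter> V) s \<in> secs F (U \<inter> V)" "restr F V (U \<inter> V) t \<in> secs F (U \<inter> V)"
      "restr F U' (U' \<inter> V') s' \<in> secs F (U' \<inter> V')" "restr F V' (U' \<inter> V') t' \<in> secs F (U' \<inter> V')"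
      using U V a b o by (auto intro!: restr_closed)
    have W: "?W \<subseteq> U \<inter> V" "?W \<subseteq> U' \<inter> V'" using a b by auto
    show ?thesis
    proof (rule germ_eqI[OF o(3,2,1) _ W(2,1) cl[OF o(3) c1(3,4)] cl[OF o(2) c1(1,2)]])
      show "x \<in> ?W" using a b by simp
      show "restr F (U' \<inter> V') ?W (g (U' \<inter> V') (restr F U' (U' \<inter> V') s') (restr F V' (U' \<inter> V') t'))
        = restr F (U \<inter> V) ?W (g (U \<inter> V) (restr F U (U \<inter> V) s) (restr F V (U \<inter> V) t))"
        unfolding re[OF o(3,1) W(2) c1(3,4)] re[OF o(2,1) W(1) c1(1,2)]
        using restr_comp[OF U(1) o(2,1) _ W(1) U(3)] restr_comp[OF V(1) o(2,1) _ W(1) V(3)]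
          restr_comp[OF a(1) o(3,1) _ W(2) a(3)] restr_comp[OF b(1) o(3,1) _ W(2) b(3)] s t by simp
    qed
  qed
  have "(U, s) \<in> germ F x U s" "(V, t) \<in> germ F x V t" using germ_self U V by auto
  thus ?thesis using * by blast
qed

lemma sec_mult: "op U \<Longrightarrow> s \<in> secs F U \<Longrightarrow> t \<in> secs F U \<Longrightarrow> s *[sec F U] t \<in> secs F U"
  by (rule cring.cring_simprules(5)[OF sec_cring])

lemma sec_add: "op U \<Longrightarrow> s \<in> secs F U \<Longrightarrow> t \<in> secs F U \<Longrightarrow> s +[sec F U] t \<in> secs F U"
  by (rule cring.cring_simprules(1)[OF sec_cring])

lemma germ_mult:
  assumes U: "op U" "x \<in> U" and s: "s \<in> secs F U" and t: "t \<in> secs F U"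
  shows "germ F x U s *[stalk F x] germ F x U t = germ F x U (s *[sec F U] t)"
proof -
  have "germ F x U s *[stalk F x] germ F x U t
    = germ F x (U \<inter> U) (restr F U (U \<inter> U) s *[sec F (U \<inter> U)] restr F U (U \<inter> U) t)"
    unfolding stalk_def monoid.simps
    by (rule stalk_op[OF U s U t, of "\<lambda>U s t. s *[sec F U] t", OF sec_mult restr_mult])
  thus ?thesis using restr_id[OF U(1)] s t by simp
qed

lemma germ_add:
  assumes U: "op U" "x \<in> U" and s: "s \<in> secs F U" and t: "t \<in> secs F U"
  shows "germ F x U s +[stalk F x] germ F x U t = germ F x U (s +[sec F U] t)"
proof -
  have "germ F x U s +[stalk F x] germ F x U t
    = germ F x (U \<inter> U) (restr F U (U \<inter> U) s +[sec F (U \<inter> U)] restr F U (U \<inter> U) t)"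
    unfolding stalk_def ring.simps
    by (rule stalk_op[OF U s U t, of "\<lambda>U s t. s +[sec F U] t", OF sec_add restr_add])
  thus ?thesis using restr_id[OF U(1)] s t by simp
qed

lemma germ_one:
  assumes U: "op U" "x \<in> U"
  shows "germ F x U 1[sec F U] = 1[stalk F x]"
proof -
  have T: "op (topspace (base F))" "U \<subseteq> topspace (base F)" using U(1) openin_subset by auto
  have "1[sec F (topspace (base F))] \<in> carrier (sec F (topspace (base F)))"
    using cring.cring_simprules[OF sec_cring[OF T(1)]] by simp
  from germ_restr[OF T(1) U T(2) this] show ?thesis using restr_one[OF T(1) U(1) T(2)] by (simp add: stalk_def)
qed

lemma germ_zero:
  assumes U: "op U" "x \<in> U"
  shows "germ F x U 0[sec F U] = 0[stalk F x]"
proof -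
  have T: "op (topspace (base F))" "U \<subseteq> topspace (base F)" using U(1) openin_subset by auto
  have "0[sec F (topspace (base F))] \<in> carrier (sec F (topspace (base F)))"
    using cring.cring_simprules[OF sec_cring[OF T(1)]] by simp
  from germ_restr[OF T(1) U T(2) this] show ?thesis using restr_zero[OF T(1) U(1) T(2)] by (simp add: stalk_def)
qed

text \<open>Any three germs have representatives over one neighbourhood, so the axioms are those of
  a ring of sections.\<close>

lemma stalk_cring:
  assumes x: "x \<in> topspace (base F)"
  shows "cring (stalk F x)"
proof -
  have T: "op (topspace (base F))" by simp
  note R = cring.cring_simprules[OF sec_cring]
  show ?thesis
  proof (rule cringI[OF abelian_groupI comm_monoidI])
    fix a b c assume a: "a \<in> stks F x" and b: "b \<in> stks F x" and c: "c \<in> stks F x"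
    obtain U0 s0 where 0: "op U0" "x \<in> U0" "s0 \<in> secs F U0" "a = germ F x U0 s0" using a by (rule stalkE)
    obtain V t0 where V: "op V" "x \<in> V" "V \<subseteq> U0" "t0 \<in> secs F V" "b = germ F x V t0"
      "restr F U0 V s0 \<in> secs F V" "germ F x U0 s0 = germ F x V (restr F U0 V s0)"
      using stalk_common[OF b 0(1-3)] by metis
    obtain U u where U: "op U" "x \<in> U" "U \<subseteq> V" "u \<in> secs F U" "c = germ F x U u"
      using stalk_in[OF c V(1,2)] by metis
    define s where "s = restr F V U (restr F U0 V s0)"
    define t where "t = restr F V U t0"
    have s: "s \<in> secs F U" "a = germ F x U s"
      using restr_closed[OF V(1) U(1,3) V(6)] germ_restr[OF V(1) U(1,2,3) V(6)] 0 V by (simp_all add: s_def)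
    have t: "t \<in> secs F U" "b = germ F x U t"
      using restr_closed[OF V(1) U(1,3) V(4)] germ_restr[OF V(1) U(1,2,3) V(4)] V by (simp_all add: t_def)
    note cs = s(1) t(1) U(4)
    note eq = s(2) t(2) U(5) germ_mult[OF U(1,2)] germ_add[OF U(1,2)] cs R[OF U(1)]
    show "a +[stalk F x] b +[stalk F x] c = a +[stalk F x] (b +[stalk F x] c)" by (simp add: eq)
    show "a *[stalk F x] b *[stalk F x] c = a *[stalk F x] (b *[stalk F x] c)" by (simp add: eq)
    show "(a +[stalk F x] b) *[stalk F x] c = a *[stalk F x] c +[stalk F x] b *[stalk F x] c" by (simp add: eq)
  next
    fix a b assume a: "a \<in> stks F x" and b: "b \<in> stks F x"
    obtain V t0 where V: "op V" "x \<in> V" "t0 \<in> secs F V" "b = germ F x V t0" using b by (rule stalkE)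
    obtain U s where U: "op U" "x \<in> U" "U \<subseteq> V" "s \<in> secs F U" "a = germ F x U s"
      "restr F V U t0 \<in> secs F U" "germ F x V t0 = germ F x U (restr F V U t0)"
      using stalk_common[OF a V(1-3)] by metis
    note eq = V(4) U(4-7) germ_mult[OF U(1,2)] germ_add[OF U(1,2)] R(1-3,5,6,10-13)[OF U(1)]
    show "a +[stalk F x] b \<in> stks F x" "a *[stalk F x] b \<in> stks F x"
      using stalkI[OF U(1,2)] by (simp_all add: eq)
    show "a +[stalk F x] b = b +[stalk F x] a" "a *[stalk F x] b = b *[stalk F x] a"
      using R[OF U(1)] U(4,6) by (simp_all add: V(4) U(5,7) germ_mult[OF U(1,2)] germ_add[OF U(1,2)])
  next
    fix a assume a: "a \<in> stks F x"
    obtain U s where U: "op U" "x \<in> U" "s \<in> secs F U" "a = germ F x U s" using a by (rule stalkE)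
    note z = germ_zero[OF U(1,2), symmetric] germ_one[OF U(1,2), symmetric]
    show "0[stalk F x] +[stalk F x] a = a" "1[stalk F x] *[stalk F x] a = a"
      using R[OF U(1)] U(3) by (simp_all add: z U(4) germ_mult[OF U(1,2)] germ_add[OF U(1,2)])
    have "germ F x U (\<ominus>[sec F U] s) +[stalk F x] a = 0[stalk F x]"
      using R[OF U(1)] U(3) by (simp add: z U(4) germ_add[OF U(1,2)])
    moreover have "germ F x U (\<ominus>[sec F U] s) \<in> stks F x" using stalkI[OF U(1,2)] R[OF U(1)] U(3) by simp
    ultimately show "\<exists>b\<in>stks F x. b +[stalk F x] a = 0[stalk F x]" by blast
  next
    show "0[stalk F x] \<in> stks F x" "1[stalk F x] \<in> stks F x"
      using stalkI[OF T x] R[OF T] germ_zero[OF T x] germ_one[OF T x] by metis+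
  qed
qed

lemma germ_hom: "op U \<Longrightarrow> x \<in> U \<Longrightarrow> germ F x U \<in> ring_hom (sec F U) (stalk F x)"
  by (rule ring_hom_memI) (simp_all add: stalkI germ_mult germ_add germ_one)

text \<open>The hypothesis \<open>gen\<close> says that \<open>x\<close> lies in the closure of
  \<open>y\<close>: a neighbourhood witnessing equality of germs at \<open>x\<close> also witnesses
  it at \<open>y\<close>.\<close>

lemma cospec_germ:
  assumes gen: "\<And>U. op U \<Longrightarrow> x \<in> U \<Longrightarrow> y \<in> U" and U: "op U" "x \<in> U" and s: "s \<in> secs F U"
  shows "cospec F y (germ F x U s) = germ F y U s"
proof -
  have *: "germ F y V t = germ F y U s" if "(V, t) \<in> germ F x U s" for V t
  proof -
    from that obtain W where W: "op V" "t \<in> secs F V" "op W" "x \<in> W" "W \<subseteq> U \<inter> V" "restr F U W s = restr F V W t"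
      unfolding germ_mem by blast
    show ?thesis by (rule germ_eqI[OF W(1) U(1) W(3) gen[OF W(3,4)] _ _ W(2) s W(6)[symmetric]]) (use W in auto)
  qed
  have "(U, s) \<in> germ F x U s" using germ_self U s by auto
  thus ?thesis unfolding cospec_def using * by blast
qed

lemma cospec_hom:
  assumes gen: "\<And>U. op U \<Longrightarrow> x \<in> U \<Longrightarrow> y \<in> U" and x: "x \<in> topspace (base F)"
  shows "cospec F y \<in> ring_hom (stalk F x) (stalk F y)"
proof (rule ring_hom_memI)
  have cg: "cospec F y (germ F x U s) = germ F y U s" if "op U" "x \<in> U" "s \<in> secs F U" for U s
    by (rule cospec_germ[OF gen that])
  fix a assume a: "a \<in> stks F x"
  then obtain V s0 where V: "op V" "x \<in> V" "s0 \<in> secs F V" "a = germ F x V s0" by (rule stalkE)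
  show "cospec F y a \<in> stks F y" using cg[OF V(1-3)] stalkI[OF V(1) gen[OF V(1,2)] V(3)] V(4) by simp
  fix b assume b: "b \<in> stks F x"
  obtain U t where U: "op U" "x \<in> U" "U \<subseteq> V" "t \<in> secs F U" "b = germ F x U t"
      "restr F V U s0 \<in> secs F U" "germ F x V s0 = germ F x U (restr F V U s0)"
      using stalk_common[OF b V(1-3)] by metis
  have cl: "restr F V U s0 *[sec F U] t \<in> secs F U" "restr F V U s0 +[sec F U] t \<in> secs F U"
    using cring.cring_simprules[OF sec_cring[OF U(1)]] U by auto
  have y: "y \<in> U" using gen U by blast
  show "cospec F y (a *[stalk F x] b) = cospec F y a *[stalk F y] cospec F y b"
    "cospec F y (a +[stalk F x] b) = cospec F y a +[stalk F y] cospec F y b"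
    unfolding V(4) U(5,7) germ_mult[OF U(1,2,6,4)] germ_add[OF U(1,2,6,4)]
      cg[OF U(1,2) cl(1)] cg[OF U(1,2) cl(2)] cg[OF U(1,2,4)] cg[OF U(1,2,6)]
    using germ_mult[OF U(1) y U(6,4)] germ_add[OF U(1) y U(6,4)] by simp_all
next
  have T: "op (topspace (base F))" by simp
  have o: "1[sec F (topspace (base F))] \<in> carrier (sec F (topspace (base F)))"
    using cring.cring_simprules[OF sec_cring[OF T]] by simp
  have "cospec F y (germ F x (topspace (base F)) 1[sec F (topspace (base F))])
      = germ F y (topspace (base F)) 1[sec F (topspace (base F))]"
    by (rule cospec_germ[OF gen T x o])
  thus "cospec F y 1[stalk F x] = 1[stalk F y]"
    using germ_one[OF T x] germ_one[OF T gen[OF T x]] by simp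
qed

end

section \<open>Structure sheaves of spectra\<close>

text \<open>In contrast to \<open>loc_map\<close>, no injection into a ring with invertible
  denominators is given, so the cancelling factor has to be carried along. The ring of an arbitrary
  affine chart requires this generality.\<close>

locale mset = cring A for A (structure) + fixes T
  assumes T: "T \<subseteq> carrier A" "\<one> \<in> T" "\<And>s t. s \<in> T \<Longrightarrow> t \<in> T \<Longrightarrow> s \<otimes> t \<in> T"
begin

lemma Tc: "t \<in> T \<Longrightarrow> t \<in> carrier A" using T(1) by blast

lemma rfrac_mem: "(a', s') \<in> rfrac A T a s \<longleftrightarrow> a' \<in> carrier A \<and> s' \<in> T \<and> (\<exists>u\<in>T. u \<otimes> (s' \<otimes> a) = u \<otimes> (s \<otimes> a'))"
  by (simp add: rfrac_def)

lemma rfrac_self: "a \<in> carrier A \<Longrightarrow> s \<in> T \<Longrightarrow> (a, s) \<in> rfrac A T a s"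
  unfolding rfrac_mem using T(2) by blast

lemma rfrac_eqI:
  assumes a: "a \<in> carrier A" "s \<in> T" and b: "b \<in> carrier A" "t \<in> T" and u: "u \<in> T" "u \<otimes> (t \<otimes> a) = u \<otimes> (s \<otimes> b)"
  shows "rfrac A T a s = rfrac A T b t"
proof -
  have *: "rfrac A T a s \<subseteq> rfrac A T b t"
    if a: "a \<in> carrier A" "s \<in> T" and b: "b \<in> carrier A" "t \<in> T" and u: "u \<in> T" "u \<otimes> (t \<otimes> a) = u \<otimes> (s \<otimes> b)" for a s b t
  proof (rule subrelI)
    fix c r assume "(c, r) \<in> rfrac A T a s"
    then obtain v where v: "c \<in> carrier A" "r \<in> T" "v \<in> T" "v \<otimes> (r \<otimes> a) = v \<otimes> (s \<otimes> c)" unfolding rfrac_mem by blast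
    note cs = Tc[OF a(2)] Tc[OF b(2)] Tc[OF u(1)] Tc[OF v(2)] Tc[OF v(3)] a(1) b(1) v(1)
    let ?w = "u \<otimes> v \<otimes> s"
    have "?w \<otimes> (r \<otimes> b) = v \<otimes> r \<otimes> (u \<otimes> (s \<otimes> b))" using cs by (simp add: m_ac)
    also have "\<dots> = u \<otimes> t \<otimes> (v \<otimes> (r \<otimes> a))" unfolding u(2)[symmetric] using cs by (simp add: m_ac)
    also have "\<dots> = ?w \<otimes> (t \<otimes> c)" unfolding v(4) using cs by (simp add: m_ac)
    finally show "(c, r) \<in> rfrac A T b t" unfolding rfrac_mem using v(1,2) T(3) u(1) v(3) a(2) by blast
  qed
  show ?thesis using *[OF a b u] *[OF b a u(1) u(2)[symmetric]] by (rule equalityI)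
qed

lemma rfrac_eq:
  assumes a: "a \<in> carrier A" "s \<in> T" and b: "b \<in> carrier A" "t \<in> T"
  shows "rfrac A T a s = rfrac A T b t \<longleftrightarrow> (\<exists>u\<in>T. u \<otimes> (t \<otimes> a) = u \<otimes> (s \<otimes> b))"
proof
  assume "rfrac A T a s = rfrac A T b t"
  hence "(b, t) \<in> rfrac A T a s" using rfrac_self[OF b] by simp
  thus "\<exists>u\<in>T. u \<otimes> (t \<otimes> a) = u \<otimes> (s \<otimes> b)" unfolding rfrac_mem by blast
qed (use rfrac_eqI assms in blast)

lemma loc_mult:
  assumes a: "a \<in> carrier A" "s \<in> T" and b: "b \<in> carrier A" "t \<in> T"
  shows "rfrac A T a s *[loc A T] rfrac A T b t = rfrac A T (a \<otimes> b) (s \<otimes> t)"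
proof -
  have "rfrac A T (a' \<otimes> b') (s' \<otimes> t') = rfrac A T (a \<otimes> b) (s \<otimes> t)"
    if m: "(a', s') \<in> rfrac A T a s" "(b', t') \<in> rfrac A T b t" for a' s' b' t'
  proof -
    obtain u where u: "a' \<in> carrier A" "s' \<in> T" "u \<in> T" "u \<otimes> (s' \<otimes> a) = u \<otimes> (s \<otimes> a')" using m(1) unfolding rfrac_mem by blast
    obtain v where v: "b' \<in> carrier A" "t' \<in> T" "v \<in> T" "v \<otimes> (t' \<otimes> b) = v \<otimes> (t \<otimes> b')" using m(2) unfolding rfrac_mem by blast
    note cs = a(1) b(1) Tc[OF a(2)] Tc[OF b(2)] u(1) v(1) Tc[OF u(2)] Tc[OF u(3)] Tc[OF v(2)] Tc[OF v(3)]
    have "u \<otimes> v \<otimes> (s \<otimes> t \<otimes> (a' \<otimes> b')) = (u \<otimes> (s \<otimes> a')) \<otimes> (v \<otimes> (t \<otimes> b'))" using cs by (simp add: m_ac)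
    also have "\<dots> = u \<otimes> v \<otimes> (s' \<otimes> t' \<otimes> (a \<otimes> b))" unfolding u(4)[symmetric] v(4)[symmetric] using cs by (simp add: m_ac)
    finally have e: "u \<otimes> v \<otimes> (s \<otimes> t \<otimes> (a' \<otimes> b')) = u \<otimes> v \<otimes> (s' \<otimes> t' \<otimes> (a \<otimes> b))" .
    show ?thesis by (rule rfrac_eqI[OF _ _ _ _ _ e]) (use cs a b u v T(3) in auto)
  qed
  thus ?thesis unfolding loc_def monoid.simps using rfrac_self[OF a] rfrac_self[OF b] by blast
qed

lemma loc_add:
  assumes a: "a \<in> carrier A" "s \<in> T" and b: "b \<in> carrier A" "t \<in> T"
  shows "rfrac A T a s +[loc A T] rfrac A T b t = rfrac A T ((t \<otimes> a) \<oplus> (s \<otimes> b)) (s \<otimes> t)"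
proof -
  have "rfrac A T ((t' \<otimes> a') \<oplus> (s' \<otimes> b')) (s' \<otimes> t') = rfrac A T ((t \<otimes> a) \<oplus> (s \<otimes> b)) (s \<otimes> t)"
    if m: "(a', s') \<in> rfrac A T a s" "(b', t') \<in> rfrac A T b t" for a' s' b' t'
  proof -
    obtain u where u: "a' \<in> carrier A" "s' \<in> T" "u \<in> T" "u \<otimes> (s' \<otimes> a) = u \<otimes> (s \<otimes> a')" using m(1) unfolding rfrac_mem by blast
    obtain v where v: "b' \<in> carrier A" "t' \<in> T" "v \<in> T" "v \<otimes> (t' \<otimes> b) = v \<otimes> (t \<otimes> b')" using m(2) unfolding rfrac_mem by blast
    note cs = a(1) b(1) Tc[OF a(2)] Tc[OF b(2)] u(1) v(1) Tc[OF u(2)] Tc[OF u(3)] Tc[OF v(2)] Tc[OF v(3)]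
    have "u \<otimes> v \<otimes> (s \<otimes> t \<otimes> (t' \<otimes> a' \<oplus> s' \<otimes> b')) = (v \<otimes> t \<otimes> t') \<otimes> (u \<otimes> (s \<otimes> a')) \<oplus> (u \<otimes> s \<otimes> s') \<otimes> (v \<otimes> (t \<otimes> b'))"
      using cs by (simp add: m_ac r_distr)
    also have "\<dots> = u \<otimes> v \<otimes> (s' \<otimes> t' \<otimes> (t \<otimes> a \<oplus> s \<otimes> b))" unfolding u(4)[symmetric] v(4)[symmetric] using cs by (simp add: m_ac r_distr)
    finally have e: "u \<otimes> v \<otimes> (s \<otimes> t \<otimes> (t' \<otimes> a' \<oplus> s' \<otimes> b')) = u \<otimes> v \<otimes> (s' \<otimes> t' \<otimes> (t \<otimes> a \<oplus> s \<otimes> b))" .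
    show ?thesis by (rule rfrac_eqI[OF _ _ _ _ _ e]) (use cs a b u v T(3) in auto)
  qed
  thus ?thesis unfolding loc_def ring.simps using rfrac_self[OF a] rfrac_self[OF b] by blast
qed

lemma loc_one: "1[loc A T] = rfrac A T \<one> \<one>" and loc_zero: "0[loc A T] = rfrac A T \<zero> \<one>"
  by (simp_all add: loc_def)

lemma loc_mem: "P \<in> carrier (loc A T) \<longleftrightarrow> (\<exists>a\<in>carrier A. \<exists>s\<in>T. P = rfrac A T a s)"
  by (auto simp: loc_def)

end

lemma mset_prime: "cring A \<Longrightarrow> p \<in> spec A \<Longrightarrow> mset A (carrier A - p)"
proof -
  assume A: "cring A" and "p \<in> spec A"
  then interpret p: primeideal p A by (simp add: spec_def)
  have "1[A] \<notin> p" using p.I_notcarr p.one_imp_carrier by blast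
  thus ?thesis using A p.I_prime by (auto simp: mset_def mset_axioms_def)
qed

abbreviation bopen :: "('a, 'm) ring_scheme \<Rightarrow> 'a \<Rightarrow> 'a set set" where
  "bopen A f \<equiv> {p \<in> spec A. f \<notin> p}"

context cring
begin

lemma spec_ideal: "p \<in> spec R \<Longrightarrow> primeideal p R"
  by (simp add: spec_def)

lemma spec_mult:
  assumes p: "p \<in> spec R" and a: "a \<in> carrier R" and b: "b \<in> carrier R"
  shows "a \<otimes> b \<in> p \<longleftrightarrow> a \<in> p \<or> b \<in> p"
proof -
  interpret p: primeideal p R by (rule spec_ideal[OF p])
  show ?thesis using p.I_prime a b p.I_l_closed p.I_r_closed by blast
qed

lemma spec_one:
  assumes p: "p \<in> spec R"
  shows "\<one> \<notin> p"
proof -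
  interpret p: primeideal p R by (rule spec_ideal[OF p])
  show ?thesis using p.I_notcarr p.one_imp_carrier by blast
qed

lemma spec_zero:
  assumes p: "p \<in> spec R"
  shows "\<zero> \<in> p"
proof -
  interpret p: primeideal p R by (rule spec_ideal[OF p])
  show ?thesis by simp
qed

lemma spec_sub:
  assumes p: "p \<in> spec R"
  shows "p \<subseteq> carrier R"
proof -
  interpret p: primeideal p R by (rule spec_ideal[OF p])
  show ?thesis using p.a_subset by simp
qed

lemma bopen_open: "f \<in> carrier R \<Longrightarrow> openin (zariski R) (bopen R f)"
  unfolding zariski_def by (rule topology_generated_by_Basis) blast

text \<open>The generating sets form a basis because a product avoids a prime exactly when both
  factors do.\<close>

lemma zariski_basis:
  assumes "openin (zariski R) W" "p \<in> W"
  shows "\<exists>f\<in>carrier R. p \<in> bopen R f \<and> bopen R f \<subseteq> W"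
proof -
  have "generate_topology_on {bopen R f | f. f \<in> carrier R} W"
    using assms(1) unfolding zariski_def openin_topology_generated_by_iff .
  thus ?thesis using assms(2)
  proof (induction arbitrary: p rule: generate_topology_on.induct)
    case (Int a b)
    obtain f where f: "f \<in> carrier R" "p \<in> bopen R f" "bopen R f \<subseteq> a" using Int by blast
    obtain g where g: "g \<in> carrier R" "p \<in> bopen R g" "bopen R g \<subseteq> b" using Int by blast
    have "bopen R (f \<otimes> g) = bopen R f \<inter> bopen R g" using spec_mult f(1) g(1) by auto
    thus ?case using f g by (intro bexI[of _ "f \<otimes> g"]) auto
  next
    case (UN k)
    then obtain a where a: "a \<in> k" "p \<in> a" by blast
    show ?case using UN.IH[OF a] a(1) by blast
  next
    case (Basis s) thus ?case by blast
  qed simp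
qed

lemma zariski_topspace: "topspace (zariski R) = spec R"
proof -
  have "{p \<in> spec R. \<one> \<notin> p} = spec R" using spec_one by blast
  hence "spec R \<in> {bopen R f | f. f \<in> carrier R}" by blast
  thus ?thesis unfolding zariski_def topology_generated_by_topspace by blast
qed

text \<open>The fraction \<open>a/f\<close> as a section over \<open>W\<close>, meaningful when
  \<open>W\<close> lies in \<open>bopen A f\<close>.\<close>

definition sfr :: "'a \<Rightarrow> 'a \<Rightarrow> 'a set set \<Rightarrow> 'a set \<Rightarrow> ('a \<times> 'a) set" where
  "sfr a f W = (\<lambda>p\<in>W. rfrac R (carrier R - p) a f)"

lemma sfr_sec:
  assumes "a \<in> carrier R" "f \<in> carrier R" "openin (zariski R) W" "W \<subseteq> bopen R f"
  shows "sfr a f W \<in> carrier (sec (spec_sheaf R) W)"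
proof -
  have "sfr a f W \<in> (\<Pi>\<^sub>E p\<in>W. carrier (loc R (carrier R - p)))"
    using assms by (auto simp: sfr_def loc_def)
  moreover have "\<forall>p\<in>W. \<exists>V b g. openin (zariski R) V \<and> p \<in> V \<and> V \<subseteq> W \<and> b \<in> carrier R \<and> g \<in> carrier R \<and>
            (\<forall>q\<in>V. g \<notin> q \<and> sfr a f W q = rfrac R (carrier R - q) b g)"
    by (intro ballI exI[of _ W] exI[of _ a] exI[of _ f]) (use assms in \<open>auto simp: sfr_def\<close>)
  ultimately show ?thesis by (simp add: spec_sheaf_def)
qed

lemma sfr_local:
  assumes "\<sigma> \<in> carrier (sec (spec_sheaf R) V)" "p \<in> V"
  shows "\<exists>W a f. openin (zariski R) W \<and> p \<in> W \<and> W \<subseteq> V \<and> a \<in> carrier R \<and> f \<in> carrier R \<and> W \<subseteq> bopen R f \<and> restrict \<sigma> W = sfr a f W"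
proof -
  from assms obtain W a f where *: "openin (zariski R) W" "p \<in> W" "W \<subseteq> V" "a \<in> carrier R" "f \<in> carrier R"
    "\<forall>q\<in>W. f \<notin> q \<and> \<sigma> q = rfrac R (carrier R - q) a f"
    unfolding spec_sheaf_def by auto
  have "W \<subseteq> spec R" using openin_subset[OF *(1)] zariski_topspace by simp
  hence "W \<subseteq> bopen R f" using *(6) by blast
  moreover have "restrict \<sigma> W = sfr a f W"
    unfolding sfr_def by (rule restrict_ext) (simp add: *(6))
  ultimately show ?thesis using *(1-5) by (intro exI[of _ W] exI[of _ a] exI[of _ f] conjI)
qed

lemma sfr_restr: "W \<subseteq> V \<Longrightarrow> restrict (sfr a f V) W = sfr a f W"
  by (auto simp: sfr_def restrict_def fun_eq_iff)

context
  fixes W assumes W: "W \<subseteq> spec R"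
begin

lemma sfr_mult:
  assumes "a \<in> carrier R" "b \<in> carrier R" "f \<in> carrier R" "g \<in> carrier R" "W \<subseteq> bopen R f" "W \<subseteq> bopen R g"
  shows "sfr a f W *[sec (spec_sheaf R) W] sfr b g W = sfr (a \<otimes> b) (f \<otimes> g) W"
proof -
  have "rfrac R (carrier R - p) a f *[loc R (carrier R - p)] rfrac R (carrier R - p) b g
     = rfrac R (carrier R - p) (a \<otimes> b) (f \<otimes> g)" if "p \<in> W" for p
    by (rule mset.loc_mult[OF mset_prime[OF cring_axioms]]) (use that assms W in auto)
  thus ?thesis by (auto simp: spec_sheaf_def sfr_def fun_eq_iff)
qed

lemma sfr_add:
  assumes "a \<in> carrier R" "b \<in> carrier R" "f \<in> carrier R" "g \<in> carrier R" "W \<subseteq> bopen R f" "W \<subseteq> bopen R g"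
  shows "sfr a f W +[sec (spec_sheaf R) W] sfr b g W = sfr ((g \<otimes> a) \<oplus> (f \<otimes> b)) (f \<otimes> g) W"
proof -
  have "rfrac R (carrier R - p) a f +[loc R (carrier R - p)] rfrac R (carrier R - p) b g
     = rfrac R (carrier R - p) ((g \<otimes> a) \<oplus> (f \<otimes> b)) (f \<otimes> g)" if "p \<in> W" for p
    by (rule mset.loc_add[OF mset_prime[OF cring_axioms]]) (use that assms W in auto)
  thus ?thesis by (auto simp: spec_sheaf_def sfr_def fun_eq_iff)
qed

lemma sfr_one: "1[sec (spec_sheaf R) W] = sfr \<one> \<one> W" and sfr_zero: "0[sec (spec_sheaf R) W] = sfr \<zero> \<one> W"
  by (auto simp: spec_sheaf_def sfr_def loc_def)

lemma sfr_eqI: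
  assumes "a \<in> carrier R" "b \<in> carrier R" "f \<in> carrier R" "g \<in> carrier R" "W \<subseteq> bopen R f" "W \<subseteq> bopen R g"
    and "g \<otimes> a = f \<otimes> b"
  shows "sfr a f W = sfr b g W"
proof -
  have "rfrac R (carrier R - p) a f = rfrac R (carrier R - p) b g" if p: "p \<in> W" for p
  proof -
    have ps: "p \<in> spec R" using p W by blast
    interpret m: mset R "carrier R - p" by (rule mset_prime[OF cring_axioms ps])
    show ?thesis by (rule m.rfrac_eqI[OF _ _ _ _ m.T(2)]) (use p assms W in auto)
  qed
  thus ?thesis unfolding sfr_def by (intro restrict_ext)
qed

end

lemma spec_sheaf_base: "base (spec_sheaf R) = zariski R" and spec_sheaf_restr: "restr (spec_sheaf R) V W s = restrict s W"
  by (simp_all add: spec_sheaf_def)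

end

section \<open>Affine charts of integral schemes\<close>

locale ischeme =
  fixes Sch :: "('p, 'a, unit) sheaf" and \<xi> :: 'p
  assumes int: "integral_scheme Sch" and gp: "generic_point Sch \<xi>"

sublocale ischeme \<subseteq> rsheaf Sch
  using int by unfold_locales (simp add: integral_scheme_def is_scheme_def)

context ischeme
begin

abbreviation "X \<equiv> topspace (base Sch)"
abbreviation "cl y \<equiv> base Sch closure_of {y}"
abbreviation "F \<equiv> stalk Sch \<xi>"
abbreviation "gO \<equiv> germ Sch \<xi>"
abbreviation "cO \<equiv> cospec Sch \<xi>"

lemma cl_iff: "x \<in> cl y \<longleftrightarrow> x \<in> X \<and> (\<forall>W. op W \<and> x \<in> W \<longrightarrow> y \<in> W)"
  by (auto simp: in_closure_of)

lemma gen_in: "op W \<Longrightarrow> x \<in> W \<Longrightarrow> \<xi> \<in> W"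
proof -
  assume W: "op W" "x \<in> W"
  hence "x \<in> cl \<xi>" using gp openin_subset[OF W(1)] by (auto simp: generic_point_def)
  thus ?thesis using W cl_iff by blast
qed

lemma gen_in': "op W \<Longrightarrow> W \<noteq> {} \<Longrightarrow> \<xi> \<in> W"
  using gen_in by blast

lemma xi_X: "\<xi> \<in> X"
  using gp by (simp add: generic_point_def)

lemma sec_domain: "op W \<Longrightarrow> W \<noteq> {} \<Longrightarrow> domain (sec Sch W)"
  using int by (simp add: integral_scheme_def)

lemma F_cring: "cring F"
  by (rule stalk_cring[OF xi_X])

lemma F_one: "1[F] \<noteq> 0[F]"
proof
  assume e: "1[F] = 0[F]"
  have T: "op X" by simp
  note R = cring.cring_simprules[OF sec_cring[OF T]]
  have "gO X 1[sec Sch X] = gO X 0[sec Sch X]"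
    using e germ_one[OF T xi_X] germ_zero[OF T xi_X] by simp
  then obtain W where W: "op W" "\<xi> \<in> W" "W \<subseteq> X" "restr Sch X W 1[sec Sch X] = restr Sch X W 0[sec Sch X]"
    using germ_eq[OF T xi_X R(6) T xi_X R(2)] by blast
  have "1[sec Sch W] = 0[sec Sch W]" using W(4) restr_one[OF T W(1,3)] restr_zero[OF T W(1,3)] by simp
  thus False using domain.one_not_zero[OF sec_domain[OF W(1)]] W(2) by blast
qed

end

text \<open>The ring \<open>A\<close> is not assumed to be a domain, so that every non-empty affine
  open set provides such a chart.\<close>

locale aff_chart = ischeme Sch \<xi> for Sch :: "('p, 'a, unit) sheaf" and \<xi> :: 'p +
  fixes U :: "'p set" and A :: "'a ring" and h :: "'p \<Rightarrow> 'a set" and \<phi> :: "'a set set \<Rightarrow> ('a set \<Rightarrow> ('a \<times> 'a) set) \<Rightarrow> 'a"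
  assumes U: "op U" "U \<noteq> {}" and Acr: "cring A"
    and iso: "ringed_space_iso (open_restrict Sch U) (spec_sheaf A) h \<phi>"

sublocale aff_chart \<subseteq> A: cring A
  by (rule Acr)

context aff_chart
begin

abbreviation "opA \<equiv> openin (zariski A)"

definition pre :: "'a set set \<Rightarrow> 'p set" where
  "pre V = {x \<in> U. h x \<in> V}"

lemma U_sub: "U \<subseteq> X" using openin_subset[OF U(1)] .

lemma or_simps: "base (open_restrict Sch U) = subtopology (base Sch) U" "sec (open_restrict Sch U) = sec Sch"
  "restr (open_restrict Sch U) = restr Sch"
  by (simp_all add: open_restrict_def)

lemma op_sub: "openin (subtopology (base Sch) U) W \<longleftrightarrow> op W \<and> W \<subseteq> U"
  using openin_open_subtopology[OF U(1)] by auto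

lemma pre_alt: "{x \<in> X. x \<in> U \<and> h x \<in> V} = pre V"
  using U_sub by (auto simp: pre_def)

lemma XU: "X \<inter> U = U"
  using U_sub by blast

lemma homeo: "homeomorphic_map (subtopology (base Sch) U) (zariski A) h"
  using iso by (simp add: ringed_space_iso_def or_simps A.spec_sheaf_base)

lemma h_img: "h ` U = spec A"
  using homeomorphic_imp_surjective_map[OF homeo] by (simp add: XU A.zariski_topspace)

lemma h_inj: "inj_on h U"
  using homeomorphic_imp_injective_map[OF homeo] by (simp add: XU)

lemma h_spec: "x \<in> U \<Longrightarrow> h x \<in> spec A"
  using h_img by blast

lemma pre_open:
  assumes V: "opA V"
  shows "op (pre V)"
proof -
  have "continuous_map (subtopology (base Sch) U) (zariski A) h" using homeomorphic_imp_continuous_map[OF homeo] .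
  from openin_continuous_map_preimage[OF this V] show ?thesis by (simp add: op_sub pre_alt)
qed

lemma pre_U: "pre V \<subseteq> U" by (auto simp: pre_def)

lemma pre_mono: "V \<subseteq> W \<Longrightarrow> pre V \<subseteq> pre W" by (auto simp: pre_def)

lemma img_open: "op W \<Longrightarrow> W \<subseteq> U \<Longrightarrow> opA (h ` W)"
  using homeomorphic_imp_open_map[OF homeo] op_sub by (auto simp: open_map_def)

lemma pre_img: "W \<subseteq> U \<Longrightarrow> pre (h ` W) = W"
  using h_inj by (auto simp: pre_def inj_on_def)

lemma spec_open: "opA (spec A)"
  using openin_topspace[of "zariski A"] by (simp add: A.zariski_topspace)

lemma V_spec: "opA V \<Longrightarrow> V \<subseteq> spec A"
  using openin_subset[of "zariski A" V] by (simp add: A.zariski_topspace)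

lemma pre_spec: "pre (spec A) = U"
  using h_spec by (auto simp: pre_def)

lemma pre_nonempty: "opA V \<Longrightarrow> V \<noteq> {} \<Longrightarrow> pre V \<noteq> {}"
proof -
  assume V: "opA V" "V \<noteq> {}"
  then obtain p where p: "p \<in> V" by blast
  hence "p \<in> h ` U" using V_spec[OF V(1)] h_img by auto
  then obtain x where "p = h x" "x \<in> U" by (rule imageE)
  hence "x \<in> pre V" using p by (simp add: pre_def)
  thus ?thesis by blast
qed

lemma phi: "opA V \<Longrightarrow> \<phi> V \<in> ring_iso (sec (spec_sheaf A) V) (sec Sch (pre V))"
  using iso by (simp add: ringed_space_iso_def or_simps A.spec_sheaf_base pre_alt)

lemma phi_restr:
  assumes "opA V" "opA W" "W \<subseteq> V" "s \<in> carrier (sec (spec_sheaf A) V)"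
  shows "\<phi> W (restrict s W) = restr Sch (pre V) (pre W) (\<phi> V s)"
proof -
  have "\<forall>V W. opA V \<and> opA W \<and> W \<subseteq> V \<longrightarrow> (\<forall>s\<in>carrier (sec (spec_sheaf A) V).
        \<phi> W (restr (spec_sheaf A) V W s) = restr Sch (pre V) (pre W) (\<phi> V s))"
    using iso by (simp add: ringed_space_iso_def or_simps A.spec_sheaf_base pre_alt)
  thus ?thesis using assms by (simp add: A.spec_sheaf_restr)
qed

lemma phi_closed: "opA V \<Longrightarrow> s \<in> carrier (sec (spec_sheaf A) V) \<Longrightarrow> \<phi> V s \<in> secs Sch (pre V)"
  by (rule ring_iso_memE(1)[OF phi])

lemma phi_surj:
  assumes "opA V" "t \<in> secs Sch (pre V)"
  shows "\<exists>s\<in>carrier (sec (spec_sheaf A) V). \<phi> V s = t"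
proof -
  have "\<phi> V ` carrier (sec (spec_sheaf A) V) = secs Sch (pre V)"
    using ring_iso_memE(5)[OF phi[OF assms(1)]] by (simp add: bij_betw_def)
  thus ?thesis using assms(2) by (metis imageE)
qed

lemma phi_inj:
  assumes "opA V" "s \<in> carrier (sec (spec_sheaf A) V)" "t \<in> carrier (sec (spec_sheaf A) V)" "\<phi> V s = \<phi> V t"
  shows "s = t"
  using ring_iso_memE(5)[OF phi[OF assms(1)]] assms(2-4) by (simp add: bij_betw_def inj_on_def)

text \<open>The fraction \<open>a/f\<close> seen as a section of the scheme over the open set
  corresponding to \<open>W\<close>.\<close>

definition fs :: "'a \<Rightarrow> 'a \<Rightarrow> 'a set set \<Rightarrow> 'a" where
  "fs a f W = \<phi> W (A.sfr a f W)"

context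
  fixes W assumes W: "opA W"
begin

lemma fs_closed: "a \<in> carrier A \<Longrightarrow> f \<in> carrier A \<Longrightarrow> W \<subseteq> bopen A f \<Longrightarrow> fs a f W \<in> secs Sch (pre W)"
  unfolding fs_def by (rule phi_closed[OF W A.sfr_sec[OF _ _ W]])

lemma fs_mult:
  assumes "a \<in> carrier A" "b \<in> carrier A" "f \<in> carrier A" "g \<in> carrier A" "W \<subseteq> bopen A f" "W \<subseteq> bopen A g"
  shows "fs a f W *[sec Sch (pre W)] fs b g W = fs (a *[A] b) (f *[A] g) W"
  unfolding fs_def A.sfr_mult[OF V_spec[OF W] assms, symmetric]
  by (rule ring_iso_memE(2)[OF phi[OF W], symmetric]) (use assms A.sfr_sec W in auto)

lemma fs_add:
  assumes "a \<in> carrier A" "b \<in> carrier A" "f \<in> carrier A" "g \<in> carrier A" "W \<subseteq> bopen A f" "W \<subseteq> bopen A g"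
  shows "fs a f W +[sec Sch (pre W)] fs b g W = fs ((g *[A] a) +[A] (f *[A] b)) (f *[A] g) W"
  unfolding fs_def A.sfr_add[OF V_spec[OF W] assms, symmetric]
  by (rule ring_iso_memE(3)[OF phi[OF W], symmetric]) (use assms A.sfr_sec W in auto)

lemma fs_one: "fs 1[A] 1[A] W = 1[sec Sch (pre W)]"
  unfolding fs_def A.sfr_one[OF V_spec[OF W], symmetric] by (rule ring_iso_memE(4)[OF phi[OF W]])

lemma fs_eqI:
  assumes "a \<in> carrier A" "b \<in> carrier A" "f \<in> carrier A" "g \<in> carrier A" "W \<subseteq> bopen A f" "W \<subseteq> bopen A g"
    and "g *[A] a = f *[A] b"
  shows "fs a f W = fs b g W"
  unfolding fs_def using A.sfr_eqI[OF V_spec[OF W] assms] by simp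

lemma bone: "W \<subseteq> bopen A 1[A]"
  using V_spec[OF W] A.spec_one by blast

end

lemma fs_restr:
  assumes "opA W" "opA V" "V \<subseteq> W" "a \<in> carrier A" "f \<in> carrier A" "W \<subseteq> bopen A f"
  shows "restr Sch (pre W) (pre V) (fs a f W) = fs a f V"
  unfolding fs_def using phi_restr[OF assms(1-3) A.sfr_sec[OF assms(4,5,1,6)]] A.sfr_restr[OF assms(3)] by simp

lemma fs_zero:
  assumes W: "opA W"
  shows "fs 0[A] 1[A] W = 0[sec Sch (pre W)]"
proof -
  interpret S: cring "sec Sch (pre W)" by (rule sec_cring[OF pre_open[OF W]])
  have c: "fs 0[A] 1[A] W \<in> secs Sch (pre W)" by (rule fs_closed[OF W _ _ bone[OF W]]) auto
  have "fs 0[A] 1[A] W +[sec Sch (pre W)] fs 0[A] 1[A] W = fs 0[A] 1[A] W"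
    using fs_add[OF W _ _ _ _ bone[OF W] bone[OF W], of "0[A]" "0[A]"] by simp
  thus ?thesis using S.add.l_cancel_one'[OF c c] by simp
qed

lemma fs_local:
  assumes W: "op W" "W \<subseteq> U" and s: "s \<in> secs Sch W" and x: "x \<in> W"
  obtains V a f where "opA V" "h x \<in> V" "pre V \<subseteq> W" "x \<in> pre V" "a \<in> carrier A" "f \<in> carrier A"
    "V \<subseteq> bopen A f" "restr Sch W (pre V) s = fs a f V"
proof -
  let ?V = "h ` W"
  have oV: "opA ?V" by (rule img_open[OF W])
  have "s \<in> secs Sch (pre ?V)" using s pre_img[OF W(2)] by simp
  then obtain \<sigma> where \<sigma>: "\<sigma> \<in> carrier (sec (spec_sheaf A) ?V)" "\<phi> ?V \<sigma> = s" using phi_surj[OF oV] by blast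
  have hx: "h x \<in> ?V" using x by simp
  obtain V a f where *: "opA V" "h x \<in> V" "V \<subseteq> ?V" "a \<in> carrier A" "f \<in> carrier A"
    "V \<subseteq> bopen A f" "restrict \<sigma> V = A.sfr a f V" using A.sfr_local[OF \<sigma>(1) hx] by (elim exE conjE)
  have p: "pre V \<subseteq> W" using pre_mono[OF *(3)] pre_img[OF W(2)] by simp
  have "restr Sch W (pre V) s = fs a f V"
    using phi_restr[OF oV *(1,3) \<sigma>(1)] *(7) \<sigma>(2) pre_img[OF W(2)] by (simp add: fs_def)
  moreover have "x \<in> pre V" using x W(2) *(2) by (auto simp: pre_def)
  ultimately show ?thesis using that[OF *(1,2) p _ *(4,5,6)] by simp
qed

definition g :: "'a \<Rightarrow> 'a" where "g a = fs a 1[A] (spec A)"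

lemma g_closed: "a \<in> carrier A \<Longrightarrow> g a \<in> secs Sch U"
  using fs_closed[OF spec_open _ _ bone[OF spec_open], of a] by (simp add: g_def pre_spec)

lemma germ_g:
  assumes "opA W" "x \<in> pre W" "a \<in> carrier A"
  shows "germ Sch x (pre W) (fs a 1[A] W) = germ Sch x U (g a)"
  using fs_restr[OF spec_open assms(1) V_spec[OF assms(1)] assms(3) A.one_closed bone[OF spec_open]]
    germ_restr[OF U(1) pre_open[OF assms(1)] assms(2) pre_U g_closed[OF assms(3)]]
  by (simp add: g_def pre_spec)

lemma g_hom: "g \<in> ring_hom A (sec Sch U)"
proof (rule ring_hom_memI)
  note b = bone[OF spec_open]
  show "g (a *[A] c) = g a *[sec Sch U] g c" "g (a +[A] c) = g a +[sec Sch U] g c"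
    if "a \<in> carrier A" "c \<in> carrier A" for a c
    using fs_mult[OF spec_open that _ _ b b] fs_add[OF spec_open that _ _ b b] that by (simp_all add: g_def pre_spec)
  show "g 1[A] = 1[sec Sch U]" using fs_one[OF spec_open] by (simp add: g_def pre_spec)
qed (rule g_closed)

text \<open>The germ of a fraction is described by its product with the denominator, which avoids
  inverses in the stalk.\<close>

lemma germ_fs:
  assumes W: "opA W" "W \<subseteq> bopen A f" and x: "x \<in> pre W" and a: "a \<in> carrier A" and f: "f \<in> carrier A"
  shows "germ Sch x (pre W) (fs a f W) *[stalk Sch x] germ Sch x U (g f) = germ Sch x U (g a)"
proof -
  note b = bone[OF W(1)]
  have fa: "f *[A] 1[A] \<in> carrier A" "a *[A] f \<in> carrier A" using a f by auto
  have "germ Sch x (pre W) (fs a f W) *[stalk Sch x] germ Sch x (pre W) (fs f 1[A] W)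
    = germ Sch x (pre W) (fs (a *[A] f) (f *[A] 1[A]) W)"
    using germ_mult[OF pre_open[OF W(1)] x fs_closed[OF W(1) a f W(2)] fs_closed[OF W(1) f _ b]]
      fs_mult[OF W(1) a f f A.one_closed W(2) b] by simp
  also have "fs (a *[A] f) (f *[A] 1[A]) W = fs a 1[A] W"
    by (rule fs_eqI[OF W(1) fa(2) a fa(1) A.one_closed _ b]) (use a f W in \<open>simp_all add: A.m_comm\<close>)
  finally show ?thesis unfolding germ_g[OF W(1) x f] germ_g[OF W(1) x a] .
qed

text \<open>Away from the zeros of \<open>f\<close> the fraction \<open>1/f\<close> provides an
  inverse. Conversely, an inverse germ is locally \<open>a/k\<close>, and comparing
  \<open>f a/k\<close> with \<open>1\<close> in the localization gives \<open>u f a = u k\<close>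
  with \<open>u\<close> and \<open>k\<close> outside the prime, so \<open>f\<close> is outside as
  well.\<close>

lemma germ_unit:
  assumes x: "x \<in> U" and f: "f \<in> carrier A"
  shows "germ Sch x U (g f) \<in> Units (stalk Sch x) \<longleftrightarrow> f \<notin> h x"
proof
  interpret S: cring "stalk Sch x" by (rule stalk_cring) (use x U_sub in blast)
  have gc: "germ Sch x U (g f) \<in> stks Sch x" by (rule stalkI[OF U(1) x g_closed[OF f]])
  {
    assume nf: "f \<notin> h x"
    let ?W = "bopen A f"
    have W: "opA ?W" by (rule A.bopen_open[OF f])
    have xW: "x \<in> pre ?W" using x nf h_spec by (simp add: pre_def)
    let ?z = "germ Sch x (pre ?W) (fs 1[A] f ?W)"
    have z: "?z \<in> stks Sch x" by (rule stalkI[OF pre_open[OF W] xW fs_closed[OF W _ f]]) auto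
    have "?z *[stalk Sch x] germ Sch x U (g f) = germ Sch x U (g 1[A])"
      by (rule germ_fs[OF W _ xW _ f]) auto
    also have "\<dots> = 1[stalk Sch x]" using ring_hom_one[OF g_hom] germ_one[OF U(1) x] by simp
    finally have e: "?z *[stalk Sch x] germ Sch x U (g f) = 1[stalk Sch x]" .
    thus "germ Sch x U (g f) \<in> Units (stalk Sch x)"
      using S.m_comm[OF z gc] z gc unfolding Units_def by auto
  }
  assume "germ Sch x U (g f) \<in> Units (stalk Sch x)"
  then obtain z where z: "z \<in> stks Sch x" "germ Sch x U (g f) *[stalk Sch x] z = 1[stalk Sch x]"
    unfolding Units_def by blast
  obtain W s where W: "op W" "x \<in> W" "W \<subseteq> U" "s \<in> secs Sch W" "z = germ Sch x W s"
    by (rule stalk_in[OF z(1) U(1) x])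
  obtain V a k where V: "opA V" "h x \<in> V" "pre V \<subseteq> W" "x \<in> pre V" "a \<in> carrier A" "k \<in> carrier A"
    "V \<subseteq> bopen A k" "restr Sch W (pre V) s = fs a k V" by (rule fs_local[OF W(1,3,4,2)])
  note pv = pre_open[OF V(1)] and b = bone[OF V(1)]
  have zz: "z = germ Sch x (pre V) (fs a k V)" using germ_restr[OF W(1) pv V(4,3) W(4)] V(8) W(5) by simp
  have fa: "f *[A] a \<in> carrier A" "1[A] *[A] k \<in> carrier A" using f V by auto
  have bk: "V \<subseteq> bopen A (1[A] *[A] k)" using V by simp
  have "germ Sch x (pre V) (fs (f *[A] a) (1[A] *[A] k) V) = germ Sch x (pre V) (fs f 1[A] V *[sec Sch (pre V)] fs a k V)"
    using fs_mult[OF V(1) f V(5) A.one_closed V(6) b V(7)] by simp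
  also have "\<dots> = germ Sch x (pre V) (fs f 1[A] V) *[stalk Sch x] germ Sch x (pre V) (fs a k V)"
    by (rule germ_mult[OF pv V(4) fs_closed[OF V(1) f _ b] fs_closed[OF V(1,5,6,7)], symmetric]) simp
  also have "\<dots> = 1[stalk Sch x]" using z(2) zz germ_g[OF V(1,4) f] by simp
  also have "\<dots> = germ Sch x (pre V) (fs 1[A] 1[A] V)" using germ_one[OF pv V(4)] fs_one[OF V(1)] by simp
  \<comment> \<open>Equal germs agree on some neighbourhood; there injectivity of
    \<open>\<phi>\<close> turns the equation of sections into one of fractions at the prime
    \<open>h x\<close>.\<close>
  finally obtain W' where W': "op W'" "x \<in> W'" "W' \<subseteq> pre V"
    "restr Sch (pre V) W' (fs (f *[A] a) (1[A] *[A] k) V) = restr Sch (pre V) W' (fs 1[A] 1[A] V)"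
    using germ_eq[OF pv V(4) fs_closed[OF V(1) fa bk] pv V(4) fs_closed[OF V(1) _ _ b]] by auto
  let ?W = "h ` W'"
  have W'U: "W' \<subseteq> U" using W'(3) pre_U by blast
  have o: "opA ?W" by (rule img_open[OF W'(1) W'U])
  have sub: "?W \<subseteq> V" using W'(3) by (auto simp: pre_def)
  have e: "fs (f *[A] a) (1[A] *[A] k) ?W = fs 1[A] 1[A] ?W"
    using W'(4) fs_restr[OF V(1) o sub fa bk] fs_restr[OF V(1) o sub A.one_closed A.one_closed b] pre_img[OF W'U] by simp
  have bk': "?W \<subseteq> bopen A (1[A] *[A] k)" using sub bk by (rule subset_trans)
  have "A.sfr (f *[A] a) (1[A] *[A] k) ?W = A.sfr 1[A] 1[A] ?W"
    by (rule phi_inj[OF o A.sfr_sec[OF fa o bk'] A.sfr_sec[OF A.one_closed A.one_closed o bone[OF o]] e[unfolded fs_def]])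
  hence "A.sfr (f *[A] a) (1[A] *[A] k) ?W (h x) = A.sfr 1[A] 1[A] ?W (h x)" by simp
  hence r: "rfrac A (carrier A - h x) (f *[A] a) (1[A] *[A] k) = rfrac A (carrier A - h x) 1[A] 1[A]"
    using W'(2) by (simp add: A.sfr_def)
  interpret m: mset A "carrier A - h x" by (rule mset_prime[OF Acr h_spec[OF x]])
  have kx: "k \<notin> h x" using V(2,7) by blast
  obtain u where u: "u \<in> carrier A - h x" "u *[A] (1[A] *[A] (f *[A] a)) = u *[A] (1[A] *[A] k *[A] 1[A])"
    using m.rfrac_eq[OF fa(1) _ A.one_closed m.T(2), of "1[A] *[A] k"] r kx V(6) by auto
  show "f \<notin> h x"
  proof
    assume "f \<in> h x"
    hence "u *[A] (f *[A] a) \<in> h x" using A.spec_mult[OF h_spec[OF x]] f V(5) u(1) by auto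
    hence "u *[A] k \<in> h x" using u(2) f V(5,6) by simp
    thus False using A.spec_mult[OF h_spec[OF x]] u(1) V(6) kx by auto
  qed
qed

text \<open>It is enough to test basic open sets, and for these the condition says that every
  function vanishing at \<open>y\<close> vanishes at \<open>x\<close>.\<close>

lemma spec_closure:
  assumes "x \<in> U" "y \<in> U"
  shows "x \<in> cl y \<longleftrightarrow> h y \<subseteq> h x"
proof
  assume c: "x \<in> cl y"
  show "h y \<subseteq> h x"
  proof
    fix f assume f: "f \<in> h y"
    have fA: "f \<in> carrier A" using A.spec_sub[OF h_spec[OF assms(2)]] f by blast
    show "f \<in> h x"
    proof (rule ccontr)
      assume "f \<notin> h x"
      hence "x \<in> pre (bopen A f)" using assms h_spec by (simp add: pre_def)
      hence "y \<in> pre (bopen A f)" using c pre_open[OF A.bopen_open[OF fA]] cl_iff by blast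
      thus False using f by (simp add: pre_def)
    qed
  qed
next
  assume s: "h y \<subseteq> h x"
  have "y \<in> W" if W: "op W" "x \<in> W" for W
  proof -
    have o: "op (W \<inter> U)" using W(1) U(1) by (rule openin_Int)
    have i: "opA (h ` (W \<inter> U))" by (rule img_open[OF o]) simp
    obtain f where f: "f \<in> carrier A" "h x \<in> bopen A f" "bopen A f \<subseteq> h ` (W \<inter> U)"
      using A.zariski_basis[OF i, of "h x"] W(2) assms(1) by blast
    have "h y \<in> bopen A f" using f(2) s h_spec[OF assms(2)] by auto
    hence "h y \<in> h ` (W \<inter> U)" using f(3) by blast
    thus ?thesis using pre_img[of "W \<inter> U"] assms(2) by (auto simp: pre_def)
  qed
  thus "x \<in> cl y" using cl_iff assms(1) U_sub by blast
qed

lemma xi_U: "\<xi> \<in> U" using gen_in' U by blast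

lemma h_xi_least: "y \<in> U \<Longrightarrow> h \<xi> \<subseteq> h y"
  using spec_closure[OF _ xi_U, of y] gp U_sub by (auto simp: generic_point_def)

end

locale dom_chart = aff_chart Sch \<xi> U A h \<phi>
  for Sch :: "('p, 'a, unit) sheaf" and \<xi> :: 'p and U A h \<phi> +
  assumes dom: "domain A"

sublocale dom_chart \<subseteq> A: domain A by (rule dom)

context dom_chart
begin

lemma zero_spec: "{0[A]} \<in> spec A"
  using A.zeroprimeideal by (simp add: spec_def)

text \<open>The zero ideal is a point of the chart, and the prime of the generic point is contained
  in every other.\<close>

lemma h_xi: "h \<xi> = {0[A]}"
proof -
  obtain y where "y \<in> U" "h y = {0[A]}" using zero_spec h_img by (metis imageE)
  hence "h \<xi> \<subseteq> {0[A]}" using h_xi_least by blast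
  thus ?thesis using A.spec_zero[OF h_spec[OF xi_U]] by blast
qed

lemma xi_fs_zero:
  assumes W: "opA W" "\<xi> \<in> pre W" "W \<subseteq> bopen A f" and a: "a \<in> carrier A" and f: "f \<in> carrier A"
    and z: "gO (pre W) (fs a f W) = 0[F]"
  shows "a = 0[A]"
proof (rule ccontr)
  interpret F: cring F by (rule F_cring)
  assume "a \<noteq> 0[A]"
  hence u: "gO U (g a) \<in> Units F" using germ_unit[OF xi_U a] h_xi by simp
  have "gO U (g f) \<in> carrier F" by (rule stalkI[OF U(1) xi_U g_closed[OF f]])
  hence "gO U (g a) = 0[F]" using germ_fs[OF W(1,3,2) a f] z by simp
  hence "0[F] \<in> Units F" using u by simp
  thus False using F_one by (metis F.Units_closed F.Units_r_inv_ex F.l_null)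
qed

lemma local_zero:
  assumes W: "op W" "W \<subseteq> U" and s: "s \<in> secs Sch W" and z: "gO W s = 0[F]" and x: "x \<in> W"
  shows "\<exists>V. op V \<and> x \<in> V \<and> V \<subseteq> W \<and> restr Sch W V s = 0[sec Sch V]"
proof -
  obtain V a f where V: "opA V" "h x \<in> V" "pre V \<subseteq> W" "x \<in> pre V" "a \<in> carrier A" "f \<in> carrier A"
    "V \<subseteq> bopen A f" "restr Sch W (pre V) s = fs a f V" by (rule fs_local[OF W s x])
  note pv = pre_open[OF V(1)]
  have xi: "\<xi> \<in> pre V" by (rule gen_in[OF pv V(4)])
  have "gO (pre V) (fs a f V) = 0[F]" using germ_restr[OF W(1) pv xi V(3) s] V(8) z by simp
  hence "a = 0[A]" by (rule xi_fs_zero[OF V(1) xi V(7,5,6)])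
  hence "fs a f V = fs 0[A] 1[A] V" using V(6,7) by (intro fs_eqI[OF V(1)] bone[OF V(1)]) auto
  hence "restr Sch W (pre V) s = 0[sec Sch (pre V)]" using V(8) fs_zero[OF V(1)] by simp
  thus ?thesis using pv V(3,4) by blast
qed

definition j :: "'a \<Rightarrow> ('p set \<times> 'a) set" where "j a = gO U (g a)"

lemma j_hom: "j \<in> ring_hom A F"
  using ring_hom_trans[OF g_hom germ_hom[OF U(1) xi_U]] by (simp add: j_def[abs_def] comp_def)

lemma j_unit: "a \<in> carrier A \<Longrightarrow> a \<noteq> 0[A] \<Longrightarrow> j a \<in> Units F"
  using germ_unit[OF xi_U] h_xi by (simp add: j_def)

lemma j_inj: "inj_on j (carrier A)"
proof -
  interpret F: cring F by (rule F_cring)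
  interpret J: ring_hom_cring A F j by (rule ring_hom_cringI[OF Acr F_cring j_hom])
  have nz: "0[F] \<notin> Units F" using F_one by (metis F.Units_closed F.Units_r_inv_ex F.l_null)
  show ?thesis
  proof (rule inj_onI)
    fix a b assume ab: "a \<in> carrier A" "b \<in> carrier A" and e: "j a = j b"
    have "j (a \<ominus>[A] b) = 0[F]" using ab e by (simp add: A.minus_eq F.r_neg)
    hence "j (a \<ominus>[A] b) \<notin> Units F" using nz by (simp only: simp_thms)
    hence "a \<ominus>[A] b = 0[A]" using j_unit[of "a \<ominus>[A] b"] A.minus_closed[OF ab] by blast
    thus "a = b" using ab A.r_right_minus_eq by blast
  qed
qed

text \<open>Locally a germ is a fraction whose denominator does not vanish at \<open>x\<close>;
  conversely such a fraction is a section over \<open>bopen A s\<close>, and \<open>j s\<close> can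
  be cancelled in the field.\<close>

lemma O_x:
  assumes x: "x \<in> U"
  shows "cO ` stks Sch x = {z \<in> carrier F. \<exists>a\<in>carrier A. \<exists>s\<in>carrier A. s \<notin> h x \<and> z *[F] j s = j a}"
proof (rule equalityI; rule subsetI)
  interpret F: cring F by (rule F_cring)
  have cg: "cO (germ Sch x W s) = gO W s" if "op W" "x \<in> W" "s \<in> secs Sch W" for W s
    by (rule cospec_germ[OF gen_in that])
  {
    fix z assume "z \<in> cO ` stks Sch x"
    then obtain y where y: "z = cO y" "y \<in> stks Sch x" by (rule imageE)
    obtain W s where W: "op W" "x \<in> W" "W \<subseteq> U" "s \<in> secs Sch W" "y = germ Sch x W s"
      by (rule stalk_in[OF y(2) U(1) x])
    obtain V a f where V: "opA V" "h x \<in> V" "pre V \<subseteq> W" "x \<in> pre V" "a \<in> carrier A" "f \<in> carrier A"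
      "V \<subseteq> bopen A f" "restr Sch W (pre V) s = fs a f V" by (rule fs_local[OF W(1,3,4,2)])
    note pv = pre_open[OF V(1)]
    have xi: "\<xi> \<in> pre V" by (rule gen_in[OF pv V(4)])
    have zz: "z = gO (pre V) (fs a f V)"
      using germ_restr[OF W(1) pv xi V(3) W(4)] V(8) y(1) W(5) cg[OF W(1,2,4)] by simp
    have "z *[F] j f = j a" unfolding zz j_def by (rule germ_fs[OF V(1,7) xi V(5,6)])
    moreover have "z \<in> carrier F" unfolding zz by (rule stalkI[OF pv xi fs_closed[OF V(1,5,6,7)]])
    moreover have "f \<notin> h x" using V(2,7) by blast
    ultimately show "z \<in> {z \<in> carrier F. \<exists>a\<in>carrier A. \<exists>s\<in>carrier A. s \<notin> h x \<and> z *[F] j s = j a}"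
      using V(5,6) by blast
  }
  fix z assume "z \<in> {z \<in> carrier F. \<exists>a\<in>carrier A. \<exists>s\<in>carrier A. s \<notin> h x \<and> z *[F] j s = j a}"
  then obtain a s where z: "z \<in> carrier F" "a \<in> carrier A" "s \<in> carrier A" "s \<notin> h x" "z *[F] j s = j a" by blast
  let ?W = "bopen A s"
  have W: "opA ?W" by (rule A.bopen_open[OF z(3)])
  note pv = pre_open[OF W]
  have xW: "x \<in> pre ?W" using x z(4) h_spec by (simp add: pre_def)
  have xi: "\<xi> \<in> pre ?W" by (rule gen_in[OF pv xW])
  have fc: "fs a s ?W \<in> secs Sch (pre ?W)" by (rule fs_closed[OF W z(2,3)]) simp
  let ?y = "gO (pre ?W) (fs a s ?W)"
  have yF: "?y \<in> carrier F" by (rule stalkI[OF pv xi fc])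
  have "?y *[F] j s = j a" unfolding j_def by (rule germ_fs[OF W _ xi z(2,3)]) simp
  hence "j s *[F] ?y = j s *[F] z" using z yF ring_hom_closed[OF j_hom z(3)] by (simp add: F.m_comm)
  moreover have "s \<noteq> 0[A]" using z(4) A.spec_zero[OF h_spec[OF x]] by blast
  ultimately have "?y = z" using F.Units_l_cancel[OF j_unit[OF z(3)] yF z(1)] by blast
  hence "z = cO (germ Sch x (pre ?W) (fs a s ?W))" using cg[OF pv xW fc] by simp
  thus "z \<in> cO ` stks Sch x" using stalkI[OF pv xW fc] by (rule image_eqI)
qed

text \<open>This is \<open>O_x\<close> at the generic point, where \<open>cospec\<close> does not
  change a germ and the prime is zero.\<close>

lemma F_frac:
  assumes "z \<in> carrier F"
  shows "\<exists>a\<in>carrier A. \<exists>s\<in>carrier A. s \<noteq> 0[A] \<and> z *[F] j s = j a"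
proof -
  obtain W s where W: "op W" "\<xi> \<in> W" "s \<in> secs Sch W" "z = gO W s" using assms by (rule stalkE)
  have "z = cO (gO W s)" using cospec_germ[OF gen_in W(1-3)] W(4) by simp
  hence "z \<in> cO ` stks Sch \<xi>" using stalkI[OF W(1-3)] by blast
  thus ?thesis unfolding O_x[OF xi_U] h_xi by auto
qed

lemma F_field: "field F"
proof -
  interpret F: cring F by (rule F_cring)
  interpret J: ring_hom_cring A F j by (rule ring_hom_cringI[OF Acr F_cring j_hom])
  have nz: "0[F] \<notin> Units F" using F_one by (metis F.Units_closed F.Units_r_inv_ex F.l_null)
  have "z \<in> Units F" if z: "z \<in> carrier F" "z \<noteq> 0[F]" for z
  proof -
    obtain a s where as: "a \<in> carrier A" "s \<in> carrier A" "s \<noteq> 0[A]" "z *[F] j s = j a" using F_frac[OF z(1)] by blast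
    note su = j_unit[OF as(2,3)]
    have "a \<noteq> 0[A]"
    proof
      assume "a = 0[A]"
      hence "j s *[F] z = j s *[F] 0[F]" using as z by (simp add: F.m_comm)
      thus False using F.Units_l_cancel[OF su z(1)] z(2) by simp
    qed
    hence "z *[F] j s \<in> Units F" using j_unit[OF as(1)] as(4) by simp
    thus ?thesis using F.prod_unit_r[OF _ su z(1)] as(2) by simp
  qed
  thus ?thesis by (intro F.cring_fieldI) (use nz in auto)
qed

end

section \<open>Krull schemes\<close>

locale kscheme =
  fixes Sch :: "('p, 'a, unit) sheaf" and \<xi> :: 'p
  assumes Kr: "Krull_scheme Sch" and gp0: "generic_point Sch \<xi>"

sublocale kscheme \<subseteq> ischeme Sch \<xi>
  by (rule ischeme.intro) (use Kr gp0 in \<open>simp_all add: Krull_scheme_def\<close>)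

locale krull_chart = dom_chart Sch \<xi> U A h \<phi> + kscheme Sch \<xi>
  for Sch :: "('p, 'a, unit) sheaf" and \<xi> :: 'p and U A h \<phi> +
  assumes KA: "Krull_ring A"

context kscheme
begin

abbreviation "Oc x \<equiv> cO ` stks Sch x"
abbreviation "P \<equiv> prime_divisors Sch"

lemma Krull_chartI:
  assumes "is_Spec_of Sch U A" "U \<noteq> {}" "Krull_ring A"
  shows "\<exists>h \<phi>. krull_chart Sch \<xi> U A h \<phi>"
proof -
  have "op U" "cring A" using assms by (auto simp: is_Spec_of_def)
  moreover obtain h \<phi> where "ringed_space_iso (open_restrict Sch U) (spec_sheaf A) h \<phi>"
    using assms(1) unfolding is_Spec_of_def by blast
  moreover have "domain A" using assms(3) by (simp add: Krull_ring_def)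
  ultimately have "krull_chart Sch \<xi> U A h \<phi>"
    using assms(2,3) by (intro krull_chart.intro krull_chart_axioms.intro dom_chart.intro dom_chart_axioms.intro
      aff_chart.intro aff_chart_axioms.intro ischeme_axioms kscheme_axioms)
  thus ?thesis by blast
qed

lemma cover: "\<exists>\<C>. finite \<C> \<and> \<Union>\<C> = X \<and> (\<forall>U\<in>\<C>. U \<noteq> {} \<and> (\<exists>A h \<phi>. krull_chart Sch \<xi> U A h \<phi>))"
proof -
  obtain \<C> where C: "finite \<C>" "\<Union>\<C> = X" "\<forall>U\<in>\<C>. \<exists>A. Krull_ring A \<and> is_Spec_of Sch U A"
    using Kr unfolding Krull_scheme_def by blast
  \<comment> \<open>An empty member of the cover would not contain the generic point and so would
    not be a chart.\<close>
  have "finite (\<C> - {{}})" "\<Union>(\<C> - {{}}) = X" using C by auto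
  moreover have "\<exists>A h \<phi>. krull_chart Sch \<xi> U A h \<phi>" if U: "U \<in> \<C> - {{}}" for U
  proof -
    obtain A where A: "Krull_ring A" "is_Spec_of Sch U A" using C(3) U by blast
    show ?thesis using Krull_chartI[OF A(2) _ A(1)] U by blast
  qed
  ultimately show ?thesis by (intro exI[of _ "\<C> - {{}}"]) simp
qed

lemma chart_at:
  assumes "x \<in> X"
  obtains U A h \<phi> where "x \<in> U" "krull_chart Sch \<xi> U A h \<phi>"
proof -
  obtain \<C> where C: "\<Union>\<C> = X" "\<forall>U\<in>\<C>. U \<noteq> {} \<and> (\<exists>A h \<phi>. krull_chart Sch \<xi> U A h \<phi>)" using cover by blast
  then obtain U where U: "U \<in> \<C>" "x \<in> U" using assms by blast
  thus ?thesis using C(2) that by blast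
qed

lemma F_field: "field F"
proof -
  obtain U A h \<phi> where "\<xi> \<in> U" and c: "krull_chart Sch \<xi> U A h \<phi>" by (rule chart_at[OF xi_X])
  interpret krull_chart Sch \<xi> U A h \<phi> by (rule c)
  show ?thesis by (rule F_field)
qed

lemma germ_zero_imp:
  assumes W: "op W" "W \<noteq> {}" and d: "d \<in> secs Sch W" and z: "gO W d = 0[F]"
  shows "d = 0[sec Sch W]"
proof (rule locality[OF W(1) d])
  show "0[sec Sch W] \<in> secs Sch W" using cring.cring_simprules(2)[OF sec_cring[OF W(1)]] .
  fix x assume x: "x \<in> W"
  hence "x \<in> X" using openin_subset[OF W(1)] by blast
  then obtain U A h \<phi> where xU: "x \<in> U" and c: "krull_chart Sch \<xi> U A h \<phi>" by (rule chart_at)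
  interpret krull_chart Sch \<xi> U A h \<phi> by (rule c)
  have o: "op (W \<inter> U)" using W(1) U(1) by (rule openin_Int)
  have dc: "restr Sch W (W \<inter> U) d \<in> secs Sch (W \<inter> U)" by (rule restr_closed[OF W(1) o _ d]) simp
  have xi: "\<xi> \<in> W \<inter> U" using gen_in[OF o, of x] x xU by simp
  have "gO (W \<inter> U) (restr Sch W (W \<inter> U) d) = 0[F]" using germ_restr[OF W(1) o xi _ d] z by simp
  then obtain V where V: "op V" "x \<in> V" "V \<subseteq> W \<inter> U" "restr Sch (W \<inter> U) V (restr Sch W (W \<inter> U) d) = 0[sec Sch V]"
    using local_zero[OF o _ dc, of x] x xU by blast
  have "restr Sch W V d = 0[sec Sch V]" using V(4) restr_comp[OF W(1) o V(1) _ V(3) d] by simp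
  moreover have "restr Sch W V 0[sec Sch W] = 0[sec Sch V]" using restr_zero[OF W(1) V(1)] V(3) by simp
  ultimately show "\<exists>V. op V \<and> x \<in> V \<and> V \<subseteq> W \<and> restr Sch W V d = restr Sch W V 0[sec Sch W]"
    using V by (intro exI[of _ V]) auto
qed

lemma germ_inj: "op W \<Longrightarrow> W \<noteq> {} \<Longrightarrow> inj_on (gO W) (secs Sch W)"
proof (rule inj_onI)
  fix s t assume W: "op W" "W \<noteq> {}" and s: "s \<in> secs Sch W" and t: "t \<in> secs Sch W"
    and e: "gO W s = gO W t"
  interpret S: cring "sec Sch W" by (rule sec_cring[OF W(1)])
  interpret F: cring F by (rule F_cring)
  interpret J: ring_hom_cring "sec Sch W" F "gO W"
    by (rule ring_hom_cringI[OF S.cring_axioms F.cring_axioms germ_hom[OF W(1) gen_in'[OF W]]])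
  have "gO W (s \<ominus>[sec Sch W] t) = 0[F]" using s t e by (simp add: S.minus_eq F.r_neg)
  hence "s \<ominus>[sec Sch W] t = 0[sec Sch W]" by (rule germ_zero_imp[OF W S.minus_closed[OF s t]])
  thus "s = t" using s t S.r_right_minus_eq by blast
qed

lemma cospec_Sch_germ: "op W \<Longrightarrow> x \<in> W \<Longrightarrow> s \<in> secs Sch W \<Longrightarrow> cO (germ Sch x W s) = gO W s"
  by (rule cospec_germ[OF gen_in])

lemma cospec_inj: "inj_on (cO) (stks Sch x)"
proof (rule inj_onI)
  fix y z assume y: "y \<in> stks Sch x" and z: "z \<in> stks Sch x" and e: "cO y = cO z"
  obtain V t where V: "op V" "x \<in> V" "t \<in> secs Sch V" "y = germ Sch x V t" using y by (rule stalkE)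
  obtain W s where W: "op W" "x \<in> W" "W \<subseteq> V" "s \<in> secs Sch W" "z = germ Sch x W s" "restr Sch V W t \<in> secs Sch W"
    "germ Sch x V t = germ Sch x W (restr Sch V W t)" by (rule stalk_common[OF z V(1-3)])
  have "gO W (restr Sch V W t) = gO W s"
    using e W(5,7) V(4) cospec_Sch_germ[OF W(1,2,4)] cospec_Sch_germ[OF W(1,2,6)] by simp
  hence "restr Sch V W t = s" using inj_onD[OF germ_inj[OF W(1)] _ W(6,4)] W(2) by blast
  thus "y = z" using V(4) W(5,7) by simp
qed

lemma O_hom: "x \<in> X \<Longrightarrow> cO \<in> ring_hom (stalk Sch x) F"
  by (rule cospec_hom[OF gen_in])

end

section \<open>Prime divisors as height one primes of a Krull chart\<close>

context krull_chart
begin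

text \<open>A defining family of \<open>A\<close>, transported to the function field. It is not
  canonical, hence the choice.\<close>

definition NN :: "(('p set \<times> 'a) set \<Rightarrow> int) set" where
  "NN = (SOME N. krull_fam F (j ` carrier A) N)"

lemma NN: "krull_fam F (j ` carrier A) NN"
  unfolding NN_def by (rule someI_ex[OF Krull_ring_fam[OF KA F_field j_hom j_inj F_frac]])

sublocale kf: krull_fam F "j ` carrier A" NN
  by (rule NN)

lemma h_sub: "x \<in> U \<Longrightarrow> h x \<subseteq> carrier A"
  by (rule A.spec_sub[OF h_spec])

lemma j_mem: "x \<in> U \<Longrightarrow> a \<in> carrier A \<Longrightarrow> j a \<in> j ` h x \<longleftrightarrow> a \<in> h x"
  using inj_on_image_mem_iff[OF j_inj _ h_sub] by blast

lemma j_sub: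
  assumes x: "x \<in> U" and y: "y \<in> U"
  shows "j ` h x \<subseteq> j ` h y \<longleftrightarrow> h x \<subseteq> h y"
proof -
  have "a \<in> h y" if "j ` h x \<subseteq> j ` h y" "a \<in> h x" for a
    using that j_mem[OF y subsetD[OF h_sub[OF x] that(2)]] by blast
  thus ?thesis by blast
qed

lemma jF: "a \<in> carrier A \<Longrightarrow> j a \<in> carrier F"
  by (rule ring_hom_closed[OF j_hom])

lemma O_locp:
  assumes x: "x \<in> U"
  shows "Oc x = kf.locp (j ` h x)"
proof -
  have "(\<exists>a\<in>carrier A. \<exists>s\<in>carrier A. s \<notin> h x \<and> z *[F] j s = j a) \<longleftrightarrow>
    (\<exists>s\<in>j ` carrier A. s \<notin> j ` h x \<and> s *[F] z \<in> j ` carrier A)" if z: "z \<in> carrier F" for z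
  proof
    assume "\<exists>a\<in>carrier A. \<exists>s\<in>carrier A. s \<notin> h x \<and> z *[F] j s = j a"
    then obtain a s where as: "a \<in> carrier A" "s \<in> carrier A" "s \<notin> h x" "z *[F] j s = j a" by blast
    have "j s \<notin> j ` h x" using j_mem[OF x as(2)] as(3) by simp
    moreover have "j s *[F] z \<in> j ` carrier A" using as z jF kf.m_comm by simp
    ultimately show "\<exists>s\<in>j ` carrier A. s \<notin> j ` h x \<and> s *[F] z \<in> j ` carrier A" using as(2) by blast
  next
    assume "\<exists>s\<in>j ` carrier A. s \<notin> j ` h x \<and> s *[F] z \<in> j ` carrier A"
    then obtain s a where sa: "s \<in> carrier A" "j s \<notin> j ` h x" "a \<in> carrier A" "j s *[F] z = j a" by blast
    have "s \<notin> h x" using sa(2) by blast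
    moreover have "z *[F] j s = j a" using sa z jF kf.m_comm by simp
    ultimately show "\<exists>a\<in>carrier A. \<exists>s\<in>carrier A. s \<notin> h x \<and> z *[F] j s = j a" using sa by blast
  qed
  thus ?thesis unfolding O_x[OF x] kf.locp_def by blast
qed

lemma h_fprime:
  assumes x: "x \<in> U"
  shows "kf.fprime (j ` h x)"
proof -
  interpret p: primeideal "h x" A by (rule A.spec_ideal[OF h_spec[OF x]])
  interpret J: ring_hom_cring A F j by (rule ring_hom_cringI[OF Acr F_cring j_hom])
  note sub = subsetD[OF h_sub[OF x]]
  show ?thesis unfolding kf.fprime_def
  proof (intro conjI ballI impI)
    show "j ` h x \<subseteq> j ` carrier A" using sub by blast
    show "0[F] \<in> j ` h x" using imageI[OF p.zero_closed, of j] by simp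
    show "1[F] \<notin> j ` h x" using j_mem[OF x A.one_closed] A.spec_one[OF h_spec[OF x]] by simp
    show "y +[F] z \<in> j ` h x" if yz: "y \<in> j ` h x" "z \<in> j ` h x" for y z
    proof -
      obtain a b where "y = j a" "a \<in> h x" "z = j b" "b \<in> h x" using yz by blast
      thus ?thesis using imageI[OF p.a_closed[of a b], of j] sub by simp
    qed
    show "y *[F] z \<in> j ` h x" if yz: "y \<in> j ` carrier A" "z \<in> j ` h x" for y z
    proof -
      obtain a b where "y = j a" "a \<in> carrier A" "z = j b" "b \<in> h x" using yz by blast
      thus ?thesis using imageI[OF p.I_l_closed[of b a], of j] sub by simp
    qed
    show "y \<in> j ` h x \<or> z \<in> j ` h x" if yz: "y \<in> j ` carrier A" "z \<in> j ` carrier A" "y *[F] z \<in> j ` h x" for y z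
    proof -
      obtain a b where ab: "y = j a" "a \<in> carrier A" "z = j b" "b \<in> carrier A" using yz by blast
      have "a *[A] b \<in> h x" using yz(3) j_mem[OF x A.m_closed[OF ab(2,4)]] ab by simp
      hence "a \<in> h x \<or> b \<in> h x" using p.I_prime ab by blast
      thus ?thesis using ab by blast
    qed
  qed
qed

lemma fprime_h:
  assumes p: "kf.fprime p"
  shows "\<exists>x\<in>U. p = j ` h x"
proof -
  interpret J: ring_hom_cring A F j by (rule ring_hom_cringI[OF Acr F_cring j_hom])
  note D = kf.fprimeD[OF p]
  define q where "q = {a \<in> carrier A. j a \<in> p}"
  have mult: "b *[A] a \<in> q" if "a \<in> q" "b \<in> carrier A" for a b
    using that D(5)[of "j b" "j a"] by (simp add: q_def)
  have neg: "\<ominus>[A] a \<in> q" if "a \<in> q" for a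
    using mult[OF that A.a_inv_closed[OF A.one_closed]] that by (simp add: q_def A.l_minus)
  have "ideal q A"
  proof (rule idealI[OF A.ring_axioms])
    show "subgroup q (add_monoid A)"
    proof (rule A.add.subgroupI)
      show "q \<noteq> {}" using D(2) by (auto simp: q_def intro!: exI[of _ "0[A]"])
      show "a +[A] b \<in> q" if "a \<in> q" "b \<in> q" for a b using that D(4) by (simp add: q_def)
    qed (use neg in \<open>auto simp: q_def a_inv_def\<close>)
    show "b *[A] a \<in> q" "a *[A] b \<in> q" if "a \<in> q" "b \<in> carrier A" for a b
      using mult[OF that] that A.m_comm[of a b] by (auto simp: q_def)
  qed
  moreover have "1[A] \<notin> q" using D(3) by (simp add: q_def)
  hence "carrier A \<noteq> q" using A.one_closed by blast
  moreover have "a \<in> q \<or> b \<in> q" if "a \<in> carrier A" "b \<in> carrier A" "a *[A] b \<in> q" for a b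
    using that D(6)[of "j a" "j b"] by (simp add: q_def)
  ultimately have "primeideal q A" by (rule primeidealI[OF _ Acr])
  hence "q \<in> spec A" by (simp add: spec_def)
  then obtain x where x: "x \<in> U" "q = h x" using h_img by (metis imageE)
  have "p = j ` q" using D(1) by (auto simp: q_def)
  thus ?thesis using x by blast
qed

text \<open>The functions vanishing on the part of \<open>C\<close> inside \<open>U\<close> form an
  ideal, prime because \<open>C\<close> is irreducible; the corresponding point is generic in
  \<open>C\<close>. This turns the chains of closed sets in \<open>codim\<close> into chains of
  primes.\<close>

lemma irreducible_point:
  assumes C: "closedin (base Sch) C" "irreducible_set (base Sch) C" and CU: "C \<inter> U \<noteq> {}"
  shows "\<exists>y\<in>U. C = cl y"
proof -
  have CX: "C \<subseteq> X" using C(2) by (simp add: irreducible_set_def)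
  define I where "I = {a \<in> carrier A. \<forall>y\<in>C \<inter> U. a \<in> h y}"
  obtain y0 where y0: "y0 \<in> C" "y0 \<in> U" using CU by blast
  have id: "ideal (h y) A" if "y \<in> U" for y
    using A.spec_ideal[OF h_spec[OF that]] by (simp add: primeideal.axioms(1))
  have "ideal I A"
  proof (rule idealI[OF A.ring_axioms])
    have add: "a +[A] b \<in> I" if "a \<in> I" "b \<in> I" for a b
      using that additive_subgroup.a_closed[OF ideal.axioms(1)[OF id]] by (simp add: I_def)
    have neg: "\<ominus>[A] a \<in> I" if a: "a \<in> I" for a
    proof -
      have aA: "a \<in> carrier A" using a by (simp add: I_def)
      have "\<ominus>[A] a \<in> h y" if y: "y \<in> C \<inter> U" for y
      proof -
        have "\<ominus>[A] 1[A] *[A] a \<in> h y" by (rule ideal.I_l_closed[OF id]) (use a y in \<open>auto simp: I_def\<close>)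
        thus ?thesis using aA by (simp add: A.l_minus)
      qed
      thus ?thesis using aA by (simp add: I_def)
    qed
    have "0[A] \<in> I" using A.spec_zero[OF h_spec] by (simp add: I_def)
    moreover have "I \<subseteq> carrier A" by (auto simp: I_def)
    ultimately show "subgroup I (add_monoid A)"
      by (intro A.add.subgroupI) (use add neg in \<open>auto simp: a_inv_def\<close>)
    show "b *[A] a \<in> I" "a *[A] b \<in> I" if "a \<in> I" "b \<in> carrier A" for a b
      using that ideal.I_l_closed[OF id] ideal.I_r_closed[OF id] by (simp_all add: I_def)
  qed
  moreover have "carrier A \<noteq> I" using A.spec_one[OF h_spec[OF y0(2)]] y0 by (auto simp: I_def)
  moreover have "a \<in> I \<or> b \<in> I" if ab: "a \<in> carrier A" "b \<in> carrier A" "a *[A] b \<in> I" for a b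
  proof -
    let ?Z = "\<lambda>a. X - pre (bopen A a)"
    have cZ: "closedin (base Sch) (?Z a)" if "a \<in> carrier A" for a
      by (rule closedin_diff[OF closedin_topspace pre_open[OF A.bopen_open[OF that]]])
    have "C \<subseteq> ?Z a \<union> ?Z b"
    proof
      fix y assume y: "y \<in> C"
      show "y \<in> ?Z a \<union> ?Z b"
      proof (cases "y \<in> U")
        case True
        hence "a *[A] b \<in> h y" using ab(3) y by (simp add: I_def)
        hence "a \<in> h y \<or> b \<in> h y" using A.spec_mult[OF h_spec[OF True] ab(1,2)] by simp
        thus ?thesis using y CX by (auto simp: pre_def)
      next
        case False thus ?thesis using y CX by (auto simp: pre_def)
      qed
    qed
    hence "C \<subseteq> ?Z a \<or> C \<subseteq> ?Z b" using C(2) cZ ab unfolding irreducible_set_def by blast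
    thus ?thesis using ab h_spec by (auto simp: I_def pre_def)
  qed
  ultimately have "primeideal I A" by (rule primeidealI[OF _ Acr])
  hence "I \<in> spec A" by (simp add: spec_def)
  then obtain y where y: "y \<in> U" "I = h y" using h_img by (metis imageE)
  \<comment> \<open>Otherwise a basic neighbourhood of \<open>y\<close> misses \<open>C\<close>; but
    its function is not in \<open>I\<close>, so it is non-zero at some point of
    \<open>C\<close>.\<close>
  have yC: "y \<in> C"
  proof (rule ccontr)
    assume n: "y \<notin> C"
    have "op (X - C)" using C(1) by (simp add: openin_diff)
    hence o: "op ((X - C) \<inter> U)" using U(1) by (rule openin_Int)
    have i: "opA (h ` ((X - C) \<inter> U))" by (rule img_open[OF o]) simp
    obtain f where f: "f \<in> carrier A" "h y \<in> bopen A f" "bopen A f \<subseteq> h ` ((X - C) \<inter> U)"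
      using A.zariski_basis[OF i, of "h y"] n y(1) U_sub by blast
    have "f \<notin> I" using f(2) y(2) by simp
    then obtain z where z: "z \<in> C \<inter> U" "f \<notin> h z" using f(1) by (auto simp: I_def)
    have "h z \<in> bopen A f" using z h_spec by simp
    hence "h z \<in> h ` ((X - C) \<inter> U)" using f(3) by blast
    hence "z \<in> X - C" using inj_on_image_mem_iff[OF h_inj, of z "(X - C) \<inter> U"] z(1) by auto
    thus False using z by blast
  qed
  have "cl y \<subseteq> C" by (rule closure_of_minimal) (use yC C(1) in auto)
  moreover have "C \<subseteq> cl y"
  proof -
    have "C \<subseteq> cl y \<union> (X - U)"
    proof
      fix z assume z: "z \<in> C"
      show "z \<in> cl y \<union> (X - U)"
      proof (cases "z \<in> U")
        case True
        hence "h y \<subseteq> h z" using z y(2) by (auto simp: I_def)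
        thus ?thesis using spec_closure[OF True y(1)] by simp
      qed (use z CX in auto)
    qed
    moreover have "closedin (base Sch) (cl y)" by (rule closedin_closure_of)
    moreover have "closedin (base Sch) (X - U)" by (rule closedin_diff[OF closedin_topspace U(1)])
    ultimately have "C \<subseteq> cl y \<or> C \<subseteq> X - U" using C(2) unfolding irreducible_set_def by blast
    thus ?thesis using y0 by blast
  qed
  ultimately show ?thesis using y(1) by blast
qed

lemma cl_irreducible: "y \<in> X \<Longrightarrow> irreducible_set (base Sch) (cl y)"
  unfolding irreducible_set_def
proof (intro conjI allI impI)
  assume y: "y \<in> X"
  have yc: "y \<in> cl y" using y cl_iff by blast
  thus "cl y \<noteq> {}" by blast
  show "cl y \<subseteq> X" by (rule closure_of_subset_topspace)
  fix B C assume "closedin (base Sch) B \<and> closedin (base Sch) C \<and> cl y \<subseteq> B \<union> C"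
  hence c: "closedin (base Sch) B" "closedin (base Sch) C" "y \<in> B \<or> y \<in> C" using yc by blast+
  show "cl y \<subseteq> B \<or> cl y \<subseteq> C" using c(3) closure_of_minimal[of "{y}" B] closure_of_minimal[of "{y}" C] c(1,2) by auto
qed

lemma cl_sub:
  assumes y: "y \<in> U" and z: "z \<in> U"
  shows "cl y \<subseteq> cl z \<longleftrightarrow> h z \<subseteq> h y"
proof -
  have "cl y \<subseteq> cl z \<longleftrightarrow> y \<in> cl z"
    using cl_iff[of y y] y U_sub closure_of_minimal[of "{y}" "cl z" "base Sch"] by auto
  thus ?thesis using spec_closure[OF y z] by simp
qed

lemma cl_xi: "cl \<xi> = X" using gp0 by (simp add: generic_point_def)

text \<open>Irreducible closed sets containing \<open>Y\<close> meet \<open>U\<close> and so are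
  closures of points of \<open>U\<close>, that is, primes inside \<open>h Y\<close>. Codimension one
  then means that \<open>h Y\<close> is non-zero and no prime lies strictly between it and
  zero.\<close>

lemma P_iff:
  assumes Y: "Y \<in> U"
  shows "Y \<in> P \<longleftrightarrow> kf.hprime (j ` h Y)"
proof -
  let ?chain = "\<lambda>n C. C 0 = cl Y \<and> (\<forall>i\<le>n. closedin (base Sch) (C i) \<and> irreducible_set (base Sch) (C i)) \<and> (\<forall>i<n. C i \<subset> C (Suc i))"
  have YX: "Y \<in> X" using Y U_sub by blast
  have P: "Y \<in> P \<longleftrightarrow> Sup {enat n | n. \<exists>C :: nat \<Rightarrow> 'p set. ?chain n C} = 1"
    using YX by (simp add: prime_divisors_def codim_def)
  have zero_img: "j ` h y = {0[F]} \<longleftrightarrow> h y = {0[A]}" if y: "y \<in> U" for y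
    using j_sub[OF y xi_U] j_sub[OF xi_U y] h_xi ring_hom_cring.hom_zero[OF ring_hom_cringI[OF Acr F_cring j_hom]]
    by (metis equalityI image_empty image_insert subset_refl)
  have clc: "closedin (base Sch) (cl y)" for y by simp
  show ?thesis
  proof
    assume YP: "Y \<in> P"
    have sup: "Sup {enat n | n. \<exists>C :: nat \<Rightarrow> 'p set. ?chain n C} = 1" using P YP by simp
    have le: "n \<le> 1" if "?chain n C" for n and C :: "nat \<Rightarrow> 'p set"
    proof -
      have "enat n \<le> Sup {enat n | n. \<exists>C :: nat \<Rightarrow> 'p set. ?chain n C}" by (rule Sup_upper) (use that in blast)
      thus ?thesis using sup by (simp add: one_enat_def)
    qed
    have "h Y \<noteq> {0[A]}"
    proof
      assume "h Y = {0[A]}"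
      hence "Y = \<xi>" using h_xi h_inj Y xi_U by (simp add: inj_on_def)
      hence top: "cl Y = X" using cl_xi by simp
      have "n = 0" if "?chain n C" for n and C :: "nat \<Rightarrow> 'p set"
      proof (rule ccontr)
        assume "n \<noteq> 0"
        hence "C 0 \<subset> C (Suc 0)" "irreducible_set (base Sch) (C (Suc 0))" using that by auto
        thus False using that top by (auto simp: irreducible_set_def)
      qed
      hence "Sup {enat n | n. \<exists>C :: nat \<Rightarrow> 'p set. ?chain n C} \<le> 0"
        by (intro Sup_least) (auto simp: zero_enat_def)
      thus False using sup by simp
    qed
    moreover have "q = j ` h Y" if q: "kf.fprime q" "q \<noteq> {0[F]}" "q \<subseteq> j ` h Y" for q
    proof (rule ccontr)
      assume ne: "q \<noteq> j ` h Y"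
      obtain y where y: "y \<in> U" "q = j ` h y" using fprime_h[OF q(1)] by blast
      have s1: "h y \<subseteq> h Y" using q(3) y j_sub[OF y(1) Y] by simp
      have s2: "\<not> h Y \<subseteq> h y" using ne s1 y by blast
      have s3: "\<not> h y \<subseteq> h \<xi>" using q(2) y zero_img[OF y(1)] h_xi A.spec_zero[OF h_spec[OF y(1)]] by auto
      \<comment> \<open>A non-zero prime strictly inside \<open>h Y\<close> refines the chain from
        the closure of \<open>Y\<close> to the whole space, giving length two.\<close>
      let ?C = "\<lambda>i::nat. if i = 0 then cl Y else if i = 1 then cl y else cl \<xi>"
      have "?chain 2 ?C"
      proof (intro conjI allI impI)
        show "?C i \<subset> ?C (Suc i)" if "i < 2" for i
        proof -
          have "i = 0 \<or> i = 1" using that by auto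
          thus ?thesis using cl_sub[OF Y y(1)] cl_sub[OF y(1) Y] cl_sub[OF y(1) xi_U] cl_sub[OF xi_U y(1)] s1 s2 s3 h_xi_least[OF y(1)]
            by auto
        qed
        show "irreducible_set (base Sch) (?C i)" for i
          using cl_irreducible YX y(1) U_sub xi_X by auto
      qed (use clc in simp_all)
      hence "2 \<le> (1::nat)" by (rule le)
      thus False by simp
    qed
    ultimately show "kf.hprime (j ` h Y)" unfolding kf.hprime_def using h_fprime[OF Y] zero_img[OF Y] by blast
  next
    assume hp: "kf.hprime (j ` h Y)"
    have ne: "\<not> h Y \<subseteq> h \<xi>" using hp zero_img[OF Y] h_xi A.spec_zero[OF h_spec[OF Y]] unfolding kf.hprime_def by auto
    let ?C = "\<lambda>i::nat. if i = 0 then cl Y else cl \<xi>"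
    have c1: "?chain 1 ?C"
      using cl_irreducible YX xi_X cl_sub[OF Y xi_U] cl_sub[OF xi_U Y] ne h_xi_least[OF Y] by auto
    have le: "n \<le> 1" if ch: "?chain n C" for n and C :: "nat \<Rightarrow> 'p set"
    proof (rule ccontr)
      assume n: "\<not> n \<le> 1"
      have lt: "C 0 \<subset> C 1" "C 1 \<subset> C 2" using ch n by (auto simp: numeral_2_eq_2)
      have irr: "closedin (base Sch) (C i)" "irreducible_set (base Sch) (C i)" if "i \<le> 2" for i using ch n that by auto
      have Yc: "Y \<in> C 0" using ch YX cl_iff by auto
      \<comment> \<open>All members of the chain contain \<open>Y\<close>, so they meet the chart
        and are closures of points in it.\<close>
      obtain y1 where y1: "y1 \<in> U" "C 1 = cl y1" using irreducible_point[OF irr[of 1]] lt Yc Y by auto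
      obtain y2 where y2: "y2 \<in> U" "C 2 = cl y2" using irreducible_point[OF irr[of 2]] lt Yc Y by auto
      have "h y1 \<subseteq> h Y" "\<not> h Y \<subseteq> h y1" "h y2 \<subseteq> h y1" "\<not> h y1 \<subseteq> h y2"
        using lt ch y1 y2 cl_sub[OF Y y1(1)] cl_sub[OF y1(1) Y] cl_sub[OF y1(1) y2(1)] cl_sub[OF y2(1) y1(1)] by auto
      moreover have "\<not> h y1 \<subseteq> {0[A]}" using calculation(4) A.spec_zero[OF h_spec[OF y2(1)]] by blast
      ultimately have "kf.fprime (j ` h y1)" "j ` h y1 \<noteq> {0[F]}" "j ` h y1 \<subseteq> j ` h Y" "j ` h y1 \<noteq> j ` h Y"
        using h_fprime[OF y1(1)] zero_img[OF y1(1)] j_sub[OF y1(1) Y] j_sub[OF Y y1(1)] by auto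
      thus False using hp unfolding kf.hprime_def by blast
    qed
    have "Sup {enat n | n. \<exists>C :: nat \<Rightarrow> 'p set. ?chain n C} = 1"
    proof (rule antisym)
      show "Sup {enat n | n. \<exists>C :: nat \<Rightarrow> 'p set. ?chain n C} \<le> 1"
        by (rule Sup_least) (use le in \<open>auto simp: one_enat_def\<close>)
      have "\<exists>C :: nat \<Rightarrow> 'p set. ?chain 1 C" by (rule exI[of _ ?C]) (rule c1)
      hence "enat 1 \<in> {enat n | n. \<exists>C :: nat \<Rightarrow> 'p set. ?chain n C}" by (intro CollectI exI[of _ 1] conjI refl)
      hence "enat 1 \<le> Sup {enat n | n. \<exists>C :: nat \<Rightarrow> 'p set. ?chain n C}" by (rule Sup_upper)
      thus "1 \<le> Sup {enat n | n. \<exists>C :: nat \<Rightarrow> 'p set. ?chain n C}" by (simp only: one_enat_def One_nat_def)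
    qed
    thus "Y \<in> P" using P by simp
  qed
qed

lemma P_center: "Y \<in> P \<Longrightarrow> Y \<in> U \<Longrightarrow> \<exists>\<nu>\<in>NN. vr F \<nu> = Oc Y \<and> j ` h Y = kf.center \<nu>"
  using kf.hprime_val[of "j ` h Y"] P_iff[of Y] O_locp[of Y] by auto

text \<open>The height one primes inside \<open>h x\<close> are those of the prime divisors whose
  closure contains \<open>x\<close>, so \<open>locp_inter\<close> applies.\<close>

lemma P_inter:
  assumes x: "x \<in> U"
  shows "Oc x = {z \<in> carrier F. \<forall>Y\<in>P. x \<in> cl Y \<longrightarrow> z \<in> Oc Y}"
proof -
  have "(\<forall>p. kf.hprime p \<and> p \<subseteq> j ` h x \<longrightarrow> z \<in> kf.locp p) \<longleftrightarrow> (\<forall>Y\<in>P. x \<in> cl Y \<longrightarrow> z \<in> Oc Y)" for z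
  proof
    assume *: "\<forall>p. kf.hprime p \<and> p \<subseteq> j ` h x \<longrightarrow> z \<in> kf.locp p"
    show "\<forall>Y\<in>P. x \<in> cl Y \<longrightarrow> z \<in> Oc Y"
    proof (intro ballI impI)
      fix Y assume Y: "Y \<in> P" "x \<in> cl Y"
      have YU: "Y \<in> U" using Y(2) cl_iff U(1) x by blast
      have "h Y \<subseteq> h x" using spec_closure[OF x YU] Y(2) by simp
      hence "j ` h Y \<subseteq> j ` h x" by blast
      thus "z \<in> Oc Y" using * P_iff[OF YU] Y(1) O_locp[OF YU] by blast
    qed
  next
    assume *: "\<forall>Y\<in>P. x \<in> cl Y \<longrightarrow> z \<in> Oc Y"
    show "\<forall>p. kf.hprime p \<and> p \<subseteq> j ` h x \<longrightarrow> z \<in> kf.locp p"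
    proof (intro allI impI)
      fix p assume p: "kf.hprime p \<and> p \<subseteq> j ` h x"
      hence "kf.fprime p" by (simp add: kf.hprime_def)
      then obtain Y where Y: "Y \<in> U" "p = j ` h Y" using fprime_h by blast
      have "Y \<in> P" using P_iff[OF Y(1)] p Y(2) by simp
      moreover have "x \<in> cl Y" using p Y j_sub[OF Y(1) x] spec_closure[OF x Y(1)] by simp
      ultimately show "z \<in> kf.locp p" using * O_locp[OF Y(1)] Y(2) by blast
    qed
  qed
  thus ?thesis using kf.locp_inter[OF h_fprime[OF x]] O_locp[OF x] by simp
qed

end

section \<open>The valuations of all prime divisors on the whole scheme\<close>

context kscheme
begin

sublocale F: field F by (rule F_field)

abbreviation "\<nu> \<equiv> nu Sch \<xi>"

lemma rat_units: "rat_units Sch \<xi> = F.nz"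
  by (simp add: rat_units_def)

lemma P_X: "Y \<in> P \<Longrightarrow> Y \<in> X"
  by (simp add: prime_divisors_def)

text \<open>The definite description in \<open>nu\<close> is met by a member of the defining family
  on a chart around \<open>Y\<close>; a discrete valuation is determined by its valuation ring, so
  nothing else meets it.\<close>

lemma nu_props:
  assumes Y: "Y \<in> P"
  shows nu_dval: "dval F (\<nu> Y)" and nu_O: "vr F (\<nu> Y) = Oc Y"
proof -
  obtain U A h \<phi> where YU: "Y \<in> U" and c: "krull_chart Sch \<xi> U A h \<phi>" by (rule chart_at[OF P_X[OF Y]])
  interpret krull_chart Sch \<xi> U A h \<phi> by (rule c)
  obtain n where n: "n \<in> NN" "vr F n = Oc Y" using P_center[OF Y YU] by blast
  have dn: "dval F n" by (rule kf.N[OF n(1)])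
  let ?Q = "\<lambda>\<nu>. \<nu> \<in> extensional (rat_units Sch \<xi>) \<and> discrete_K_valuation trivK (triv_graded F) \<nu> \<and>
     K_valuation_ring trivK (triv_graded F) \<nu> = Oc Y"
  have iff: "?Q \<nu> \<longleftrightarrow> \<nu> \<in> extensional F.nz \<and> dval F \<nu> \<and> vr F \<nu> = Oc Y" for \<nu>
    by (cases "dval F \<nu>") (simp_all add: dval_iff[OF F_field] vr_generate[OF F_field] rat_units)
  \<comment> \<open>\<open>nu\<close> is required to be extensional, so the member is cut down to
    the non-zero rational functions.\<close>
  let ?n = "restrict n F.nz"
  have "dval F ?n" unfolding dval_def
  proof (intro conjI ballI impI)
    show "?n ` F.nz = UNIV" using dn by (simp add: dval_def)
    show "?n (x *[F] y) = ?n x + ?n y" if "x \<in> F.nz" "y \<in> F.nz" for x y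
      using F.nz_mult[OF that] F.dval_mult[OF dn that] that by simp
    show "min (?n x) (?n y) \<le> ?n (x +[F] y)" if "x \<in> F.nz" "y \<in> F.nz" "x +[F] y \<noteq> 0[F]" for x y
      using F.dval_add[OF dn that] that by simp
  qed
  moreover have "vr F ?n = Oc Y" using n(2) by (auto simp: vr_def)
  ultimately have "?Q ?n" unfolding iff by simp
  moreover have "\<mu> = ?n" if "?Q \<mu>" for \<mu>
  proof (rule extensionalityI[of _ F.nz])
    show "\<mu> \<in> extensional F.nz" "?n \<in> extensional F.nz" using that unfolding iff by auto
    show "\<mu> x = ?n x" if "x \<in> F.nz" for x
      using F.dval_unique[of \<mu> ?n x] \<open>?Q \<mu>\<close> \<open>?Q ?n\<close> that unfolding iff by simp
  qed
  ultimately have "\<exists>!\<nu>. ?Q \<nu>" by (rule ex1I)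
  from theI'[OF this] have "?Q (\<nu> Y)" unfolding nu_def .
  thus "dval F (\<nu> Y)" "vr F (\<nu> Y) = Oc Y" unfolding iff by auto
qed

text \<open>On each of finitely many charts the prime divisors inject into the defining family,
  since the center of a member recovers the prime, and only finitely many members are non-zero at
  \<open>f\<close>.\<close>

lemma nu_fin:
  assumes f: "f \<in> F.nz"
  shows "finite {Y \<in> P. \<nu> Y f \<noteq> 0}"
proof -
  obtain \<C> where C: "finite \<C>" "\<Union>\<C> = X" "\<forall>U\<in>\<C>. U \<noteq> {} \<and> (\<exists>A h \<phi>. krull_chart Sch \<xi> U A h \<phi>)" using cover by blast
  have fin: "finite {Y \<in> P \<inter> U. \<nu> Y f \<noteq> 0}" if U: "U \<in> \<C>" for U
  proof -
    obtain A h \<phi> where c: "krull_chart Sch \<xi> U A h \<phi>" using C(3) U by blast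
    interpret krull_chart Sch \<xi> U A h \<phi> by (rule c)
    have "\<forall>Y. \<exists>n. Y \<in> P \<inter> U \<longrightarrow> n \<in> NN \<and> vr F n = Oc Y \<and> j ` h Y = kf.center n" using P_center by blast
    then obtain t where t: "\<And>Y. Y \<in> P \<inter> U \<Longrightarrow> t Y \<in> NN \<and> vr F (t Y) = Oc Y \<and> j ` h Y = kf.center (t Y)" by metis
    have "inj_on t (P \<inter> U)"
    proof (rule inj_onI)
      fix Y Z assume Y: "Y \<in> P \<inter> U" and Z: "Z \<in> P \<inter> U" and e: "t Y = t Z"
      have "j ` h Y = j ` h Z" using t[OF Y] t[OF Z] e by simp
      hence "h Y = h Z" using j_sub[of Y Z] j_sub[of Z Y] Y Z by auto
      thus "Y = Z" using h_inj Y Z by (auto simp: inj_on_def)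
    qed
    hence i: "inj_on t {Y \<in> P \<inter> U. \<nu> Y f \<noteq> 0}" by (rule inj_on_subset) auto
    have "t ` {Y \<in> P \<inter> U. \<nu> Y f \<noteq> 0} \<subseteq> {n \<in> NN. n f \<noteq> 0}"
    proof
      fix n assume "n \<in> t ` {Y \<in> P \<inter> U. \<nu> Y f \<noteq> 0}"
      then obtain Y where Y: "n = t Y" "Y \<in> P \<inter> U" "\<nu> Y f \<noteq> 0" by blast
      have "\<nu> Y f = t Y f"
        by (rule F.dval_unique[OF nu_dval kf.N _ f]) (use Y t[OF Y(2)] nu_O[of Y] in auto)
      thus "n \<in> {n \<in> NN. n f \<noteq> 0}" using Y t[OF Y(2)] by simp
    qed
    thus ?thesis by (rule finite_imageD[OF finite_subset[OF _ kf.fin[OF f]] i])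
  qed
  have "{Y \<in> P. \<nu> Y f \<noteq> 0} \<subseteq> (\<Union>U\<in>\<C>. {Y \<in> P \<inter> U. \<nu> Y f \<noteq> 0})" using C(2) P_X by blast
  thus ?thesis by (rule finite_subset) (use C(1) fin in blast)
qed

lemma O_inter:
  assumes x: "x \<in> X"
  shows "Oc x = {z \<in> carrier F. z = 0[F] \<or> (\<forall>Y\<in>P. x \<in> cl Y \<longrightarrow> 0 \<le> \<nu> Y z)}"
proof -
  obtain U A h \<phi> where xU: "x \<in> U" and c: "krull_chart Sch \<xi> U A h \<phi>" by (rule chart_at[OF x])
  interpret krull_chart Sch \<xi> U A h \<phi> by (rule c)
  have "z \<in> Oc Y \<longleftrightarrow> z = 0[F] \<or> 0 \<le> \<nu> Y z" if "Y \<in> P" "z \<in> carrier F" for Y z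
    using nu_O[OF that(1)] that(2) by (auto simp: vr_def)
  thus ?thesis unfolding P_inter[OF xU] by auto
qed

text \<open>If the generic point were in the closure of \<open>Y\<close>, every rational function
  would be regular at \<open>Y\<close>, against a function of value \<open>-1\<close>.\<close>

lemma xi_notin: "Y \<in> P \<Longrightarrow> \<xi> \<notin> cl Y"
proof
  assume Y: "Y \<in> P" and xi: "\<xi> \<in> cl Y"
  obtain z where z: "z \<in> F.nz" "\<nu> Y z = -1" using F.dval_surj[OF nu_dval[OF Y], of "-1"] by blast
  have "z \<in> Oc Y"
  proof -
    have "z \<in> carrier F" using z(1) by simp
    then obtain W s where W: "op W" "\<xi> \<in> W" "s \<in> secs Sch W" "z = gO W s"
      by (rule stalkE)
    have "Y \<in> W" using xi cl_iff W by blast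
    thus ?thesis using cospec_Sch_germ[OF W(1) _ W(3)] W(4) stalkI[OF W(1) _ W(3)] by (metis imageI)
  qed
  thus False using nu_O[OF Y] z(2) F.vr_nz[OF z(1), of "\<nu> Y"] by simp
qed

text \<open>With a common denominator \<open>w\<close> outside the prime,
  \<open>w y + w z = w\<close> shows that \<open>w y\<close> or \<open>w z\<close> is outside too,
  and that summand is a unit at \<open>x\<close>. The conclusion is phrased through values because
  it is used for the Cox sheaf.\<close>

lemma local_O:
  assumes x: "x \<in> X" and z: "y \<in> stks Sch x" "z \<in> stks Sch x" "y +[stalk Sch x] z = 1[stalk Sch x]"
  shows "cO y \<noteq> 0[F] \<and> (\<forall>Y\<in>P. x \<in> cl Y \<longrightarrow> \<nu> Y (cO y) = 0) \<or>
    cO z \<noteq> 0[F] \<and> (\<forall>Y\<in>P. x \<in> cl Y \<longrightarrow> \<nu> Y (cO z) = 0)"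
proof -
  obtain U A h \<phi> where xU: "x \<in> U" and c: "krull_chart Sch \<xi> U A h \<phi>" by (rule chart_at[OF x])
  interpret krull_chart Sch \<xi> U A h \<phi> by (rule c)
  let ?q = "j ` h x" and ?y = "cO y" and ?z = "cO z"
  note D = kf.fprimeD[OF h_fprime[OF xU]]
  have yF: "?y \<in> carrier F" and zF: "?z \<in> carrier F" using ring_hom_closed[OF O_hom[OF x]] z by auto
  have e: "?y +[F] ?z = 1[F]" using ring_hom_add[OF O_hom[OF x] z(1,2)] ring_hom_one[OF O_hom[OF x]] z(3) by simp
  have "?y \<in> kf.locp ?q" "?z \<in> kf.locp ?q" using O_locp[OF xU] z by blast+
  then obtain s t where s: "s \<in> j ` carrier A" "s \<notin> ?q" "s *[F] ?y \<in> j ` carrier A"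
    and t: "t \<in> j ` carrier A" "t \<notin> ?q" "t *[F] ?z \<in> j ` carrier A" unfolding kf.locp_def by blast
  note sF = kf.A_sub[OF s(1)] and tF = kf.A_sub[OF t(1)]
  let ?w = "s *[F] t"
  have wA: "?w \<in> j ` carrier A" by (rule kf.A_mult[OF s(1) t(1)])
  have wq: "?w \<notin> ?q" using D(6)[OF s(1) t(1)] s(2) t(2) by blast
  have wy: "?w *[F] ?y \<in> j ` carrier A"
    using kf.A_mult[OF t(1) s(3)] sF tF yF by (simp add: F.m_assoc F.m_lcomm)
  have wz: "?w *[F] ?z \<in> j ` carrier A"
    using kf.A_mult[OF s(1) t(3)] sF tF zF by (simp add: F.m_assoc)
  \<comment> \<open>If \<open>w v\<close> avoids the prime, the inverse of \<open>v\<close> is the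
    fraction of \<open>w\<close> by \<open>w v\<close> and hence regular at \<open>x\<close>; both
    values are then non-negative with sum zero.\<close>
  have key: "v \<noteq> 0[F] \<and> (\<forall>Y\<in>P. x \<in> cl Y \<longrightarrow> \<nu> Y v = 0)"
    if v: "v \<in> Oc x" "v \<in> carrier F" "?w *[F] v \<in> j ` carrier A" "?w *[F] v \<notin> ?q" for v
  proof -
    have v0: "v \<noteq> 0[F]" using v(4) D(2) F.r_null[OF kf.A_sub[OF wA]] by metis
    hence vn: "v \<in> F.nz" using v(2) by simp
    have i: "inv[F] v \<in> F.nz" by (rule F.nz_inv[OF vn])
    have "(?w *[F] v) *[F] inv[F] v = ?w" using kf.A_sub[OF wA] vn i F.nz_r_inv[OF vn] by (simp add: F.m_assoc)
    hence "(?w *[F] v) *[F] inv[F] v \<in> j ` carrier A" using wA by (simp only:)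
    hence "\<exists>s\<in>j ` carrier A. s \<notin> ?q \<and> s *[F] inv[F] v \<in> j ` carrier A" using v(3,4) by blast
    hence "inv[F] v \<in> kf.locp ?q" unfolding kf.locp_def using DiffD1[OF i] by blast
    hence iO: "inv[F] v \<in> Oc x" using O_locp[OF xU] by simp
    have "\<nu> Y v = 0" if Y: "Y \<in> P" "x \<in> cl Y" for Y
    proof -
      have "0 \<le> \<nu> Y v" "0 \<le> \<nu> Y (inv[F] v)" using v(1) iO Y vn i unfolding O_inter[OF x] by auto
      thus ?thesis using F.dval_inv[OF nu_dval[OF Y(1)] vn] by simp
    qed
    thus ?thesis using v0 by blast
  qed
  have "?w *[F] ?y +[F] ?w *[F] ?z = ?w" using e yF zF kf.A_sub[OF wA] F.r_distr[OF yF zF kf.A_sub[OF wA]] by simp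
  hence "?w *[F] ?y \<notin> ?q \<or> ?w *[F] ?z \<notin> ?q" using D(4) wq by metis
  thus ?thesis using key[OF _ yF wy] key[OF _ zF wz] z(1,2) by blast
qed

text \<open>Were the value at \<open>Y\<close> zero, the inverse of \<open>f\<close> would be
  regular at \<open>Y\<close> and the germ of \<open>f\<close> a unit there, which
  \<open>germ_unit\<close> excludes for \<open>f\<close> in \<open>h Y\<close>. That
  \<open>f\<close> is outside \<open>h \<xi>\<close> makes it a non-zero rational function.\<close>

lemma affine_vanishing:
  assumes c: "aff_chart Sch \<xi> U A h \<phi>" and Y: "Y \<in> P" "Y \<in> U" and f: "f \<in> carrier A" "f \<in> h Y" "f \<notin> h \<xi>"
  shows "gO U (aff_chart.g A \<phi> f) \<in> F.nz" "0 < \<nu> Y (gO U (aff_chart.g A \<phi> f))"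
    "\<forall>Z\<in>P \<inter> U. 0 \<le> \<nu> Z (gO U (aff_chart.g A \<phi> f))"
proof -
  interpret aff_chart Sch \<xi> U A h \<phi> by (rule c)
  let ?z = "gO U (g f)"
  have zU: "?z \<in> Units F" using germ_unit[OF xi_U f(1)] f(3) by simp
  thus zn: "?z \<in> F.nz" by (simp add: F.field_Units)
  have gc: "g f \<in> secs Sch U" by (rule g_closed[OF f(1)])
  have zO: "?z \<in> Oc Z" if "Z \<in> U" for Z
    using cospec_Sch_germ[OF U(1) that gc] stalkI[OF U(1) that gc] by (metis imageI)
  show nn: "\<forall>Z\<in>P \<inter> U. 0 \<le> \<nu> Z ?z" using zO nu_O F.vr_nz[OF zn] by blast
  have "\<nu> Y ?z \<noteq> 0"
  proof
    assume z0: "\<nu> Y ?z = 0"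
    have i: "inv[F] ?z \<in> F.nz" by (rule F.nz_inv[OF zn])
    have "\<nu> Y (inv[F] ?z) = 0" using F.dval_inv[OF nu_dval[OF Y(1)] zn] z0 by simp
    hence "inv[F] ?z \<in> Oc Y" using nu_O[OF Y(1)] F.vr_nz[OF i, of "\<nu> Y"] by simp
    then obtain w where w: "inv[F] ?z = cO w" "w \<in> stks Sch Y" by (rule imageE)
    let ?y = "germ Sch Y U (g f)"
    have y: "?y \<in> stks Sch Y" by (rule stalkI[OF U(1) Y(2) gc])
    interpret S: cring "stalk Sch Y" by (rule stalk_cring[OF P_X[OF Y(1)]])
    have "cO (?y *[stalk Sch Y] w) = ?z *[F] inv[F] ?z"
      using ring_hom_mult[OF O_hom[OF P_X[OF Y(1)]] y w(2)] cospec_Sch_germ[OF U(1) Y(2) gc] w(1) by simp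
    also have "\<dots> = cO 1[stalk Sch Y]" using F.nz_r_inv[OF zn] ring_hom_one[OF O_hom[OF P_X[OF Y(1)]]] by simp
    finally have "?y *[stalk Sch Y] w = 1[stalk Sch Y]"
      by (rule inj_onD[OF cospec_inj]) (use y w(2) in auto)
    hence "?y \<in> Units (stalk Sch Y)" using y w(2) S.m_comm[OF y w(2)] unfolding Units_def by auto
    thus False using germ_unit[OF Y(2) f(1)] f(2) by simp
  qed
  thus "0 < \<nu> Y ?z" using nn Y by force
qed

end

section \<open>Stalks of graded sheaves\<close>

lemma gstalk_simps [simp]:
  "carrier (gstalk R x) = stks R x" "monoid.mult (gstalk R x) = monoid.mult (stalk R x)"
  "ring.add (gstalk R x) = ring.add (stalk R x)" "monoid.one (gstalk R x) = monoid.one (stalk R x)"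
  "ring.zero (gstalk R x) = ring.zero (stalk R x)"
  "gcomp (gstalk R x) w = {germ R x U s | U s. opens R U \<and> x \<in> U \<and> s \<in> gcomp (sec R U) w}"
  by (simp_all add: gstalk_def ring.defs gring.defs)

locale gsheaf =
  fixes K :: "('k, 'l) monoid_scheme" and R :: "('p, 'r, ('r, 'k, 'm) gring_ext) sheaf"
  assumes gr: "graded_sheaf K R"

sublocale gsheaf \<subseteq> rsheaf R
  using gr by unfold_locales (simp add: graded_sheaf_def)

context gsheaf
begin

lemma sec_grd: "op U \<Longrightarrow> grd K (sec R U)"
  using gr by (intro grdI) (simp add: graded_sheaf_def)

lemma restr_gcomp: "op U \<Longrightarrow> op V \<Longrightarrow> V \<subseteq> U \<Longrightarrow> w \<in> carrier K \<Longrightarrow> s \<in> gcomp (sec R U) w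
  \<Longrightarrow> restr R U V s \<in> gcomp (sec R V) w"
  using gr unfolding graded_sheaf_def by blast

lemma gcomp_sec: "op U \<Longrightarrow> w \<in> carrier K \<Longrightarrow> s \<in> gcomp (sec R U) w \<Longrightarrow> s \<in> secs R U"
  by (rule grd.gcomp_carrier[OF sec_grd])

lemma gstalkE:
  assumes "z \<in> gcomp (gstalk R x) w" "w \<in> carrier K" "op V" "x \<in> V"
  obtains U s where "op U" "x \<in> U" "U \<subseteq> V" "s \<in> gcomp (sec R U) w" "z = germ R x U s"
proof -
  obtain U s where *: "op U" "x \<in> U" "s \<in> gcomp (sec R U) w" "z = germ R x U s" using assms(1) by auto
  have o: "op (U \<inter> V)" using * assms by (simp add: openin_Int)
  show ?thesis
    by (rule that[OF o, of "restr R U (U \<inter> V) s"])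
      (use * assms o germ_restr[OF *(1) o] restr_gcomp[OF *(1) o] gcomp_sec in auto)
qed

lemma gstalk_common:
  assumes "finite J" "x \<in> topspace (base R)" "\<And>w. w \<in> J \<Longrightarrow> w \<in> carrier K \<and> c w \<in> gcomp (gstalk R x) w"
  shows "\<exists>V s. op V \<and> x \<in> V \<and> (\<forall>w\<in>J. s w \<in> gcomp (sec R V) w \<and> c w = germ R x V (s w))"
  using assms
proof (induction J rule: finite_induct)
  case empty
  thus ?case by (intro exI[of _ "topspace (base R)"]) simp
next
  case (insert v J)
  then obtain V s where V: "op V" "x \<in> V" "\<forall>w\<in>J. s w \<in> gcomp (sec R V) w \<and> c w = germ R x V (s w)" by blast
  have vK: "v \<in> carrier K" and cv: "c v \<in> gcomp (gstalk R x) v" using insert.prems by auto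
  obtain U t where U: "op U" "x \<in> U" "U \<subseteq> V" "t \<in> gcomp (sec R U) v" "c v = germ R x U t"
    by (rule gstalkE[OF cv vK V(1,2)])
  let ?s = "\<lambda>w. if w = v then t else restr R V U (s w)"
  have "?s w \<in> gcomp (sec R U) w \<and> c w = germ R x U (?s w)" if w: "w \<in> insert v J" for w
  proof (cases "w = v")
    case False
    hence wJ: "w \<in> J" and wK: "w \<in> carrier K" using w insert.prems by auto
    show ?thesis using False V(3) wJ restr_gcomp[OF V(1) U(1,3) wK] germ_restr[OF V(1) U(1,2,3) gcomp_sec[OF V(1) wK]] by simp
  qed (use U in simp)
  thus ?case by (intro exI[of _ U] exI[of _ ?s] conjI ballI U(1,2)) auto
qed

text \<open>Finitely many homogeneous germs live over one neighbourhood. If their sum is zero, it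
  vanishes over a smaller one, where the grading of the sections separates the terms.\<close>

theorem gstalk_graded:
  assumes x: "x \<in> topspace (base R)"
  shows "graded_ring K (gstalk R x)"
proof -
  have T: "op (topspace (base R))" by simp
  have KG: "comm_group K" using sec_grd[OF T] by (simp add: grd_def)
  let ?G = "gstalk R x"
  interpret St: cring "stalk R x" by (rule stalk_cring[OF x])
  have G: "cring ?G"
    by (rule cring_transport[OF St.cring_axioms, of id]) (auto simp: ring_hom_def bij_betw_def)
  interpret G: cring ?G by (rule G)
  have gh: "germ R x U \<in> ring_hom (sec R U) ?G" if "op U" "x \<in> U" for U
    using germ_hom[OF that] by (simp add: ring_hom_def)
  have rh: "ring_hom_cring (sec R U) ?G (germ R x U)" if "op U" "x \<in> U" for U
    by (rule ring_hom_cringI[OF sec_cring[OF that(1)] G gh[OF that]])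
  show ?thesis
  proof (rule graded_ringI[OF KG G])
    fix w assume w: "w \<in> carrier K"
    have sub: "gcomp ?G w \<subseteq> carrier ?G" using stalkI gcomp_sec[OF _ w] by auto
    have cl: "a +[?G] b \<in> gcomp ?G w \<and> \<ominus>[?G] a \<in> gcomp ?G w" if a: "a \<in> gcomp ?G w" and b: "b \<in> gcomp ?G w" for a b
    proof -
      obtain V s where V: "op V" "x \<in> V" "s \<in> gcomp (sec R V) w" "a = germ R x V s" using a by auto
      obtain U t where U: "op U" "x \<in> U" "U \<subseteq> V" "t \<in> gcomp (sec R U) w" "b = germ R x U t"
        by (rule gstalkE[OF b w V(1,2)])
      interpret g: grd K "sec R U" by (rule sec_grd[OF U(1)])
      interpret h: ring_hom_cring "sec R U" ?G "germ R x U" by (rule rh[OF U(1,2)])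
      let ?s = "restr R V U s"
      have s: "?s \<in> gcomp (sec R U) w" by (rule restr_gcomp[OF V(1) U(1,3) w V(3)])
      have a': "a = germ R x U ?s" using germ_restr[OF V(1) U(1,2,3) gcomp_sec[OF V(1) w V(3)]] V(4) by simp
      note c = g.gcomp_carrier[OF w s] g.gcomp_carrier[OF w U(4)]
      have "a +[?G] b = germ R x U (?s +[sec R U] t)" "\<ominus>[?G] a = germ R x U (\<ominus>[sec R U] ?s)"
        unfolding a' U(5) using c by (simp_all del: gstalk_simps)
      thus ?thesis using g.gcomp_add[OF w s U(4)] g.gcomp_neg[OF w s] U(1,2) unfolding gstalk_simps(6) by blast
    qed
    have "0[?G] \<in> gcomp ?G w"
      using germ_zero[OF T x] grd.gcomp_zero[OF sec_grd[OF T] w] T x by (auto intro!: exI[of _ "topspace (base R)"])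
    thus "additive_subgroup (gcomp ?G w) ?G"
      by (intro additive_subgroupI G.add.subgroupI) (use sub cl in \<open>auto simp: a_inv_def simp del: gstalk_simps(6)\<close>)
  next
    fix v w a b assume v: "v \<in> carrier K" and w: "w \<in> carrier K" and a: "a \<in> gcomp ?G v" and b: "b \<in> gcomp ?G w"
    obtain V s where V: "op V" "x \<in> V" "s \<in> gcomp (sec R V) v" "a = germ R x V s" using a by auto
    obtain U t where U: "op U" "x \<in> U" "U \<subseteq> V" "t \<in> gcomp (sec R U) w" "b = germ R x U t"
      by (rule gstalkE[OF b w V(1,2)])
    interpret g: grd K "sec R U" by (rule sec_grd[OF U(1)])
    have s: "restr R V U s \<in> gcomp (sec R U) v" by (rule restr_gcomp[OF V(1) U(1,3) v V(3)])
    have "a = germ R x U (restr R V U s)" using germ_restr[OF V(1) U(1,2,3) gcomp_sec[OF V(1) v V(3)]] V(4) by simp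
    hence "a *[?G] b = germ R x U (restr R V U s *[sec R U] t)"
      using germ_mult[OF U(1,2) g.gcomp_carrier[OF v s] g.gcomp_carrier[OF w U(4)]] U(5) by simp
    thus "a *[?G] b \<in> gcomp ?G (v *[K] w)" using g.gcomp_mult[OF v w s U(4)] U(1,2) unfolding gstalk_simps(6) by blast
  next
    fix a assume "a \<in> carrier ?G"
    hence "a \<in> stks R x" by simp
    then obtain U s where U: "op U" "x \<in> U" "s \<in> secs R U" "a = germ R x U s" by (rule stalkE)
    interpret g: grd K "sec R U" by (rule sec_grd[OF U(1)])
    interpret h: ring_hom_cring "sec R U" ?G "germ R x U" by (rule rh[OF U(1,2)])
    let ?c = "\<lambda>w. germ R x U (hcomp K (sec R U) s w)"
    have "a = germ R x U (finsum (sec R U) (hcomp K (sec R U) s) (g.supp s))"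
      unfolding U(4) by (rule arg_cong[OF g.hcomp_props(3)[OF U(3)]])
    also have "\<dots> = finsum ?G ?c (g.supp s)"
      using h.hom_finsum[of "hcomp K (sec R U) s" "g.supp s"] g.hcomp_carrier[OF U(3)] by (simp add: o_def del: gstalk_simps)
    finally have "a = finsum ?G ?c (g.supp s)" .
    moreover have "\<forall>w\<in>g.supp s. ?c w \<in> gcomp ?G w" using g.hcomp_in[OF U(3)] U(1,2) by auto
    ultimately show "\<exists>c J. finite J \<and> J \<subseteq> carrier K \<and> (\<forall>w\<in>J. c w \<in> gcomp ?G w) \<and> a = finsum ?G c J"
      using g.hcomp_props(2)[OF U(3)] by (intro exI[of _ ?c] exI[of _ "g.supp s"]) auto
  next
    fix c J w assume J: "finite J" "J \<subseteq> carrier K" and c: "\<And>w. w \<in> J \<Longrightarrow> c w \<in> gcomp ?G w"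
      and z: "finsum ?G c J = 0[?G]" and w: "w \<in> J"
    obtain V s where V: "op V" "x \<in> V" and s: "\<forall>w\<in>J. s w \<in> gcomp (sec R V) w \<and> c w = germ R x V (s w)"
      using gstalk_common[OF J(1) x, of c] c J(2) by blast
    interpret g: grd K "sec R V" by (rule sec_grd[OF V(1)])
    interpret h: ring_hom_cring "sec R V" ?G "germ R x V" by (rule rh[OF V])
    have sc: "s u \<in> secs R V" if "u \<in> J" for u using s that J(2) gcomp_sec[OF V(1)] by blast
    have sum: "finsum (sec R V) s J \<in> secs R V" using sc by (intro g.R.finsum_closed) auto
    have "germ R x V (finsum (sec R V) s J) = finsum ?G (germ R x V \<circ> s) J" by (rule h.hom_finsum) (use sc in auto)
    also have "\<dots> = finsum ?G c J" by (rule G.finsum_cong') (use s sc h.hom_closed in auto)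
    also have "\<dots> = germ R x V 0[sec R V]" using z by simp
    finally obtain W where W: "op W" "x \<in> W" "W \<subseteq> V" "restr R V W (finsum (sec R V) s J) = restr R V W 0[sec R V]"
      using germ_eq[OF V sum V g.R.zero_closed] by blast
    interpret g2: grd K "sec R W" by (rule sec_grd[OF W(1)])
    interpret r: ring_hom_cring "sec R V" "sec R W" "restr R V W"
      by (rule ring_hom_cringI[OF g.R.cring_axioms g2.R.cring_axioms restr_ring_hom[OF V(1) W(1,3)]])
    have e: "0[sec R W] = finsum (sec R W) (\<lambda>w. restr R V W (s w)) J"
      using W(4) r.hom_finsum[of s J] sc by (simp add: o_def)
    have wK: "w \<in> carrier K" using w J(2) by blast
    have rc: "restr R V W (s u) \<in> gcomp (sec R W) u" if "u \<in> J" for u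
      using restr_gcomp[OF V(1) W(1,3) subsetD[OF J(2) that]] s that by simp
    have "restr R V W (s w) = 0[sec R W]"
      using g2.hcomp_eqI[OF J rc e wK] g2.hcomp_zero[OF wK] w by simp
    thus "c w = 0[?G]"
      using s w germ_restr[OF V(1) W(1,2,3) sc[OF w]] germ_zero[OF W(1,2)] by simp
  qed
qed

end

section \<open>Divisor class groups\<close>

context kscheme
begin

abbreviation "WD \<equiv> WDiv Sch"
abbreviation "dv \<equiv> pdiv Sch \<xi> X"
abbreviation "K \<equiv> Cl Sch \<xi>"
abbreviation "cls \<equiv> div_class Sch \<xi>"

lemma PX: "P \<inter> X = P"
  using P_X by blast

lemma WD_carrier: "D \<in> carrier WD \<longleftrightarrow> D \<in> extensional P \<and> finite {Y \<in> P. D Y \<noteq> 0}"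
  by (auto simp: wdiv_def carrier_sum_group PX PiE_def)

lemma WD_mult: "D *[WD] E = (\<lambda>Y\<in>P. D Y + E Y)" and WD_one: "1[WD] = (\<lambda>Y\<in>P. 0)"
  by (simp_all add: wdiv_def PX)

lemma WD_inv: "D \<in> carrier WD \<Longrightarrow> inv[WD] D = (\<lambda>Y\<in>P. - D Y)"
  by (simp add: wdiv_def PX)

lemma WD_comm: "comm_group WD"
proof (rule group.group_comm_groupI)
  show "group WD" by (simp add: wdiv_def)
qed (simp add: WD_mult add.commute)

sublocale WD: comm_group WD
  by (rule WD_comm)

lemma dv_apply: "dv f = (\<lambda>Y\<in>P. \<nu> Y f)"
  by (simp add: pdiv_def PX)

lemma dv_WD:
  assumes f: "f \<in> F.nz"
  shows "dv f \<in> carrier WD"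
proof -
  have "{Y \<in> P. dv f Y \<noteq> 0} = {Y \<in> P. \<nu> Y f \<noteq> 0}" by (auto simp: dv_apply)
  thus ?thesis using nu_fin[OF f] by (simp add: WD_carrier dv_apply)
qed

lemma dv_mult: "f \<in> F.nz \<Longrightarrow> g \<in> F.nz \<Longrightarrow> dv (f *[F] g) = dv f *[WD] dv g"
  unfolding dv_apply WD_mult by (intro restrict_ext) (simp only: F.dval_mult[OF nu_dval] restrict_apply if_True)

lemma dv_inv:
  assumes f: "f \<in> F.nz"
  shows "dv (inv[F] f) = inv[WD] (dv f)"
proof -
  show ?thesis unfolding WD_inv[OF dv_WD[OF f]] unfolding dv_apply
    by (intro restrict_ext) (simp only: F.dval_inv[OF nu_dval f] restrict_apply if_True)
qed

lemma Prin: "Prin Sch \<xi> = dv ` F.nz"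
  by (simp add: Prin_def rat_units)

lemma Prin_sub: "subgroup (Prin Sch \<xi>) WD"
proof (rule WD.subgroupI)
  show "Prin Sch \<xi> \<subseteq> carrier WD" using dv_WD Prin by auto
  show "Prin Sch \<xi> \<noteq> {}" using F.nz_one Prin by auto
  show "inv[WD] a \<in> Prin Sch \<xi>" if a: "a \<in> Prin Sch \<xi>" for a
  proof -
    obtain f where "a = dv f" "f \<in> F.nz" using a unfolding Prin by (rule imageE)
    thus ?thesis unfolding Prin using dv_inv F.nz_inv by (metis imageI)
  qed
  show "a *[WD] b \<in> Prin Sch \<xi>" if a: "a \<in> Prin Sch \<xi>" and b: "b \<in> Prin Sch \<xi>" for a b
  proof -
    obtain f where "a = dv f" "f \<in> F.nz" using a unfolding Prin by (rule imageE)
    moreover obtain g where "b = dv g" "g \<in> F.nz" using b unfolding Prin by (rule imageE)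
    ultimately show ?thesis unfolding Prin using dv_mult F.nz_mult by (metis imageI)
  qed
qed

sublocale Pr: normal "Prin Sch \<xi>" WD
  by (rule WD.subgroup_imp_normal[OF Prin_sub])

lemma K_carrier: "carrier K = cls ` carrier WD"
  by (auto simp: Cl_def FactGroup_def RCOSETS_def div_class_def)

lemma cls_K: "D \<in> carrier WD \<Longrightarrow> cls D \<in> carrier K"
  by (simp add: K_carrier)

lemma cls_mult: "D \<in> carrier WD \<Longrightarrow> E \<in> carrier WD \<Longrightarrow> cls D *[K] cls E = cls (D *[WD] E)"
  by (simp add: Cl_def FactGroup_def div_class_def Pr.rcos_sum)

lemma cls_one: "cls 1[WD] = 1[K]"
  by (simp add: Cl_def FactGroup_def div_class_def WD.coset_mult_one Pr.subset)

lemma cls_eq: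
  assumes "D \<in> carrier WD" "E \<in> carrier WD"
  shows "cls D = cls E \<longleftrightarrow> (\<exists>f\<in>F.nz. D = dv f *[WD] E)"
proof
  assume "cls D = cls E"
  hence "D \<in> Prin Sch \<xi> #>\<^bsub>WD\<^esub> E" using WD.rcos_self[OF assms(1) Prin_sub] by (simp add: div_class_def)
  thus "\<exists>f\<in>F.nz. D = dv f *[WD] E" unfolding r_coset_def Prin by blast
next
  assume "\<exists>f\<in>F.nz. D = dv f *[WD] E"
  hence "D \<in> Prin Sch \<xi> #>\<^bsub>WD\<^esub> E" unfolding r_coset_def Prin by blast
  from WD.repr_independence[OF this assms(2) Prin_sub] show "cls D = cls E" by (simp add: div_class_def)
qed

lemma O_sec_iff: "U \<noteq> {} \<Longrightarrow> f \<in> O_sec Sch \<xi> D U \<longleftrightarrow> f \<in> carrier F \<and> (f = 0[F] \<or> (\<forall>Y\<in>P \<inter> U. 0 \<le> \<nu> Y f + D Y))"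
  by (auto simp: O_sec_def rat_sheaf_def const_sheaf_def pdiv_def div_restrict_def)

text \<open>The largest open set over which \<open>f\<close> is a section of the sheaf of
  \<open>D\<close>: the closures of the finitely many polar prime divisors are removed.\<close>

definition dom :: "('p set \<times> 'a) set \<Rightarrow> ('p \<Rightarrow> int) \<Rightarrow> 'p set" where
  "dom f D = (if f = 0[F] then X else X - (\<Union>Y\<in>{Y \<in> P. \<nu> Y f + D Y < 0}. cl Y))"

lemma fin_val:
  assumes f: "f \<in> F.nz" and D: "D \<in> carrier WD"
  shows "finite {Y \<in> P. \<nu> Y f + D Y \<noteq> 0}"
proof -
  have "{Y \<in> P. \<nu> Y f + D Y \<noteq> 0} \<subseteq> {Y \<in> P. \<nu> Y f \<noteq> 0} \<union> {Y \<in> P. D Y \<noteq> 0}" by auto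
  moreover have "finite {Y \<in> P. D Y \<noteq> 0}" using D by (simp add: WD_carrier)
  ultimately show ?thesis using finite_subset[OF _ finite_UnI[OF nu_fin[OF f]]] by blast
qed

lemma dom_props:
  assumes f: "f \<in> carrier F" and D: "D \<in> carrier WD"
  shows "op (dom f D)" "\<xi> \<in> dom f D" "f \<in> O_sec Sch \<xi> D (dom f D)"
proof -
  have fin: "finite {Y \<in> P. \<nu> Y f + D Y < 0}" if "f \<noteq> 0[F]"
  proof -
    have "f \<in> F.nz" using that f by simp
    from fin_val[OF this D] show ?thesis by (rule rev_finite_subset) (simp add: Collect_mono_iff)
  qed
  show "op (dom f D)"
  proof (cases "f = 0[F]")
    case False
    have "closedin (base Sch) (\<Union>Y\<in>{Y \<in> P. \<nu> Y f + D Y < 0}. cl Y)"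
      by (rule closedin_Union) (use fin[OF False] in \<open>simp_all add: image_iff\<close>, blast intro: closedin_closure_of)
    thus ?thesis using False by (simp add: dom_def openin_diff)
  qed (simp add: dom_def)
  show xi: "\<xi> \<in> dom f D" using xi_X xi_notin by (auto simp: dom_def)
  have "Y \<in> cl Y" if "Y \<in> P" for Y using P_X[OF that] cl_iff by blast
  hence "\<forall>Y\<in>P \<inter> dom f D. 0 \<le> \<nu> Y f + D Y" if "f \<noteq> 0[F]"
    using that unfolding dom_def by (auto simp: not_le[symmetric])
  thus "f \<in> O_sec Sch \<xi> D (dom f D)" using O_sec_iff[of "dom f D" f D] xi f by auto
qed

lemma dom_mem: "f \<in> F.nz \<Longrightarrow> x \<in> X \<Longrightarrow> x \<in> dom f D \<longleftrightarrow> (\<forall>Y\<in>P. x \<in> cl Y \<longrightarrow> 0 \<le> \<nu> Y f + D Y)"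
  by (auto simp: dom_def not_le[symmetric])

abbreviation "mo f D \<equiv> gmono F f D"
abbreviation "OW \<equiv> O_WDiv Sch \<xi>"

lemma rat_sec: "U \<noteq> {} \<Longrightarrow> sec (rat_sheaf Sch \<xi>) U = triv_graded F"
  by (simp add: rat_sheaf_def const_sheaf_def)

lemma OW_base: "base OW = base Sch"
  by (simp add: O_WDiv_def)

lemma OW_simps: "U \<noteq> {} \<Longrightarrow> secs OW U = {H \<in> carrier (group_alg (triv_graded F) WD). \<forall>D\<in>carrier WD. H D \<in> O_sec Sch \<xi> D U}"
   "U \<noteq> {} \<Longrightarrow> monoid.mult (sec OW U) = monoid.mult (group_alg (triv_graded F) WD)"
   "U \<noteq> {} \<Longrightarrow> ring.add (sec OW U) = ring.add (group_alg (triv_graded F) WD)"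
   "U \<noteq> {} \<Longrightarrow> monoid.one (sec OW U) = monoid.one (group_alg (triv_graded F) WD)"
   "gcomp (sec OW U) D = {mo f D | f. f \<in> O_sec Sch \<xi> D U}"
  by (simp_all add: O_WDiv_def ring.defs gring.defs rat_sec)

lemma zero_O: "U \<noteq> {} \<Longrightarrow> 0[F] \<in> O_sec Sch \<xi> D U"
  by (simp add: O_sec_iff)

lemma mo_mem: "U \<noteq> {} \<Longrightarrow> D \<in> carrier WD \<Longrightarrow> f \<in> O_sec Sch \<xi> D U \<Longrightarrow> mo f D \<in> secs OW U"
  using O_sec_iff[of U f D] zero_O[of U]
  by (auto simp: OW_simps(1) group_alg_def gmono_def intro: finite_subset[of _ "{D}"])

lemma mo_mult:
  assumes U: "U \<noteq> {}" and D: "D \<in> carrier WD" and E: "E \<in> carrier WD" and f: "f \<in> carrier F" and g: "g \<in> carrier F"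
  shows "mo f D *[sec OW U] mo g E = mo (f *[F] g) (D *[WD] E)"
proof (rule ext)
  fix k
  interpret T: cring "triv_graded F" by (rule triv_cring[OF F.cring_axioms])
  show "(mo f D *[sec OW U] mo g E) k = mo (f *[F] g) (D *[WD] E) k"
  proof (cases "k \<in> carrier WD")
    case True
    have kE: "inv[WD] D *[WD] k = E \<longleftrightarrow> k = D *[WD] E"
      using True D E by (metis WD.inv_solve_left)
    \<comment> \<open>The convolution sum has at most one term; it is empty when \<open>f\<close> is
      zero, a case to be kept apart.\<close>
    have "{h \<in> carrier WD. mo f D h \<noteq> 0[F]} = (if f = 0[F] then {} else {D})"
      using D by (auto simp: gmono_def)
    moreover have "mo f D D = f" by (simp add: gmono_def)
    ultimately have "(mo f D *[sec OW U] mo g E) k = (if f = 0[F] then 0[F] else f *[F] mo g E (inv[WD] D *[WD] k))"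
      using True f g T.r_zero[of "f *[F] mo g E (inv[WD] D *[WD] k)"] by (auto simp: OW_simps(2)[OF U] group_alg_def gmono_def)
    thus ?thesis using f g kE by (auto simp: gmono_def)
  next
    case False
    hence "k \<noteq> D *[WD] E" using D E by auto
    thus ?thesis using False by (simp add: OW_simps(2)[OF U] group_alg_def gmono_def)
  qed
qed

lemma mo_add: "U \<noteq> {} \<Longrightarrow> f \<in> carrier F \<Longrightarrow> g \<in> carrier F \<Longrightarrow> mo f D +[sec OW U] mo g D = mo (f +[F] g) D"
  by (auto simp: OW_simps(3) group_alg_def gmono_def fun_eq_iff)

lemma mo_one: "U \<noteq> {} \<Longrightarrow> 1[sec OW U] = mo 1[F] 1[WD]"
  by (auto simp: OW_simps(4) group_alg_def gmono_def fun_eq_iff)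

lemma mo_restr: "V \<noteq> {} \<Longrightarrow> restr OW U V (mo f D) = mo f D"
  by (auto simp: O_WDiv_def rat_sheaf_def const_sheaf_def)

end

section \<open>Cox sheaves\<close>

locale cox = kscheme Sch \<xi> for Sch :: "('p, 'a, unit) sheaf" and \<xi> :: 'p +
  fixes R :: "('p, 'r, ('p \<Rightarrow> int) set) gsheaf" and \<pi> :: "'p set \<Rightarrow> (('p \<Rightarrow> int) \<Rightarrow> ('p set \<times> 'a) set) \<Rightarrow> 'r"
  assumes Cox: "Cox_sheaf Sch \<xi> R \<pi>"

sublocale cox \<subseteq> R: gsheaf "Cl Sch \<xi>" R
  using Cox by unfold_locales (simp add: Cox_sheaf_def)

context cox
begin

abbreviation "gR \<equiv> germ R \<xi>"
abbreviation "cR \<equiv> cospec R \<xi>"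
abbreviation "scal \<equiv> Cox_scalar Sch \<xi> \<pi>"
abbreviation "stim \<equiv> stalk_image R \<xi>"
abbreviation "gnim \<equiv> generic_image R \<xi>"
abbreviation "gsh \<equiv> generic_sheaf R \<xi>"
abbreviation "cdiv \<equiv> Cox_div Sch \<xi> R \<pi>"

lemma baseR: "base R = base Sch"
  using Cox by (simp add: Cox_sheaf_def graded_sheaf_morphism_def OW_base)

lemma pi_hom: "op U \<Longrightarrow> \<pi> U \<in> ring_hom (sec OW U) (sec R U)"
  using Cox by (simp add: Cox_sheaf_def graded_sheaf_morphism_def OW_base)

lemma pi_restr: "op U \<Longrightarrow> op V \<Longrightarrow> V \<subseteq> U \<Longrightarrow> s \<in> secs OW U \<Longrightarrow> \<pi> V (restr OW U V s) = restr R U V (\<pi> U s)"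
  using Cox by (simp add: Cox_sheaf_def graded_sheaf_morphism_def OW_base)

lemma pi_bij: "op U \<Longrightarrow> D \<in> carrier WD \<Longrightarrow> bij_betw (\<pi> U) (gcomp (sec OW U) D) (gcomp (sec R U) (cls D))"
  using Cox by (simp add: Cox_sheaf_def)

section \<open>Homogeneous sections of the Cox sheaf as images of monomials\<close>

abbreviation "OD \<equiv> O_sec Sch \<xi>"

definition rho :: "'p set \<Rightarrow> ('p set \<times> 'a) set \<Rightarrow> ('p \<Rightarrow> int) \<Rightarrow> 'r" where
  "rho U f D = \<pi> U (mo f D)"

lemma OD_F: "U \<noteq> {} \<Longrightarrow> f \<in> OD D U \<Longrightarrow> f \<in> carrier F"
  by (simp add: O_sec_iff)

lemma OD_mono: "V \<noteq> {} \<Longrightarrow> V \<subseteq> U \<Longrightarrow> f \<in> OD D U \<Longrightarrow> f \<in> OD D V"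
  using O_sec_iff[of U f D] O_sec_iff[of V f D] by (auto simp: Ball_def)

lemma OD_add:
  assumes "U \<noteq> {}" "f \<in> OD D U" "g \<in> OD D U" shows "f +[F] g \<in> OD D U"
proof (cases "f = 0[F] \<or> g = 0[F] \<or> f +[F] g = 0[F]")
  case True thus ?thesis using assms O_sec_iff[of U] by auto
next
  case False
  hence n: "f \<in> F.nz" "g \<in> F.nz" using assms OD_F by auto
  have "0 \<le> \<nu> Y (f +[F] g) + D Y" if Y: "Y \<in> P \<inter> U" for Y
  proof -
    have "0 \<le> \<nu> Y f + D Y" "0 \<le> \<nu> Y g + D Y" using assms O_sec_iff[of U] False Y by auto
    thus ?thesis using F.dval_add[OF nu_dval n, of Y] False Y by (auto simp: min_def split: if_splits)
  qed
  thus ?thesis using O_sec_iff[OF assms(1)] n by auto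
qed

lemma OD_mult:
  assumes "U \<noteq> {}" "f \<in> OD D U" "g \<in> OD E U" shows "f *[F] g \<in> OD (D *[WD] E) U"
proof (cases "f = 0[F] \<or> g = 0[F]")
  case True thus ?thesis using assms O_sec_iff[OF assms(1)] by auto
next
  case False
  hence n: "f \<in> F.nz" "g \<in> F.nz" using assms OD_F by auto
  have "0 \<le> \<nu> Y (f *[F] g) + (D *[WD] E) Y" if Y: "Y \<in> P \<inter> U" for Y
  proof -
    have "0 \<le> \<nu> Y f + D Y" "0 \<le> \<nu> Y g + E Y" using assms O_sec_iff[of U] False Y by auto
    thus ?thesis using F.dval_mult[OF nu_dval n, of Y] Y by (simp add: WD_mult)
  qed
  thus ?thesis using O_sec_iff[OF assms(1)] n by auto
qed

lemma OD_one: "U \<noteq> {} \<Longrightarrow> 1[F] \<in> OD 1[WD] U"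
  using F.dval_one[OF nu_dval] by (simp add: O_sec_iff WD_one)

context
  fixes U assumes U: "op U" "U \<noteq> {}"
begin

lemma rho_gcomp: "D \<in> carrier WD \<Longrightarrow> f \<in> OD D U \<Longrightarrow> rho U f D \<in> gcomp (sec R U) (cls D)"
  using pi_bij[OF U(1), of D] by (auto simp: bij_betw_def rho_def OW_simps(5))

lemma rho_sec: "D \<in> carrier WD \<Longrightarrow> f \<in> OD D U \<Longrightarrow> rho U f D \<in> secs R U"
  using R.gcomp_sec[OF _ cls_K rho_gcomp] U(1) baseR by simp

lemma rho_surj:
  assumes D: "D \<in> carrier WD" and s: "s \<in> gcomp (sec R U) (cls D)"
  shows "\<exists>f\<in>OD D U. s = rho U f D"
proof -
  have "s \<in> \<pi> U ` gcomp (sec OW U) D" using s pi_bij[OF U(1) D] by (simp add: bij_betw_def)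
  thus ?thesis unfolding OW_simps(5) rho_def by blast
qed

lemma rho_inj:
  assumes D: "D \<in> carrier WD" and f: "f \<in> OD D U" and g: "g \<in> OD D U" and e: "rho U f D = rho U g D"
  shows "f = g"
proof -
  have "inj_on (\<pi> U) (gcomp (sec OW U) D)" using pi_bij[OF U(1) D] by (simp add: bij_betw_def)
  hence "mo f D = mo g D" by (rule inj_onD) (use f g e in \<open>auto simp: OW_simps(5) rho_def\<close>)
  hence "mo f D D = mo g D D" by simp
  thus "f = g" by (simp add: gmono_def)
qed

lemma rho_mult:
  assumes D: "D \<in> carrier WD" "E \<in> carrier WD" and f: "f \<in> OD D U" "g \<in> OD E U"
  shows "rho U f D *[sec R U] rho U g E = rho U (f *[F] g) (D *[WD] E)"
proof -
  show ?thesis unfolding rho_def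
    using ring_hom_mult[OF pi_hom[OF U(1)] mo_mem[OF U(2) D(1) f(1)] mo_mem[OF U(2) D(2) f(2)]] mo_mult[OF U(2) D OD_F[OF U(2) f(1)] OD_F[OF U(2) f(2)]] by simp
qed

lemma rho_add:
  assumes D: "D \<in> carrier WD" and f: "f \<in> OD D U" "g \<in> OD D U"
  shows "rho U f D +[sec R U] rho U g D = rho U (f +[F] g) D"
proof -
  show ?thesis unfolding rho_def
    using ring_hom_add[OF pi_hom[OF U(1)] mo_mem[OF U(2) D f(1)] mo_mem[OF U(2) D f(2)]] mo_add[OF U(2) OD_F[OF U(2) f(1)] OD_F[OF U(2) f(2)], of D] by simp
qed

lemma rho_one: "rho U 1[F] 1[WD] = 1[sec R U]"
  unfolding rho_def mo_one[OF U(2), symmetric] by (rule ring_hom_one[OF pi_hom[OF U(1)]])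

lemma rho_zero:
  assumes D: "D \<in> carrier WD" shows "rho U 0[F] D = 0[sec R U]"
proof -
  interpret S: cring "sec R U" by (rule R.sec_cring) (use U baseR in simp)
  have c: "rho U 0[F] D \<in> secs R U" by (rule rho_sec[OF D zero_O[OF U(2)]])
  have "rho U 0[F] D +[sec R U] rho U 0[F] D = rho U 0[F] D"
    using rho_add[OF D zero_O[OF U(2)] zero_O[OF U(2)]] by simp
  thus ?thesis using S.add.l_cancel_one'[OF c c] by simp
qed

lemma rho_restr: "op V \<Longrightarrow> V \<noteq> {} \<Longrightarrow> V \<subseteq> U \<Longrightarrow> D \<in> carrier WD \<Longrightarrow> f \<in> OD D U \<Longrightarrow> restr R U V (rho U f D) = rho V f D"
  unfolding rho_def using pi_restr[OF U(1) _ _ mo_mem[OF U(2)]] mo_restr by metis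

end

section \<open>The generic stalk and the values of its homogeneous elements\<close>

abbreviation "S \<equiv> gstalk R \<xi>"

lemma S_graded: "graded_ring K S"
  by (rule R.gstalk_graded) (simp add: baseR xi_X)

sublocale S: grd K S
  by (rule grdI[OF S_graded])

text \<open>\<open>dom f D\<close> serves as a canonical open set over which the monomial is
  defined; by \<open>germ_rho\<close> every other one yields the same germ.\<close>

definition Pi' :: "('p set \<times> 'a) set \<Rightarrow> ('p \<Rightarrow> int) \<Rightarrow> ('p set \<times> 'r) set" where
  "Pi' f D = gR (dom f D) (rho (dom f D) f D)"

lemma germ_rho:
  assumes U: "op U" "U \<noteq> {}" and D: "D \<in> carrier WD" and f: "f \<in> OD D U"
  shows "gR U (rho U f D) = Pi' f D"
proof -
  let ?V = "dom f D"
  have fF: "f \<in> carrier F" by (rule OD_F[OF U(2) f])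
  note d = dom_props[OF fF D]
  have W: "op (U \<inter> ?V)" "\<xi> \<in> U \<inter> ?V" using U d gen_in'[OF U] by (auto intro: openin_Int)
  have ne: "U \<inter> ?V \<noteq> {}" "?V \<noteq> {}" using W by auto
  show ?thesis unfolding Pi'_def
    by (rule R.germ_eqI[of _ _ "U \<inter> ?V"])
      (use U d W ne rho_sec[OF U D f] rho_sec[OF d(1) ne(2) D d(3)] rho_restr[OF U W(1) ne(1) _ D f]
        rho_restr[OF d(1) ne(2) W(1) ne(1) _ D d(3)] in \<open>auto simp: baseR\<close>)
qed

lemma pi_generic_eq:
  assumes f: "f \<in> carrier F" and D: "D \<in> carrier WD"
  shows "pi_generic Sch \<xi> R \<pi> (mo f D) = Pi' f D"
  unfolding pi_generic_def
proof (rule the_equality)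
  note d = dom_props[OF f D]
  show "\<exists>U. op U \<and> U \<noteq> {} \<and> mo f D \<in> secs OW U \<and> Pi' f D = gR U (\<pi> U (mo f D))"
    using d mo_mem[OF _ D d(3)] by (intro exI[of _ "dom f D"]) (auto simp: Pi'_def rho_def)
  fix z assume "\<exists>U. op U \<and> U \<noteq> {} \<and> mo f D \<in> secs OW U \<and> z = gR U (\<pi> U (mo f D))"
  then obtain U where U: "op U" "U \<noteq> {}" "mo f D \<in> secs OW U" "z = gR U (\<pi> U (mo f D))" by blast
  have "mo f D D \<in> OD D U" using U(3) D unfolding OW_simps(1)[OF U(2)] by blast
  hence "f \<in> OD D U" by (simp add: gmono_def)
  thus "z = Pi' f D" using germ_rho[OF U(1,2) D] U(4) by (simp add: rho_def)
qed

lemma two_dom: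
  assumes "f \<in> carrier F" "g \<in> carrier F" "D \<in> carrier WD" "E \<in> carrier WD"
  obtains U where "op U" "U \<noteq> {}" "\<xi> \<in> U" "f \<in> OD D U" "g \<in> OD E U"
proof
  note d = dom_props[OF assms(1,3)] dom_props[OF assms(2,4)]
  let ?U = "dom f D \<inter> dom g E"
  show "op ?U" "\<xi> \<in> ?U" using d by (auto intro: openin_Int)
  thus ne: "?U \<noteq> {}" by auto
  show "f \<in> OD D ?U" "g \<in> OD E ?U" using OD_mono[OF ne] d by auto
qed

lemma Pi_gcomp: "f \<in> carrier F \<Longrightarrow> D \<in> carrier WD \<Longrightarrow> Pi' f D \<in> gcomp S (cls D)"
  using dom_props[of f D] rho_gcomp[of "dom f D" D f] by (auto simp: Pi'_def baseR)

lemma Pi_S: "f \<in> carrier F \<Longrightarrow> D \<in> carrier WD \<Longrightarrow> Pi' f D \<in> carrier S"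
  by (rule S.gcomp_carrier[OF cls_K Pi_gcomp])

lemma Pi_mult:
  assumes "f \<in> carrier F" "g \<in> carrier F" "D \<in> carrier WD" "E \<in> carrier WD"
  shows "Pi' f D *[S] Pi' g E = Pi' (f *[F] g) (D *[WD] E)"
proof -
  obtain U where U: "op U" "U \<noteq> {}" "\<xi> \<in> U" "f \<in> OD D U" "g \<in> OD E U" by (rule two_dom[OF assms])
  have "gR U (rho U f D) *[S] gR U (rho U g E) = gR U (rho U (f *[F] g) (D *[WD] E))"
    using R.germ_mult[OF _ U(3) rho_sec[OF U(1,2) assms(3) U(4)] rho_sec[OF U(1,2) assms(4) U(5)]] U(1)
      rho_mult[OF U(1,2) assms(3,4) U(4,5)] by (simp add: baseR)
  moreover have "D *[WD] E \<in> carrier WD" using assms by simp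
  ultimately show ?thesis
    using germ_rho[OF U(1,2) assms(3) U(4)] germ_rho[OF U(1,2) assms(4) U(5)] germ_rho[OF U(1,2) _ OD_mult[OF U(2,4,5)]] by simp
qed

lemma Pi_add:
  assumes "f \<in> carrier F" "g \<in> carrier F" "D \<in> carrier WD"
  shows "Pi' f D +[S] Pi' g D = Pi' (f +[F] g) D"
proof -
  obtain U where U: "op U" "U \<noteq> {}" "\<xi> \<in> U" "f \<in> OD D U" "g \<in> OD D U" by (rule two_dom[OF assms assms(3)])
  have "gR U (rho U f D) +[S] gR U (rho U g D) = gR U (rho U (f +[F] g) D)"
    using R.germ_add[OF _ U(3) rho_sec[OF U(1,2) assms(3) U(4)] rho_sec[OF U(1,2) assms(3) U(5)]] U(1)
      rho_add[OF U(1,2) assms(3) U(4,5)] by (simp add: baseR)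
  thus ?thesis
    using germ_rho[OF U(1,2) assms(3) U(4)] germ_rho[OF U(1,2) assms(3) U(5)] germ_rho[OF U(1,2) assms(3) OD_add[OF U(2,4,5)]] by simp
qed

lemma Pi_one: "Pi' 1[F] 1[WD] = 1[S]"
proof -
  have X: "op X" "X \<noteq> {}" using xi_X by auto
  show ?thesis using germ_rho[OF X WD.one_closed OD_one[OF X(2)]] rho_one[OF X] R.germ_one[of X \<xi>] xi_X by (simp add: baseR)
qed

lemma Pi_zero:
  assumes D: "D \<in> carrier WD"
  shows "Pi' 0[F] D = 0[S]"
proof -
  have X: "op X" "X \<noteq> {}" using xi_X by auto
  show ?thesis using germ_rho[OF X D zero_O[OF X(2)]] rho_zero[OF X D] R.germ_zero[of X \<xi>] xi_X by (simp add: baseR)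
qed

lemma Pi_inj:
  assumes f: "f \<in> carrier F" and g: "g \<in> carrier F" and D: "D \<in> carrier WD" and e: "Pi' f D = Pi' g D"
  shows "f = g"
proof -
  obtain U where U: "op U" "U \<noteq> {}" "\<xi> \<in> U" "f \<in> OD D U" "g \<in> OD D U" by (rule two_dom[OF f g D D])
  have oR: "R.op U" using U(1) by (simp add: baseR)
  have "gR U (rho U f D) = gR U (rho U g D)" using germ_rho[OF U(1,2) D U(4)] germ_rho[OF U(1,2) D U(5)] e by simp
  then obtain W where W: "R.op W" "\<xi> \<in> W" "W \<subseteq> U" "restr R U W (rho U f D) = restr R U W (rho U g D)"
    using R.germ_eq[OF oR U(3) rho_sec[OF U(1,2) D U(4)] oR U(3) rho_sec[OF U(1,2) D U(5)]] by blast
  have W': "op W" "W \<noteq> {}" using W by (auto simp: baseR)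
  have "rho W f D = rho W g D" using W(4) rho_restr[OF U(1,2) W' W(3) D] U(4,5) by simp
  thus ?thesis by (rule rho_inj[OF W' D OD_mono[OF W'(2) W(3) U(4)] OD_mono[OF W'(2) W(3) U(5)]])
qed

lemma Pi_nz: "f \<in> carrier F \<Longrightarrow> D \<in> carrier WD \<Longrightarrow> Pi' f D = 0[S] \<longleftrightarrow> f = 0[F]"
  using Pi_inj[of f "0[F]" D] Pi_zero[of D] by auto

lemma S_gcomp: "D \<in> carrier WD \<Longrightarrow> gcomp S (cls D) = {Pi' f D | f. f \<in> carrier F}"
proof (rule equalityI; rule subsetI)
  fix z assume D: "D \<in> carrier WD" and "z \<in> gcomp S (cls D)"
  then obtain U s where U: "op U" "\<xi> \<in> U" "s \<in> gcomp (sec R U) (cls D)" "z = gR U s" by (auto simp: baseR)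
  hence ne: "U \<noteq> {}" by auto
  obtain f where f: "f \<in> OD D U" "s = rho U f D" using rho_surj[OF U(1) ne D U(3)] by blast
  show "z \<in> {Pi' f D | f. f \<in> carrier F}" using germ_rho[OF U(1) ne D f(1)] f(2) U(4) OD_F[OF ne f(1)] by blast
qed (use Pi_gcomp in blast)

lemma S_hplus: "z \<in> hplus K S \<longleftrightarrow> (\<exists>f\<in>F.nz. \<exists>D\<in>carrier WD. z = Pi' f D)"
proof
  assume z: "z \<in> hplus K S"
  then obtain w where w: "w \<in> carrier K" "z \<in> gcomp S w" "z \<noteq> 0[S]" by (rule S.hplusE)
  obtain D where D: "w = cls D" "D \<in> carrier WD" using w(1) unfolding K_carrier by (rule imageE)
  obtain f where f: "f \<in> carrier F" "z = Pi' f D" using w(2) unfolding D(1) S_gcomp[OF D(2)] by blast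
  hence "f \<in> F.nz" using Pi_nz[OF f(1) D(2)] w(3) by auto
  thus "\<exists>f\<in>F.nz. \<exists>D\<in>carrier WD. z = Pi' f D" using f D by blast
next
  assume "\<exists>f\<in>F.nz. \<exists>D\<in>carrier WD. z = Pi' f D"
  then obtain f D where fD: "f \<in> F.nz" "D \<in> carrier WD" "z = Pi' f D" by blast
  show "z \<in> hplus K S"
    by (rule S.hplusI[OF cls_K[OF fD(2)]]) (use Pi_gcomp[of f D] Pi_nz[of f D] fD in auto)
qed

text \<open>If \<open>D = div h + E\<close> then \<open>\<pi>(h\<chi>\<^sup>E\<^sup>-\<^sup>D)\<close> is a unit of degree zero, hence the image of a global unit of the structure sheaf.\<close>

lemma mu_wd:
  assumes f: "f \<in> F.nz" and g: "g \<in> F.nz" and D: "D \<in> carrier WD" and E: "E \<in> carrier WD"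
    and e: "Pi' f D = Pi' g E" and Y: "Y \<in> P"
  shows "\<nu> Y f + D Y = \<nu> Y g + E Y"
proof -
  have fF: "f \<in> carrier F" and gF: "g \<in> carrier F" using f g by auto
  have X: "op X" "X \<noteq> {}" using xi_X by auto
  have "Pi' f D \<noteq> 0[S]" using Pi_nz[OF fF D] f by auto
  hence "cls D = cls E"
    using S.gcomp_disjoint[OF Pi_gcomp[OF fF D] _ cls_K[OF D] cls_K[OF E]] e Pi_gcomp[OF gF E] by simp
  then obtain h where h: "h \<in> F.nz" "D = dv h *[WD] E" using cls_eq[OF D E] by blast
  have Dh: "D Z = \<nu> Z h + E Z" if "Z \<in> P" for Z using h(2) that by (simp add: WD_mult dv_apply)
  let ?M = "E *[WD] inv[WD] D" and ?M' = "D *[WD] inv[WD] E"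
  have M: "?M \<in> carrier WD" "?M' \<in> carrier WD" using D E by auto
  have MZ: "?M Z = E Z - D Z" "?M' Z = D Z - E Z" if "Z \<in> P" for Z using that D E by (simp_all add: WD_mult WD_inv)
  have one: "?M *[WD] ?M' = 1[WD]" unfolding WD_mult[of ?M] WD_one by (intro restrict_ext) (simp add: MZ)
  have hi: "inv[F] h \<in> F.nz" by (rule F.nz_inv[OF h(1)])
  have hF: "h \<in> carrier F" "inv[F] h \<in> carrier F" using h(1) hi by auto
  have deg: "cls ?M = 1[K]" "cls ?M' = 1[K]"
  proof -
    have "?M = dv (inv[F] h) *[WD] 1[WD]" "?M' = dv h *[WD] 1[WD]"
      unfolding WD_mult[of "dv (inv[F] h)"] WD_mult[of "dv h"] WD_mult[of E] WD_mult[of D] WD_inv[OF D] WD_inv[OF E]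
      by (intro restrict_ext; simp add: Dh F.dval_inv[OF nu_dval h(1)] WD_one dv_apply)+
    thus "cls ?M = 1[K]" "cls ?M' = 1[K]" using cls_eq[OF _ WD.one_closed] M h(1) hi cls_one by metis+
  qed
  \<comment> \<open>The component of trivial degree is already filled by monomials at the trivial
    divisor, so a monomial of trivial class that is regular everywhere can be traded for a global
    function \<open>c\<close>.\<close>
  have ex: "\<exists>c\<in>OD 1[WD] X. Pi' k N = Pi' c 1[WD]"
    if k: "k \<in> OD N X" "N \<in> carrier WD" "cls N = 1[K]" for k N
  proof -
    have "rho X k N \<in> gcomp (sec R X) (cls 1[WD])" using rho_gcomp[OF X k(2,1)] k(3) cls_one by simp
    then obtain c where "c \<in> OD 1[WD] X" "rho X k N = rho X c 1[WD]" using rho_surj[OF X WD.one_closed] by blast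
    thus ?thesis using germ_rho[OF X k(2,1)] germ_rho[OF X WD.one_closed] by (metis)
  qed
  have "h \<in> OD ?M X" "inv[F] h \<in> OD ?M' X"
    using hF Dh MZ F.dval_inv[OF nu_dval h(1)] by (simp_all add: O_sec_iff[OF X(2)])
  then obtain c c' where c: "c \<in> OD 1[WD] X" "Pi' h ?M = Pi' c 1[WD]" and c': "c' \<in> OD 1[WD] X" "Pi' (inv[F] h) ?M' = Pi' c' 1[WD]"
    using ex M deg by metis
  have cF: "c \<in> carrier F" "c' \<in> carrier F" using OD_F[OF X(2)] c c' by auto
  have "Pi' (c *[F] c') 1[WD] = Pi' h ?M *[S] Pi' (inv[F] h) ?M'"
    unfolding c(2) c'(2) using Pi_mult[OF cF WD.one_closed WD.one_closed] by simp
  also have "\<dots> = Pi' 1[F] 1[WD]" using Pi_mult[OF hF M] F.nz_r_inv[OF h(1)] one by simp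
  finally have cc: "c *[F] c' = 1[F]" using Pi_inj[OF _ _ WD.one_closed] cF by simp
  hence cn: "c \<in> F.nz" "c' \<in> F.nz" using cF by auto
  \<comment> \<open>\<open>c\<close> and its inverse are both regular at \<open>Y\<close>, which
    forces the value zero.\<close>
  have "0 \<le> \<nu> Y c" "0 \<le> \<nu> Y c'" using c(1) c'(1) cn Y P_X by (auto simp: O_sec_iff[OF X(2)] WD_one)
  hence c0: "\<nu> Y c = 0" using F.dval_mult[OF nu_dval[OF Y] cn] cc F.dval_one[OF nu_dval[OF Y]] by simp
  \<comment> \<open>Multiplication by the unit brings both representations to the divisor
    \<open>E\<close>, where \<open>Pi'\<close> is injective in the function.\<close>
  have "Pi' (c *[F] g) E = Pi' c 1[WD] *[S] Pi' f D" unfolding e using Pi_mult[OF cF(1) gF WD.one_closed E] E by simp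
  also have "\<dots> = Pi' (h *[F] f) (?M *[WD] D)" unfolding c(2)[symmetric] using Pi_mult[OF hF(1) fF M(1) D] .
  also have "?M *[WD] D = E" using D E by (simp add: WD.m_assoc)
  finally have "c *[F] g = h *[F] f" using Pi_inj[OF _ _ E] cF gF hF fF by simp
  hence "\<nu> Y c + \<nu> Y g = \<nu> Y h + \<nu> Y f" using F.dval_mult[OF nu_dval[OF Y]] cn g h(1) f by metis
  thus ?thesis using c0 Dh[OF Y] by simp
qed

abbreviation "mu \<equiv> Cox_mu Sch \<xi> R \<pi>"

lemma mu_eq:
  assumes f: "f \<in> F.nz" and D: "D \<in> carrier WD" and Y: "Y \<in> P"
  shows "mu Y U (Pi' f D) = (if Y \<in> U then \<nu> Y f + D Y else 0)"
proof -
  have "(THE n. \<exists>g\<in>rat_units Sch \<xi>. \<exists>E\<in>carrier WD. Pi' f D = pi_generic Sch \<xi> R \<pi> (mo g E) \<and> n = \<nu> Y g + E Y) = \<nu> Y f + D Y"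
  proof (rule the_equality)
    show "\<exists>g\<in>rat_units Sch \<xi>. \<exists>E\<in>carrier WD. Pi' f D = pi_generic Sch \<xi> R \<pi> (mo g E) \<and> \<nu> Y f + D Y = \<nu> Y g + E Y"
      unfolding rat_units by (intro bexI[of _ f] bexI[of _ D] conjI refl f D pi_generic_eq[OF DiffD1[OF f] D, symmetric])
    show "n = \<nu> Y f + D Y"
      if m: "\<exists>g\<in>rat_units Sch \<xi>. \<exists>E\<in>carrier WD. Pi' f D = pi_generic Sch \<xi> R \<pi> (mo g E) \<and> n = \<nu> Y g + E Y" for n
    proof -
      obtain g where g': "g \<in> F.nz" "\<exists>E\<in>carrier WD. Pi' f D = pi_generic Sch \<xi> R \<pi> (mo g E) \<and> n = \<nu> Y g + E Y"
        using m unfolding rat_units by (rule bexE)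
      obtain E where E: "E \<in> carrier WD" "Pi' f D = pi_generic Sch \<xi> R \<pi> (mo g E) \<and> n = \<nu> Y g + E Y"
        using g'(2) by (rule bexE)
      note g = g'(1) E(1) conjunct1[OF E(2)] conjunct2[OF E(2)]
      have "Pi' f D = Pi' g E" using g(3) pi_generic_eq[OF DiffD1[OF g(1)] g(2)] by simp
      thus ?thesis using mu_wd[OF f g(1) D g(2) _ Y] g(4) by simp
    qed
  qed
  thus ?thesis by (simp add: Cox_mu_def)
qed

lemma S_simple: "hplus K S \<subseteq> Units S" "carrier S \<noteq> {0[S]}"
proof
  fix z assume "z \<in> hplus K S"
  then obtain f D where fD: "f \<in> F.nz" "D \<in> carrier WD" "z = Pi' f D" unfolding S_hplus by blast
  have i: "inv[F] f \<in> carrier F" "f \<in> carrier F" "inv[WD] D \<in> carrier WD" using F.nz_inv[OF fD(1)] fD by auto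
  have "z *[S] Pi' (inv[F] f) (inv[WD] D) = 1[S]" "Pi' (inv[F] f) (inv[WD] D) *[S] z = 1[S]"
    unfolding fD(3) Pi_mult[OF i(2,1) fD(2) i(3)] Pi_mult[OF i(1,2,3) fD(2)]
    using F.nz_r_inv[OF fD(1)] F.nz_l_inv[OF fD(1)] fD(2) Pi_one by simp_all
  thus "z \<in> Units S" using Pi_S[OF i(1,3)] Pi_S[OF i(2) fD(2)] fD(3) unfolding Units_def by blast
next
  have "Pi' 1[F] 1[WD] \<noteq> 0[S]" using Pi_nz[of "1[F]" "1[WD]"] by simp
  thus "carrier S \<noteq> {0[S]}" using Pi_S[of "1[F]" "1[WD]"] by auto
qed

section \<open>Sections and stalks as subrings of the generic stalk\<close>

lemma grd_hom_inj:
  assumes "grd_hom K A S h" "\<And>w a. w \<in> carrier K \<Longrightarrow> a \<in> gcomp A w \<Longrightarrow> h a = 0[S] \<Longrightarrow> a = 0[A]"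
  shows "inj_on h (carrier A)"
proof (rule inj_onI)
  interpret h: grd_hom K A S h by (rule assms(1))
  fix a b assume a: "a \<in> carrier A" and b: "b \<in> carrier A" and e: "h a = h b"
  let ?d = "a \<ominus>[A] b"
  have d: "?d \<in> carrier A" using a b by simp
  have "h ?d = 0[S]" using a b e by (simp add: h.A.R.minus_eq S.R.r_neg del: gstalk_simps)
  hence "h (hcomp K A ?d w) = 0[S]" if "w \<in> carrier K" for w
    using h.hom_hcomp[OF d that] S.hcomp_zero[OF that] by simp
  hence "hcomp K A ?d w = 0[A]" if "w \<in> carrier K" for w using assms(2)[OF that h.A.hcomp_in[OF d that]] that by simp
  hence "?d = 0[A]" by (intro h.A.hcomp_ext[OF d h.A.R.zero_closed]) (simp add: h.A.hcomp_zero)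
  thus "a = b" using a b by simp
qed

text \<open>Sections over an open set and stalks differ only in the ring and in \<open>Q\<close>.
  All conditions on values are therefore derived once, from the description of homogeneous elements
  by \<open>Pi'\<close>; only the image of each component and the kernel are left to the two
  cases.\<close>

theorem cox_subI:
  assumes Q: "Q \<subseteq> P \<inter> U" and h: "grd_hom K A S h"
    and im: "\<And>D. D \<in> carrier WD \<Longrightarrow> h ` gcomp A (cls D) = {Pi' f D | f. f \<in> carrier F \<and> (f = 0[F] \<or> (\<forall>Y\<in>Q. 0 \<le> \<nu> Y f + D Y))}"
    and ker: "\<And>w a. w \<in> carrier K \<Longrightarrow> a \<in> gcomp A w \<Longrightarrow> h a = 0[S] \<Longrightarrow> a = 0[A]"
  shows "cox_sub K A S h Q (\<lambda>Y. mu Y U)"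
proof (intro cox_sub.intro cox_sub_axioms.intro h S_simple grd_hom_inj[OF h ker])
  have mq: "mu Y U (Pi' f D) = \<nu> Y f + D Y" if "Y \<in> Q" "f \<in> F.nz" "D \<in> carrier WD" for Y f D
    using mu_eq[OF that(2,3), of Y U] subsetD[OF Q that(1)] by simp
  show "h ` gcomp A w = {s \<in> gcomp S w. s = 0[S] \<or> (\<forall>Y\<in>Q. 0 \<le> mu Y U s)}" if w: "w \<in> carrier K" for w
  proof -
    obtain D where D: "w = cls D" "D \<in> carrier WD" using w unfolding K_carrier by (rule imageE)
    have "f = 0[F] \<or> (\<forall>Y\<in>Q. 0 \<le> \<nu> Y f + D Y) \<longleftrightarrow> Pi' f D = 0[S] \<or> (\<forall>Y\<in>Q. 0 \<le> mu Y U (Pi' f D))" if "f \<in> carrier F" for f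
      using Pi_nz[OF that D(2)] mq[OF _ _ D(2), of _ f] that by (cases "f = 0[F]") auto
    thus ?thesis unfolding D(1) im[OF D(2)] S_gcomp[OF D(2)] by blast
  qed
  show "mu Y U (a *[S] b) = mu Y U a + mu Y U b" if Y: "Y \<in> Q" and a: "a \<in> hplus K S" and b: "b \<in> hplus K S" for Y a b
  proof -
    obtain f D where f: "f \<in> F.nz" "D \<in> carrier WD" "a = Pi' f D" using a unfolding S_hplus by blast
    obtain g E where g: "g \<in> F.nz" "E \<in> carrier WD" "b = Pi' g E" using b unfolding S_hplus by blast
    have YP: "Y \<in> P" using Y Q by blast
    have DE: "D *[WD] E \<in> carrier WD" using f g by simp
    have "a *[S] b = Pi' (f *[F] g) (D *[WD] E)" unfolding f(3) g(3) using Pi_mult f g by blast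
    hence "mu Y U (a *[S] b) = \<nu> Y (f *[F] g) + (D *[WD] E) Y" using mq[OF Y F.nz_mult[OF f(1) g(1)] DE] by simp
    also have "\<dots> = (\<nu> Y f + D Y) + (\<nu> Y g + E Y)" using F.dval_mult[OF nu_dval[OF YP] f(1) g(1)] YP by (simp add: WD_mult)
    finally show ?thesis using mq[OF Y f(1,2)] mq[OF Y g(1,2)] f(3) g(3) by simp
  qed
  show "min (mu Y U a) (mu Y U b) \<le> mu Y U (a +[S] b)"
    if Y: "Y \<in> Q" and w: "w \<in> carrier K" and a: "a \<in> gcomp S w" "a \<noteq> 0[S]" and b: "b \<in> gcomp S w" "b \<noteq> 0[S]" and ab: "a +[S] b \<noteq> 0[S]" for Y w a b
  proof -
    obtain D where D: "w = cls D" "D \<in> carrier WD" using w unfolding K_carrier by (rule imageE)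
    obtain f where f: "f \<in> carrier F" "a = Pi' f D" using a(1) unfolding D(1) S_gcomp[OF D(2)] by blast
    obtain g where g: "g \<in> carrier F" "b = Pi' g D" using b(1) unfolding D(1) S_gcomp[OF D(2)] by blast
    have s: "a +[S] b = Pi' (f +[F] g) D" unfolding f(2) g(2) using Pi_add[OF f(1) g(1) D(2)] .
    have n: "f \<in> F.nz" "g \<in> F.nz" "f +[F] g \<in> F.nz" using Pi_nz[OF _ D(2)] f g a b ab s by auto
    have YP: "Y \<in> P" using Y Q by blast
    show ?thesis unfolding s unfolding f(2) g(2) mq[OF Y n(1) D(2)] mq[OF Y n(2) D(2)] mq[OF Y n(3) D(2)]
      using F.dval_add[OF nu_dval[OF YP] n(1,2)] n(3) by auto
  qed
  show "finite {Y \<in> Q. mu Y U a \<noteq> 0}" if a: "a \<in> hplus K S" for a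
  proof -
    obtain f D where f: "f \<in> F.nz" "D \<in> carrier WD" "a = Pi' f D" using a unfolding S_hplus by blast
    show ?thesis by (rule finite_subset[OF _ fin_val[OF f(1,2)]]) (use mq[OF _ f(1,2)] f(3) Q in auto)
  qed
  show "\<exists>s\<in>hplus K S. \<forall>Y\<in>Q. mu Y U s = D Y" if D: "finite {Y \<in> Q. D Y \<noteq> 0}" for D
  proof -
    \<comment> \<open>Outside \<open>Q\<close> the coefficients are set to zero, which keeps the
      divisor finitely supported.\<close>
    let ?D = "\<lambda>Y\<in>P. if Y \<in> Q then D Y else 0"
    have DW: "?D \<in> carrier WD" unfolding WD_carrier by (rule conjI[OF restrict_extensional finite_subset[OF _ D]]) auto
    have "mu Y U (Pi' 1[F] ?D) = D Y" if Y: "Y \<in> Q" for Y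
      using mq[OF Y F.nz_one DW] Y Q F.dval_one[OF nu_dval, of Y] by auto
    moreover have "Pi' 1[F] ?D \<in> hplus K S" unfolding S_hplus using F.nz_one DW by blast
    ultimately show ?thesis by blast
  qed
  show "\<exists>s\<in>gcomp S w. s \<noteq> 0[S]" if w: "w \<in> carrier K" for w
  proof -
    obtain D where D: "w = cls D" "D \<in> carrier WD" using w unfolding K_carrier by (rule imageE)
    show ?thesis unfolding D(1) using Pi_gcomp[OF F.one_closed D(2)] Pi_nz[OF F.one_closed D(2)] by auto
  qed
qed

lemma sec_sub:
  assumes U: "op U" "U \<noteq> {}"
  shows "cox_sub K (sec R U) S (gR U) (P \<inter> U) (\<lambda>Y. mu Y U)"
proof (rule cox_subI)
  have oR: "R.op U" "\<xi> \<in> U" using U gen_in'[OF U] by (simp_all add: baseR)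
  show "grd_hom K (sec R U) S (gR U)"
  proof (intro grd_hom.intro grd_hom_axioms.intro R.sec_grd[OF oR(1)] S.grd_axioms)
    show "gR U \<in> ring_hom (sec R U) S" using R.germ_hom[OF oR] by (simp add: ring_hom_def)
    show "gR U a \<in> gcomp S w" if "a \<in> gcomp (sec R U) w" for w a using that oR by auto
  qed
  show "gR U ` gcomp (sec R U) (cls D) = {Pi' f D | f. f \<in> carrier F \<and> (f = 0[F] \<or> (\<forall>Y\<in>P \<inter> U. 0 \<le> \<nu> Y f + D Y))}"
    if D: "D \<in> carrier WD" for D
  proof -
    have "gcomp (sec R U) (cls D) = {rho U f D | f. f \<in> OD D U}"
      using rho_surj[OF U D] rho_gcomp[OF U D] by blast
    hence "gR U ` gcomp (sec R U) (cls D) = {gR U (rho U f D) | f. f \<in> OD D U}" by auto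
    also have "\<dots> = {Pi' f D | f. f \<in> OD D U}" using germ_rho[OF U D] by (auto; metis)
    finally show ?thesis by (simp only: O_sec_iff[OF U(2)] conj_assoc)
  qed
  show "a = 0[sec R U]" if w: "w \<in> carrier K" and a: "a \<in> gcomp (sec R U) w" and z: "gR U a = 0[S]" for w a
  proof -
    obtain D where D: "w = cls D" "D \<in> carrier WD" using w unfolding K_carrier by (rule imageE)
    obtain f where f: "f \<in> OD D U" "a = rho U f D" using rho_surj[OF U D(2)] a D(1) by blast
    have "f = 0[F]" using germ_rho[OF U D(2) f(1)] z f(2) Pi_nz[OF OD_F[OF U(2) f(1)] D(2)] by simp
    thus ?thesis using rho_zero[OF U D(2)] f(2) by simp
  qed
qed simp

lemma cospec_R: "op U \<Longrightarrow> x \<in> U \<Longrightarrow> s \<in> secs R U \<Longrightarrow> cR (germ R x U s) = gR U s"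
  by (rule R.cospec_germ) (use gen_in in \<open>auto simp: baseR\<close>)

lemma stalk_sub:
  assumes x: "x \<in> X"
  shows "cox_sub K (gstalk R x) S (cR) {Y \<in> P. x \<in> cl Y} (\<lambda>Y. mu Y X)"
proof (rule cox_subI)
  have xR: "x \<in> topspace (base R)" using x by (simp add: baseR)
  show "grd_hom K (gstalk R x) S (cR)"
  proof (intro grd_hom.intro grd_hom_axioms.intro S.grd_axioms grdI[OF R.gstalk_graded[OF xR]])
    have "cR \<in> ring_hom (stalk R x) (stalk R \<xi>)" by (rule R.cospec_hom) (use gen_in x in \<open>auto simp: baseR\<close>)
    thus "cR \<in> ring_hom (gstalk R x) S" by (simp add: ring_hom_def)
    fix w a assume w: "w \<in> carrier K" and "a \<in> gcomp (gstalk R x) w"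
    then obtain U s where U: "op U" "x \<in> U" "s \<in> gcomp (sec R U) w" "a = germ R x U s" by (auto simp: baseR)
    have oR: "R.op U" using U(1) by (simp add: baseR)
    show "cR a \<in> gcomp S w"
      using cospec_R[OF U(1,2) R.gcomp_sec[OF oR w U(3)]] U(3,4) oR gen_in[OF U(1,2)] by auto
  qed
  have rep: "\<exists>U f. op U \<and> x \<in> U \<and> f \<in> OD D U \<and> a = germ R x U (rho U f D) \<and> cR a = Pi' f D"
    if D: "D \<in> carrier WD" and a: "a \<in> gcomp (gstalk R x) (cls D)" for D a
  proof -
    obtain U s where U: "op U" "x \<in> U" "s \<in> gcomp (sec R U) (cls D)" "a = germ R x U s" using a by (auto simp: baseR)
    hence ne: "U \<noteq> {}" by auto
    obtain f where f: "f \<in> OD D U" "s = rho U f D" using rho_surj[OF U(1) ne D U(3)] by blast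
    have "cR a = Pi' f D" using cospec_R[OF U(1,2) rho_sec[OF U(1) ne D f(1)]] germ_rho[OF U(1) ne D f(1)] U(4) f(2) by simp
    thus ?thesis using U f by blast
  qed
  show "cR ` gcomp (gstalk R x) (cls D) = {Pi' f D | f. f \<in> carrier F \<and> (f = 0[F] \<or> (\<forall>Y\<in>{Y \<in> P. x \<in> cl Y}. 0 \<le> \<nu> Y f + D Y))}"
    if D: "D \<in> carrier WD" for D
  proof (rule equalityI; rule subsetI)
    fix z assume "z \<in> cR ` gcomp (gstalk R x) (cls D)"
    then obtain a where a: "z = cR a" "a \<in> gcomp (gstalk R x) (cls D)" by (rule imageE)
    obtain U f where U: "op U" "x \<in> U" "f \<in> OD D U" "cR a = Pi' f D" using rep[OF D a(2)] by blast
    have ne: "U \<noteq> {}" using U by auto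
    have "Y \<in> U" if "x \<in> cl Y" for Y using that U cl_iff by blast
    thus "z \<in> {Pi' f D | f. f \<in> carrier F \<and> (f = 0[F] \<or> (\<forall>Y\<in>{Y \<in> P. x \<in> cl Y}. 0 \<le> \<nu> Y f + D Y))}"
      using a U(3,4) unfolding O_sec_iff[OF ne] by blast
  next
    fix z assume "z \<in> {Pi' f D | f. f \<in> carrier F \<and> (f = 0[F] \<or> (\<forall>Y\<in>{Y \<in> P. x \<in> cl Y}. 0 \<le> \<nu> Y f + D Y))}"
    then obtain f where f: "z = Pi' f D" "f \<in> carrier F" "f = 0[F] \<or> (\<forall>Y\<in>{Y \<in> P. x \<in> cl Y}. 0 \<le> \<nu> Y f + D Y)" by blast
    \<comment> \<open>No polar prime divisor of the monomial passes through \<open>x\<close>, so the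
      monomial is a section near \<open>x\<close>.\<close>
    have xd: "x \<in> dom f D"
    proof (cases "f = 0[F]")
      case False
      thus ?thesis using dom_mem[of f x D] f x by auto
    qed (use x in \<open>simp add: dom_def\<close>)
    note d = dom_props[OF f(2) D]
    have ne: "dom f D \<noteq> {}" using xd by auto
    let ?a = "germ R x (dom f D) (rho (dom f D) f D)"
    have "?a \<in> gcomp (gstalk R x) (cls D)" using rho_gcomp[OF d(1) ne D d(3)] d(1) xd by (auto simp: baseR)
    moreover have "cR ?a = z" using cospec_R[OF d(1) xd rho_sec[OF d(1) ne D d(3)]] f(1) by (simp add: Pi'_def)
    ultimately show "z \<in> cR ` gcomp (gstalk R x) (cls D)" by blast
  qed
  show "a = 0[gstalk R x]" if w: "w \<in> carrier K" and a: "a \<in> gcomp (gstalk R x) w" and z: "cR a = 0[S]" for w a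
  proof -
    obtain D where D: "w = cls D" "D \<in> carrier WD" using w unfolding K_carrier by (rule imageE)
    obtain U f where U: "op U" "x \<in> U" "f \<in> OD D U" "a = germ R x U (rho U f D)" "cR a = Pi' f D" using rep[OF D(2)] a D(1) by blast
    have ne: "U \<noteq> {}" using U by auto
    have "f = 0[F]" using U(5) z Pi_nz[OF OD_F[OF ne U(3)] D(2)] by simp
    thus ?thesis using rho_zero[OF U(1) ne D(2)] U(1,2,4) R.germ_zero[of U x] by (simp add: baseR)
  qed
qed (use P_X in auto)

end

declare gstalk_simps(6) [simp del]

section \<open>Functions vanishing along given prime divisors\<close>

context kscheme
begin

text \<open>For \<open>Y\<close> in \<open>B\<close> some function lies in \<open>h Y\<close> but
  not in \<open>h x\<close>, since \<open>x\<close> is not in the closure of \<open>Y\<close>.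
  Powers raise the order along \<open>Y\<close>, and products over \<open>B\<close> remain outside
  the prime \<open>h x\<close>. The orders are bounded from below only.\<close>

lemma vanishing_function:
  assumes c: "aff_chart Sch \<xi> U A h \<phi>" and x: "x \<in> U" and B: "finite B" "B \<subseteq> P \<inter> U" "\<forall>Y\<in>B. x \<notin> cl Y"
  shows "\<exists>f\<in>carrier A. f \<notin> h x \<and> gO U (aff_chart.g A \<phi> f) \<in> F.nz \<and>
    (\<forall>Z\<in>P \<inter> U. 0 \<le> \<nu> Z (gO U (aff_chart.g A \<phi> f))) \<and> (\<forall>Z\<in>B. n Z \<le> \<nu> Z (gO U (aff_chart.g A \<phi> f)))"
proof -
  interpret aff_chart Sch \<xi> U A h \<phi> by (rule c)
  let ?G = "\<lambda>f. gO U (g f)"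
  define good where "good f \<longleftrightarrow> f \<in> carrier A \<and> f \<notin> h x \<and> ?G f \<in> F.nz \<and> (\<forall>Z\<in>P \<inter> U. 0 \<le> \<nu> Z (?G f))" for f
  have goodD: "f \<in> carrier A" "f \<notin> h x" "?G f \<in> F.nz" "Z \<in> P \<Longrightarrow> Z \<in> U \<Longrightarrow> 0 \<le> \<nu> Z (?G f)" if "good f" for f Z
    using that unfolding good_def by blast+
  have v: "\<nu> Z (?G (a *[A] b)) = \<nu> Z (?G a) + \<nu> Z (?G b)" and gm: "good (a *[A] b)" if a: "good a" and b: "good b" and Z: "Z \<in> P" for a b Z
  proof -
    note ab = goodD[OF a] goodD[OF b]
    have m: "?G (a *[A] b) = ?G a *[F] ?G b"
      using ring_hom_mult[OF g_hom goodD(1)[OF a] goodD(1)[OF b]] germ_mult[OF U(1) xi_U g_closed[OF goodD(1)[OF a]] g_closed[OF goodD(1)[OF b]]] by simp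
    have v: "\<nu> Z (?G (a *[A] b)) = \<nu> Z (?G a) + \<nu> Z (?G b)" if "Z \<in> P" for Z
      unfolding m by (rule F.dval_mult[OF nu_dval[OF that] goodD(3)[OF a] goodD(3)[OF b]])
    show "\<nu> Z (?G (a *[A] b)) = \<nu> Z (?G a) + \<nu> Z (?G b)" by (rule v[OF Z])
    show "good (a *[A] b)" unfolding good_def
    proof (intro conjI ballI)
      show "a *[A] b \<in> carrier A" using ab by simp
      show "a *[A] b \<notin> h x" using A.spec_mult[OF h_spec[OF x]] ab by simp
      show "?G (a *[A] b) \<in> F.nz" unfolding m by (rule F.nz_mult[OF goodD(3)[OF a] goodD(3)[OF b]])
      show "0 \<le> \<nu> Z (?G (a *[A] b))" if "Z \<in> P \<inter> U" for Z using that v[of Z] goodD(4)[OF a, of Z] goodD(4)[OF b, of Z] by simp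
    qed
  qed
  have G1: "?G 1[A] = 1[F]" using ring_hom_one[OF g_hom] germ_one[OF U(1) xi_U] by simp
  have one: "good 1[A]" unfolding good_def G1
    using A.spec_one[OF h_spec[OF x]] F.nz_one F.dval_one[OF nu_dval] by simp
  have pow: "\<exists>a. good a \<and> int k \<le> \<nu> Y (?G a)" if Y: "Y \<in> P" "Y \<in> U" "x \<notin> cl Y" for Y k
  proof -
    obtain a where a: "a \<in> h Y" "a \<notin> h x" using spec_closure[OF x Y(2)] Y(3) by blast
    have aA: "a \<in> carrier A" using A.spec_sub[OF h_spec[OF Y(2)]] a(1) by blast
    have "a \<notin> h \<xi>" using h_xi_least[OF x] a(2) by blast
    note av = affine_vanishing[OF c Y(1,2) aA a(1) this]
    have ga: "good a" using av aA a(2) unfolding good_def by blast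
    show ?thesis
    proof (induction k)
      case 0 thus ?case using one G1 F.dval_one[OF nu_dval[OF Y(1)]] by (intro exI[of _ "1[A]"]) simp
    next
      case (Suc k)
      then obtain b where b: "good b" "int k \<le> \<nu> Y (?G b)" by blast
      show ?case using gm[OF ga b(1) Y(1)] v[OF ga b(1) Y(1)] b(2) av(2) by (intro exI[of _ "a *[A] b"]) simp
    qed
  qed
  have "\<exists>a. good a \<and> (\<forall>Z\<in>B. n Z \<le> \<nu> Z (?G a))" using B
  proof (induction B rule: finite_induct)
    case empty thus ?case using one by blast
  next
    case (insert Y B)
    obtain a where a: "good a" "\<forall>Z\<in>B. n Z \<le> \<nu> Z (?G a)" using insert by blast
    have Y: "Y \<in> P" "Y \<in> U" "x \<notin> cl Y" using insert.prems by auto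
    \<comment> \<open>The bound \<open>n Y\<close> may be negative, whereas powers are counted by
      natural numbers.\<close>
    obtain b where b: "good b" "int (nat (n Y)) \<le> \<nu> Y (?G b)" using pow[OF Y] by blast
    have "n Z \<le> \<nu> Z (?G (a *[A] b))" if Z: "Z \<in> insert Y B" for Z
    proof -
      have ZP: "Z \<in> P" "Z \<in> U" using Z insert.prems by auto
      have "0 \<le> \<nu> Z (?G a)" "0 \<le> \<nu> Z (?G b)" "Z = Y \<or> n Z \<le> \<nu> Z (?G a)" using goodD(4)[OF a(1) ZP] goodD(4)[OF b(1) ZP] a(2) Z by auto
      moreover have "n Y \<le> \<nu> Y (?G b)" using b(2) by linarith
      ultimately show ?thesis using v[OF a(1) b(1) ZP(1)] by auto
    qed
    thus ?case using gm[OF a(1) b(1) Y(1)] by blast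
  qed
  thus ?thesis unfolding good_def by blast
qed

text \<open>Both points correspond to minimal non-zero primes of a chart around \<open>Y\<close>,
  and these cannot be properly nested.\<close>

lemma cl_P:
  assumes Y: "Y \<in> P" and Z: "Z \<in> P" and c: "Y \<in> cl Z"
  shows "Z = Y"
proof -
  obtain U A h \<phi> where YU: "Y \<in> U" and c: "krull_chart Sch \<xi> U A h \<phi>" by (rule chart_at[OF P_X[OF Y]])
  interpret krull_chart Sch \<xi> U A h \<phi> by (rule c)
  have ZU: "Z \<in> U" using assms(3) YU U(1) cl_iff by blast
  have "j ` h Z \<subseteq> j ` h Y" using j_sub[OF ZU YU] spec_closure[OF YU ZU] assms(3) by simp
  moreover have "kf.hprime (j ` h Y)" "kf.hprime (j ` h Z)" using P_iff[OF YU] P_iff[OF ZU] Y Z by simp_all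
  ultimately have e: "j ` h Z = j ` h Y" by (simp add: kf.hprime_def)
  have "h Z = h Y" by (rule equalityI) (use e j_sub[OF ZU YU] j_sub[OF YU ZU] in simp_all)
  thus ?thesis using h_inj ZU YU by (simp add: inj_on_eq_iff)
qed

lemma self_cl: "x \<in> X \<Longrightarrow> x \<in> cl x"
  using cl_iff by blast

end

section \<open>Images in the generic stalk and the essential valuations\<close>

context cox
begin

abbreviation "Qx x \<equiv> {Y \<in> P. x \<in> cl Y}"
abbreviation "VR Y \<equiv> K_valuation_ring K S (mu Y X)"

lemma gen_simps: "base (gsh) = base Sch" "U \<noteq> {} \<Longrightarrow> sec (gsh) U = S"
  "V \<noteq> {} \<Longrightarrow> restr (gsh) U V s = s"
  by (simp_all add: generic_sheaf_def const_sheaf_def baseR)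

lemma mu_indep: "Y \<in> U \<Longrightarrow> Y \<in> V \<Longrightarrow> mu Y U = mu Y V"
  by (rule ext) (simp add: Cox_mu_def)

lemma mu_out: "Y \<notin> U \<Longrightarrow> mu Y U s = 0"
  by (simp add: Cox_mu_def)

lemma XX: "op X" "X \<noteq> {}"
  using xi_X by auto

lemma Qx_P: "Y \<in> P \<Longrightarrow> Qx Y = {Y}"
  using cl_P self_cl P_X by blast

lemma mu_discrete:
  assumes Y: "Y \<in> P"
  shows "discrete_K_valuation K S (mu Y X)"
proof -
  interpret c: cox_sub K "sec R X" S "gR X" "P \<inter> X" "\<lambda>Y. mu Y X" by (rule sec_sub[OF XX])
  show ?thesis by (rule c.discrete) (use Y P_X in simp)
qed

lemma stalk_image_eq:
  assumes x: "x \<in> X"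
  shows "stim x = carrier S \<inter> (\<Inter>Y\<in>Qx x. VR Y)"
proof -
  interpret c: cox_sub K "gstalk R x" S "cR" "Qx x" "\<lambda>Y. mu Y X" by (rule stalk_sub[OF x])
  have "stim x = c.V (Qx x)" using c.img_V by (simp add: stalk_image_def)
  also have "\<dots> = carrier S \<inter> (\<Inter>Y\<in>Qx x. c.V {Y})" by (rule c.V_inter)
  also have "\<dots> = carrier S \<inter> (\<Inter>Y\<in>Qx x. VR Y)" using c.V_generate by (simp cong: INF_cong_simp)
  finally show ?thesis .
qed

lemma VR_carrier: "Y \<in> P \<Longrightarrow> VR Y \<subseteq> carrier S"
proof
  fix s assume Y: "Y \<in> P" and s: "s \<in> VR Y"
  interpret c: cox_sub K "sec R X" S "gR X" "P \<inter> X" "\<lambda>Y. mu Y X" by (rule sec_sub[OF XX])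
  show "s \<in> carrier S" by (rule c.V_carrier[of _ "{Y}"]) (use c.V_generate[of Y] Y P_X s in simp)
qed

lemma stalk_image_P: "Y \<in> P \<Longrightarrow> stim Y = VR Y"
  using stalk_image_eq[OF P_X, of Y] Qx_P[of Y] VR_carrier[of Y] by auto

lemma stalk_image_inter: "x \<in> X \<Longrightarrow> stim x = carrier S \<inter> (\<Inter>Y\<in>Qx x. stim Y)"
  using stalk_image_eq stalk_image_P by simp

lemma generic_image_eq:
  assumes U: "op U" "U \<noteq> {}"
  shows "gnim U = carrier S \<inter> (\<Inter>Y\<in>P \<inter> U. stim Y)"
proof -
  interpret c: cox_sub K "sec R U" S "gR U" "P \<inter> U" "\<lambda>Y. mu Y U" by (rule sec_sub[OF U])
  have "gnim U = carrier S \<inter> (\<Inter>Y\<in>P \<inter> U. c.V {Y})" using c.img_V c.V_inter by (simp add: generic_image_def)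
  moreover have "c.V {Y} = stim Y" if Y: "Y \<in> P \<inter> U" for Y
    using c.V_generate[OF Y] mu_indep[of Y U X] stalk_image_P[of Y] P_X[of Y] Y by simp
  ultimately show ?thesis by simp
qed

text \<open>For an open set not containing \<open>Y\<close> the valuation is identically zero, so
  its valuation sheaf is generated there by all homogeneous elements; the result is the whole
  ring.\<close>

lemma generate_hplus:
  assumes s: "s \<in> carrier S"
  shows "s \<in> generate_ring S (hplus K S)"
proof -
  have zero: "0[S] \<in> generate_ring S (hplus K S)"
    using generate_ring.eng_add[OF generate_ring.one generate_ring.a_inv[OF generate_ring.one], of S "hplus K S"]
      S.R.r_neg[OF S.R.one_closed] by simp
  show ?thesis
  proof (rule S.hom_induct[OF s, of "\<lambda>s. s \<in> generate_ring S (hplus K S)", OF zero])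
    show "x +[S] y \<in> generate_ring S (hplus K S)" if "x \<in> generate_ring S (hplus K S)" "y \<in> generate_ring S (hplus K S)" for x y
      by (rule generate_ring.eng_add[OF that])
    show "hcomp K S s w \<in> generate_ring S (hplus K S)" if w: "w \<in> carrier K" for w
    proof (cases "hcomp K S s w = 0[S]")
      case False
      show ?thesis by (rule generate_ring.incl[OF S.hplusI[OF w S.hcomp_in[OF s w] False]])
    qed (use zero in simp)
  qed
qed

lemma valuation_sheaf_sec:
  assumes U: "op U" "U \<noteq> {}" and Y: "Y \<in> P"
  shows "K_valuation_sheaf_sec K (gsh) (mu Y) U = (if Y \<in> U then stim Y else carrier S)"
proof -
  let ?g = "\<lambda>V. generate_ring S {a \<in> hplus K S. 0 \<le> mu Y V a}"
  have "(restr (gsh) U V s \<in> generate_ring (sec (gsh) V) {a \<in> hplus K (sec (gsh) V). 0 \<le> mu Y V a}) = (s \<in> ?g V)"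
    if "x \<in> V" for V s x
  proof -
    have "V \<noteq> {}" using that by blast
    show ?thesis unfolding gen_simps(2,3)[OF \<open>V \<noteq> {}\<close>] by (rule refl)
  qed
  note helper = this
  have "K_valuation_sheaf_sec K (gsh) (mu Y) U = {s \<in> carrier S. \<forall>x\<in>U. \<exists>V. op V \<and> x \<in> V \<and> V \<subseteq> U \<and> s \<in> ?g V}"
    unfolding K_valuation_sheaf_sec_def gen_simps(1) gen_simps(2)[OF U(2)]
    by (intro Collect_cong conj_cong refl ball_cong ex_cong1) (rule helper)
  also have "\<dots> = (if Y \<in> U then stim Y else carrier S)"
  proof (cases "Y \<in> U")
    case True
    have g: "?g V = VR Y" if "Y \<in> V" for V
      using mu_indep[of Y V X] that P_X[OF Y] by (simp add: K_valuation_ring_def)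
    have "{s \<in> carrier S. \<forall>x\<in>U. \<exists>V. op V \<and> x \<in> V \<and> V \<subseteq> U \<and> s \<in> ?g V} = VR Y"
    proof (rule equalityI; rule subsetI)
      fix s assume "s \<in> {s \<in> carrier S. \<forall>x\<in>U. \<exists>V. op V \<and> x \<in> V \<and> V \<subseteq> U \<and> s \<in> ?g V}"
      \<comment> \<open>The local condition is exploited at the point \<open>Y\<close> only: over
        every open set containing \<open>Y\<close> the valuation is the same.\<close>
      then obtain V where "Y \<in> V" "s \<in> ?g V" using True by blast
      thus "s \<in> VR Y" using g by simp
    next
      fix s assume s: "s \<in> VR Y"
      have "s \<in> ?g U" unfolding g[OF True] by (rule s)
      thus "s \<in> {s \<in> carrier S. \<forall>x\<in>U. \<exists>V. op V \<and> x \<in> V \<and> V \<subseteq> U \<and> s \<in> ?g V}"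
        using subsetD[OF VR_carrier[OF Y] s] U(1) by blast
    qed
    thus ?thesis using True stalk_image_P[OF Y] by simp
  next
    case False
    have "s \<in> ?g U" if "s \<in> carrier S" for s using generate_hplus[OF that] mu_out[OF False] by simp
    hence "{s \<in> carrier S. \<forall>x\<in>U. \<exists>V. op V \<and> x \<in> V \<and> V \<subseteq> U \<and> s \<in> ?g V} = carrier S" using U(1) by blast
    thus ?thesis using False by simp
  qed
  finally show ?thesis .
qed

lemma K_simple_S: "K_simple K S"
  using S_simple S_graded by (simp add: K_simple_def)

lemma valuation_sheaf:
  assumes Y: "Y \<in> P"
  shows "discrete_K_valuation_sheaf K (gsh) Y (mu Y)"
  unfolding discrete_K_valuation_sheaf_def gen_simps(1)
proof (intro conjI allI impI)
  note d = mu_discrete[OF Y]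
  have d': "discrete_K_valuation K S (mu Y U)" if "Y \<in> U" for U
    using d mu_indep[OF P_X[OF Y] that] by simp
  fix U assume U: "op U \<and> U \<noteq> {}"
  hence s: "sec (gsh) U = S" by (simp add: gen_simps)
  show "K_simple K (sec (gsh) U)" unfolding s by (rule K_simple_S)
  have "1[S] \<in> hplus K S" using S_hplus F.nz_one WD.one_closed Pi_one by metis
  thus "mu Y U ` hplus K (sec (gsh) U) = skyscraper_sec Y U" unfolding s
    using d'[of U] mu_out[of Y U] by (cases "Y \<in> U") (auto simp: discrete_K_valuation_def skyscraper_sec_def)
  show "\<forall>a\<in>hplus K (sec (gsh) U). \<forall>b\<in>hplus K (sec (gsh) U). mu Y U (a *[sec (gsh) U] b) = mu Y U a + mu Y U b"
    unfolding s using d'[of U] mu_out[of Y U] unfolding discrete_K_valuation_def by (cases "Y \<in> U") simp_all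
  show "discrete_K_valuation K (sec (gsh) U) (mu Y U) \<or> (\<forall>a\<in>hplus K (sec (gsh) U). mu Y U a = 0)"
    unfolding s using d'[of U] mu_out[of Y U] by blast
next
  fix U V assume V: "op U \<and> op V \<and> V \<subseteq> U \<and> V \<noteq> {}"
  show "\<forall>a\<in>hplus K (sec (gsh) U). mu Y V (restr (gsh) U V a) = (if Y \<in> V then mu Y U a else 0)"
    using V mu_indep[of Y V U] mu_out[of Y V] by (auto simp: gen_simps)
qed

lemma essential_valuations: "essential_K_valuations_of_sheaf Sch K R \<xi> P mu"
  unfolding essential_K_valuations_of_sheaf_def K_Krull_sheaf_by_def
proof (intro conjI ballI allI impI)
  show "discrete_K_valuation_sheaf K (gsh) Y (mu Y)" if "Y \<in> P" for Y by (rule valuation_sheaf[OF that])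
  fix U assume "R.op U \<and> U \<noteq> {}"
  hence U: "op U" "U \<noteq> {}" by (simp_all add: baseR)
  interpret c: cox_sub K "sec R U" S "gR U" "P \<inter> U" "\<lambda>Y. mu Y U" by (rule sec_sub[OF U])
  show "inj_on (gR U) (secs R U)" by (rule c.\<iota>_inj)
  show "gnim U = carrier (sec (gsh) U) \<inter> (\<Inter>Y\<in>P. K_valuation_sheaf_sec K (gsh) (mu Y) U)"
    unfolding generic_image_eq[OF U] gen_simps(2)[OF U(2)] using valuation_sheaf_sec[OF U]
    by (auto split: if_splits)
  fix f assume "f \<in> hplus K (sec R U)"
  from c.m_fin[OF c.\<iota>_hplus[OF this]] show "finite {Y \<in> P. mu Y U (gR U f) \<noteq> 0}"
    by (rule rev_finite_subset) (use mu_out in auto)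
next
  fix U assume U': "affine_open Sch U \<and> U \<noteq> {}"
  hence U: "op U" "U \<noteq> {}" by (auto simp: affine_open_def is_Spec_of_def)
  interpret c: cox_sub K "sec R U" S "gR U" "P \<inter> U" "\<lambda>Y. mu Y U" by (rule sec_sub[OF U])
  show "K_Krull_in K (Qplus K (sec R U)) (Qplus_embed K (sec R U))" by (rule c.Krull_Qplus)
  note s = gen_simps(2)[OF U(2)]
  have nz: "(\<exists>a\<in>hplus K S. mu Y U a \<noteq> 0) \<longleftrightarrow> Y \<in> U" if "Y \<in> P" for Y
  proof
    assume "Y \<in> U"
    hence "mu Y U ` hplus K S = UNIV" using c.discrete[of Y] that by (simp add: discrete_K_valuation_def)
    then obtain a where "a \<in> hplus K S" "mu Y U a = 1" by (metis UNIV_I imageE)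
    thus "\<exists>a\<in>hplus K S. mu Y U a \<noteq> 0" by (intro bexI[of _ a]) auto
  qed (use mu_out in blast)
  have "{Y \<in> P. \<exists>a\<in>hplus K (sec (gsh) U). mu Y U a \<noteq> 0} = P \<inter> U" unfolding s using nz by blast
  moreover have "essential_K_valuation K (sec R U) (c.pp Y) (mu Y U \<circ> Qplus_to_generic R \<xi> U)" if "Y \<in> P \<inter> U" for Y
    using c.essential[OF that] by (simp add: Qplus_to_generic_def s)
  ultimately show "\<exists>\<theta>. bij_betw \<theta> {Y \<in> P. \<exists>a\<in>hplus K (sec (gsh) U). mu Y U a \<noteq> 0} (K_prime_divisors K (sec R U)) \<and>
      (\<forall>Y\<in>P. (\<exists>a\<in>hplus K (sec (gsh) U). mu Y U a \<noteq> 0) \<longrightarrow>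
        essential_K_valuation K (sec R U) (\<theta> Y) (mu Y U \<circ> Qplus_to_generic R \<xi> U))"
    \<comment> \<open>The valuations that are not identically zero over \<open>U\<close> are those
      of the prime divisors in \<open>U\<close>; each is sent to the principal K-prime ideal of its
      prime element.\<close>
    using c.pp_bij nz unfolding s by (intro exI[of _ "\<lambda>Y. c.pp Y"]) auto
qed

text \<open>A degree \<open>[D]\<close> occurs once there is a non-zero section of the sheaf of
  \<open>D\<close> over \<open>U\<close>, that is, a function whose zeros compensate the finitely
  many negative coefficients of \<open>D\<close>.\<close>

lemma affine_degrees:
  assumes aff: "affine_open Sch U" and ne: "U \<noteq> {}"
  shows "hdeg K (sec R U) ` hplus K (sec R U) = carrier K"
proof (rule equalityI; rule subsetI)
  have U: "op U" using aff by (auto simp: affine_open_def is_Spec_of_def)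
  interpret c: cox_sub K "sec R U" S "gR U" "P \<inter> U" "\<lambda>Y. mu Y U" by (rule sec_sub[OF U ne])
  fix w
  show "w \<in> carrier K" if "w \<in> hdeg K (sec R U) ` hplus K (sec R U)"
    using that by (auto elim: c.A.hplusE)
  assume "w \<in> carrier K"
  then obtain D where D: "w = cls D" "D \<in> carrier WD" unfolding K_carrier by (rule imageE)
  obtain A where sp: "is_Spec_of Sch U A" using aff unfolding affine_open_def by blast
  obtain h \<phi> where iso: "ringed_space_iso (open_restrict Sch U) (spec_sheaf A) h \<phi>" using sp unfolding is_Spec_of_def by blast
  have ch: "aff_chart Sch \<xi> U A h \<phi>"
    using sp ne U iso by (intro aff_chart.intro aff_chart_axioms.intro ischeme_axioms) (auto simp: is_Spec_of_def)
  have B: "finite {Y \<in> P \<inter> U. D Y \<noteq> 0}" using D(2) unfolding WD_carrier by (auto elim: rev_finite_subset)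
  \<comment> \<open>The point at which the function must not vanish is taken to be
    \<open>\<xi>\<close>. It lies in the closure of no prime divisor, so the whole support of
    \<open>D\<close> can be treated.\<close>
  obtain f where f: "gO U (aff_chart.g A \<phi> f) \<in> F.nz" "\<forall>Z\<in>P \<inter> U. 0 \<le> \<nu> Z (gO U (aff_chart.g A \<phi> f))"
      "\<forall>Z\<in>{Y \<in> P \<inter> U. D Y \<noteq> 0}. - D Z \<le> \<nu> Z (gO U (aff_chart.g A \<phi> f))"
    using vanishing_function[OF ch gen_in'[OF U ne] B, of "\<lambda>Z. - D Z"] xi_notin by auto
  let ?z = "gO U (aff_chart.g A \<phi> f)"
  have "0 \<le> \<nu> Z ?z + D Z" if Z: "Z \<in> P \<inter> U" for Z
  proof (cases "D Z = 0")
    case True thus ?thesis using f(2) Z by simp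
  next
    case False
    hence "- D Z \<le> \<nu> Z ?z" using f(3) Z by blast
    thus ?thesis by simp
  qed
  hence O: "?z \<in> OD D U" unfolding O_sec_iff[OF ne] using DiffD1[OF f(1)] by blast
  have g: "rho U ?z D \<in> gcomp (sec R U) w" unfolding D(1) by (rule rho_gcomp[OF U ne D(2) O])
  have wK: "w \<in> carrier K" unfolding D(1) by (rule cls_K[OF D(2)])
  have "rho U ?z D \<noteq> 0[sec R U]"
  proof
    assume "rho U ?z D = 0[sec R U]"
    hence "?z = 0[F]" using rho_inj[OF U ne D(2) O zero_O[OF ne]] rho_zero[OF U ne D(2)] by simp
    thus False using f(1) by simp
  qed
  thus "w \<in> hdeg K (sec R U) ` hplus K (sec R U)" using c.A.hplusI[OF wK g] c.A.hdeg_eq[OF g wK] by (metis imageI)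
qed

end

section \<open>Locality, homogeneous units and degrees of the stalks\<close>

context cox
begin

text \<open>In trivial degree the divisor can be taken trivial, and then the sign conditions on the
  values are exactly those that describe the local ring of the structure sheaf in
  \<open>O_inter\<close>.\<close>

lemma cospec_image_one:
  assumes x: "x \<in> X" and a: "a \<in> gcomp (gstalk R x) 1[K]"
  shows "\<exists>y\<in>stks Sch x. cR a = Pi' (cO y) 1[WD]"
proof -
  interpret c: cox_sub K "gstalk R x" S "cR" "Qx x" "\<lambda>Y. mu Y X" by (rule stalk_sub[OF x])
  have "cR a \<in> {s \<in> gcomp S 1[K]. s = 0[S] \<or> (\<forall>Y\<in>Qx x. 0 \<le> mu Y X s)}"
    using c.img[OF S.K.one_closed] a by (metis (no_types, lifting) imageI)
  hence s: "cR a \<in> gcomp S (cls 1[WD])" "cR a = 0[S] \<or> (\<forall>Y\<in>Qx x. 0 \<le> mu Y X (cR a))"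
    by (simp_all add: cls_one)
  obtain f where f: "f \<in> carrier F" "cR a = Pi' f 1[WD]" using s(1) unfolding S_gcomp[OF WD.one_closed] by blast
  have "f = 0[F] \<or> (\<forall>Y\<in>P. x \<in> cl Y \<longrightarrow> 0 \<le> \<nu> Y f)"
  proof (cases "f = 0[F]")
    case False
    hence fn: "f \<in> F.nz" using f(1) by simp
    have "\<forall>Y\<in>Qx x. 0 \<le> mu Y X (Pi' f 1[WD])" using s(2) Pi_nz[OF f(1) WD.one_closed] False unfolding f(2) by simp
    thus ?thesis using mu_eq[OF fn WD.one_closed] P_X by (simp add: WD_one)
  qed simp
  hence "f \<in> Oc x" unfolding O_inter[OF x] using f(1) by blast
  then obtain y where "f = cO y" "y \<in> stks Sch x" by (rule imageE)
  thus ?thesis using f(2) by blast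
qed

text \<open>In trivial degree the stalk is the local ring of the structure sheaf, so the claim is
  \<open>local_O\<close> read through the generic stalk, with units recognized by their
  values.\<close>

lemma stalk_local:
  assumes x: "x \<in> X" and a: "a \<in> gcomp (gstalk R x) 1[K]" and b: "b \<in> gcomp (gstalk R x) 1[K]" and e: "a +[gstalk R x] b = 1[gstalk R x]"
  shows "a \<in> Units (gstalk R x) \<or> b \<in> Units (gstalk R x)"
proof -
  interpret c: cox_sub K "gstalk R x" S "cR" "Qx x" "\<lambda>Y. mu Y X" by (rule stalk_sub[OF x])
  note oK = S.K.one_closed
  note ab = c.A.gcomp_carrier[OF oK a] c.A.gcomp_carrier[OF oK b]
  interpret St: cring "stalk Sch x" by (rule stalk_cring[OF x])
  obtain y where y: "y \<in> stks Sch x" "cR a = Pi' (cO y) 1[WD]" using cospec_image_one[OF x a] by blast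
  obtain z where z: "z \<in> stks Sch x" "cR b = Pi' (cO z) 1[WD]" using cospec_image_one[OF x b] by blast
  note yz = ring_hom_closed[OF O_hom[OF x] y(1)] ring_hom_closed[OF O_hom[OF x] z(1)]
  have "Pi' (cO y +[F] cO z) 1[WD] = cR (a +[gstalk R x] b)"
    using Pi_add[OF yz WD.one_closed] y(2) z(2) c.rh.hom_add[OF ab] by simp
  also have "\<dots> = Pi' 1[F] 1[WD]" unfolding e using c.rh.hom_one Pi_one by simp
  finally have "cO y +[F] cO z = 1[F]" using Pi_inj[OF _ _ WD.one_closed] yz by simp
  hence "cO (y +[stalk Sch x] z) = cO 1[stalk Sch x]"
    using ring_hom_add[OF O_hom[OF x] y(1) z(1)] ring_hom_one[OF O_hom[OF x]] by simp
  hence "y +[stalk Sch x] z = 1[stalk Sch x]" by (rule inj_onD[OF cospec_inj[of x]]) (use y z in simp_all)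
  note l = local_O[OF x y(1) z(1) this]
  have key: "d \<in> Units (gstalk R x)" if d: "d \<in> gcomp (gstalk R x) 1[K]" "cR d = Pi' f 1[WD]" "f \<in> F.nz" and v: "\<forall>Y\<in>P. x \<in> cl Y \<longrightarrow> \<nu> Y f = 0" for d f
  proof -
    have "cR d \<noteq> 0[S]" unfolding d(2) using Pi_nz[OF DiffD1[OF d(3)] WD.one_closed] d(3) by simp
    hence "d \<noteq> 0[gstalk R x]" using c.rh.hom_zero by metis
    hence "d \<in> hplus K (gstalk R x)" by (rule c.A.hplusI[OF oK d(1)])
    moreover have "\<forall>Y\<in>Qx x. mu Y X (cR d) = 0" unfolding d(2) using mu_eq[OF d(3) WD.one_closed] v P_X by (simp add: WD_one)
    ultimately show ?thesis using c.unit_iff by blast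
  qed
  from l show ?thesis
  proof
    assume "cO y \<noteq> 0[F] \<and> (\<forall>Y\<in>P. x \<in> cl Y \<longrightarrow> \<nu> Y (cO y) = 0)"
    thus ?thesis using key[OF a y(2)] yz(1) by simp
  next
    assume "cO z \<noteq> 0[F] \<and> (\<forall>Y\<in>P. x \<in> cl Y \<longrightarrow> \<nu> Y (cO z) = 0)"
    thus ?thesis using key[OF b z(2)] yz(2) by simp
  qed
qed

lemma hplus_rep:
  assumes x: "x \<in> X" and z: "z \<in> hplus K (gstalk R x)"
  obtains U f where "op U" "x \<in> U" "f \<in> hplus K (sec R U)" "z = germ R x U f" "cR z = gR U f"
proof -
  interpret c: cox_sub K "gstalk R x" S "cR" "Qx x" "\<lambda>Y. mu Y X" by (rule stalk_sub[OF x])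
  obtain w where w: "w \<in> carrier K" "z \<in> gcomp (gstalk R x) w" "z \<noteq> 0[gstalk R x]" using z by (rule c.A.hplusE)
  obtain U f where U: "op U" "x \<in> U" "f \<in> gcomp (sec R U) w" "z = germ R x U f" using w(2) by (auto simp: gstalk_simps baseR)
  have oR: "R.op U" using U(1) by (simp add: baseR)
  interpret g: grd K "sec R U" by (rule R.sec_grd[OF oR])
  have "f \<noteq> 0[sec R U]" using R.germ_zero[OF oR U(2)] U(4) w(3) by (metis gstalk_simps(5))
  hence "f \<in> hplus K (sec R U)" by (rule g.hplusI[OF w(1) U(3)])
  moreover have "cR z = gR U f" unfolding U(4) by (rule cospec_R[OF U(1,2) g.gcomp_carrier[OF w(1) U(3)]])
  ultimately show ?thesis using that U by blast
qed

lemma germ_cospec: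
  assumes U: "op U" "x \<in> U" and f: "f \<in> hplus K (sec R U)"
  shows "cR (germ R x U f) = gR U f"
proof -
  have oR: "R.op U" using U(1) by (simp add: baseR)
  interpret g: grd K "sec R U" by (rule R.sec_grd[OF oR])
  show ?thesis by (rule cospec_R[OF U g.hplus_carrier[OF f]])
qed

lemma max_ideal_support:
  assumes x: "x \<in> X"
  shows "max_K_ideal K (gstalk R x) \<inter> hplus K (gstalk R x) =
    {z \<in> hplus K (gstalk R x). \<exists>U f. op U \<and> x \<in> U \<and> f \<in> hplus K (sec R U) \<and>
      z = germ R x U f \<and> x \<in> div_support Sch U (cdiv U (gR U f))}" (is "_ = {z \<in> _. ?R z}")
proof -
  interpret c: cox_sub K "gstalk R x" S "cR" "Qx x" "\<lambda>Y. mu Y X" by (rule stalk_sub[OF x])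
  \<comment> \<open>For \<open>Y\<close> in \<open>U\<close> the closure of \<open>Y\<close>
    relative to \<open>U\<close> has the same points in \<open>U\<close> as the full closure, and
    every prime divisor whose closure contains \<open>x\<close> lies in \<open>U\<close>.\<close>
  have s: "x \<in> div_support Sch U (cdiv U t) \<longleftrightarrow> (\<exists>Y\<in>Qx x. mu Y X t \<noteq> 0)" if U: "op U" "x \<in> U" for U t
  proof -
    have "x \<in> subtopology (base Sch) U closure_of {Y} \<longleftrightarrow> x \<in> cl Y" if "Y \<in> U" for Y
      using U that by (simp add: closure_of_subtopology)
    hence "x \<in> div_support Sch U (cdiv U t) \<longleftrightarrow> (\<exists>Y\<in>P \<inter> U. mu Y U t \<noteq> 0 \<and> x \<in> cl Y)"
      by (auto simp: div_support_def Cox_div_def)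
    moreover have "Y \<in> U" if "x \<in> cl Y" for Y using that U cl_iff by blast
    moreover have "mu Y U = mu Y X" if "Y \<in> P" "Y \<in> U" for Y using mu_indep[OF that(2) P_X[OF that(1)]] .
    ultimately show ?thesis by auto
  qed
  have "(\<exists>Y\<in>Qx x. mu Y X (cR z) \<noteq> 0) \<longleftrightarrow> ?R z" if z: "z \<in> hplus K (gstalk R x)" for z
  proof
    assume l: "\<exists>Y\<in>Qx x. mu Y X (cR z) \<noteq> 0"
    obtain U f where U: "op U" "x \<in> U" "f \<in> hplus K (sec R U)" "z = germ R x U f" "cR z = gR U f" by (rule hplus_rep[OF x z])
    show "?R z"
      using U l s[OF U(1,2), of "gR U f"] by (intro exI[of _ U] exI[of _ f]) simp
  next
    assume "?R z"
    then obtain U f where U: "op U" "x \<in> U" "f \<in> hplus K (sec R U)" "z = germ R x U f" "x \<in> div_support Sch U (cdiv U (gR U f))"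
      by (elim exE conjE)
    show "\<exists>Y\<in>Qx x. mu Y X (cR z) \<noteq> 0" unfolding U(4) germ_cospec[OF U(1,2,3)] using s[OF U(1,2)] U(5) by simp
  qed
  moreover have "max_K_ideal K (gstalk R x) \<inter> hplus K (gstalk R x) = {a \<in> hplus K (gstalk R x). \<exists>Y\<in>Qx x. mu Y X (cR a) \<noteq> 0}"
    by (rule c.max_K_ideal_hplus) (rule stalk_local[OF x])
  ultimately show ?thesis by (simp cong: conj_cong)
qed

lemma open_minus:
  assumes B: "finite B"
  shows "op (X - \<Union> (cl ` B))" "x \<in> X \<Longrightarrow> (\<forall>Y\<in>B. x \<notin> cl Y) \<Longrightarrow> x \<in> X - \<Union> (cl ` B)"
  "Y \<in> X - \<Union> (cl ` B) \<Longrightarrow> Y \<notin> B"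
proof -
  have "closedin (base Sch) (\<Union> (cl ` B))" by (rule closedin_Union) (use B in auto)
  thus "op (X - \<Union> (cl ` B))" by (rule openin_diff[OF openin_topspace])
  show "Y \<notin> B" if "Y \<in> X - \<Union> (cl ` B)" using that self_cl by blast
qed auto

text \<open>A unit germ has value zero at the prime divisors through \<open>x\<close>. The closures
  of the finitely many others at which its value is not zero can be removed, and on the remaining
  neighbourhood of \<open>x\<close> the divisor is trivial.\<close>

lemma hunits_div:
  assumes x: "x \<in> X"
  shows "hunits K (gstalk R x) =
    {z \<in> hplus K (gstalk R x). \<exists>U f. op U \<and> x \<in> U \<and> f \<in> hplus K (sec R U) \<and>
      z = germ R x U f \<and> cdiv U (gR U f) = 1[wdiv Sch U]}" (is "_ = {z \<in> _. ?R z}")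
proof -
  interpret c: cox_sub K "gstalk R x" S "cR" "Qx x" "\<lambda>Y. mu Y X" by (rule stalk_sub[OF x])
  have s: "cdiv U t = 1[wdiv Sch U] \<longleftrightarrow> (\<forall>Y\<in>P \<inter> U. mu Y X t = 0)" for U t
  proof -
    have m: "mu Y U = mu Y X" if "Y \<in> P \<inter> U" for Y using that P_X[of Y] mu_indep[of Y U X] by simp
    have "cdiv U t = 1[wdiv Sch U] \<longleftrightarrow> (\<lambda>Y\<in>P \<inter> U. mu Y X t) = (\<lambda>Y\<in>P \<inter> U. 0)"
      unfolding Cox_div_def wdiv_def using m by (simp cong: restrict_cong)
    also have "\<dots> \<longleftrightarrow> (\<forall>Y\<in>P \<inter> U. mu Y X t = 0)"
      by (auto simp: fun_eq_iff restrict_def split: if_splits)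
    finally show ?thesis .
  qed
  have "(\<forall>Y\<in>Qx x. mu Y X (cR z) = 0) \<longleftrightarrow> ?R z" if z: "z \<in> hplus K (gstalk R x)" for z
  proof
    assume l: "\<forall>Y\<in>Qx x. mu Y X (cR z) = 0"
    obtain U f where U: "op U" "x \<in> U" "f \<in> hplus K (sec R U)" "z = germ R x U f" "cR z = gR U f" by (rule hplus_rep[OF x z])
    have fin: "finite {Y \<in> P. mu Y X (cR z) \<noteq> 0}"
    proof -
      obtain g D where g: "g \<in> F.nz" "D \<in> carrier WD" "cR z = Pi' g D" using c.\<iota>_hplus[OF z] unfolding S_hplus by blast
      have "{Y \<in> P. mu Y X (Pi' g D) \<noteq> 0} = {Y \<in> P. \<nu> Y g + D Y \<noteq> 0}"
        using mu_eq[OF g(1,2)] P_X by (intro Collect_cong conj_cong refl) simp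
      thus ?thesis unfolding g(3) using fin_val[OF g(1,2)] by simp
    qed
    let ?B = "{Y \<in> P. mu Y X (cR z) \<noteq> 0}"
    let ?V = "U \<inter> (X - \<Union> (cl ` ?B))"
    have "\<forall>Y\<in>?B. x \<notin> cl Y" using l by blast
    hence V: "op ?V" "x \<in> ?V" using openin_Int[OF U(1) open_minus(1)[OF fin]] IntI[OF U(2) open_minus(2)[OF fin x]] by simp_all
    have oR: "R.op U" "R.op ?V" using U(1) V(1) by (simp_all add: baseR)
    interpret g: grd K "sec R U" by (rule R.sec_grd[OF oR(1)])
    interpret v: grd K "sec R ?V" by (rule R.sec_grd[OF oR(2)])
    obtain w where w: "w \<in> carrier K" "f \<in> gcomp (sec R U) w" using U(3) by (rule g.hplusE)
    let ?f = "restr R U ?V f"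
    have fw: "?f \<in> gcomp (sec R ?V) w" by (rule R.restr_gcomp[OF oR _ w]) blast
    have gz: "germ R x ?V ?f = z" using R.germ_restr[OF oR V(2) _ g.gcomp_carrier[OF w]] U(4) by simp
    have "?f \<noteq> 0[sec R ?V]" using gz R.germ_zero[OF oR(2) V(2)] z c.A.hplusE by (metis gstalk_simps(5))
    hence fh: "?f \<in> hplus K (sec R ?V)" by (rule v.hplusI[OF w(1) fw])
    have g: "gR ?V ?f = cR z" using germ_cospec[OF V fh] gz by simp
    have "cdiv ?V (gR ?V ?f) = 1[wdiv Sch ?V]" unfolding s g
    proof
      fix Y assume "Y \<in> P \<inter> ?V"
      hence "Y \<in> P" "Y \<notin> ?B" using open_minus(3)[OF fin, of Y] by blast+
      thus "mu Y X (cR z) = 0" by simp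
    qed
    thus "?R z"
      by (intro exI[of _ ?V] exI[of _ ?f] conjI V fh gz[symmetric])
  next
    assume "?R z"
    then obtain U f where U: "op U" "x \<in> U" "f \<in> hplus K (sec R U)" "z = germ R x U f" "cdiv U (gR U f) = 1[wdiv Sch U]"
      by (elim exE conjE)
    have "Y \<in> U" if "x \<in> cl Y" for Y using that U cl_iff by blast
    moreover have "\<forall>Y\<in>P \<inter> U. mu Y X (cR z) = 0" using U(5) unfolding s U(4) germ_cospec[OF U(1,2,3)] .
    ultimately show "\<forall>Y\<in>Qx x. mu Y X (cR z) = 0" by blast
  qed
  thus ?thesis unfolding c.hunits_eq by (simp cong: conj_cong)
qed

text \<open>Agreement at the prime divisors through \<open>x\<close> spreads to a neighbourhood,
  because the remaining disagreements are finitely many and their closures avoid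
  \<open>x\<close>.\<close>

lemma principal_near:
  assumes x: "x \<in> X" and D: "D \<in> carrier WD"
  shows "(\<exists>U. op U \<and> x \<in> U \<and> (\<exists>f\<in>rat_units Sch \<xi>. div_restrict Sch U D = pdiv Sch \<xi> U f)) \<longleftrightarrow>
    (\<exists>f\<in>F.nz. \<forall>Y\<in>Qx x. D Y = \<nu> Y f)"
proof
  assume "\<exists>U. op U \<and> x \<in> U \<and> (\<exists>f\<in>rat_units Sch \<xi>. div_restrict Sch U D = pdiv Sch \<xi> U f)"
  then obtain U f where U: "op U" "x \<in> U" "f \<in> F.nz" "div_restrict Sch U D = pdiv Sch \<xi> U f" unfolding rat_units by blast
  have "D Y = \<nu> Y f" if "Y \<in> Qx x" for Y
  proof -
    have "Y \<in> U" using that U(1,2) cl_iff by blast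
    thus ?thesis using fun_cong[OF U(4), of Y] that by (simp add: div_restrict_def pdiv_def)
  qed
  thus "\<exists>f\<in>F.nz. \<forall>Y\<in>Qx x. D Y = \<nu> Y f" using U(3) by blast
next
  assume "\<exists>f\<in>F.nz. \<forall>Y\<in>Qx x. D Y = \<nu> Y f"
  then obtain f where f: "f \<in> F.nz" "\<forall>Y\<in>Qx x. D Y = \<nu> Y f" by blast
  let ?B = "{Y \<in> P. \<nu> Y f - D Y \<noteq> 0}"
  have B: "finite ?B" using fin_val[OF f(1) WD.inv_closed[OF D]] by (simp add: WD_inv[OF D] cong: conj_cong)
  let ?U = "X - \<Union> (cl ` ?B)"
  have "div_restrict Sch ?U D = pdiv Sch \<xi> ?U f" unfolding div_restrict_def pdiv_def
  proof (rule restrict_ext)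
    fix Y assume "Y \<in> P \<inter> ?U"
    hence "Y \<in> P" "Y \<notin> ?B" using open_minus(3)[OF B, of Y] by blast+
    thus "D Y = \<nu> Y f" by simp
  qed
  moreover have "\<forall>Y\<in>?B. x \<notin> cl Y" using f(2) by force
  hence "x \<in> ?U" by (rule open_minus(2)[OF B x])
  ultimately show "\<exists>U. op U \<and> x \<in> U \<and> (\<exists>f\<in>rat_units Sch \<xi>. div_restrict Sch U D = pdiv Sch \<xi> U f)"
    unfolding rat_units using f(1) open_minus(1)[OF B] by blast
qed

text \<open>A unit is given by a monomial with function \<open>f\<close> and divisor
  \<open>D\<close> whose value is zero at every prime divisor through \<open>x\<close>. So
  \<open>D\<close> agrees there with the divisor of the inverse of \<open>f\<close>, and this
  argument can be reversed.\<close>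

lemma unit_degrees:
  assumes x: "x \<in> X"
  shows "hdeg K (gstalk R x) ` hunits K (gstalk R x) = {cls D | D. D \<in> carrier WD \<and> (\<exists>f\<in>F.nz. \<forall>Y\<in>Qx x. D Y = \<nu> Y f)}" (is "?L = ?R")
proof (rule equalityI; rule subsetI)
  interpret c: cox_sub K "gstalk R x" S "cR" "Qx x" "\<lambda>Y. mu Y X" by (rule stalk_sub[OF x])
  fix w
  {
    assume "w \<in> ?L"
    then obtain a where a: "w = hdeg K (gstalk R x) a" "a \<in> hunits K (gstalk R x)" by (rule imageE)
    have ah: "a \<in> hplus K (gstalk R x)" "\<forall>Y\<in>Qx x. mu Y X (cR a) = 0" using a(2) unfolding c.hunits_eq by blast+
    have w: "w \<in> carrier K" "a \<in> gcomp (gstalk R x) w" "a \<noteq> 0[gstalk R x]" using ah(1) a(1) by (auto elim: c.A.hplusE simp del: gstalk_simps)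
    obtain D where D: "w = cls D" "D \<in> carrier WD" using w(1) unfolding K_carrier by (rule imageE)
    have "cR a \<in> gcomp S (cls D)" using c.gcomp_iff[OF c.A.gcomp_carrier[OF w(1,2)] w(1)] w(2) D(1) by simp
    then obtain f where f: "f \<in> carrier F" "cR a = Pi' f D" unfolding S_gcomp[OF D(2)] by blast
    have "cR a \<noteq> 0[S]" using c.\<iota>_hplus[OF ah(1)] by (auto elim: S.hplusE)
    hence fn: "f \<in> F.nz" using f Pi_nz[OF f(1) D(2)] by simp
    have "D Y = \<nu> Y (inv[F] f)" if Y: "Y \<in> Qx x" for Y
      using ah(2) Y mu_eq[OF fn D(2), of Y X] P_X[of Y] F.dval_inv[OF nu_dval fn, of Y] unfolding f(2) by simp
    thus "w \<in> ?R" using D F.nz_inv[OF fn] by blast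
  next
    assume "w \<in> ?R"
    then obtain D f where D: "w = cls D" "D \<in> carrier WD" "f \<in> F.nz" "\<forall>Y\<in>Qx x. D Y = \<nu> Y f" by blast
    note wK = cls_K[OF D(2)]
    have i: "inv[F] f \<in> F.nz" by (rule F.nz_inv[OF D(3)])
    have m: "mu Y X (Pi' (inv[F] f) D) = 0" if Y: "Y \<in> Qx x" for Y
      using D(4) Y mu_eq[OF i D(2), of Y X] P_X[of Y] F.dval_inv[OF nu_dval D(3), of Y] by simp
    have "Pi' (inv[F] f) D \<in> hplus K S" unfolding S_hplus using i D(2) by blast
    hence "\<exists>a\<in>hplus K (gstalk R x). cR a = Pi' (inv[F] f) D" by (rule c.lift_hplus) (simp only: m order_refl)
    then obtain a where a: "a \<in> hplus K (gstalk R x)" "cR a = Pi' (inv[F] f) D" by (rule bexE)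
    have "a \<in> hunits K (gstalk R x)" unfolding c.hunits_eq using a m by simp
    moreover have "a \<in> gcomp (gstalk R x) (cls D)"
      using c.gcomp_iff[OF c.A.hplus_carrier[OF a(1)] wK] Pi_gcomp[OF DiffD1[OF i] D(2)] a(2) by simp
    hence "hdeg K (gstalk R x) a = w" unfolding D(1) by (rule c.A.hdeg_eq[OF _ wK]) (rule c.A.hplusE[OF a(1)])
    ultimately show "w \<in> ?L" by (metis imageI)
  }
qed

lemma unit_degrees_subgroup:
  assumes x: "x \<in> X"
  shows "subgroup (hdeg K (gstalk R x) ` hunits K (gstalk R x)) K"
proof -
  have inv: "inv[K] (cls D) = cls (inv[WD] D)" if "D \<in> carrier WD" for D
    by (rule S.K.inv_equality) (use that cls_mult[of "inv[WD] D" D] cls_one cls_K in simp_all)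
  show ?thesis unfolding unit_degrees[OF x]
  proof (rule S.K.subgroupI)
    let ?R = "{cls D | D. D \<in> carrier WD \<and> (\<exists>f\<in>F.nz. \<forall>Y\<in>Qx x. D Y = \<nu> Y f)}"
    show "?R \<subseteq> carrier K" using cls_K by blast
    have "\<forall>Y\<in>Qx x. 1[WD] Y = \<nu> Y 1[F]" using F.dval_one[OF nu_dval] by (simp add: WD_one)
    thus "?R \<noteq> {}" using WD.one_closed F.nz_one by blast
    fix a assume "a \<in> ?R"
    then obtain D f where D: "a = cls D" "D \<in> carrier WD" "f \<in> F.nz" "\<forall>Y\<in>Qx x. D Y = \<nu> Y f" by blast
    have "(inv[WD] D) Y = \<nu> Y (inv[F] f)" if "Y \<in> Qx x" for Y
      using that D(4) F.dval_inv[OF nu_dval D(3), of Y] by (simp add: WD_inv[OF D(2)])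
    thus "inv[K] a \<in> ?R" unfolding D(1) inv[OF D(2)] using WD.inv_closed[OF D(2)] F.nz_inv[OF D(3)] by blast
    fix b assume "b \<in> ?R"
    then obtain E g where E: "b = cls E" "E \<in> carrier WD" "g \<in> F.nz" "\<forall>Y\<in>Qx x. E Y = \<nu> Y g" by blast
    have "(D *[WD] E) Y = \<nu> Y (f *[F] g)" if "Y \<in> Qx x" for Y
      using that D(4) E(4) F.dval_mult[OF nu_dval D(3) E(3), of Y] by (simp add: WD_mult)
    thus "a *[K] b \<in> ?R" unfolding D(1) E(1) cls_mult[OF D(2) E(2)]
      using WD.m_closed[OF D(2) E(2)] F.nz_mult[OF D(3) E(3)] by blast
  qed
qed

text \<open>Only \<open>Y\<close> itself passes through the point \<open>Y\<close>, and the
  valuation at \<open>Y\<close> takes every integer value.\<close>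

lemma unit_degrees_all:
  assumes Y: "Y \<in> P"
  shows "hdeg K (gstalk R Y) ` hunits K (gstalk R Y) = carrier K"
proof -
  have "\<exists>f\<in>F.nz. D Y = \<nu> Y f" for D using F.dval_surj[OF nu_dval[OF Y], of "D Y"] by metis
  thus ?thesis unfolding unit_degrees[OF P_X[OF Y]] Qx_P[OF Y] K_carrier by auto
qed

lemma unit_degrees_principal:
  assumes x: "x \<in> X"
  shows "hdeg K (gstalk R x) ` hunits K (gstalk R x) = {cls D | D. D \<in> carrier WD \<and>
    (\<exists>U. op U \<and> x \<in> U \<and> (\<exists>f\<in>rat_units Sch \<xi>. div_restrict Sch U D = pdiv Sch \<xi> U f))}"
  unfolding unit_degrees[OF x] using principal_near[OF x] by (intro Collect_cong ex_cong1 conj_cong refl) simp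

lemma stalk_K_Krull:
  assumes x: "x \<in> X"
  shows "K_local K (gstalk R x)" "K_Krull_in K S (stim x)" "inj_on (cR) (stks R x)"
proof -
  interpret c: cox_sub K "gstalk R x" S "cR" "Qx x" "\<lambda>Y. mu Y X" by (rule stalk_sub[OF x])
  show "K_local K (gstalk R x)" by (rule c.K_local) (rule stalk_local[OF x])
  show "K_Krull_in K S (stim x)" "inj_on (cR) (stks R x)"
    using c.Krull c.\<iota>_inj by (simp_all add: stalk_image_def)
qed

lemma sections_K_factorial:
  assumes U: "op U" "U \<noteq> {}"
  shows "K_factorial K (sec R U)" (is ?F) "generate K (hdeg K (sec R U) ` hplus K (sec R U)) = carrier K" (is ?G)
    "graded_ring_iso K (Qplus K (sec R U)) (sec (gsh) U) (Qplus_to_generic R \<xi> U)" (is ?Q)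
proof -
  interpret c: cox_sub K "sec R U" S "gR U" "P \<inter> U" "\<lambda>Y. mu Y U" by (rule sec_sub[OF U])
  show ?F ?G ?Q using c.factorial c.degrees_generate c.Qplus_iso gen_simps(2)[OF U(2)] by (simp_all add: Qplus_to_generic_def)
qed

section \<open>Scalars\<close>

abbreviation "sc \<equiv> Cox_scalar_stalk Sch \<xi> R \<pi>"

lemma scalar_OD:
  assumes U: "op U" "U \<noteq> {}" and a: "a \<in> secs Sch U"
  shows "gO U a \<in> OD 1[WD] U"
proof -
  have "gO U a = 0[F] \<or> 0 \<le> \<nu> Y (gO U a)" if Y: "Y \<in> P \<inter> U" for Y
  proof -
    have Y': "Y \<in> U" "Y \<in> P" using Y by auto
    have "gO U a \<in> Oc Y" using cospec_Sch_germ[OF U(1) Y'(1) a] stalkI[OF U(1) Y'(1) a] by (metis imageI)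
    thus ?thesis unfolding nu_O[OF Y'(2), symmetric] vr_def by simp
  qed
  moreover have "gO U a \<in> carrier F" by (rule stalkI[OF U(1) gen_in'[OF U] a])
  ultimately show ?thesis by (auto simp: O_sec_iff[OF U(2)] WD_one)
qed

lemma scalar_eq: "U \<noteq> {} \<Longrightarrow> scal U a = rho U (gO U a) 1[WD]"
  by (simp add: Cox_scalar_def rho_def)

lemma sc:
  assumes x: "x \<in> X" and z: "z \<in> stks Sch x"
  shows "sc x z \<in> gcomp (gstalk R x) 1[K]" "cR (sc x z) = Pi' (cO z) 1[WD]"
proof -
  obtain U a where U: "op U" "x \<in> U" "a \<in> secs Sch U" "z = germ Sch x U a" using z by (rule stalkE)
  have germ1: "germ R x V (scal V b) \<in> gcomp (gstalk R x) 1[K] \<and>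
      cR (germ R x V (scal V b)) = Pi' (gO V b) 1[WD]"
    if V: "op V" "x \<in> V" and b: "b \<in> secs Sch V" for V b
  proof -
    have ne: "V \<noteq> {}" using V by blast
    note o = scalar_OD[OF V(1) ne b]
    note g = rho_gcomp[OF V(1) ne WD.one_closed o, unfolded cls_one]
    show ?thesis unfolding scalar_eq[OF ne]
      using cospec_R[OF V rho_sec[OF V(1) ne WD.one_closed o]] germ_rho[OF V(1) ne WD.one_closed o] g V
      by (auto simp: gstalk_simps baseR)
  qed
  interpret c: cox_sub K "gstalk R x" S "cR" "Qx x" "\<lambda>Y. mu Y X" by (rule stalk_sub[OF x])
  \<comment> \<open>Independence of the representative is tested in the generic stalk, into which
    the stalk at \<open>x\<close> embeds.\<close>
  have same: "germ R x V (scal V b) = germ R x U (scal U a)" if m: "(V, b) \<in> z" for V b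
  proof -
    have V: "op V" "x \<in> V" "b \<in> secs Sch V" using m unfolding U(4) germ_mem by blast+
    have e: "germ Sch x V b = germ Sch x U a" using germ_of_mem[OF U(1,3)] m unfolding U(4) by blast
    have "gO V b = gO U a"
      using cospec_Sch_germ[OF V] cospec_Sch_germ[OF U(1-3)] e by simp
    hence "cR (germ R x V (scal V b)) = cR (germ R x U (scal U a))"
      using germ1[OF V] germ1[OF U(1-3)] by simp
    thus ?thesis by (rule inj_onD[OF c.\<iota>_inj]) (use germ1[OF V] germ1[OF U(1-3)] c.A.gcomp_carrier[OF S.K.one_closed] in blast)+
  qed
  have mem: "(U, a) \<in> z" unfolding U(4) by (rule germ_self[OF U(1-3)])
  have "sc x z = (\<Union>(V, b)\<in>z. germ R x U (scal U a))"
    unfolding Cox_scalar_stalk_def by (intro SUP_cong refl) (use same in \<open>auto split: prod.splits\<close>)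
  also have "\<dots> = germ R x U (scal U a)" using mem by auto
  finally have s: "sc x z = germ R x U (scal U a)" .
  show "sc x z \<in> gcomp (gstalk R x) 1[K]" "cR (sc x z) = Pi' (cO z) 1[WD]"
    unfolding s using germ1[OF U(1-3)] cospec_Sch_germ[OF U(1-3)] U(4) by simp_all
qed

text \<open>All identities are tested in the generic stalk, where the map becomes \<open>Pi'\<close>
  at the trivial divisor.\<close>

lemma scalar_iso:
  assumes x: "x \<in> X"
  shows "sc x \<in> ring_iso (stalk Sch x) ((stalk R x)\<lparr>carrier := gcomp (gstalk R x) 1[K]\<rparr>)"
proof -
  interpret c: cox_sub K "gstalk R x" S "cR" "Qx x" "\<lambda>Y. mu Y X" by (rule stalk_sub[OF x])
  interpret St: cring "stalk Sch x" by (rule stalk_cring[OF x])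
  note O = O_hom[OF x]
  have car: "sc x z \<in> carrier (gstalk R x)" if "z \<in> stks Sch x" for z
    by (rule c.A.gcomp_carrier[OF S.K.one_closed sc(1)[OF x that]])
  have inj: "y = z" if "cR y = cR z" "y \<in> carrier (gstalk R x)" "z \<in> carrier (gstalk R x)" for y z
    by (rule inj_onD[OF c.\<iota>_inj that])
  note OF = ring_hom_closed[OF O]
  have m: "sc x (y *[stalk Sch x] z) = sc x y *[gstalk R x] sc x z" and a: "sc x (y +[stalk Sch x] z) = sc x y +[gstalk R x] sc x z"
    if y: "y \<in> stks Sch x" and z: "z \<in> stks Sch x" for y z
  proof -
    show "sc x (y *[stalk Sch x] z) = sc x y *[gstalk R x] sc x z"
    proof (rule inj)
      show "cR (sc x (y *[stalk Sch x] z)) = cR (sc x y *[gstalk R x] sc x z)"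
        unfolding sc(2)[OF x St.m_closed[OF y z]] c.rh.hom_mult[OF car[OF y] car[OF z]] sc(2)[OF x y] sc(2)[OF x z]
          Pi_mult[OF OF[OF y] OF[OF z] WD.one_closed WD.one_closed] ring_hom_mult[OF O y z] by simp
    qed (use car y z c.A.R.m_closed in \<open>simp_all del: gstalk_simps\<close>)
    show "sc x (y +[stalk Sch x] z) = sc x y +[gstalk R x] sc x z"
    proof (rule inj)
      show "cR (sc x (y +[stalk Sch x] z)) = cR (sc x y +[gstalk R x] sc x z)"
        unfolding sc(2)[OF x St.a_closed[OF y z]] c.rh.hom_add[OF car[OF y] car[OF z]] sc(2)[OF x y] sc(2)[OF x z]
          Pi_add[OF OF[OF y] OF[OF z] WD.one_closed] ring_hom_add[OF O y z] by simp
    qed (use car y z c.A.R.a_closed in \<open>simp_all del: gstalk_simps\<close>)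
  qed
  have one: "sc x 1[stalk Sch x] = 1[gstalk R x]"
  proof (rule inj)
    show "cR (sc x 1[stalk Sch x]) = cR 1[gstalk R x]"
      unfolding sc(2)[OF x St.one_closed] ring_hom_one[OF O] Pi_one using c.rh.hom_one by simp
  qed (use car[OF St.one_closed] c.A.R.one_closed in \<open>simp_all del: gstalk_simps\<close>)
  have "bij_betw (sc x) (stks Sch x) (gcomp (gstalk R x) 1[K])"
  proof (rule bij_betwI')
    fix y z assume y: "y \<in> stks Sch x" and z: "z \<in> stks Sch x"
    show "sc x y = sc x z \<longleftrightarrow> y = z"
    proof
      assume "sc x y = sc x z"
      hence "cO y = cO z" using sc(2)[OF x] y z Pi_inj[OF OF[OF y] OF[OF z] WD.one_closed] by metis
      thus "y = z" by (rule inj_onD[OF cospec_inj[of x]]) (use y z in simp_all)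
    qed simp
  next
    show "sc x y \<in> gcomp (gstalk R x) 1[K]" if "y \<in> stks Sch x" for y by (rule sc(1)[OF x that])
    fix a assume a: "a \<in> gcomp (gstalk R x) 1[K]"
    obtain y where y: "y \<in> stks Sch x" "cR a = Pi' (cO y) 1[WD]" using cospec_image_one[OF x a] by blast
    have "a = sc x y" by (rule inj) (use y sc(2)[OF x y(1)] car[OF y(1)] c.A.gcomp_carrier[OF S.K.one_closed a] in simp_all)
    thus "\<exists>y\<in>stks Sch x. a = sc x y" using y(1) by blast
  qed
  thus ?thesis unfolding ring_iso_def ring_hom_def using m a one sc(1)[OF x] by simp
qed

text \<open>The ideal \<open>m\<close> is only known to be maximal and generated by
  \<open>t\<close>. The elements of positive value form a proper ideal containing it, hence equal to
  it; so an element of value one is a multiple of \<open>t\<close>, which leaves value one for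
  \<open>t\<close>.\<close>

lemma uniformizer:
  assumes Y: "Y \<in> P" and m: "maximalideal m (stalk Sch Y)" and t: "t \<in> m" "m = PIdl\<^bsub>stalk Sch Y\<^esub> t"
  shows "cO t \<in> F.nz" "\<nu> Y (cO t) = 1"
proof -
  let ?A = "stalk Sch Y" and ?c = "cO"
  note YX = P_X[OF Y]
  interpret A: cring ?A by (rule stalk_cring[OF YX])
  interpret m: maximalideal m ?A by (rule m)
  interpret c: ring_hom_cring ?A F ?c by (rule ring_hom_cringI[OF A.cring_axioms F.cring_axioms O_hom[OF YX]])
  note d = nu_dval[OF Y]
  have tA: "t \<in> carrier ?A" using m.a_subset t(1) by blast
  have pos: "?c y = 0[F] \<or> 0 \<le> \<nu> Y (?c y)" if "y \<in> carrier ?A" for y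
    using nu_O[OF Y] that imageI[OF that, of ?c] by (auto simp: vr_def)
  have lift: "\<exists>y\<in>carrier ?A. z = ?c y" if "z \<in> F.nz" "0 \<le> \<nu> Y z" for z
    using nu_O[OF Y] F.vr_nz[OF that(1), of "\<nu> Y"] that by (metis imageE)
  let ?J = "{y \<in> carrier ?A. ?c y = 0[F] \<or> 1 \<le> \<nu> Y (?c y)}"
  have J: "ideal ?J ?A"
  proof (rule idealI[OF A.ring_axioms])
    have add: "y +[?A] z \<in> ?J" if y: "y \<in> ?J" and z: "z \<in> ?J" for y z
    proof (cases "?c y = 0[F] \<or> ?c z = 0[F] \<or> ?c y +[F] ?c z = 0[F]")
      case True thus ?thesis using y z by (elim disjE) simp_all
    next
      case False
      hence n: "?c y \<in> F.nz" "?c z \<in> F.nz" using y z by simp_all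
      show ?thesis using F.dval_add[OF d n] False y z by (simp add: min_def split: if_splits)
    qed
    have mul: "y *[?A] z \<in> ?J" if y: "y \<in> carrier ?A" and z: "z \<in> ?J" for y z
    proof (cases "?c y = 0[F] \<or> ?c z = 0[F]")
      case True thus ?thesis using y z by (elim disjE) simp_all
    next
      case False
      hence n: "?c y \<in> F.nz" "?c z \<in> F.nz" using y z by simp_all
      show ?thesis using F.dval_mult[OF d n] False y z pos[OF y] by simp
    qed
    have zJ: "0[?A] \<in> ?J" by simp
    have neg: "\<ominus>[?A] y \<in> ?J" if "y \<in> ?J" for y
      using mul[of "\<ominus>[?A] 1[?A]" y] that A.l_minus[OF A.one_closed, of y] by simp
    show "subgroup ?J (add_monoid ?A)"
    proof (rule A.add.subgroupI)
      show "?J \<subseteq> carrier ?A" by blast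
      show "?J \<noteq> {}" using zJ by blast
    qed (rule neg add; assumption)+
    show "x *[?A] a \<in> ?J" "a *[?A] x \<in> ?J" if a: "a \<in> ?J" and x: "x \<in> carrier ?A" for a x
      using mul[OF x a] A.m_comm[OF x, of a] a by simp_all
  qed
  \<comment> \<open>An element of value zero is a unit of the local ring, as its inverse is regular
    at \<open>Y\<close> as well.\<close>
  have unit: "m = carrier ?A" if "y \<in> m" "?c y \<in> F.nz" "\<nu> Y (?c y) = 0" for y
  proof -
    have "\<exists>w\<in>carrier ?A. inv[F] (?c y) = ?c w"
      by (rule lift[OF F.nz_inv[OF that(2)]]) (simp add: F.dval_inv[OF d that(2)] that(3))
    then obtain w where w: "w \<in> carrier ?A" "inv[F] (?c y) = ?c w" by (rule bexE)
    have yA: "y \<in> carrier ?A" using m.a_subset that(1) by blast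
    have "?c (y *[?A] w) = ?c 1[?A]" using F.nz_r_inv[OF that(2)] w yA by simp
    hence "y *[?A] w = 1[?A]" by (rule inj_onD[OF cospec_inj[of Y]]) (use w yA in simp_all)
    hence "1[?A] \<in> m" using m.I_r_closed[OF that(1) w(1)] by simp
    thus ?thesis by (rule m.one_imp_carrier)
  qed
  have "t \<in> ?J"
  proof (rule ccontr)
    assume n: "t \<notin> ?J"
    hence t0: "?c t \<noteq> 0[F]" "\<not> 1 \<le> \<nu> Y (?c t)" using tA by simp_all
    hence "\<nu> Y (?c t) = 0" using pos[OF tA] by linarith
    thus False using unit[OF t(1)] tA t0(1) m.I_notcarr by simp
  qed
  hence "m \<subseteq> ?J" unfolding t(2) by (rule A.cgenideal_minimal[OF J])
  hence "?J = m \<or> ?J = carrier ?A" by (rule m.I_maximal[OF J]) blast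
  moreover have "?J \<noteq> carrier ?A"
  proof
    assume "?J = carrier ?A"
    hence "1[?A] \<in> ?J" using A.one_closed by (simp only:)
    thus False using F.dval_one[OF d] by simp
  qed
  ultimately have mJ: "?J = m" by (simp only: simp_thms)
  obtain z where z: "z \<in> F.nz" "\<nu> Y z = 1" using F.dval_surj[OF d, of 1] by blast
  have "\<exists>y\<in>carrier ?A. z = ?c y" by (rule lift[OF z(1)]) (simp add: z(2))
  then obtain y where y: "y \<in> carrier ?A" "z = ?c y" by (rule bexE)
  have "y \<in> m" unfolding mJ[symmetric] using y z by simp
  then obtain r where r: "r \<in> carrier ?A" "y = r *[?A] t" unfolding t(2) cgenideal_def by blast
  have e: "z = ?c r *[F] ?c t" unfolding y(2) r(2) using r(1) tA by simp
  have z0: "z \<noteq> 0[F]" using z(1) by simp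
  have "?c r = 0[F] \<or> ?c t = 0[F] \<Longrightarrow> z = 0[F]" unfolding e using r(1) tA by (elim disjE) simp_all
  hence "?c r \<noteq> 0[F]" "?c t \<noteq> 0[F]" using z0 by blast+
  hence n: "?c r \<in> F.nz" "?c t \<in> F.nz" using r(1) tA by simp_all
  show "?c t \<in> F.nz" by (rule n(2))
  have "1 \<le> \<nu> Y (?c t)" using \<open>t \<in> ?J\<close> n(2) by simp
  thus "\<nu> Y (?c t) = 1" using F.dval_mult[OF d n] e z(2) pos[OF r(1)] n(1) by simp
qed

text \<open>The generator has value one, and this value is unchanged in the stalk of the Cox sheaf.
  There \<open>Y\<close> carries the only valuation, so \<open>max_K_ideal_principal\<close>
  applies.\<close>

lemma max_ideal_generator:
  assumes Y: "Y \<in> P" and m: "maximalideal m (stalk Sch Y)" and t: "t \<in> m" "m = PIdl\<^bsub>stalk Sch Y\<^esub> t"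
  shows "max_K_ideal K (gstalk R Y) = PIdl\<^bsub>gstalk R Y\<^esub> (sc Y t)"
proof -
  interpret c: cox_sub K "gstalk R Y" S "cR" "Qx Y" "\<lambda>Y. mu Y X" by (rule stalk_sub[OF P_X[OF Y]])
  note u = uniformizer[OF Y m t]
  have tA: "t \<in> stks Sch Y"
    using additive_subgroup.a_Hcarr[OF ideal.axioms(1)[OF maximalideal.axioms(1)[OF m]] t(1)] .
  note s = sc[OF P_X[OF Y] tA]
  have "Pi' (cO t) 1[WD] \<noteq> 0[S]" using Pi_nz[OF DiffD1[OF u(1)] WD.one_closed] u(1) by simp
  hence "sc Y t \<noteq> 0[gstalk R Y]" using s(2) c.rh.hom_zero by metis
  hence "sc Y t \<in> hplus K (gstalk R Y)" by (rule c.A.hplusI[OF S.K.one_closed s(1)])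
  moreover have "mu Y X (cR (sc Y t)) = 1" unfolding s(2) using mu_eq[OF u(1) WD.one_closed Y] P_X[OF Y] u(2) Y by (simp add: WD_one)
  ultimately show ?thesis by (intro c.max_K_ideal_principal[OF _ Qx_P[OF Y]]) (rule stalk_local[OF P_X[OF Y]])
qed

end

declare gstalk_simps [simp del]

section \<open>Quasi-coherence\<close>

lemma module_of_hom:
  assumes A: "cring A" and B: "cring B" and h: "h \<in> ring_hom A B"
    and M: "carrier M = carrier B" "ring.add M = ring.add B" "ring.zero M = ring.zero B"
      "\<And>a r. a \<odot>\<^bsub>M\<^esub> r = h a *[B] r"
  shows "module A M"
proof -
  interpret h: ring_hom_cring A B h by (rule ring_hom_cringI[OF A B h])
  have ab: "abelian_group M"
  proof (rule abelian_groupI)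
    show "\<exists>y\<in>carrier M. y +[M] x = 0[M]" if "x \<in> carrier M" for x
      by (rule bexI[of _ "\<ominus>[B] x"]) (use that in \<open>simp_all add: M h.S.l_neg\<close>)
  qed (simp_all add: M h.S.a_assoc, simp add: h.S.a_comm)
  show ?thesis
    by (rule module.intro[OF A ab]) (unfold_locales, simp_all add: M h.S.l_distr h.S.r_distr h.S.m_assoc)
qed

lemma UN_pair_const:
  assumes "(a, b) \<in> P" "(c, d) \<in> Q" and G: "\<And>m f n k. (m, f) \<in> P \<Longrightarrow> (n, k) \<in> Q \<Longrightarrow> G m f n k = C"
  shows "(\<Union>(m, f)\<in>P. \<Union>(n, k)\<in>Q. G m f n k) = C"
proof (rule equalityI; rule subsetI)
  fix z assume "z \<in> C"
  hence "z \<in> G a b c d" using G[OF assms(1,2)] by simp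
  thus "z \<in> (\<Union>(m, f)\<in>P. \<Union>(n, k)\<in>Q. G m f n k)" using assms(1,2) by blast
qed (use G in blast)

context cox
begin

lemma empty_eq: "s \<in> secs R {} \<Longrightarrow> t \<in> secs R {} \<Longrightarrow> s = t"
  by (rule R.empty_sec)

lemma scalar_closed:
  assumes V: "op V" and a: "a \<in> secs Sch V"
  shows "scal V a \<in> secs R V"
proof (cases "V = {}")
  case True
  \<comment> \<open>Over the empty set every rational function is zero, and
    \<open>Cox_scalar\<close> takes the zero function there.\<close>
  have "gmono F 0[F] 1[WD] \<in> secs OW {}"
    by (simp add: O_WDiv_def group_alg_def gmono_def rat_sheaf_def const_sheaf_def O_sec_def ring.defs)
  thus ?thesis using ring_hom_closed[OF pi_hom[of "{}"]] True by (simp add: Cox_scalar_def)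
next
  case False
  show ?thesis unfolding scalar_eq[OF False] by (rule rho_sec[OF V False WD.one_closed scalar_OD[OF V False a]])
qed

lemma scalar_hom:
  assumes V: "op V"
  shows "scal V \<in> ring_hom (sec Sch V) (sec R V)"
proof (rule ring_hom_memI)
  interpret A: cring "sec Sch V" by (rule sec_cring[OF V])
  interpret B: cring "sec R V" by (rule R.sec_cring) (use V in \<open>simp add: baseR\<close>)
  note c = scalar_closed[OF V]
  show "scal V a \<in> secs R V" if "a \<in> secs Sch V" for a by (rule c[OF that])
  show "scal V 1[sec Sch V] = 1[sec R V]"
  proof (cases "V = {}")
    case True
    show ?thesis by (rule empty_eq) (use c[OF A.one_closed] B.one_closed True in simp_all)
  next
    case False
    show ?thesis unfolding scalar_eq[OF False] germ_one[OF V gen_in'[OF V False]] by (rule rho_one[OF V False])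
  qed
  fix a b assume a: "a \<in> secs Sch V" and b: "b \<in> secs Sch V"
  show "scal V (a *[sec Sch V] b) = scal V a *[sec R V] scal V b"
  proof (cases "V = {}")
    case True
    show ?thesis by (rule empty_eq) (use c[OF A.m_closed[OF a b]] B.m_closed[OF c[OF a] c[OF b]] True in simp_all)
  next
    case False
    note o = scalar_OD[OF V False]
    show ?thesis unfolding scalar_eq[OF False] rho_mult[OF V False WD.one_closed WD.one_closed o[OF a] o[OF b]]
      using germ_mult[OF V gen_in'[OF V False] a b] by simp
  qed
  show "scal V (a +[sec Sch V] b) = scal V a +[sec R V] scal V b"
  proof (cases "V = {}")
    case True
    show ?thesis by (rule empty_eq) (use c[OF A.a_closed[OF a b]] B.a_closed[OF c[OF a] c[OF b]] True in simp_all)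
  next
    case False
    note o = scalar_OD[OF V False]
    show ?thesis unfolding scalar_eq[OF False] rho_add[OF V False WD.one_closed o[OF a] o[OF b]]
      using germ_add[OF V gen_in'[OF V False] a b] by simp
  qed
qed

lemma scalar_restr:
  assumes V: "op V" and W: "op W" "W \<subseteq> V" and a: "a \<in> secs Sch V"
  shows "restr R V W (scal V a) = scal W (restr Sch V W a)"
proof (cases "W = {}")
  case True
  have "restr R V W (scal V a) \<in> secs R W"
    by (rule R.restr_closed) (use V W scalar_closed[OF V a] in \<open>simp_all add: baseR\<close>)
  thus ?thesis using empty_eq scalar_closed[OF W(1) restr_closed[OF V W a]] True by simp
next
  case False
  hence Vn: "V \<noteq> {}" using W(2) by blast
  show ?thesis unfolding scalar_eq[OF False] scalar_eq[OF Vn]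
    using rho_restr[OF V Vn W(1) False W(2) WD.one_closed scalar_OD[OF V Vn a]] germ_restr[OF V W(1) gen_in'[OF W(1) False] W(2) a] by simp
qed

section \<open>The Cox sheaf as a sheaf of modules\<close>

abbreviation "CM \<equiv> Cox_module Sch \<xi> R \<pi>"

lemma CM_simps: "base CM = base R" "restr CM = restr R" "secs CM U = secs R U"
  "ring.add (sec CM U) = ring.add (sec R U)" "ring.zero (sec CM U) = ring.zero (sec R U)"
  "a \<odot>\<^bsub>sec CM U\<^esub> r = scal U a *[sec R U] r"
  by (simp_all add: Cox_module_def ring.defs module.defs)

lemma CM_sheaf: "sheaf_of_modules Sch CM"
  unfolding sheaf_of_modules_def
proof (intro conjI allI impI ballI)
  show "base CM = base Sch" by (simp add: CM_simps baseR)
  have "sheaf_of_sets R" using R.sheaf by (simp add: sheaf_of_rings_def)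
  thus "sheaf_of_sets CM" by (simp only: sheaf_of_sets_def CM_simps)
  show "module (sec Sch U) (sec CM U)" if "op U" for U
    by (rule module_of_hom[OF sec_cring[OF that] R.sec_cring scalar_hom[OF that]]) (use that in \<open>simp_all add: CM_simps baseR\<close>)
  fix U V s t assume UV: "op U \<and> op V \<and> V \<subseteq> U" and s: "s \<in> secs CM U"
  hence o: "R.op U" "R.op V" "V \<subseteq> U" "op U" "op V" and s': "s \<in> secs R U" by (simp_all add: baseR CM_simps)
  show "restr CM U V (s +[sec CM U] t) = restr CM U V s +[sec CM V] restr CM U V t" if "t \<in> secs CM U"
    using ring_hom_add[OF R.restr_ring_hom[OF o(1-3)] s'] that by (simp add: CM_simps)
next
  fix U V a s assume UV: "op U \<and> op V \<and> V \<subseteq> U" and a: "a \<in> secs Sch U" and s: "s \<in> secs CM U"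
  hence o: "R.op U" "R.op V" "V \<subseteq> U" "op U" "op V" and s': "s \<in> secs R U" by (simp_all add: baseR CM_simps)
  show "restr CM U V (a \<odot>\<^bsub>sec CM U\<^esub> s) = restr Sch U V a \<odot>\<^bsub>sec CM V\<^esub> restr CM U V s"
    using R.restr_mult[OF o(1-3) scalar_closed[OF o(4) a] s'] scalar_restr[OF o(4,5,3) a] by (simp add: CM_simps)
qed

lemma scalar_stalk_image:
  assumes x: "x \<in> X" and y: "y \<in> stks Sch x"
  shows "Pi' (cO y) 1[WD] \<in> stim x"
proof -
  interpret c: cox_sub K "gstalk R x" S "cR" "Qx x" "\<lambda>Y. mu Y X" by (rule stalk_sub[OF x])
  have "sc x y \<in> stks R x" using c.A.gcomp_carrier[OF S.K.one_closed sc(1)[OF x y]] by (simp add: gstalk_simps)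
  thus ?thesis unfolding stalk_image_def sc(2)[OF x y, symmetric] by (rule imageI)
qed

lemma stalk_image_mult:
  assumes x: "x \<in> X" and a: "a \<in> stim x" and b: "b \<in> stim x"
  shows "a *[S] b \<in> stim x"
proof -
  interpret c: cox_sub K "gstalk R x" S "cR" "Qx x" "\<lambda>Y. mu Y X" by (rule stalk_sub[OF x])
  have i: "stim x = cR ` carrier (gstalk R x)" by (simp add: stalk_image_def gstalk_simps)
  obtain u where u: "a = cR u" "u \<in> carrier (gstalk R x)" using a unfolding i by (rule imageE)
  obtain v where v: "b = cR v" "v \<in> carrier (gstalk R x)" using b unfolding i by (rule imageE)
  show ?thesis unfolding i u(1) v(1) c.rh.hom_mult[OF u(2) v(2), symmetric] by (rule imageI[OF c.A.R.m_closed[OF u(2) v(2)]])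
qed

end

section \<open>Comparison with the sheaf associated to the module of sections over a Krull
  chart\<close>

locale cox_chart = cox Sch \<xi> R \<pi> + krull_chart Sch \<xi> U A h \<phi>
  for Sch :: "('p, 'a, unit) sheaf" and \<xi> :: 'p
    and R :: "('p, 'r, ('p \<Rightarrow> int) set) gsheaf" and \<pi> and U A h \<phi>
begin

abbreviation "RU \<equiv> secs R U"
abbreviation "\<iota> \<equiv> gR U"

text \<open>The element \<open>a\<close> of the chart ring as a scalar in the generic stalk; for
  non-zero \<open>a\<close> it is a unit there.\<close>

definition e :: "'a \<Rightarrow> ('p set \<times> 'r) set" where
  "e f = Pi' (j f) 1[WD]"

definition M :: "('a, 'r) module" where
  "M = ring.extend (ring.truncate (sec R U)) (module.fields (\<lambda>a r. scal U (g a) *[sec R U] r))"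

abbreviation "TS V \<equiv> carrier (sec (tilde A M) V)"

definition val :: "'r \<Rightarrow> 'a \<Rightarrow> ('p set \<times> 'r) set" where
  "val m f = \<iota> m *[S] inv[S] (e f)"

text \<open>By \<open>mfrac_eq\<close> these are the classes of fractions at \<open>p\<close>,
  indexed by their value in the generic stalk.\<close>

definition fib :: "'a set \<Rightarrow> ('p set \<times> 'r) set \<Rightarrow> ('r \<times> 'a) set" where
  "fib p z = {(m, f). m \<in> RU \<and> f \<in> carrier A - p \<and> val m f = z}"

text \<open>The value of a class of fractions; on a non-empty \<open>fib p z\<close> it returns
  \<open>z\<close>.\<close>

definition mv :: "('r \<times> 'a) set \<Rightarrow> ('p set \<times> 'r) set" where
  "mv Q = (SOME z. \<exists>m f. (m, f) \<in> Q \<and> z = val m f)"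

text \<open>A section has one value in the generic stalk, read at the generic point and then lifted
  to the Cox sheaf. The empty set has no generic point and is treated separately.\<close>

definition \<psi> :: "'a set set \<Rightarrow> ('a set \<Rightarrow> ('r \<times> 'a) set) \<Rightarrow> 'r" where
  "\<psi> V s = (if V = {} then 0[sec R {}] else inv_into (secs R (pre V)) (gR (pre V)) (mv (s (h \<xi>))))"

lemma M_simps: "carrier M = RU" "ring.add M = ring.add (sec R U)" "ring.zero M = ring.zero (sec R U)"
  "a \<odot>\<^bsub>M\<^esub> r = scal U (g a) *[sec R U] r"
  by (simp_all add: M_def ring.defs module.defs)

lemma M_module: "module A M"
proof (rule module_of_hom[OF Acr R.sec_cring])
  show "R.op U" using U by (simp add: baseR)
  show "scal U \<circ> g \<in> ring_hom A (sec R U)" by (rule ring_hom_trans[OF g_hom scalar_hom[OF U(1)]])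
qed (simp_all add: M_simps)

lemma \<iota>_hom: "\<iota> \<in> ring_hom (sec R U) S"
  using R.germ_hom[of U \<xi>] U xi_U by (simp add: baseR ring_hom_def gstalk_simps)

sublocale RU: cring "sec R U"
  by (rule R.sec_cring) (use U in \<open>simp add: baseR\<close>)

sublocale ih: ring_hom_cring "sec R U" S \<iota>
  by (rule ring_hom_cringI[OF RU.cring_axioms S.R.cring_axioms \<iota>_hom])

lemma jn: "a \<in> carrier A \<Longrightarrow> a \<noteq> 0[A] \<Longrightarrow> j a \<in> F.nz"
  using j_unit F.field_Units by blast

lemma e_closed: "a \<in> carrier A \<Longrightarrow> e a \<in> carrier S"
  unfolding e_def by (rule Pi_S[OF jF WD.one_closed])

lemma e_mult: "a \<in> carrier A \<Longrightarrow> b \<in> carrier A \<Longrightarrow> e (a *[A] b) = e a *[S] e b"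
  unfolding e_def ring_hom_mult[OF j_hom] using Pi_mult[OF jF jF WD.one_closed WD.one_closed] by simp

lemma e_unit: "a \<in> carrier A \<Longrightarrow> a \<noteq> 0[A] \<Longrightarrow> e a \<in> Units S"
proof -
  assume "a \<in> carrier A" "a \<noteq> 0[A]"
  hence "e a \<in> hplus K S" unfolding S_hplus e_def using jn WD.one_closed by blast
  thus ?thesis using S_simple(1) by blast
qed

lemma e_one: "e 1[A] = 1[S]"
  unfolding e_def ring_hom_one[OF j_hom] by (rule Pi_one)

lemma e_germ: "a \<in> carrier A \<Longrightarrow> \<iota> (scal U (g a)) = e a"
  unfolding scalar_eq[OF U(2)] e_def j_def
  by (rule germ_rho[OF U WD.one_closed scalar_OD[OF U g_closed]])

lemma sm:
  assumes "a \<in> carrier A" "m \<in> RU"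
  shows "a \<odot>\<^bsub>M\<^esub> m \<in> RU" "\<iota> (a \<odot>\<^bsub>M\<^esub> m) = e a *[S] \<iota> m"
proof -
  have s: "scal U (g a) \<in> RU" by (rule scalar_closed[OF U(1) g_closed[OF assms(1)]])
  show "a \<odot>\<^bsub>M\<^esub> m \<in> RU" unfolding M_simps by (rule RU.m_closed[OF s assms(2)])
  show "\<iota> (a \<odot>\<^bsub>M\<^esub> m) = e a *[S] \<iota> m" unfolding M_simps ih.hom_mult[OF s assms(2)] e_germ[OF assms(1)] ..
qed

lemma \<iota>_inj: "m \<in> RU \<Longrightarrow> n \<in> RU \<Longrightarrow> \<iota> m = \<iota> n \<Longrightarrow> m = n"
proof -
  interpret c: cox_sub K "sec R U" S "gR U" "P \<inter> U" "\<lambda>Y. mu Y U" by (rule sec_sub[OF U])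
  show "m \<in> RU \<Longrightarrow> n \<in> RU \<Longrightarrow> \<iota> m = \<iota> n \<Longrightarrow> m = n" using c.\<iota>_eq by blast
qed

lemma val_closed: "m \<in> RU \<Longrightarrow> f \<in> carrier A \<Longrightarrow> f \<noteq> 0[A] \<Longrightarrow> val m f \<in> carrier S"
  unfolding val_def by (rule S.R.m_closed[OF ih.hom_closed S.R.Units_inv_closed[OF e_unit]])

lemma val_iff:
  assumes "m \<in> RU" "f \<in> carrier A" "f \<noteq> 0[A]" "z \<in> carrier S"
  shows "val m f = z \<longleftrightarrow> \<iota> m = e f *[S] z"
proof -
  note u = e_unit[OF assms(2,3)]
  note c = ih.hom_closed[OF assms(1)] e_closed[OF assms(2)] S.R.Units_inv_closed[OF u]
  have "e f *[S] val m f = \<iota> m" unfolding val_def using c S.R.Units_r_inv[OF u] S.R.m_lcomm[OF c(2,1,3)] by simp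
  thus ?thesis using S.R.Units_l_cancel[OF u val_closed[OF assms(1-3)] assms(4)] by metis
qed

lemma spec_nz: "p \<in> spec A \<Longrightarrow> f \<notin> p \<Longrightarrow> f \<noteq> 0[A]"
  using A.spec_zero by blast

text \<open>\<open>\<iota>\<close> is injective and scalars outside \<open>p\<close> become units in
  the generic stalk, so the cancelling factor disappears and classes are fibres of
  \<open>val\<close>.\<close>

lemma mfrac_eq:
  assumes p: "p \<in> spec A" and m: "m \<in> RU" and f: "f \<in> carrier A" "f \<notin> p"
  shows "mfrac A M (carrier A - p) m f = fib p (val m f)"
proof -
  have key: "(\<exists>u\<in>carrier A - p. u \<odot>\<^bsub>M\<^esub> (f' \<odot>\<^bsub>M\<^esub> m) = u \<odot>\<^bsub>M\<^esub> (f \<odot>\<^bsub>M\<^esub> m')) \<longleftrightarrow> val m' f' = val m f"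
    if m': "m' \<in> RU" and f': "f' \<in> carrier A" "f' \<notin> p" for m' f'
  proof -
    note nz = spec_nz[OF p f(2)] spec_nz[OF p f'(2)]
    note c = e_closed[OF f(1)] e_closed[OF f'(1)] ih.hom_closed[OF m] ih.hom_closed[OF m'] val_closed[OF m f(1) nz(1)]
    have im: "\<iota> m = e f *[S] val m f" using val_iff[OF m f(1) nz(1) c(5)] by simp
    have e1: "val m' f' = val m f \<longleftrightarrow> e f' *[S] \<iota> m = e f *[S] \<iota> m'"
    proof -
      have "e f' *[S] \<iota> m = e f *[S] (e f' *[S] val m f)" unfolding im by (rule S.R.m_lcomm[OF c(2,1,5)])
      hence "e f' *[S] \<iota> m = e f *[S] \<iota> m' \<longleftrightarrow> e f' *[S] val m f = \<iota> m'"
        using S.R.Units_l_cancel[OF e_unit[OF f(1) nz(1)] S.R.m_closed[OF c(2,5)] c(4)] by simp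
      thus ?thesis using val_iff[OF m' f'(1) nz(2) c(5)] by metis
    qed
    have e2: "u \<odot>\<^bsub>M\<^esub> (f' \<odot>\<^bsub>M\<^esub> m) = u \<odot>\<^bsub>M\<^esub> (f \<odot>\<^bsub>M\<^esub> m') \<longleftrightarrow> e f' *[S] \<iota> m = e f *[S] \<iota> m'"
      if u: "u \<in> carrier A" "u \<notin> p" for u
    proof -
      note s = sm[OF f'(1) m] sm[OF f(1) m']
      have "u \<odot>\<^bsub>M\<^esub> (f' \<odot>\<^bsub>M\<^esub> m) = u \<odot>\<^bsub>M\<^esub> (f \<odot>\<^bsub>M\<^esub> m') \<longleftrightarrow>
          e u *[S] (e f' *[S] \<iota> m) = e u *[S] (e f *[S] \<iota> m')"
        using sm[OF u(1) s(1)] sm[OF u(1) s(3)] \<iota>_inj s(2,4) by metis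
      thus ?thesis using S.R.Units_l_cancel[OF e_unit[OF u(1) spec_nz[OF p u(2)]] S.R.m_closed[OF c(2,3)] S.R.m_closed[OF c(1,4)]] by simp
    qed
    show ?thesis unfolding e1 using e2 A.spec_one[OF p] A.one_closed by blast
  qed
  show ?thesis unfolding mfrac_def fib_def M_simps(1) by (intro Collect_cong prod.case_cong refl conj_cong) (use key in blast)
qed

lemma mv_fib: "(m, f) \<in> fib p z \<Longrightarrow> mv (fib p z) = z"
  unfolding mv_def by (rule some_equality) (auto simp: fib_def)

lemma h_xi_V: "opA V \<Longrightarrow> V \<noteq> {} \<Longrightarrow> h \<xi> \<in> V"
  using gen_in'[OF pre_open pre_nonempty] by (simp add: pre_def)

lemma tilde_iff:
  "s \<in> TS V \<longleftrightarrow> s \<in> (\<Pi>\<^sub>E p\<in>V. carrier (mloc A M (carrier A - p))) \<and>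
    (\<forall>p\<in>V. \<exists>W m f. opA W \<and> p \<in> W \<and> W \<subseteq> V \<and> m \<in> RU \<and> f \<in> carrier A \<and>
      (\<forall>q\<in>W. f \<notin> q \<and> s q = mfrac A M (carrier A - q) m f))"
  by (simp add: tilde_def M_simps)

text \<open>Near \<open>p\<close> the section is a single fraction, and every non-empty open set
  contains the generic point. So the value of that fraction is the one read there, whatever
  \<open>p\<close> is.\<close>

lemma sec_value:
  assumes V: "opA V" and s: "s \<in> TS V" and p: "p \<in> V"
  obtains m f where "m \<in> RU" "f \<in> carrier A" "f \<notin> p" "s p = fib p (mv (s (h \<xi>)))" "val m f = mv (s (h \<xi>))"
proof -
  obtain W m f where W: "opA W" "p \<in> W" "W \<subseteq> V" "m \<in> RU" "f \<in> carrier A"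
    "\<forall>q\<in>W. f \<notin> q \<and> s q = mfrac A M (carrier A - q) m f" using s p unfolding tilde_iff by blast
  have sq: "s q = fib q (val m f)" "(m, f) \<in> fib q (val m f)" if q: "q \<in> W" for q
  proof -
    have "q \<in> spec A" using V_spec[OF W(1)] q by blast
    thus "s q = fib q (val m f)" using mfrac_eq[OF _ W(4,5)] W(6) q by simp
    show "(m, f) \<in> fib q (val m f)" using W q by (simp add: fib_def)
  qed
  have x: "h \<xi> \<in> W" by (rule h_xi_V[OF W(1)]) (use W(2) in blast)
  have e: "mv (s (h \<xi>)) = val m f" unfolding sq(1)[OF x] by (rule mv_fib[OF sq(2)[OF x]])
  have "f \<notin> p" using W(2,6) by blast
  thus ?thesis by (rule that[OF W(4,5)]) (simp_all only: e sq(1)[OF W(2)])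
qed

text \<open>The denominator is a unit in the local ring of the structure sheaf at \<open>x\<close>,
  so dividing by it stays inside the image of the stalk.\<close>

lemma val_stalk:
  assumes x: "x \<in> U" and m: "m \<in> RU" and f: "f \<in> carrier A" "f \<notin> h x"
  shows "val m f \<in> stim x"
proof -
  have xX: "x \<in> X" using x U_sub by blast
  interpret A': cring "stalk Sch x" by (rule stalk_cring[OF xX])
  have "germ Sch x U (g f) \<in> Units (stalk Sch x)" using germ_unit[OF x f(1)] f(2) by simp
  then obtain w where w: "w \<in> stks Sch x" "germ Sch x U (g f) *[stalk Sch x] w = 1[stalk Sch x]"
    unfolding Units_def by blast
  have gc: "germ Sch x U (g f) \<in> stks Sch x" by (rule stalkI[OF U(1) x g_closed[OF f(1)]])
  have jw: "j f *[F] cO w = 1[F]"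
    using ring_hom_mult[OF O_hom[OF xX] gc w(1)] w(2) ring_hom_one[OF O_hom[OF xX]] cospec_Sch_germ[OF U(1) x g_closed[OF f(1)]]
    by (simp add: j_def)
  note wF = ring_hom_closed[OF O_hom[OF xX] w(1)]
  have "e f *[S] Pi' (cO w) 1[WD] = 1[S]"
    unfolding e_def Pi_mult[OF jF[OF f(1)] wF WD.one_closed WD.one_closed] jw using Pi_one by simp
  hence i: "inv[S] (e f) = Pi' (cO w) 1[WD]"
    by (rule S.R.comm_inv_char[OF e_closed[OF f(1)] Pi_S[OF wF WD.one_closed]])
  have "\<iota> m = cR (germ R x U m)" using cospec_R[OF U(1) x m] by simp
  hence "\<iota> m \<in> stim x" unfolding stalk_image_def
    using R.stalkI[of U x m] U(1) x m by (simp add: baseR)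
  thus ?thesis unfolding val_def i by (rule stalk_image_mult[OF xX _ scalar_stalk_image[OF xX w(1)]])
qed

text \<open>At each prime divisor inside \<open>pre V\<close> the section has a denominator that
  does not vanish there, so its value is regular along all of them.\<close>

lemma value_generic:
  assumes V: "opA V" "V \<noteq> {}" and s: "s \<in> TS V"
  shows "mv (s (h \<xi>)) \<in> gnim (pre V)"
proof -
  have "mv (s (h \<xi>)) \<in> carrier S"
  proof -
    obtain m f where "m \<in> RU" "f \<in> carrier A" "f \<notin> h \<xi>" "val m f = mv (s (h \<xi>))"
      by (rule sec_value[OF V(1) s h_xi_V[OF V]])
    thus ?thesis using val_closed spec_nz[OF h_spec[OF xi_U]] by metis
  qed
  moreover have "mv (s (h \<xi>)) \<in> stim Y" if Y: "Y \<in> P \<inter> pre V" for Y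
  proof -
    have Y': "h Y \<in> V" "Y \<in> U" using Y by (simp_all add: pre_def)
    obtain m f where mf: "m \<in> RU" "f \<in> carrier A" "f \<notin> h Y" "val m f = mv (s (h \<xi>))"
      by (rule sec_value[OF V(1) s Y'(1)])
    show ?thesis using val_stalk[OF Y'(2) mf(1-3)] mf(4) by simp
  qed
  ultimately show ?thesis unfolding generic_image_eq[OF pre_open[OF V(1)] pre_nonempty[OF V]] by blast
qed

text \<open>The poles over \<open>U\<close> of a component of \<open>z\<close> are prime divisors
  outside \<open>pre V\<close>; there are finitely many, and their closures miss \<open>x\<close>
  because \<open>pre V\<close> is a neighbourhood of it. \<open>vanishing_function\<close> clears
  them without vanishing at \<open>x\<close>, and for sums denominators are multiplied.\<close>

lemma denominators:
  assumes V: "opA V" and x: "x \<in> pre V" and z: "z \<in> gnim (pre V)"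
  shows "\<exists>f\<in>carrier A. f \<notin> h x \<and> e f *[S] z \<in> \<iota> ` RU"
proof -
  have xU: "x \<in> U" using x by (simp add: pre_def)
  note pv = pre_open[OF V]
  have ne: "pre V \<noteq> {}" using x by blast
  interpret c: cox_sub K "sec R U" S "gR U" "P \<inter> U" "\<lambda>Y. mu Y U" by (rule sec_sub[OF U])
  interpret c': cox_sub K "sec R (pre V)" S "gR (pre V)" "P \<inter> pre V" "\<lambda>Y. mu Y (pre V)" by (rule sec_sub[OF pv ne])
  have zV: "z \<in> c'.V (P \<inter> pre V)" using z c'.img_V by (simp add: generic_image_def)
  have zS: "z \<in> carrier S" by (rule c'.V_carrier[OF zV])
  have eR: "e f \<in> \<iota> ` RU" if "f \<in> carrier A" for f
    using e_germ[OF that] scalar_closed[OF U(1) g_closed[OF that]] by (metis imageI)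
  have mul: "a *[S] b \<in> \<iota> ` RU" if a: "a \<in> \<iota> ` RU" and b: "b \<in> \<iota> ` RU" for a b
  proof -
    obtain u where u: "a = \<iota> u" "u \<in> RU" using a by (rule imageE)
    obtain v where v: "b = \<iota> v" "v \<in> RU" using b by (rule imageE)
    show ?thesis unfolding u(1) v(1) ih.hom_mult[OF u(2) v(2), symmetric] by (rule imageI[OF RU.m_closed[OF u(2) v(2)]])
  qed
  have add: "a +[S] b \<in> \<iota> ` RU" if a: "a \<in> \<iota> ` RU" and b: "b \<in> \<iota> ` RU" for a b
  proof -
    obtain u where u: "a = \<iota> u" "u \<in> RU" using a by (rule imageE)
    obtain v where v: "b = \<iota> v" "v \<in> RU" using b by (rule imageE)
    show ?thesis unfolding u(1) v(1) ih.hom_add[OF u(2) v(2), symmetric] by (rule imageI[OF RU.a_closed[OF u(2) v(2)]])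
  qed
  let ?P = "\<lambda>s. s \<in> carrier S \<and> (\<exists>f\<in>carrier A. f \<notin> h x \<and> e f *[S] s \<in> \<iota> ` RU)"
  have zero: "?P 0[S]"
  proof -
    have "e 1[A] *[S] 0[S] = \<iota> 0[sec R U]" by (simp add: e_one)
    thus ?thesis using A.spec_one[OF h_spec[OF xU]] A.one_closed imageI[OF RU.zero_closed] S.R.zero_closed by metis
  qed
  have "?P z"
  proof (rule S.hom_induct[OF zS, of ?P, OF zero])
    fix s t assume s: "?P s" and t: "?P t"
    obtain f where f: "f \<in> carrier A" "f \<notin> h x" "e f *[S] s \<in> \<iota> ` RU" using s by blast
    obtain k where k: "k \<in> carrier A" "k \<notin> h x" "e k *[S] t \<in> \<iota> ` RU" using t by blast
    have st: "s \<in> carrier S" "t \<in> carrier S" using s t by blast+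
    note ek = e_closed[OF f(1)] e_closed[OF k(1)]
    have "e (f *[A] k) *[S] (s +[S] t) = (e k *[S] (e f *[S] s)) +[S] (e f *[S] (e k *[S] t))"
      unfolding e_mult[OF f(1) k(1)] using ek st by (simp add: S.R.r_distr S.R.m_assoc S.R.m_lcomm)
    hence "e (f *[A] k) *[S] (s +[S] t) \<in> \<iota> ` RU"
      using add[OF mul[OF eR[OF k(1)] f(3)] mul[OF eR[OF f(1)] k(3)]] by simp
    moreover have "f *[A] k \<notin> h x" using A.spec_mult[OF h_spec[OF xU] f(1) k(1)] f(2) k(2) by simp
    ultimately show "?P (s +[S] t)" using A.m_closed[OF f(1) k(1)] S.R.a_closed[OF st] by blast
  next
    fix w assume w: "w \<in> carrier K"
    obtain D where D: "w = cls D" "D \<in> carrier WD" using w unfolding K_carrier by (rule imageE)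
    obtain k where k: "k \<in> carrier F" "hcomp K S z w = Pi' k D" using S.hcomp_in[OF zS w] unfolding D(1) S_gcomp[OF D(2)] by blast
    show "?P (hcomp K S z w)"
    proof (cases "k = 0[F]")
      case True
      hence "hcomp K S z w = 0[S]" using k Pi_zero[OF D(2)] by simp
      thus ?thesis using zero by simp
    next
      case False
      hence kn: "k \<in> F.nz" using k(1) by simp
      have "c'.nonneg (P \<inter> pre V) (hcomp K S z w)" using zV w by (simp add: c'.V_def)
      hence nn: "\<forall>Y\<in>P \<inter> pre V. 0 \<le> \<nu> Y k + D Y"
        using Pi_nz[OF k(1) D(2)] False mu_eq[OF kn D(2)] unfolding k(2) c'.nonneg_def by simp
      let ?B = "{Y \<in> P \<inter> U. \<nu> Y k + D Y < 0}"
      have "finite ?B" by (rule finite_subset[OF _ fin_val[OF kn D(2)]]) auto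
      moreover have "\<forall>Y\<in>?B. x \<notin> cl Y"
      proof
        fix Y assume Y: "Y \<in> ?B"
        hence "Y \<notin> pre V" using nn by force
        thus "x \<notin> cl Y" using x pv cl_iff by blast
      qed
      ultimately obtain f where f: "f \<in> carrier A" "f \<notin> h x" "\<forall>Y\<in>P \<inter> U. 0 \<le> \<nu> Y (j f)" "\<forall>Y\<in>?B. - (\<nu> Y k + D Y) \<le> \<nu> Y (j f)"
        using vanishing_function[OF aff_chart_axioms xU, of ?B "\<lambda>Y. - (\<nu> Y k + D Y)"] unfolding j_def by blast
      have jf: "j f \<in> F.nz" by (rule jn[OF f(1) spec_nz[OF h_spec[OF xU] f(2)]])
      have m: "j f *[F] k \<in> F.nz" by (rule F.nz_mult[OF jf kn])
      have ek: "e f *[S] Pi' k D = Pi' (j f *[F] k) D"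
        unfolding e_def Pi_mult[OF jF[OF f(1)] k(1) WD.one_closed D(2)] WD.l_one[OF D(2)] ..
      have "0 \<le> mu Y U (Pi' (j f *[F] k) D)" if Y: "Y \<in> P \<inter> U" for Y
      proof -
        have "0 \<le> \<nu> Y (j f) + (\<nu> Y k + D Y)"
        proof (cases "\<nu> Y k + D Y < 0")
          case True
          hence "Y \<in> ?B" using Y by simp
          hence "- (\<nu> Y k + D Y) \<le> \<nu> Y (j f)" using f(4) by blast
          thus ?thesis by simp
        next
          case False
          have "0 \<le> \<nu> Y (j f)" using f(3) Y by blast
          thus ?thesis using False by simp
        qed
        thus ?thesis using mu_eq[OF m D(2), of Y U] Y F.dval_mult[OF nu_dval jf kn, of Y] by simp
      qed
      hence "Pi' (j f *[F] k) D \<in> c.V (P \<inter> U)"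
        using c.V_hom[OF Pi_gcomp[OF DiffD1[OF m] D(2)] cls_K[OF D(2)]] unfolding c.nonneg_def by blast
      hence "e f *[S] hcomp K S z w \<in> \<iota> ` RU" unfolding k(2) ek c.img_V .
      thus ?thesis using f(1,2) S.gcomp_carrier[OF w S.hcomp_in[OF zS w]] by blast
    qed
  qed
  thus ?thesis by blast
qed

lemma fib_section:
  assumes V: "opA V" and z: "z \<in> gnim (pre V)" and zS: "z \<in> carrier S"
  shows "(\<lambda>p\<in>V. fib p z) \<in> TS V" "p \<in> V \<Longrightarrow> \<exists>m f. (m, f) \<in> fib p z"
proof -
  have ex: "\<exists>m f. m \<in> RU \<and> f \<in> carrier A \<and> f \<notin> p \<and> val m f = z" if p: "p \<in> V" for p
  proof -
    obtain x where x: "x \<in> U" "p = h x" using p V_spec[OF V] h_img by (metis imageE subsetD)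
    have "x \<in> pre V" using x p by (simp add: pre_def)
    then obtain f where f: "f \<in> carrier A" "f \<notin> h x" "e f *[S] z \<in> \<iota> ` RU" using denominators[OF V _ z] by blast
    obtain m where m: "e f *[S] z = \<iota> m" "m \<in> RU" using f(3) by (rule imageE)
    have "val m f = z" using val_iff[OF m(2) f(1) spec_nz[OF h_spec[OF x(1)] f(2)] zS] m(1) by simp
    thus ?thesis using m(2) f(1,2) x(2) by blast
  qed
  show "p \<in> V \<Longrightarrow> \<exists>m f. (m, f) \<in> fib p z" using ex unfolding fib_def by blast
  show "(\<lambda>p\<in>V. fib p z) \<in> TS V" unfolding tilde_iff
  proof (intro conjI ballI PiE_I)
    fix p assume p: "p \<in> V"
    obtain m f where mf: "m \<in> RU" "f \<in> carrier A" "f \<notin> p" "val m f = z" using ex[OF p] by blast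
    have eq: "fib q z = mfrac A M (carrier A - q) m f" if "q \<in> V" "f \<notin> q" for q
      using mfrac_eq[OF _ mf(1,2) that(2)] V_spec[OF V] that(1) mf(4) by blast
    have "fib p z \<in> carrier (mloc A M (carrier A - p))" unfolding eq[OF p mf(3)] mloc_def using mf(1-3) by (auto simp: M_simps)
    thus "(\<lambda>p\<in>V. fib p z) p \<in> carrier (mloc A M (carrier A - p))" using p by simp
    \<comment> \<open>The denominator found at \<open>p\<close> serves on the whole neighbourhood
      where it does not vanish.\<close>
    let ?W = "V \<inter> bopen A f"
    have W: "opA ?W" by (rule openin_Int[OF V A.bopen_open[OF mf(2)]])
    have pW: "p \<in> ?W" using p mf(3) V_spec[OF V] by blast
    have "\<forall>q\<in>?W. f \<notin> q \<and> (\<lambda>p\<in>V. fib p z) q = mfrac A M (carrier A - q) m f" using eq by simp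
    thus "\<exists>W m f. opA W \<and> p \<in> W \<and> W \<subseteq> V \<and> m \<in> RU \<and> f \<in> carrier A \<and>
      (\<forall>q\<in>W. f \<notin> q \<and> (\<lambda>p\<in>V. fib p z) q = mfrac A M (carrier A - q) m f)"
      using W pW mf(1,2) by (intro exI[of _ ?W] exI[of _ m] exI[of _ f]) simp
  qed simp
qed

text \<open>Every pair of representatives yields the class of the sum of the values, so the union
  defining the sum is a single class. The last premises ensure that both classes are
  non-empty.\<close>

lemma mloc_fib_add:
  assumes p: "p \<in> spec A" and z: "z \<in> carrier S" "z' \<in> carrier S" and ne: "(m0, f0) \<in> fib p z" "(n0, k0) \<in> fib p z'"
  shows "mv (fib p z +[mloc A M (carrier A - p)] fib p z') = z +[S] z'"
proof -
  have key: "mfrac A M (carrier A - p) ((k \<odot>\<^bsub>M\<^esub> m) +[M] (f \<odot>\<^bsub>M\<^esub> n)) (f *[A] k) = fib p (z +[S] z') \<and>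
      ((k \<odot>\<^bsub>M\<^esub> m) +[M] (f \<odot>\<^bsub>M\<^esub> n), f *[A] k) \<in> fib p (z +[S] z')"
    if mf: "(m, f) \<in> fib p z" and nk: "(n, k) \<in> fib p z'" for m f n k
  proof -
    have a: "m \<in> RU" "f \<in> carrier A" "f \<notin> p" "val m f = z" "n \<in> RU" "k \<in> carrier A" "k \<notin> p" "val n k = z'"
      using mf nk by (simp_all add: fib_def)
    have fk: "f *[A] k \<in> carrier A" "f *[A] k \<notin> p" using a A.spec_mult[OF p] by simp_all
    note s = sm[OF a(6,1)] sm[OF a(2,5)]
    have im: "\<iota> m = e f *[S] z" "\<iota> n = e k *[S] z'"
      using val_iff[OF a(1,2) spec_nz[OF p a(3)] z(1)] val_iff[OF a(5,6) spec_nz[OF p a(7)] z(2)] a(4,8) by simp_all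
    have c: "(k \<odot>\<^bsub>M\<^esub> m) +[M] (f \<odot>\<^bsub>M\<^esub> n) \<in> RU" unfolding M_simps(2) by (rule RU.a_closed[OF s(1,3)])
    have "\<iota> ((k \<odot>\<^bsub>M\<^esub> m) +[M] (f \<odot>\<^bsub>M\<^esub> n)) = e k *[S] (e f *[S] z) +[S] e f *[S] (e k *[S] z')"
      unfolding M_simps(2) ih.hom_add[OF s(1,3)] s(2,4) im ..
    also have "\<dots> = e (f *[A] k) *[S] (z +[S] z')"
      unfolding e_mult[OF a(2,6)] using e_closed[OF a(2)] e_closed[OF a(6)] z by (simp add: S.R.r_distr S.R.m_assoc S.R.m_lcomm)
    finally have v: "val ((k \<odot>\<^bsub>M\<^esub> m) +[M] (f \<odot>\<^bsub>M\<^esub> n)) (f *[A] k) = z +[S] z'"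
      using val_iff[OF c fk(1) spec_nz[OF p fk(2)] S.R.a_closed[OF z]] by simp
    show ?thesis using mfrac_eq[OF p c fk] v c fk by (simp add: fib_def)
  qed
  have "fib p z +[mloc A M (carrier A - p)] fib p z' = (\<Union>(m, f)\<in>fib p z. \<Union>(n, k)\<in>fib p z'.
      mfrac A M (carrier A - p) ((k \<odot>\<^bsub>M\<^esub> m) +[M] (f \<odot>\<^bsub>M\<^esub> n)) (f *[A] k))" by (simp add: mloc_def)
  also have "\<dots> = fib p (z +[S] z')" by (rule UN_pair_const[OF ne conjunct1[OF key]])
  finally show ?thesis using mv_fib key[OF ne] by metis
qed

lemma mloc_fib_smult:
  assumes p: "p \<in> spec A" and z: "z \<in> carrier S" and ne: "(m0, f0) \<in> fib p z"
    and y: "y \<in> carrier S" and q: "(a0, k0) \<in> q" "\<And>a k. (a, k) \<in> q \<Longrightarrow> a \<in> carrier A \<and> k \<in> carrier A \<and> k \<notin> p \<and> e a = e k *[S] y"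
  shows "mv (q \<odot>\<^bsub>mloc A M (carrier A - p)\<^esub> fib p z) = y *[S] z"
proof -
  have key: "mfrac A M (carrier A - p) (a \<odot>\<^bsub>M\<^esub> m) (k *[A] f) = fib p (y *[S] z) \<and> (a \<odot>\<^bsub>M\<^esub> m, k *[A] f) \<in> fib p (y *[S] z)"
    if mf: "(m, f) \<in> fib p z" and ak: "(a, k) \<in> q" for m f a k
  proof -
    have a: "m \<in> RU" "f \<in> carrier A" "f \<notin> p" "val m f = z" using mf by (simp_all add: fib_def)
    have b: "a \<in> carrier A" "k \<in> carrier A" "k \<notin> p" "e a = e k *[S] y" using q(2)[OF ak] by simp_all
    have fk: "k *[A] f \<in> carrier A" "k *[A] f \<notin> p" using a b A.spec_mult[OF p] by simp_all
    note s = sm[OF b(1) a(1)]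
    have im: "\<iota> m = e f *[S] z" using val_iff[OF a(1,2) spec_nz[OF p a(3)] z] a(4) by simp
    have "\<iota> (a \<odot>\<^bsub>M\<^esub> m) = (e k *[S] y) *[S] (e f *[S] z)" unfolding s(2) im b(4) ..
    also have "\<dots> = e (k *[A] f) *[S] (y *[S] z)"
      unfolding e_mult[OF b(2) a(2)] using e_closed[OF b(2)] e_closed[OF a(2)] y z by (simp add: S.R.m_assoc S.R.m_lcomm)
    finally have v: "val (a \<odot>\<^bsub>M\<^esub> m) (k *[A] f) = y *[S] z"
      using val_iff[OF s(1) fk(1) spec_nz[OF p fk(2)] S.R.m_closed[OF y z]] by simp
    show ?thesis using mfrac_eq[OF p s(1) fk] v s(1) fk by (simp add: fib_def)
  qed
  have "q \<odot>\<^bsub>mloc A M (carrier A - p)\<^esub> fib p z = (\<Union>(a, k)\<in>q. \<Union>(m, f)\<in>fib p z.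
      mfrac A M (carrier A - p) (a \<odot>\<^bsub>M\<^esub> m) (k *[A] f))" by (simp add: mloc_def)
  also have "\<dots> = fib p (y *[S] z)" by (rule UN_pair_const[OF q(1) ne]) (rule conjunct1[OF key])
  finally show ?thesis using mv_fib key[OF ne q(1)] by metis
qed

lemma \<psi>_eq:
  assumes V: "opA V" "V \<noteq> {}" and r: "r \<in> secs R (pre V)" "gR (pre V) r = mv (s (h \<xi>))"
  shows "\<psi> V s = r"
proof -
  interpret c: cox_sub K "sec R (pre V)" S "gR (pre V)" "P \<inter> pre V" "\<lambda>Y. mu Y (pre V)"
    by (rule sec_sub[OF pre_open[OF V(1)] pre_nonempty[OF V]])
  show ?thesis unfolding \<psi>_def r(2)[symmetric] using V(2) inv_into_f_f[OF c.\<iota>_inj r(1)] by simp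
qed

lemma \<psi>_germ:
  assumes V: "opA V" "V \<noteq> {}" and s: "s \<in> TS V"
  shows "\<psi> V s \<in> secs R (pre V)" "gR (pre V) (\<psi> V s) = mv (s (h \<xi>))"
proof -
  have i: "mv (s (h \<xi>)) \<in> gR (pre V) ` secs R (pre V)" using value_generic[OF assms] by (simp add: generic_image_def)
  show "\<psi> V s \<in> secs R (pre V)" "gR (pre V) (\<psi> V s) = mv (s (h \<xi>))"
    using inv_into_into[OF i] f_inv_into_f[OF i] V(2) by (simp_all add: \<psi>_def)
qed

lemma zero_empty: "0[sec R {}] \<in> secs R {}"
  using cring.cring_simprules(2)[OF R.sec_cring[of "{}"]] by simp

lemma \<psi>_closed: "opA V \<Longrightarrow> s \<in> TS V \<Longrightarrow> \<psi> V s \<in> secs R (pre V)"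
  using \<psi>_germ(1) zero_empty by (cases "V = {}") (simp_all add: \<psi>_def pre_def)

lemma empty_pre: "V = {} \<Longrightarrow> s \<in> secs R (pre V) \<Longrightarrow> t \<in> secs R (pre V) \<Longrightarrow> s = t"
  by (rule empty_eq) (simp_all add: pre_def)

text \<open>By \<open>sec_value\<close> a section is recovered from its value as the family of
  fibres, which gives injectivity; for surjectivity the family of fibres over a generic germ is a
  section by \<open>denominators\<close>.\<close>

lemma \<psi>_bij:
  assumes V: "opA V"
  shows "bij_betw (\<psi> V) (TS V) (secs R (pre V))"
proof (rule bij_betwI')
  show "\<psi> V s \<in> secs R (pre V)" if "s \<in> TS V" for s by (rule \<psi>_closed[OF V that])
  show "\<psi> V s = \<psi> V t \<longleftrightarrow> s = t" if s: "s \<in> TS V" and t: "t \<in> TS V" for s t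
  proof
    assume e: "\<psi> V s = \<psi> V t"
    have "s p = t p" if p: "p \<in> V" for p
    proof -
      have ne: "V \<noteq> {}" using p by blast
      have m: "mv (s (h \<xi>)) = mv (t (h \<xi>))" using \<psi>_germ(2)[OF V ne s] \<psi>_germ(2)[OF V ne t] e by simp
      have "s p = fib p (mv (s (h \<xi>)))" by (rule sec_value[OF V s p])
      moreover have "t p = fib p (mv (t (h \<xi>)))" by (rule sec_value[OF V t p])
      ultimately show ?thesis unfolding m by simp
    qed
    moreover have "s \<in> (\<Pi>\<^sub>E p\<in>V. carrier (mloc A M (carrier A - p)))" "t \<in> (\<Pi>\<^sub>E p\<in>V. carrier (mloc A M (carrier A - p)))"
      using s t unfolding tilde_iff by blast+
    ultimately show "s = t" by (intro PiE_ext)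
  qed simp
  show "\<exists>s\<in>TS V. r = \<psi> V s" if r: "r \<in> secs R (pre V)" for r
  proof (cases "V = {}")
    case True
    have "(\<lambda>_. undefined) \<in> TS V" unfolding tilde_iff using True by simp
    thus ?thesis using empty_pre[OF True r \<psi>_closed[OF V]] by blast
  next
    case False
    let ?z = "gR (pre V) r"
    have z: "?z \<in> gnim (pre V)" using r by (simp add: generic_image_def)
    have zS: "?z \<in> carrier S" using z unfolding generic_image_eq[OF pre_open[OF V] pre_nonempty[OF V False]] by blast
    note f = fib_section[OF V z zS]
    obtain m k where "(m, k) \<in> fib (h \<xi>) ?z" using f(2)[OF h_xi_V[OF V False]] by blast
    hence "?z = mv ((\<lambda>p\<in>V. fib p ?z) (h \<xi>))" using mv_fib h_xi_V[OF V False] by simp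
    thus ?thesis using \<psi>_eq[OF V False r] f(1) by metis
  qed
qed

lemma \<psi>_add:
  assumes V: "opA V" and s: "s \<in> TS V" and t: "t \<in> TS V"
  shows "\<psi> V (s +[sec (tilde A M) V] t) = \<psi> V s +[sec R (pre V)] \<psi> V t"
proof -
  have oR: "R.op (pre V)" using pre_open[OF V] by (simp add: baseR)
  interpret V: cring "sec R (pre V)" by (rule R.sec_cring[OF oR])
  note c = V.a_closed[OF \<psi>_closed[OF V s] \<psi>_closed[OF V t]]
  show ?thesis
  proof (cases "V = {}")
    case True
    show ?thesis by (rule empty_pre[OF True _ c]) (use True zero_empty in \<open>simp add: \<psi>_def pre_def\<close>)
  next
    case False
    note x = h_xi_V[OF V False]
    have xp: "\<xi> \<in> pre V" using x xi_U by (simp add: pre_def)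
    obtain m f where m: "m \<in> RU" "f \<in> carrier A" "f \<notin> h \<xi>" "s (h \<xi>) = fib (h \<xi>) (mv (s (h \<xi>)))" "val m f = mv (s (h \<xi>))" by (rule sec_value[OF V s x])
    obtain n k where n: "n \<in> RU" "k \<in> carrier A" "k \<notin> h \<xi>" "t (h \<xi>) = fib (h \<xi>) (mv (t (h \<xi>)))" "val n k = mv (t (h \<xi>))" by (rule sec_value[OF V t x])
    have mem: "(m, f) \<in> fib (h \<xi>) (mv (s (h \<xi>)))" "(n, k) \<in> fib (h \<xi>) (mv (t (h \<xi>)))" using m(1-3,5) n(1-3,5) by (simp_all add: fib_def)
    note xs = h_spec[OF xi_U]
    have zS: "mv (s (h \<xi>)) \<in> carrier S" "mv (t (h \<xi>)) \<in> carrier S"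
      using val_closed[OF m(1,2) spec_nz[OF xs m(3)]] val_closed[OF n(1,2) spec_nz[OF xs n(3)]] m(5) n(5) by simp_all
    have "(s +[sec (tilde A M) V] t) (h \<xi>) = s (h \<xi>) +[mloc A M (carrier A - h \<xi>)] t (h \<xi>)" using x by (simp add: tilde_def)
    hence "mv ((s +[sec (tilde A M) V] t) (h \<xi>)) = mv (s (h \<xi>)) +[S] mv (t (h \<xi>))"
      using mloc_fib_add[OF xs zS mem] m(4) n(4) by simp
    also have "\<dots> = gR (pre V) (\<psi> V s +[sec R (pre V)] \<psi> V t)"
      using R.germ_add[OF oR xp \<psi>_closed[OF V s] \<psi>_closed[OF V t]] \<psi>_germ(2)[OF V False s] \<psi>_germ(2)[OF V False t] by (simp add: gstalk_simps)
    finally show ?thesis by (intro \<psi>_eq[OF V False c]) simp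
  qed
qed

text \<open>The generic germ of \<open>\<phi> V a\<close> is read off a local presentation
  \<open>b1/f1\<close>. As \<open>A\<close> is a domain, every other representative satisfies the
  same equation without a cancelling factor.\<close>

lemma structure_value:
  assumes V: "opA V" "V \<noteq> {}" and a: "a \<in> carrier (sec (spec_sheaf A) V)"
  shows "\<exists>b k. (b, k) \<in> a (h \<xi>)"
    "(b, k) \<in> a (h \<xi>) \<Longrightarrow> b \<in> carrier A \<and> k \<in> carrier A \<and> k \<notin> h \<xi> \<and> e b = e k *[S] Pi' (gO (pre V) (\<phi> V a)) 1[WD]"
proof -
  interpret A: domain A by (rule dom)
  note x = h_xi_V[OF V] and xs = h_spec[OF xi_U]
  let ?y = "gO (pre V) (\<phi> V a)"
  obtain W b1 f1 where W: "opA W" "h \<xi> \<in> W" "W \<subseteq> V" "b1 \<in> carrier A" "f1 \<in> carrier A" "W \<subseteq> bopen A f1" "restrict a W = A.sfr b1 f1 W"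
    using A.sfr_local[OF a x] by (elim exE conjE)
  have ax: "a (h \<xi>) = rfrac A (carrier A - h \<xi>) b1 f1" using fun_cong[OF W(7), of "h \<xi>"] W(2) by (simp add: A.sfr_def)
  have f1: "f1 \<notin> h \<xi>" using W(2,6) by blast
  have xp: "\<xi> \<in> pre W" using W(2) xi_U by (simp add: pre_def)
  note pc = phi_closed[OF V(1) a]
  have "gO (pre W) (fs b1 f1 W) = ?y"
    using germ_restr[OF pre_open[OF V(1)] pre_open[OF W(1)] xp pre_mono[OF W(3)] pc] phi_restr[OF V(1) W(1,3) a] W(7) by (simp add: fs_def)
  hence y: "?y *[F] j f1 = j b1" using germ_fs[OF W(1,6) xp W(4,5)] by (simp add: j_def)
  have yF: "?y \<in> carrier F" by (rule stalkI[OF pre_open[OF V(1)] gen_in'[OF pre_open[OF V(1)] pre_nonempty[OF V]] pc])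
  have "(b1, f1) \<in> a (h \<xi>)" unfolding ax rfrac_def using W(4,5) f1 A.spec_one[OF xs] by auto
  thus "\<exists>b k. (b, k) \<in> a (h \<xi>)" by blast
  assume "(b, k) \<in> a (h \<xi>)"
  then obtain u where b: "b \<in> carrier A" "k \<in> carrier A" "k \<notin> h \<xi>" and u: "u \<in> carrier A" "u \<notin> h \<xi>"
    "u *[A] (k *[A] b1) = u *[A] (f1 *[A] b)" unfolding ax rfrac_def by blast
  have "k *[A] b1 = f1 *[A] b" using u(3) A.m_lcancel[OF spec_nz[OF xs u(2)] u(1) A.m_closed[OF b(2) W(4)] A.m_closed[OF W(5) b(1)]] by simp
  hence "j k *[F] j b1 = j f1 *[F] j b" using ring_hom_mult[OF j_hom b(2) W(4)] ring_hom_mult[OF j_hom W(5) b(1)] by simp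
  moreover note jj = jF[OF b(2)] jF[OF W(5)] jF[OF b(1)]
  ultimately have "j f1 *[F] (j k *[F] ?y) = j f1 *[F] j b" unfolding y[symmetric] using yF by (simp add: F.m_ac)
  hence "j k *[F] ?y = j b" using F.Units_l_cancel[OF j_unit[OF W(5) spec_nz[OF xs f1]] F.m_closed[OF jj(1) yF] jj(3)] by simp
  hence "e b = e k *[S] Pi' ?y 1[WD]" unfolding e_def using Pi_mult[OF jj(1) yF WD.one_closed WD.one_closed] by simp
  thus "b \<in> carrier A \<and> k \<in> carrier A \<and> k \<notin> h \<xi> \<and> e b = e k *[S] Pi' ?y 1[WD]" using b by simp
qed

lemma \<psi>_smult:
  assumes V: "opA V" and a: "a \<in> carrier (sec (spec_sheaf A) V)" and s: "s \<in> TS V"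
  shows "\<psi> V (a \<odot>\<^bsub>sec (tilde A M) V\<^esub> s) = scal (pre V) (\<phi> V a) *[sec R (pre V)] \<psi> V s"
proof -
  note pv = pre_open[OF V] and pc = phi_closed[OF V a]
  have oR: "R.op (pre V)" using pv by (simp add: baseR)
  interpret V: cring "sec R (pre V)" by (rule R.sec_cring[OF oR])
  note sc = scalar_closed[OF pv pc]
  note c = V.m_closed[OF sc \<psi>_closed[OF V s]]
  show ?thesis
  proof (cases "V = {}")
    case True
    show ?thesis by (rule empty_pre[OF True _ c]) (use True zero_empty in \<open>simp add: \<psi>_def pre_def\<close>)
  next
    case False
    note x = h_xi_V[OF V False] and ne = pre_nonempty[OF V False] and xs = h_spec[OF xi_U]
    have xp: "\<xi> \<in> pre V" using x xi_U by (simp add: pre_def)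
    let ?y = "gO (pre V) (\<phi> V a)"
    have yF: "?y \<in> carrier F" by (rule stalkI[OF pv xp pc])
    have gy: "gR (pre V) (scal (pre V) (\<phi> V a)) = Pi' ?y 1[WD]"
      unfolding scalar_eq[OF ne] by (rule germ_rho[OF pv ne WD.one_closed scalar_OD[OF pv ne pc]])
    obtain m f where m: "m \<in> RU" "f \<in> carrier A" "f \<notin> h \<xi>" "s (h \<xi>) = fib (h \<xi>) (mv (s (h \<xi>)))" "val m f = mv (s (h \<xi>))" by (rule sec_value[OF V s x])
    have mem: "(m, f) \<in> fib (h \<xi>) (mv (s (h \<xi>)))" using m(1-3,5) by (simp add: fib_def)
    have zS: "mv (s (h \<xi>)) \<in> carrier S" using val_closed[OF m(1,2) spec_nz[OF xs m(3)]] m(5) by simp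
    obtain b k where bk: "(b, k) \<in> a (h \<xi>)" using structure_value(1)[OF V False a] by blast
    have "(a \<odot>\<^bsub>sec (tilde A M) V\<^esub> s) (h \<xi>) = a (h \<xi>) \<odot>\<^bsub>mloc A M (carrier A - h \<xi>)\<^esub> s (h \<xi>)" using x by (simp add: tilde_def)
    hence "mv ((a \<odot>\<^bsub>sec (tilde A M) V\<^esub> s) (h \<xi>)) = Pi' ?y 1[WD] *[S] mv (s (h \<xi>))"
      using mloc_fib_smult[OF xs zS mem Pi_S[OF yF WD.one_closed] bk structure_value(2)[OF V False a]] m(4) by simp
    also have "\<dots> = gR (pre V) (scal (pre V) (\<phi> V a) *[sec R (pre V)] \<psi> V s)"
      using R.germ_mult[OF oR xp sc \<psi>_closed[OF V s]] \<psi>_germ(2)[OF V False s] gy by (simp add: gstalk_simps)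
    finally show ?thesis by (intro \<psi>_eq[OF V False c]) simp
  qed
qed

lemma \<psi>_restr:
  assumes V: "opA V" and W: "opA W" "W \<subseteq> V" and s: "s \<in> TS V"
  shows "\<psi> W (restr (tilde A M) V W s) = restr R (pre V) (pre W) (\<psi> V s)"
proof -
  have oR: "R.op (pre V)" "R.op (pre W)" using pre_open[OF V] pre_open[OF W(1)] by (simp_all add: baseR)
  note c = R.restr_closed[OF oR pre_mono[OF W(2)] \<psi>_closed[OF V s]]
  show ?thesis
  proof (cases "W = {}")
    case True
    show ?thesis by (rule empty_pre[OF True _ c]) (use True zero_empty in \<open>simp add: \<psi>_def pre_def\<close>)
  next
    case False
    hence ne: "V \<noteq> {}" using W(2) by blast
    note x = h_xi_V[OF W(1) False]
    have xp: "\<xi> \<in> pre W" using x xi_U by (simp add: pre_def)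
    have "restr (tilde A M) V W s (h \<xi>) = s (h \<xi>)" using x by (simp add: tilde_def)
    thus ?thesis using R.germ_restr[OF oR xp pre_mono[OF W(2)] \<psi>_closed[OF V s]] \<psi>_germ(2)[OF V ne s]
      by (intro \<psi>_eq[OF W(1) False c]) simp
  qed
qed

end

theorem (in cox) Cox_module_quasi_coherent: "quasi_coherent Sch CM"
  unfolding quasi_coherent_def CM_simps
  apply (rule conjI[OF CM_sheaf], rule ballI, erule chart_at)
  subgoal premises prems for x U A h \<phi>
  proof -
    interpret cox_chart Sch \<xi> R \<pi> U A h \<phi> by (rule cox_chart.intro[OF cox_axioms prems(2)])
    show ?thesis
    proof (rule exI[of _ U], rule exI[of _ A], rule exI[of _ M], rule exI[of _ h], rule exI[of _ \<phi>], rule exI[of _ \<psi>],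
        unfold pre_def[symmetric], intro conjI allI impI ballI)
      fix V s assume V: "openin (zariski A) V"
      show "bij_betw (\<psi> V) (carrier (sec (tilde A M) V)) (secs R (pre V))" by (rule \<psi>_bij[OF V])
      assume s: "s \<in> carrier (sec (tilde A M) V)"
      show "\<psi> V (s +[sec (tilde A M) V] t) = \<psi> V s +[sec R (pre V)] \<psi> V t" if "t \<in> carrier (sec (tilde A M) V)" for t
        by (rule \<psi>_add[OF V s that])
      show "\<psi> V (a \<odot>\<^bsub>sec (tilde A M) V\<^esub> s) = scal (pre V) (\<phi> V a) *[sec R (pre V)] \<psi> V s"
        if "a \<in> carrier (sec (spec_sheaf A) V)" for a by (rule \<psi>_smult[OF V that s])
    next
      fix V W s assume "openin (zariski A) V \<and> openin (zariski A) W \<and> W \<subseteq> V" and s: "s \<in> carrier (sec (tilde A M) V)"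
      thus "\<psi> W (restr (tilde A M) V W s) = restr R (pre V) (pre W) (\<psi> V s)" by (intro \<psi>_restr) simp_all
    qed (rule prems(1) U Acr M_module iso)+
  qed
  done

theorem theorem2:
  fixes Sch :: "('p, 'a, unit) sheaf"
    and \<xi> :: 'p
    and R :: "('p, 'r, ('p \<Rightarrow> int) set) gsheaf"
    and \<pi> :: "'p set \<Rightarrow> (('p \<Rightarrow> int) \<Rightarrow> ('p set \<times> 'a) set) \<Rightarrow> 'r"
    and K :: "('p \<Rightarrow> int) set monoid"
    and S :: "('p, ('p set \<times> 'r) set, ('p \<Rightarrow> int) set) gsheaf"
    and SX :: "(('p set \<times> 'r) set, ('p \<Rightarrow> int) set) gring"
    and \<mu> :: "'p \<Rightarrow> 'p set \<Rightarrow> ('p set \<times> 'r) set \<Rightarrow> int"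
    and P :: "'p set"
  assumes Sch: "Krull_scheme Sch"
    and \<xi>: "generic_point Sch \<xi>"
    and R: "Cox_sheaf Sch \<xi> R \<pi>"
    and K: "K = Cl Sch \<xi>"
    and S: "S = generic_sheaf R \<xi>"
    and SX: "SX = sec S (topspace (base Sch))"
    and \<mu>: "\<mu> = Cox_mu Sch \<xi> R \<pi>"
    and P: "P = prime_divisors Sch"
  shows
    "quasi_coherent Sch (Cox_module Sch \<xi> R \<pi>) \<and>

     (\<forall>U. opens Sch U \<and> U \<noteq> {} \<longrightarrow>
        K_factorial K (sec R U) \<and>
        generate K (hdeg K (sec R U) ` hplus K (sec R U)) = carrier K \<and>
        (affine_open Sch U \<longrightarrow>
           graded_ring_iso K (Qplus K (sec R U)) (sec S U) (Qplus_to_generic R \<xi> U) \<and>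
           hdeg K (sec R U) ` hplus K (sec R U) = carrier K)) \<and>

     essential_K_valuations_of_sheaf Sch K R \<xi> P \<mu> \<and>
     (\<forall>Y\<in>P. inj_on (cospec R \<xi>) (carrier (stalk R Y))) \<and>
     (\<forall>U. opens Sch U \<and> U \<noteq> {} \<longrightarrow>
        (\<forall>Y\<in>P. K_valuation_sheaf_sec K S (\<mu> Y) U =
           (if Y \<in> U then stalk_image R \<xi> Y else carrier SX)) \<and>
        generic_image R \<xi> U = carrier SX \<inter> (\<Inter>Y\<in>P \<inter> U. stalk_image R \<xi> Y)) \<and>

     (\<forall>x\<in>topspace (base Sch).
        K_local K (gstalk R x) \<and>
        K_Krull_in K SX (stalk_image R \<xi> x) \<and>
        inj_on (cospec R \<xi>) (carrier (stalk R x)) \<and>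
        stalk_image R \<xi> x = carrier SX \<inter>
          (\<Inter>Y\<in>{Y \<in> P. x \<in> base Sch closure_of {Y}}. K_valuation_ring K SX (\<mu> Y (topspace (base Sch)))) \<and>
        stalk_image R \<xi> x = carrier SX \<inter>
          (\<Inter>Y\<in>{Y \<in> P. x \<in> base Sch closure_of {Y}}. stalk_image R \<xi> Y) \<and>
        max_K_ideal K (gstalk R x) \<inter> hplus K (gstalk R x) =
          {z \<in> hplus K (gstalk R x). \<exists>U f. opens Sch U \<and> x \<in> U \<and> f \<in> hplus K (sec R U) \<and>
             z = germ R x U f \<and> x \<in> div_support Sch U (Cox_div Sch \<xi> R \<pi> U (germ R \<xi> U f))} \<and>
        hunits K (gstalk R x) =
          {z \<in> hplus K (gstalk R x). \<exists>U f. opens Sch U \<and> x \<in> U \<and> f \<in> hplus K (sec R U) \<and>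
             z = germ R x U f \<and> Cox_div Sch \<xi> R \<pi> U (germ R \<xi> U f) = \<one>\<^bsub>wdiv Sch U\<^esub>} \<and>
        subgroup (hdeg K (gstalk R x) ` hunits K (gstalk R x)) K \<and>
        hdeg K (gstalk R x) ` hunits K (gstalk R x) =
          {div_class Sch \<xi> D | D. D \<in> carrier (WDiv Sch) \<and>
             (\<exists>U. opens Sch U \<and> x \<in> U \<and>
                (\<exists>f\<in>rat_units Sch \<xi>. div_restrict Sch U D = pdiv Sch \<xi> U f))}) \<and>

     (\<forall>Y\<in>P.
        Cox_scalar_stalk Sch \<xi> R \<pi> Y \<in>
          ring_iso (stalk Sch Y) ((stalk R Y)\<lparr>carrier := gcomp (gstalk R Y) \<one>\<^bsub>K\<^esub>\<rparr>) \<and>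
        (\<forall>m t. maximalideal m (stalk Sch Y) \<and> t \<in> m \<and> m = PIdl\<^bsub>stalk Sch Y\<^esub> t \<longrightarrow>
           max_K_ideal K (gstalk R Y) = PIdl\<^bsub>gstalk R Y\<^esub> (Cox_scalar_stalk Sch \<xi> R \<pi> Y t)) \<and>
        hdeg K (gstalk R Y) ` hunits K (gstalk R Y) = carrier K)"
proof -
  interpret cox Sch \<xi> R \<pi>
    using Sch \<xi> R by (intro cox.intro kscheme.intro cox_axioms.intro)
  \<comment> \<open>The ring of global sections of the constant sheaf is the generic stalk, because
    the whole space is not empty.\<close>
  show ?thesis unfolding K \<mu> P SX S gen_simps(2)[OF XX(2)]
    by (intro conjI allI ballI impI; rule Cox_module_quasi_coherent essential_valuations sections_K_factorial[OF conjunct1 conjunct2]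
      affine_degrees[OF _ conjunct2] generic_image_eq[OF conjunct1 conjunct2] valuation_sheaf_sec[OF conjunct1 conjunct2]
      stalk_K_Krull stalk_K_Krull(3)[OF P_X] stalk_image_eq stalk_image_inter max_ideal_support hunits_div
      unit_degrees_subgroup unit_degrees_principal scalar_iso[OF P_X] unit_degrees_all
      max_ideal_generator[OF _ conjunct1 conjunct1[OF conjunct2] conjunct2[OF conjunct2]]; assumption)
qed

end
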